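(* Let $f$ satisfy hypotheses $(\mathcal F_1)$–$(\mathcal F_4)$ (listed in the context). If $a^{\frac{N-4}{2}}b\ge C_2(N)$, then there exists $\varepsilon>0$ such that for each $\lambda$ with $\lambda_0^*-\varepsilon<\lambda<\lambda_0^*$, problem $(\mathcal P_\lambda)$ has a non-zero solution $u_\lambda$, which is a local minimizer of $\Phi_\lambda$ with positive energy (i.e. $\Phi_\lambda(u_\lambda)>0$). Moreover $\Phi_\lambda(u)>0$ for all $u\in H_0^1(\Omega)\setminus\{0\}$ (for these $\lambda$).
   Context: $N>4$ is an integer, $2^*=\frac{2N}{N-2}$, $\Omega\subseteq\mathbb R^N$ is a bounded domain, $a,b$ are positive numbers, $\lambda>0$ is a (positive) parameter. $H_0^1(\Omega)$ has norm $\|u\|=(\int_\Omega|\nabla u|^2dx)^{1/2}$ and $\|u\|_q$ is the $L^q(\Omega)$ norm. $S_N=\inf_{u\in H_0^1(\Omega)\setminus\{0\}}\|u\|^2/\|u\|_{2^*}^2$, $C_1(N)=\frac{4(N-4)^{\frac{N-4}{2}}}{N^{\frac{N-2}{2}}S_N^{\frac N2}}$, $C_2(N)=\frac{2(N-4)^{\frac{N-4}{2}}}{(N-2)^{\frac{N-2}{2}}S_N^{\frac N2}}$; one has $C_1(N)<C_2(N)$. Problem $(\mathcal P_\lambda)$: $-\left(a+b\int_\Omega|\nabla u|^2dx\right)\Delta u=|u|^{2^*-2}u+\lambda f(x,u)$ in $\Omega$, $u=0$ on $\partial\Omega$. Solutions are weak solutions, i.e. critical points in $H_0^1(\Omega)$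 of the energy functional $\Phi_\lambda(u)=\frac a2\|u\|^2+\frac b4\|u\|^4-\frac1{2^*}\|u\|_{2^*}^{2^*}-\lambda\int_\Omega F(x,u)dx$, where $F(x,v)=\int_0^vf(x,t)dt$. Hypotheses on $f$: $(\mathcal F_1)$ $f:\Omega\times\mathbb R\to\mathbb R$ is a Carathéodory function with $f(x,0)=0$ for a.a. $x\in\Omega$. $(\mathcal F_2)$ $f(x,v)>0$ for every $v>0$ and a.a. $x\in\Omega$, $f(x,v)<0$ for every $v<0$ and a.a. $x\in\Omega$; moreover there exist $\mu>0$ and an open interval $I\subset(0,+\infty)$ such that $f(x,v)\ge\mu>0$ for a.a. $x\in\Omega$ and every $v\in I$. $(\mathcal F_3)$ There exist $c>0$, $p\in(2,2^* )$ such that $|f(x,v)|\le c(1+|v|^{p-1})$ for every $v\in\mathbb R$ and a.a. $x\in\Omega$. $(\mathcal F_4)$ $f(x,v)=o(|v|)$ as $v\to0$, uniformly in $x\in\Omega$. Definition of $\lambda_0^*$: for $u\in H_0^1(\Omega)\setminus\{0\}$ let $\psi_{\lambda,u}(t)=\Phi_\lambda(tu)$, $t>0$. When $a^{\frac{N-4}{2}}b\ge C_1(N)$, for every such $u$ there is a unique $\lambda_0(u)>0$ for which, with $\lambda=\lambda_0(u)$, there exists $t>0$ with $\psi_{\lambda,u}(t)=0$, $\psi_{\lambda,u}'(t)=0$ and $\psi_{\lambda,u}(t)=\inf_{s>0}\psi_{\lambda,u}(s)$. Then $\lambda_0^*=\lambda_0^*(a,b)=\inf_{u\in H_0^1(\Omega)\setminus\{0\}}\lambda_0(u)$,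 which is positive if $a^{\frac{N-4}{2}}b>C_1(N)$. *)

theory Defs
  imports "HOL-Analysis.Analysis"
begin

text \<open>
  Throughout, \<open>\<Omega>\<close> is a subset of an \<open>N\<close>-dimensional Euclidean space, \<open>N = DIM('a)\<close>. Elements of
  Lebesgue and Sobolev spaces over \<open>\<Omega>\<close> are represented by functions on the whole space. Only their
  values almost everywhere on \<open>\<Omega>\<close> matter, since all notions below go through \<open>lebesgue_on \<Omega>\<close>; in
  particular the zero element is represented by every function vanishing a.e. on \<open>\<Omega>\<close>.
\<close>

section \<open>The Sobolev space of order one with zero boundary values\<close>

primrec C_k :: "nat \<Rightarrow> ('a::euclidean_space \<Rightarrow> real) \<Rightarrow> bool" where
  "C_k 0 \<phi> \<longleftrightarrow> continuous_on UNIV \<phi>"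
| "C_k (Suc k) \<phi> \<longleftrightarrow> (\<forall>x. \<phi> differentiable (at x)) \<and>
     (\<forall>i\<in>Basis. C_k k (\<lambda>x. frechet_derivative \<phi> (at x) i))"

definition test_functions :: "'a::euclidean_space set \<Rightarrow> ('a \<Rightarrow> real) set" where
  "test_functions \<Omega> = {\<phi>. (\<forall>k. C_k k \<phi>) \<and>
     compact (closure {x. \<phi> x \<noteq> 0}) \<and> closure {x. \<phi> x \<noteq> 0} \<subseteq> \<Omega>}"

definition locally_integrable ::
    "'a::euclidean_space set \<Rightarrow> ('a \<Rightarrow> 'b::euclidean_space) \<Rightarrow> bool" where
  "locally_integrable \<Omega> u \<longleftrightarrow> (\<forall>K. compact K \<and> K \<subseteq> \<Omega> \<longrightarrow> integrable (lebesgue_on K) u)"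

definition has_weak_gradient ::
    "'a::euclidean_space set \<Rightarrow> ('a \<Rightarrow> real) \<Rightarrow> ('a \<Rightarrow> 'a) \<Rightarrow> bool" where
  "has_weak_gradient \<Omega> u g \<longleftrightarrow> locally_integrable \<Omega> u \<and> locally_integrable \<Omega> g \<and>
     (\<forall>\<phi>\<in>test_functions \<Omega>. \<forall>i\<in>Basis.
        (LINT x|lebesgue_on \<Omega>. u x * frechet_derivative \<phi> (at x) i)
          = - (LINT x|lebesgue_on \<Omega>. (g x \<bullet> i) * \<phi> x))"

text \<open>Weak gradients are unique only up to null sets, so this picks a representative.\<close>

definition weak_grad :: "'a::euclidean_space set \<Rightarrow> ('a \<Rightarrow> real) \<Rightarrow> 'a \<Rightarrow> 'a" where
  "weak_grad \<Omega> u = (SOME g. has_weak_gradient \<Omega> u g)"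

definition L2 :: "'a::euclidean_space set \<Rightarrow> ('a \<Rightarrow> 'b::euclidean_space) set" where
  "L2 \<Omega> = {u \<in> borel_measurable (lebesgue_on \<Omega>). integrable (lebesgue_on \<Omega>) (\<lambda>x. (norm (u x))\<^sup>2)}"

definition W12 :: "'a::euclidean_space set \<Rightarrow> ('a \<Rightarrow> real) set" where
  "W12 \<Omega> = {u \<in> L2 \<Omega>. \<exists>g\<in>L2 \<Omega>. has_weak_gradient \<Omega> u g}"

definition W12_norm :: "'a::euclidean_space set \<Rightarrow> ('a \<Rightarrow> real) \<Rightarrow> real" where
  "W12_norm \<Omega> u = sqrt ((LINT x|lebesgue_on \<Omega>. (u x)\<^sup>2)
                        + (LINT x|lebesgue_on \<Omega>. (norm (weak_grad \<Omega> u x))\<^sup>2))"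

text \<open>The closure of the test functions in \<open>W12 \<Omega>\<close>.\<close>

definition H01 :: "'a::euclidean_space set \<Rightarrow> ('a \<Rightarrow> real) set" where
  "H01 \<Omega> = {u \<in> W12 \<Omega>. \<forall>e>0. \<exists>\<phi>\<in>test_functions \<Omega>. W12_norm \<Omega> (\<lambda>x. u x - \<phi> x) < e}"

definition H01_nonzero :: "'a::euclidean_space set \<Rightarrow> ('a \<Rightarrow> real) set" where
  "H01_nonzero \<Omega> = {u \<in> H01 \<Omega>. \<not> (AE x in lebesgue_on \<Omega>. u x = 0)}"

definition H01_norm :: "'a::euclidean_space set \<Rightarrow> ('a \<Rightarrow> real) \<Rightarrow> real" where
  "H01_norm \<Omega> u = sqrt (LINT x|lebesgue_on \<Omega>. (norm (weak_grad \<Omega> u x))\<^sup>2)"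

definition Lq_norm :: "real \<Rightarrow> 'a::euclidean_space set \<Rightarrow> ('a \<Rightarrow> real) \<Rightarrow> real" where
  "Lq_norm q \<Omega> u = (LINT x|lebesgue_on \<Omega>. \<bar>u x\<bar> powr q) powr (1 / q)"

section \<open>Critical exponent and constants\<close>

definition crit_exp :: "nat \<Rightarrow> real" where
  "crit_exp N = 2 * real N / (real N - 2)"

definition sobolev_const :: "'a::euclidean_space set \<Rightarrow> real" where
  "sobolev_const \<Omega> =
     (INF u\<in>H01_nonzero \<Omega>. (H01_norm \<Omega> u)\<^sup>2 / (Lq_norm (crit_exp DIM('a)) \<Omega> u)\<^sup>2)"

definition C2_const :: "'a::euclidean_space set \<Rightarrow> real" where
  "C2_const \<Omega> = (let N = real DIM('a) in
     2 * (N - 4) powr ((N - 4) / 2)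
       / ((N - 2) powr ((N - 2) / 2) * sobolev_const \<Omega> powr (N / 2)))"

section \<open>Hypotheses on the nonlinearity\<close>

definition hyp_F1 :: "'a::euclidean_space set \<Rightarrow> ('a \<Rightarrow> real \<Rightarrow> real) \<Rightarrow> bool" where
  "hyp_F1 \<Omega> f \<longleftrightarrow>
     (\<forall>v. (\<lambda>x. f x v) \<in> borel_measurable (lebesgue_on \<Omega>)) \<and>
     (AE x in lebesgue_on \<Omega>. continuous_on UNIV (f x)) \<and>
     (AE x in lebesgue_on \<Omega>. f x 0 = 0)"

definition hyp_F2 :: "'a::euclidean_space set \<Rightarrow> ('a \<Rightarrow> real \<Rightarrow> real) \<Rightarrow> bool" where
  "hyp_F2 \<Omega> f \<longleftrightarrow>
     (\<forall>v>0. AE x in lebesgue_on \<Omega>. f x v > 0) \<and>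
     (\<forall>v<0. AE x in lebesgue_on \<Omega>. f x v < 0) \<and>
     (\<exists>\<mu>>0. \<exists>I. open I \<and> is_interval I \<and> I \<noteq> {} \<and> I \<subseteq> {0<..} \<and>
        (AE x in lebesgue_on \<Omega>. \<forall>v\<in>I. f x v \<ge> \<mu>))"

definition hyp_F3 :: "'a::euclidean_space set \<Rightarrow> ('a \<Rightarrow> real \<Rightarrow> real) \<Rightarrow> bool" where
  "hyp_F3 \<Omega> f \<longleftrightarrow> (\<exists>c>0. \<exists>p. 2 < p \<and> p < crit_exp DIM('a) \<and>
     (\<forall>v. AE x in lebesgue_on \<Omega>. \<bar>f x v\<bar> \<le> c * (1 + \<bar>v\<bar> powr (p - 1))))"

definition hyp_F4 :: "'a::euclidean_space set \<Rightarrow> ('a \<Rightarrow> real \<Rightarrow> real) \<Rightarrow> bool" where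
  "hyp_F4 \<Omega> f \<longleftrightarrow> uniform_limit \<Omega> (\<lambda>v x. f x v / \<bar>v\<bar>) (\<lambda>x. 0) (at 0)"

section \<open>The Kirchhoff problem and its energy functional\<close>

text \<open>The interval integral is oriented, i.e. it changes sign for \<open>v < 0\<close>.\<close>

definition primitive :: "('a \<Rightarrow> real \<Rightarrow> real) \<Rightarrow> 'a \<Rightarrow> real \<Rightarrow> real" where
  "primitive f x v = (LBINT t=ereal 0..ereal v. f x t)"

definition energy :: "'a::euclidean_space set \<Rightarrow> real \<Rightarrow> real \<Rightarrow> ('a \<Rightarrow> real \<Rightarrow> real) \<Rightarrow> real
    \<Rightarrow> ('a \<Rightarrow> real) \<Rightarrow> real" where
  "energy \<Omega> a b f lam u =
     a / 2 * (H01_norm \<Omega> u)\<^sup>2 + b / 4 * (H01_norm \<Omega> u) ^ 4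
     - 1 / crit_exp DIM('a) * Lq_norm (crit_exp DIM('a)) \<Omega> u powr crit_exp DIM('a)
     - lam * (LINT x|lebesgue_on \<Omega>. primitive f x (u x))"

definition weak_solution :: "'a::euclidean_space set \<Rightarrow> real \<Rightarrow> real \<Rightarrow> ('a \<Rightarrow> real \<Rightarrow> real) \<Rightarrow> real
    \<Rightarrow> ('a \<Rightarrow> real) \<Rightarrow> bool" where
  "weak_solution \<Omega> a b f lam u \<longleftrightarrow> u \<in> H01 \<Omega> \<and>
     (\<forall>v\<in>H01 \<Omega>.
        (a + b * (LINT x|lebesgue_on \<Omega>. (norm (weak_grad \<Omega> u x))\<^sup>2))
            * (LINT x|lebesgue_on \<Omega>. weak_grad \<Omega> u x \<bullet> weak_grad \<Omega> v x)
          = (LINT x|lebesgue_on \<Omega>. \<bar>u x\<bar> powr (crit_exp DIM('a) - 2) * u x * v x)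
            + lam * (LINT x|lebesgue_on \<Omega>. f x (u x) * v x))"

text \<open>Frechet derivative zero at \<open>u\<close>, with respect to \<open>H01_norm\<close>.\<close>

definition critical_point :: "'a::euclidean_space set \<Rightarrow> (('a \<Rightarrow> real) \<Rightarrow> real)
    \<Rightarrow> ('a \<Rightarrow> real) \<Rightarrow> bool" where
  "critical_point \<Omega> \<Phi> u \<longleftrightarrow> u \<in> H01 \<Omega> \<and>
     (\<forall>e>0. \<exists>d>0. \<forall>v\<in>H01 \<Omega>. H01_norm \<Omega> (\<lambda>x. v x - u x) < d \<longrightarrow>
        \<bar>\<Phi> v - \<Phi> u\<bar> \<le> e * H01_norm \<Omega> (\<lambda>x. v x - u x))"

definition local_minimizer :: "'a::euclidean_space set \<Rightarrow> (('a \<Rightarrow> real) \<Rightarrow> real)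
    \<Rightarrow> ('a \<Rightarrow> real) \<Rightarrow> bool" where
  "local_minimizer \<Omega> \<Phi> u \<longleftrightarrow> u \<in> H01 \<Omega> \<and>
     (\<exists>r>0. \<forall>v\<in>H01 \<Omega>. H01_norm \<Omega> (\<lambda>x. v x - u x) < r \<longrightarrow> \<Phi> u \<le> \<Phi> v)"

section \<open>The extremal parameter\<close>

definition fiber :: "'a::euclidean_space set \<Rightarrow> real \<Rightarrow> real \<Rightarrow> ('a \<Rightarrow> real \<Rightarrow> real) \<Rightarrow> real
    \<Rightarrow> ('a \<Rightarrow> real) \<Rightarrow> real \<Rightarrow> real" where
  "fiber \<Omega> a b f lam u t = energy \<Omega> a b f lam (\<lambda>x. t * u x)"

text \<open>
  The last conjunct says that the infimum of the fibering map over \<open>s > 0\<close> is attained at \<open>t\<close>;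
  spelling it out avoids the unspecified value of \<open>Inf\<close> on sets not bounded below.
\<close>

definition lambda0 :: "'a::euclidean_space set \<Rightarrow> real \<Rightarrow> real \<Rightarrow> ('a \<Rightarrow> real \<Rightarrow> real)
    \<Rightarrow> ('a \<Rightarrow> real) \<Rightarrow> real" where
  "lambda0 \<Omega> a b f u = (THE lam. lam > 0 \<and>
     (\<exists>t>0. fiber \<Omega> a b f lam u t = 0 \<and>
        (fiber \<Omega> a b f lam u has_real_derivative 0) (at t) \<and>
        (\<forall>s>0. fiber \<Omega> a b f lam u t \<le> fiber \<Omega> a b f lam u s)))"

definition lambda0_star :: "'a::euclidean_space set \<Rightarrow> real \<Rightarrow> real \<Rightarrow> ('a \<Rightarrow> real \<Rightarrow> real)
    \<Rightarrow> real" where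
  "lambda0_star \<Omega> a b f = (INF u\<in>H01_nonzero \<Omega>. lambda0 \<Omega> a b f u)"

end

theory Submission
  imports Defs "HOL-Complex_Analysis.Great_Picard"
begin

text \<open>
  Write \<open>\<Phi>\<close> for the energy at \<open>lam = 0\<close> and \<open>J u\<close> for the integral of \<open>F(x, u)\<close>. The condition on \<open>a, b\<close>
  gives a bound \<open>\<Phi> u \<ge> \<kappa> (\<parallel>u\<parallel>\<^sup>2 + \<parallel>u\<parallel>\<^sup>4)\<close> with \<open>\<kappa> > 0\<close>, and \<open>lambda0_star\<close> is the infimum of \<open>\<Phi> / J\<close>,
  so the energy is positive below it. Near \<open>0\<close> the energy is at least \<open>\<kappa> / 2 \<parallel>u\<parallel>\<^sup>2\<close>, hence on a small sphere of
  radius \<open>r\<close> it is at least \<open>\<kappa> / 2 r\<^sup>2\<close>, whereas for \<open>lam\<close> close to \<open>lambda0_star\<close> some function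
  outside the ball has smaller energy. Along a minimizing sequence outside the ball with weak limit \<open>w\<close>,
  the Brezis--Lieb splitting and the lower bound for \<open>\<Phi>\<close> applied to \<open>u\<^sub>n - w\<close> show that \<open>w\<close> is a minimizer
  and lies outside the closed ball, so it is a local minimizer.

  The Poincare, Sobolev and Rellich theorems are all obtained from the \<open>L\<^sup>2\<close> estimate of \<open>u(x + h) - u(x)\<close>
  by \<open>\<bar>h\<bar> \<parallel>\<nabla>u\<parallel>\<close>.
\<close>

section \<open>Compactly supported functions of class \<open>C\<^sup>1\<close>\<close>

text \<open>The obstacle is the critical exponent q = 2N/(N-2). The embedding into L^q is not
  compact, so the power term is not weakly continuous; nor is the outside of a ball weakly closed,
  since norms can drop in a weak limit. Both losses are measured by the same defect u_n - w. The
  threshold C_2(N) enters only through \<open>\<kappa>\<close>: a defect carries at least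
  \<open>\<kappa>\<close> times its squared norm in energy, so losing norm costs energy. The gap
  \<open>\<kappa>\<close> is positive even if a and b meet the threshold with equality, because 2^t
  < 1 + t strictly on (0, 1). One half of \<open>\<kappa>\<close> pays for lam J near zero, the
  other half is the barrier on the small sphere. N > 4 means q < 4, so the quartic term controls the
  critical power at infinity. Closeness of lam to \<open>lambda0_star\<close> serves to push a
  competitor under the barrier: its energy is (l - lam) J w, with J w bounded in advance and l close
  to \<open>lambda0_star\<close>. Since functions are representatives modulo null sets and
  \<open>weak_grad\<close> is a choice, gradients are handled through a relation that does not see
  null sets.\<close>

definition C1c :: "('a::euclidean_space \<Rightarrow> real) \<Rightarrow> ('a \<Rightarrow> 'a) \<Rightarrow> bool" where
  "C1c u g \<longleftrightarrow> (\<forall>x. (u has_derivative (\<lambda>h. g x \<bullet> h)) (at x)) \<and> continuous_on UNIV g \<and>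
     (\<exists>R. \<forall>x. R < norm x \<longrightarrow> u x = 0)"

lemma C1c_D:
  assumes "C1c u g"
  shows "(u has_derivative (\<lambda>h. g x \<bullet> h)) (at x)" "continuous_on UNIV g" "continuous_on UNIV u"
  using assms unfolding C1c_def
  by (blast intro: continuous_at_imp_continuous_on has_derivative_continuous)+

lemma C1c_supp:
  assumes "C1c u g"
  shows "\<exists>R. \<forall>x. R < norm x \<longrightarrow> u x = 0 \<and> g x = 0"
proof -
  obtain R where R: "\<And>x. R < norm x \<Longrightarrow> u x = 0" using assms unfolding C1c_def by auto
  have "g x = 0" if x: "R < norm x" for x
  proof -
    have "open {y::'a. R < norm y}" by (intro open_Collect_less continuous_intros)
    then have "((\<lambda>y. 0) has_derivative (\<lambda>h. g x \<bullet> h)) (at x)"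
      using x R by (intro has_derivative_transform_within_open[OF C1c_D(1)[OF assms]]) auto
    then have "(\<lambda>h. g x \<bullet> h) = (\<lambda>h. 0)"
      by (rule has_derivative_unique) (rule has_derivative_const)
    then have "g x \<bullet> g x = 0" by metis
    then show ?thesis by simp
  qed
  with R show ?thesis by blast
qed

lemma cont_supp_integrable:
  fixes f :: "'a::euclidean_space \<Rightarrow> 'b::{banach, second_countable_topology}"
  assumes "continuous_on UNIV f" "\<And>x. R < norm x \<Longrightarrow> f x = 0"
  shows "integrable lborel f"
proof -
  have "integrable lborel (\<lambda>x. indicator (cball 0 R) x *\<^sub>R f x)"
    using assms(1) by (intro borel_integrable_compact) (auto intro: continuous_on_subset)
  moreover have "(\<lambda>x. indicator (cball 0 R) x *\<^sub>R f x) = f"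
    using assms(2) by (auto simp: indicator_def fun_eq_iff dist_norm not_le)
  ultimately show ?thesis by simp
qed

lemma cont_supp_bounded:
  fixes f :: "'a::euclidean_space \<Rightarrow> 'b::real_normed_vector"
  assumes "continuous_on UNIV f" "\<And>x. R < norm x \<Longrightarrow> f x = 0"
  shows "\<exists>B>0. \<forall>x. norm (f x) \<le> B"
proof -
  have "compact (f ` cball 0 R)"
    using assms(1) by (intro compact_continuous_image) (auto intro: continuous_on_subset)
  from compact_imp_bounded[OF this] obtain B where B: "B > 0" "\<And>y. y \<in> f ` cball 0 R \<Longrightarrow> norm y \<le> B"
    unfolding bounded_pos by blast
  have "norm (f x) \<le> B" for x
    using B assms(2)[of x] by (cases "R < norm x") (auto simp: not_less)
  with B(1) show ?thesis by auto
qed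

lemma C1c_bound:
  assumes "C1c u g"
  shows "\<exists>B>0. \<forall>x. norm (g x) \<le> B"
proof -
  obtain R where "\<And>x. R < norm x \<Longrightarrow> g x = 0" using C1c_supp[OF assms] by auto
  from cont_supp_bounded[OF C1c_D(2)[OF assms] this] show ?thesis .
qed

lemma C1c_lipschitz:
  assumes "C1c u g" and B: "\<And>x. norm (g x) \<le> B"
  shows "\<bar>u (x + h) - u x\<bar> \<le> B * norm h"
proof -
  have on: "onorm (\<lambda>h. g x \<bullet> h) \<le> B" for x
  proof (rule onorm_le)
    fix h have "norm (g x \<bullet> h) \<le> norm (g x) * norm h" by (simp add: Cauchy_Schwarz_ineq2)
    also have "\<dots> \<le> B * norm h" using B by (intro mult_right_mono) auto
    finally show "norm (g x \<bullet> h) \<le> B * norm h" .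
  qed
  have "norm (u (x + h) - u x) \<le> B * norm ((x + h) - x)"
    using on by (intro differentiable_bound[of UNIV u "\<lambda>x h. g x \<bullet> h"])
       (auto intro: C1c_D(1)[OF assms(1)])
  then show ?thesis by simp
qed

lemma C1c_diffquot:
  assumes "C1c u g"
  shows "(\<lambda>n. real (Suc n) * (u (x + h /\<^sub>R real (Suc n)) - u x)) \<longlonglongrightarrow> g x \<bullet> h"
proof -
  define f where "f t = u (x + t *\<^sub>R h)" for t :: real
  have "((\<lambda>t. u (x + t *\<^sub>R h)) has_derivative (\<lambda>t. g (x + 0 *\<^sub>R h) \<bullet> (t *\<^sub>R h))) (at 0)"
    by (rule has_derivative_compose[of _ _ _ _ u, OF _ C1c_D(1)[OF assms]])
       (auto intro!: derivative_eq_intros)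
  then have "DERIV f 0 :> g x \<bullet> h"
    unfolding f_def has_field_derivative_def by (simp add: mult_commute_abs)
  then have l: "((\<lambda>t. (f (0 + t) - f 0) / t) \<longlongrightarrow> g x \<bullet> h) (at 0)" by (simp add: DERIV_def)
  have "filterlim (\<lambda>n. inverse (real (Suc n))) (at 0) sequentially"
    using LIMSEQ_inverse_real_of_nat by (auto simp: filterlim_at)
  from filterlim_compose[OF l this] show ?thesis
    unfolding f_def by (simp add: divide_inverse mult.commute)
qed

section \<open>Translations, difference quotients and integrals of gradients\<close>

lemma lborel_translate:
  fixes f :: "'a::euclidean_space \<Rightarrow> 'b::{banach, second_countable_topology}"
  assumes [measurable]: "f \<in> borel_measurable borel"
  shows "(LINT x|lborel. f (x + h)) = (LINT x|lborel. f x)"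
proof -
  have "(LINT x|lborel. f x) = (LINT x|distr lborel borel ((+) h). f x)"
    by (simp add: lborel_distr_plus)
  also have "\<dots> = (LINT x|lborel. f (h + x))" by (subst integral_distr) auto
  finally show ?thesis by (simp add: add.commute)
qed

lemma lborel_translate_integrable:
  fixes f :: "'a::euclidean_space \<Rightarrow> 'b::{banach, second_countable_topology}"
  assumes "integrable lborel f"
  shows "integrable lborel (\<lambda>x. f (x + h))"
proof -
  have "integrable (distr lborel borel ((+) h)) f" using assms by (simp add: lborel_distr_plus)
  then have "integrable lborel (\<lambda>x. f (h + x))"
    using assms by (subst (asm) integrable_distr_eq) (auto dest: borel_measurable_integrable)
  then show ?thesis by (simp add: add.commute)
qed

lemma continuous_borel [intro]: "continuous_on UNIV f \<Longrightarrow> f \<in> borel_measurable borel"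
  by (rule borel_measurable_continuous_onI)

text \<open>The exponent 1 serves integration by parts, the exponent 2 the translation estimate. The
  Lipschitz bound dominates all quotients at once, and as no shift is longer than \<open>h\<close>
  they vanish outside one ball, enlarged by \<open>norm h\<close>.\<close>

lemma C1c_dq_tendsto:
  assumes u: "C1c u g" and p: "p = (1::nat) \<or> p = 2"
  shows "(\<lambda>n. LINT x|lborel. (real (Suc n) * (u (x + h /\<^sub>R real (Suc n)) - u x)) ^ p)
            \<longlonglongrightarrow> (LINT x|lborel. (g x \<bullet> h) ^ p)"
proof -
  obtain R where R: "\<And>x. R < norm x \<Longrightarrow> u x = 0 \<and> g x = 0" using C1c_supp[OF u] by auto
  obtain B where B: "B > 0" "\<And>x. norm (g x) \<le> B" using C1c_bound[OF u] by auto
  have [measurable]: "u \<in> borel_measurable borel" "g \<in> borel_measurable borel"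
    using C1c_D[OF u] by auto
  show ?thesis
  proof (rule integral_dominated_convergence[where w="\<lambda>x. (B * norm h) ^ p * indicator (cball 0 (R + norm h)) x"])
    show "integrable lborel (\<lambda>x. (B * norm h) ^ p * indicator (cball (0::'a) (R + norm h)) x)"
      by (intro integrable_mult_right integrable_real_indicator emeasure_bounded_finite) auto
    show "AE x in lborel. (\<lambda>n. (real (Suc n) * (u (x + h /\<^sub>R real (Suc n)) - u x)) ^ p) \<longlonglongrightarrow> (g x \<bullet> h) ^ p"
      using C1c_diffquot[OF u] by (auto intro!: AE_I2 tendsto_power simp del: of_nat_Suc)
    fix n
    have "norm ((real (Suc n) * (u (x + h /\<^sub>R real (Suc n)) - u x)) ^ p)
       \<le> (B * norm h) ^ p * indicator (cball 0 (R + norm h)) x" for x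
    proof -
      have "\<bar>u (x + h /\<^sub>R real (Suc n)) - u x\<bar> \<le> B * norm (h /\<^sub>R real (Suc n))"
        by (rule C1c_lipschitz[OF u B(2)])
      then have "real (Suc n) * \<bar>u (x + h /\<^sub>R real (Suc n)) - u x\<bar> \<le> real (Suc n) * (B * norm (h /\<^sub>R real (Suc n)))"
        by (intro mult_left_mono) auto
      also have "\<dots> = B * norm h" by (simp add: field_simps del: of_nat_Suc)
      finally have 1: "\<bar>real (Suc n) * (u (x + h /\<^sub>R real (Suc n)) - u x)\<bar> \<le> B * norm h"
        by (simp add: abs_mult)
      have 2: "u (x + h /\<^sub>R real (Suc n)) - u x = 0" if "R + norm h < norm x"
      proof -
        have "norm (h /\<^sub>R real (Suc n)) \<le> norm h"
          by (simp add: field_simps mult_left_le_one_le)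
        moreover have "norm x \<le> norm (x + h /\<^sub>R real (Suc n)) + norm (h /\<^sub>R real (Suc n))"
          by (metis add_diff_cancel norm_triangle_sub norm_minus_commute norm_triangle_ineq4)
        ultimately have "R < norm (x + h /\<^sub>R real (Suc n))" using that by linarith
        moreover have "R < norm x" using that norm_ge_zero[of h] by linarith
        ultimately show ?thesis using R by simp
      qed
      show ?thesis
      proof (cases "R + norm h < norm x")
        case True
        then show ?thesis using 2 p B by auto
      next
        case False
        then show ?thesis using power_mono[OF 1, of p] by (simp add: power_abs)
      qed
    qed
    then show "AE x in lborel. norm ((real (Suc n) * (u (x + h /\<^sub>R real (Suc n)) - u x)) ^ p)
       \<le> (B * norm h) ^ p * indicator (cball 0 (R + norm h)) x" by blast
  qed measurable
qed

lemma C1c_integrable: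
  assumes u: "C1c u g"
  shows "integrable lborel u" "integrable lborel g" "integrable lborel (\<lambda>x. (u x)\<^sup>2)"
    "integrable lborel (\<lambda>x. (norm (g x))\<^sup>2)" "integrable lborel (\<lambda>x. (g x \<bullet> h)\<^sup>2)"
    "integrable lborel (\<lambda>x. (u (x + h) - u x)\<^sup>2)"
proof -
  obtain R where R: "\<And>x. R < norm x \<Longrightarrow> u x = 0 \<and> g x = 0" using C1c_supp[OF u] by auto
  note c = C1c_D(2,3)[OF u]
  show "integrable lborel u" "integrable lborel g" "integrable lborel (\<lambda>x. (u x)\<^sup>2)"
    "integrable lborel (\<lambda>x. (norm (g x))\<^sup>2)" "integrable lborel (\<lambda>x. (g x \<bullet> h)\<^sup>2)"
    using R by (auto intro!: cont_supp_integrable[where R=R] c continuous_intros)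
  have z: "(u (x + h) - u x)\<^sup>2 = 0" if "R + norm h < norm x" for x
  proof -
    have "norm x \<le> norm (x + h) + norm h"
      by (metis add_diff_cancel norm_triangle_ineq4)
    then have "R < norm (x + h)" "R < norm x" using that norm_ge_zero[of h] by linarith+
    then show ?thesis using R by simp
  qed
  have "continuous_on UNIV (\<lambda>x. (u (x + h) - u x)\<^sup>2)"
    by (intro continuous_intros c continuous_on_compose2[OF c(2)]) auto
  then show "integrable lborel (\<lambda>x. (u (x + h) - u x)\<^sup>2)"
    using z by (rule cont_supp_integrable)
qed

text \<open>Translation invariance gives every difference quotient the integral 0. Applied to a
  product of two functions this is integration by parts.\<close>

lemma C1c_integral_zero:
  assumes u: "C1c u g"
  shows "(LINT x|lborel. g x \<bullet> h) = 0"
proof -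
  have "(LINT x|lborel. (real (Suc n) * (u (x + h /\<^sub>R real (Suc n)) - u x)) ^ 1) = 0" for n
    using C1c_D[OF u] lborel_translate_integrable[OF C1c_integrable(1)[OF u]] C1c_integrable(1)[OF u]
    by (simp add: lborel_translate continuous_borel)
  then have "(\<lambda>n. 0) \<longlonglongrightarrow> (LINT x|lborel. (g x \<bullet> h) ^ 1)"
    using C1c_dq_tendsto[OF u, of 1 h] by (simp del: of_nat_Suc)
  then show ?thesis by (simp add: LIMSEQ_const_iff)
qed

text \<open>Cutting the shift into $n$ equal steps reduces the estimate to difference quotients,
  whose square integrals converge.\<close>

lemma C1c_translation_estimate:
  assumes u: "C1c u g"
  shows "(LINT x|lborel. (u (x + h) - u x)\<^sup>2) \<le> (norm h)\<^sup>2 * (LINT x|lborel. (norm (g x))\<^sup>2)"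
proof -
  have [measurable]: "u \<in> borel_measurable borel" using C1c_D[OF u] by auto
  have step: "(LINT x|lborel. (u (x + h) - u x)\<^sup>2)
      \<le> (LINT x|lborel. (real (Suc n) * (u (x + h /\<^sub>R real (Suc n)) - u x)) ^ 2)" for n
  proof -
    define k where "k = h /\<^sub>R real (Suc n)"
    define d where "d y = (u (y + k) - u y)\<^sup>2" for y
    have h: "h = real (Suc n) *\<^sub>R k" by (simp add: k_def del: of_nat_Suc)
    have [measurable]: "d \<in> borel_measurable borel" unfolding d_def by measurable
    have di: "integrable lborel d" unfolding d_def by (rule C1c_integrable(6)[OF u])
    have pw: "(u (x + h) - u x)\<^sup>2 \<le> (\<Sum>j<Suc n. d (x + real j *\<^sub>R k)) * real (Suc n)" for x
    proof -
      have "u (x + h) - u x = (\<Sum>j<Suc n. u (x + real (Suc j) *\<^sub>R k) - u (x + real j *\<^sub>R k))"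
        unfolding h by (subst sum_lessThan_telescope) simp
      also have "\<dots> = (\<Sum>j<Suc n. u ((x + real j *\<^sub>R k) + k) - u (x + real j *\<^sub>R k))"
        by (intro sum.cong refl) (simp add: algebra_simps)
      finally show ?thesis
        using sum_squared_le_sum_of_squares[of "\<lambda>j. u ((x + real j *\<^sub>R k) + k) - u (x + real j *\<^sub>R k)" "{..<Suc n}"]
        by (simp add: d_def del: of_nat_Suc)
    qed
    have "(LINT x|lborel. (u (x + h) - u x)\<^sup>2) \<le> (LINT x|lborel. (\<Sum>j<Suc n. d (x + real j *\<^sub>R k)) * real (Suc n))"
      by (intro integral_mono integrable_mult_left Bochner_Integration.integrable_sum
          lborel_translate_integrable[OF di] C1c_integrable(6)[OF u] pw)
    also have "\<dots> = (\<Sum>j<Suc n. LINT x|lborel. d (x + real j *\<^sub>R k)) * real (Suc n)"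
      by (subst integral_mult_left_zero, subst Bochner_Integration.integral_sum)
        (auto intro: lborel_translate_integrable[OF di])
    also have "\<dots> = (real (Suc n))\<^sup>2 * (LINT x|lborel. d x)"
      by (simp add: lborel_translate power2_eq_square del: of_nat_Suc)
    also have "\<dots> = (LINT x|lborel. (real (Suc n) * (u (x + h /\<^sub>R real (Suc n)) - u x)) ^ 2)"
      by (simp add: d_def k_def power_mult_distrib del: of_nat_Suc)
    finally show ?thesis .
  qed
  have "(LINT x|lborel. (u (x + h) - u x)\<^sup>2) \<le> (LINT x|lborel. (g x \<bullet> h)\<^sup>2)"
    by (rule LIMSEQ_le_const[OF C1c_dq_tendsto[OF u, of 2 h, simplified]]) (use step in auto)
  also have "\<dots> \<le> (LINT x|lborel. (norm h)\<^sup>2 * (norm (g x))\<^sup>2)"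
    by (intro integral_mono integrable_mult_right C1c_integrable[OF u])
      (metis Cauchy_Schwarz_ineq mult.commute power2_norm_eq_inner)
  finally show ?thesis by simp
qed

lemma C1c_add: "C1c u g \<Longrightarrow> C1c v k \<Longrightarrow> C1c (\<lambda>x. u x + v x) (\<lambda>x. g x + k x)"
  unfolding C1c_def
proof (safe, goal_cases)
  case (1 R S x)
  then show ?case by (auto intro!: derivative_eq_intros simp: inner_add_left)
next
  case (2 R S) then show ?case by (intro continuous_intros)
next
  case (3 R S) then show ?case by (intro exI[of _ "max R S"]) auto
qed

lemma C1c_scale: "C1c u g \<Longrightarrow> C1c (\<lambda>x. c * u x) (\<lambda>x. c *\<^sub>R g x)"
  unfolding C1c_def by (auto intro!: derivative_eq_intros continuous_intros)

lemma C1c_mult: "C1c u g \<Longrightarrow> C1c v k \<Longrightarrow> C1c (\<lambda>x. u x * v x) (\<lambda>x. v x *\<^sub>R g x + u x *\<^sub>R k x)"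
  using C1c_D(3)[of u g] C1c_D(3)[of v k]
  unfolding C1c_def
  by (auto intro!: derivative_eq_intros continuous_intros simp: inner_add_left algebra_simps)

text \<open>The truncation used below is only of class C^1. This is why the inequalities are proved
  for \<open>C1c\<close> and not just for smooth test functions.\<close>

lemma C1c_comp:
  assumes u: "C1c u g" and T: "\<And>s. (T has_real_derivative T' s) (at s)" and T': "continuous_on UNIV T'"
    and T0: "T 0 = 0"
  shows "C1c (\<lambda>x. T (u x)) (\<lambda>x. T' (u x) *\<^sub>R g x)"
  unfolding C1c_def
proof (intro conjI allI)
  fix x show "((\<lambda>x. T (u x)) has_derivative (\<lambda>h. T' (u x) *\<^sub>R g x \<bullet> h)) (at x)"
    using has_derivative_compose[OF C1c_D(1)[OF u] T[THEN has_field_derivative_imp_has_derivative], of x]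
    by (simp add: inner_scaleR_left)
  show "continuous_on UNIV (\<lambda>x. T' (u x) *\<^sub>R g x)"
    by (intro continuous_intros C1c_D[OF u] continuous_on_compose2[OF T' C1c_D(3)[OF u]]) auto
  show "\<exists>R. \<forall>x. R < norm x \<longrightarrow> T (u x) = 0" using u T0 unfolding C1c_def by metis
qed

section \<open>Poincare and Sobolev inequalities\<close>

text \<open>A shift longer than the diameter \<open>2 * R\<close> moves the support off itself. The
  squared difference of \<open>u\<close> and its translate then integrates to twice the squared norm
  of \<open>u\<close>, and the translation estimate bounds it.\<close>

lemma C1c_poincare:
  fixes u :: "'a::euclidean_space \<Rightarrow> real"
  assumes u: "C1c u g" and R: "\<And>x. R < norm x \<Longrightarrow> u x = 0" and R0: "R \<ge> 0"
  shows "(LINT x|lborel. (u x)\<^sup>2) \<le> (2 * R + 1)\<^sup>2 * (LINT x|lborel. (norm (g x))\<^sup>2)"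
proof -
  obtain b :: 'a where b: "b \<in> Basis" using nonempty_Basis by blast
  define h where "h = (2 * R + 1) *\<^sub>R b"
  have nh: "norm h = 2 * R + 1" using b R0 by (simp add: h_def)
  have [measurable]: "u \<in> borel_measurable borel" using C1c_D[OF u] by auto
  note i = C1c_integrable(3)[OF u]
  have eq: "(u (x + h) - u x)\<^sup>2 = (u (x + h))\<^sup>2 + (u x)\<^sup>2" for x
  proof -
    have "u (x + h) = 0 \<or> u x = 0"
    proof (rule disjCI)
      assume "u x \<noteq> 0"
      then have "norm x \<le> R" using R[of x] by fastforce
      moreover have "norm h \<le> norm (x + h) + norm x"
        by (metis add.commute add_diff_cancel norm_triangle_ineq4)
      ultimately show "u (x + h) = 0" using nh R R0 by auto
    qed
    then show ?thesis by (auto simp: power2_diff)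
  qed
  have "(LINT x|lborel. (u (x + h) - u x)\<^sup>2) = 2 * (LINT x|lborel. (u x)\<^sup>2)"
    unfolding eq using lborel_translate_integrable[OF i, of h] i lborel_translate[of "\<lambda>x. (u x)\<^sup>2" h]
    by simp
  moreover have "0 \<le> (LINT x|lborel. (u x)\<^sup>2)" by simp
  ultimately show ?thesis using C1c_translation_estimate[OF u, of h] unfolding nh by linarith
qed

lemma C1c_powr_integrable:
  assumes u: "C1c u g" and q: "q > 0"
  shows "integrable lborel (\<lambda>x. \<bar>u x\<bar> powr q)" "continuous_on UNIV (\<lambda>x. \<bar>u x\<bar> powr q)"
proof -
  obtain R where R: "\<And>x. R < norm x \<Longrightarrow> u x = 0" using C1c_supp[OF u] by auto
  show *: "continuous_on UNIV (\<lambda>x. \<bar>u x\<bar> powr q)"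
    using q by (intro continuous_on_powr' continuous_intros C1c_D[OF u]) auto
  show "integrable lborel (\<lambda>x. \<bar>u x\<bar> powr q)"
    using R by (intro cont_supp_integrable[OF *, of R]) auto
qed

text \<open>Split at the level \<open>s\<close>: values below it contribute at most
  \<open>s\<^sup>2\<close>, values above it can afford the extra factor
  \<open>(\<bar>v\<bar> / s) powr (q - 2)\<close>.\<close>

lemma square_le_powr:
  fixes v s q :: real
  assumes "s > 0" "q > 2"
  shows "v\<^sup>2 \<le> s\<^sup>2 + \<bar>v\<bar> powr q / s powr (q - 2)"
proof (cases "\<bar>v\<bar> \<le> s")
  case True
  then have "v\<^sup>2 \<le> s\<^sup>2" by (metis abs_ge_zero power2_abs power_mono)
  then show ?thesis by (smt (verit) divide_nonneg_nonneg powr_ge_zero)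
next
  case False
  then have v: "\<bar>v\<bar> > s" "\<bar>v\<bar> > 0" using assms by auto
  have "v\<^sup>2 * s powr (q - 2) \<le> v\<^sup>2 * \<bar>v\<bar> powr (q - 2)"
    using v assms by (intro mult_left_mono powr_mono2) auto
  also have "v\<^sup>2 = \<bar>v\<bar> powr 2" using v by (simp add: powr_numeral)
  also have "\<bar>v\<bar> powr 2 * \<bar>v\<bar> powr (q - 2) = \<bar>v\<bar> powr q" using v by (simp add: powr_add[symmetric] del: powr_numeral)
  finally have "v\<^sup>2 \<le> \<bar>v\<bar> powr q / s powr (q - 2)"
    using assms v by (simp add: field_simps powr_numeral)
  then show ?thesis by (smt (verit) zero_le_power2)
qed

text \<open>By \<open>V\<close>, the q-th power of \<open>u\<close> averaged over any ball of radius
  \<open>r\<close> is at most \<open>(t / 4) powr q\<close>, so \<open>u\<close> is small there in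
  quadratic mean. Around a point with \<open>t \<le> \<bar>u x\<bar>\<close> the mean of
  \<open>(u (x + h) - u x)\<^sup>2\<close> over \<open>h\<close> is therefore at least
  \<open>t\<^sup>2 / 4\<close>. Integrating over all such points and exchanging the integrals leads
  back to the translation estimate.\<close>

lemma C1c_weak_type:
  fixes u :: "'a::euclidean_space \<Rightarrow> real"
  assumes u: "C1c u g" and q: "q > 2" and t: "t > 0" and r: "r > 0"
    and V: "(LINT x|lborel. \<bar>u x\<bar> powr q) \<le> (t / 4) powr q * measure lborel (cball (0::'a) r)"
  shows "t\<^sup>2 / 4 * measure lborel {x. t \<le> \<bar>u x\<bar>} \<le> r\<^sup>2 * (LINT x|lborel. (norm (g x))\<^sup>2)"
proof -
  \<comment> \<open>At this level the two contributions of \<open>s\<close> add up to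
    \<open>4 * s\<^sup>2 * W = t\<^sup>2 * W / 4\<close>, against \<open>t\<^sup>2 * W\<close> on
    the left; half of the difference still exceeds \<open>t\<^sup>2 / 4 * W\<close>.\<close>
  define s where "s = t / 4"
  define B where "B = cball (0::'a) r"
  define W where "W = measure lborel B"
  define G where "G = (LINT x|lborel. (norm (g x))\<^sup>2)"
  define P where "P = {x. t \<le> \<bar>u x\<bar>}"
  define J where "J x h = indicator B h * (u (x + h) - u x)\<^sup>2" for x h
  have W: "W > 0" unfolding W_def B_def using r by (simp add: content_cball)
  have G: "G \<ge> 0" by (simp add: G_def)
  have s: "s > 0" using t by (simp add: s_def)
  note cu = C1c_D(3)[OF u]
  have [measurable]: "u \<in> borel_measurable borel" using cu by auto
  have Bm[measurable]: "B \<in> sets borel" unfolding B_def by simp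
  have emB: "emeasure lborel B = ennreal W" unfolding W_def B_def
    using emeasure_lborel_cball_finite[of "0::'a" r] by (intro emeasure_eq_ennreal_measure) auto
  have Pm[measurable]: "P \<in> sets borel" unfolding P_def by measurable
  have emP: "emeasure lborel P = ennreal (measure lborel P)"
  proof -
    obtain R where R: "\<And>x. R < norm x \<Longrightarrow> u x = 0" using C1c_supp[OF u] by auto
    have "P \<subseteq> cball 0 R"
    proof
      fix x assume "x \<in> P"
      then have "u x \<noteq> 0" using t by (auto simp: P_def)
      then show "x \<in> cball 0 R" using R[of x] by (auto simp: not_less[symmetric])
    qed
    then have "emeasure lborel P < \<infinity>"
      by (intro emeasure_bounded_finite bounded_subset[OF bounded_cball])
    then show ?thesis by (intro emeasure_eq_ennreal_measure) (auto simp: less_top)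
  qed
  have int: "integrable lborel (J x)" for x
    using borel_integrable_compact[of B "\<lambda>h. (u (x + h) - u x)\<^sup>2"]
    unfolding J_def B_def
    by (force intro!: continuous_intros continuous_on_compose2[OF cu])
  have intB: "integrable lborel (\<lambda>h. indicator B h * c)" for c :: real
    using emeasure_lborel_cball_finite[of "0::'a" r] unfolding B_def
    by (intro integrable_mult_left integrable_real_indicator) auto
  have lower: "t\<^sup>2 / 4 * W \<le> (LINT h|lborel. J x h)" if x: "x \<in> P" for x
  proof -
    define c where "c = 1 / s powr (q - 2)"
    have c: "c \<ge> 0" by (simp add: c_def)
    have pi: "integrable lborel (\<lambda>h. \<bar>u (h + x)\<bar> powr q)"
      using lborel_translate_integrable[OF C1c_powr_integrable(1)[OF u, of q]] q by simp
    have "indicator B h * t\<^sup>2 \<le> 2 * J x h + indicator B h * (2 * s\<^sup>2) + 2 * c * \<bar>u (h + x)\<bar> powr q" for h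
    proof (cases "h \<in> B")
      case True
      have "t\<^sup>2 \<le> (u x)\<^sup>2" using x t unfolding P_def by (simp add: abs_le_square_iff[symmetric])
      also have "\<dots> \<le> 2 * (u (x + h) - u x)\<^sup>2 + 2 * (u (x + h))\<^sup>2"
        using zero_le_power2[of "u x - 2 * u (x + h)"] by (simp add: power2_eq_square algebra_simps)
      also have "(u (x + h))\<^sup>2 \<le> s\<^sup>2 + c * \<bar>u (x + h)\<bar> powr q"
        using square_le_powr[OF s q, of "u (x + h)"] by (simp add: c_def)
      finally show ?thesis using True by (simp add: J_def algebra_simps)
    next
      case False
      then show ?thesis using c by (simp add: J_def)
    qed
    then have "(LINT h|lborel. indicator B h * t\<^sup>2)
      \<le> (LINT h|lborel. 2 * J x h + indicator B h * (2 * s\<^sup>2) + 2 * c * \<bar>u (h + x)\<bar> powr q)"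
      by (intro integral_mono Bochner_Integration.integrable_add integrable_mult_right int intB pi)
    also have "\<dots> = 2 * (LINT h|lborel. J x h) + W * (2 * s\<^sup>2) + 2 * c * (LINT h|lborel. \<bar>u h\<bar> powr q)"
      using int pi intB lborel_translate[of "\<lambda>h. \<bar>u h\<bar> powr q" x] by (simp add: W_def)
    also have "2 * c * (LINT h|lborel. \<bar>u h\<bar> powr q) \<le> 2 * c * (s powr q * W)"
      using V c by (intro mult_left_mono) (auto simp: s_def W_def B_def)
    also have "2 * c * (s powr q * W) = 2 * s\<^sup>2 * W"
      using s by (simp add: c_def powr_diff powr_numeral)
    also have "(LINT h|lborel. indicator B h * t\<^sup>2) = t\<^sup>2 * W" by (simp add: W_def)
    finally have "t\<^sup>2 * W \<le> 2 * (LINT h|lborel. J x h) + W * (2 * s\<^sup>2) + 2 * s\<^sup>2 * W" by simp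
    moreover have "s\<^sup>2 * W = t\<^sup>2 * W / 16" by (simp add: s_def power_divide)
    moreover have "0 \<le> t\<^sup>2 * W" using W by simp
    moreover have "W * (2 * s\<^sup>2) = 2 * (s\<^sup>2 * W)" "2 * s\<^sup>2 * W = 2 * (s\<^sup>2 * W)" "t\<^sup>2 / 4 * W = (t\<^sup>2 * W) / 4"
      by simp_all
    ultimately show ?thesis by linarith
  qed
  have Jm[measurable]: "(\<lambda>(x, h). J x h) \<in> borel_measurable (borel \<Otimes>\<^sub>M borel)"
    unfolding J_def by measurable
  have Jm': "(\<lambda>(x, h). ennreal (J x h)) \<in> borel_measurable (lborel \<Otimes>\<^sub>M lborel)" by measurable
  have "ennreal (t\<^sup>2 / 4 * W * measure lborel P) = (\<integral>\<^sup>+x. ennreal (t\<^sup>2 / 4 * W) * indicator P x \<partial>lborel)"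
    using W by (subst ennreal_mult) (auto simp: nn_integral_cmult_indicator emP)
  also have "\<dots> \<le> (\<integral>\<^sup>+x. (\<integral>\<^sup>+h. J x h \<partial>lborel) \<partial>lborel)"
  proof (rule nn_integral_mono)
    fix x
    have "(\<integral>\<^sup>+h. J x h \<partial>lborel) = ennreal (LINT h|lborel. J x h)"
      by (rule nn_integral_eq_integral[OF int]) (simp add: J_def)
    then show "ennreal (t\<^sup>2 / 4 * W) * indicator P x \<le> (\<integral>\<^sup>+h. J x h \<partial>lborel)"
      using lower[of x] by (auto simp: indicator_def intro: ennreal_leI)
  qed
  also have "\<dots> = (\<integral>\<^sup>+h. (\<integral>\<^sup>+x. J x h \<partial>lborel) \<partial>lborel)"
    using lborel_pair.Fubini'[OF Jm'] by simp
  also have "\<dots> \<le> (\<integral>\<^sup>+h. ennreal (r\<^sup>2 * G) * indicator B h \<partial>lborel)"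
  proof (rule nn_integral_mono)
    fix h :: 'a
    show "(\<integral>\<^sup>+x. J x h \<partial>lborel) \<le> ennreal (r\<^sup>2 * G) * indicator B h"
    proof (cases "h \<in> B")
      case True
      then have h: "norm h \<le> r" by (simp add: B_def)
      have "(\<integral>\<^sup>+x. J x h \<partial>lborel) = ennreal (LINT x|lborel. (u (x + h) - u x)\<^sup>2)"
        using True by (simp add: J_def nn_integral_eq_integral C1c_integrable(6)[OF u])
      also have "\<dots> \<le> ennreal ((norm h)\<^sup>2 * G)"
        unfolding G_def by (intro ennreal_leI C1c_translation_estimate[OF u])
      also have "\<dots> \<le> ennreal (r\<^sup>2 * G)"
        using h G by (intro ennreal_leI mult_right_mono power_mono) auto
      finally show ?thesis using True by simp
    qed (simp add: J_def)
  qed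
  also have "\<dots> = ennreal (r\<^sup>2 * G * W)"
    using G W by (subst ennreal_mult) (auto simp: nn_integral_cmult_indicator emB)
  finally have "t\<^sup>2 / 4 * W * measure lborel P \<le> r\<^sup>2 * G * W"
    using G W by (subst (asm) ennreal_le_iff) auto
  then have "W * (t\<^sup>2 / 4 * measure lborel P) \<le> W * (r\<^sup>2 * G)" by (simp add: mult_ac)
  then show ?thesis using W unfolding P_def[symmetric] G_def[symmetric] by simp
qed

section \<open>A truncation of class C^1 and the strong Sobolev inequality\<close>

definition pos_part_sq :: "real \<Rightarrow> real" where "pos_part_sq x = (max 0 x)\<^sup>2"

lemma pos_part_sq_deriv: "(pos_part_sq has_real_derivative 2 * max 0 x) (at x)"
proof -
  consider "x > 0" | "x < 0" | "x = 0" by linarith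
  then show ?thesis
  proof cases
    case 1
    have "((\<lambda>x::real. x\<^sup>2) has_real_derivative 2 * max 0 x) (at x)"
      using 1 by (auto intro!: derivative_eq_intros)
    then show ?thesis
      by (rule has_field_derivative_transform_within_open[where S="{0<..}"]) (use 1 in \<open>auto simp: pos_part_sq_def\<close>)
  next
    case 2
    have "((\<lambda>x::real. 0) has_real_derivative 2 * max 0 x) (at x)"
      using 2 by (auto intro!: derivative_eq_intros)
    then show ?thesis
      by (rule has_field_derivative_transform_within_open[where S="{..<0}"]) (use 2 in \<open>auto simp: pos_part_sq_def\<close>)
  next
    case 3
    have "((\<lambda>h. pos_part_sq h / h) \<longlongrightarrow> 0) (at 0)"
    proof (rule Lim_null_comparison)
      show "eventually (\<lambda>h. norm (pos_part_sq h / h) \<le> \<bar>h\<bar>) (at 0)"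
        by (auto simp: pos_part_sq_def max_def power2_eq_square intro!: always_eventually)
      show "(abs \<longlongrightarrow> 0) (at (0::real))" by (auto intro!: tendsto_eq_intros)
    qed
    then show ?thesis using 3 by (simp add: DERIV_def pos_part_sq_def)
  qed
qed

text \<open>A quadratic spline in \<open>s\<^sup>2\<close>, whose coefficients are chosen so that it is constant for \<open>2 \<le> \<bar>s\<bar>\<close>.\<close>

definition truncation :: "real \<Rightarrow> real" where
  "truncation s = pos_part_sq (s\<^sup>2 - 1) - 2 * pos_part_sq (s\<^sup>2 - 5/2) + pos_part_sq (s\<^sup>2 - 4)"

definition truncation' :: "real \<Rightarrow> real" where
  "truncation' s = (2 * max 0 (s\<^sup>2 - 1) - 4 * max 0 (s\<^sup>2 - 5/2) + 2 * max 0 (s\<^sup>2 - 4)) * (2 * s)"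

lemma truncation_deriv: "(truncation has_real_derivative truncation' s) (at s)"
  unfolding truncation_def[abs_def] truncation'_def
  by (auto intro!: derivative_eq_intros DERIV_chain2[OF pos_part_sq_deriv] simp: algebra_simps)

lemma sq_cases: fixes s :: real shows "\<bar>s\<bar> \<le> 1 \<longleftrightarrow> s\<^sup>2 \<le> 1" "2 \<le> \<bar>s\<bar> \<longleftrightarrow> 4 \<le> s\<^sup>2"
  using abs_le_square_iff[of s 1] abs_le_square_iff[of 2 s] by auto

text \<open>As a function of \<open>s\<^sup>2\<close>, the derivative of the spline is a triangular
  hat on [1, 4] with peak 3 at 5/2. The constant 9/2 is the area of this hat.\<close>

lemma truncation_bounds:
  "\<bar>s\<bar> \<le> 1 \<Longrightarrow> truncation s = 0" "\<bar>s\<bar> \<ge> 2 \<Longrightarrow> truncation s = 9/2" "\<bar>truncation s\<bar> \<le> 9/2"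
proof -
  define y where "y = s\<^sup>2"
  have y: "y \<ge> 0" by (simp add: y_def)
  have t: "truncation s = (max 0 (y - 1))\<^sup>2 - 2 * (max 0 (y - 5/2))\<^sup>2 + (max 0 (y - 4))\<^sup>2"
    by (simp add: truncation_def pos_part_sq_def y_def)
  show "\<bar>s\<bar> \<le> 1 \<Longrightarrow> truncation s = 0" unfolding t sq_cases y_def[symmetric] by (simp add: max_def)
  show "\<bar>s\<bar> \<ge> 2 \<Longrightarrow> truncation s = 9/2" unfolding t sq_cases y_def[symmetric]
    by (simp add: max_def power2_eq_square algebra_simps)
  consider "y \<le> 1" | "1 \<le> y" "y < 5/2" | "5/2 \<le> y" "y \<le> 4" | "4 \<le> y" by linarith
  then show "\<bar>truncation s\<bar> \<le> 9/2"
  proof cases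
    case 1 then show ?thesis unfolding t by (simp add: max_def)
  next
    case 2
    then have "(y - 1)\<^sup>2 \<le> (3/2)\<^sup>2" by (intro power_mono) auto
    then show ?thesis using 2 unfolding t by (simp add: max_def power2_eq_square)
  next
    case 3
    have "(y - 4)\<^sup>2 \<le> (3/2)\<^sup>2" using 3 by (subst abs_le_square_iff[symmetric]) auto
    moreover have "(y - 1)\<^sup>2 - 2 * (y - 5/2)\<^sup>2 = 9/2 - (y - 4)\<^sup>2"
      by (simp add: power2_eq_square algebra_simps)
    ultimately show ?thesis using 3 unfolding t by (simp add: max_def power2_eq_square abs_le_iff)
  next
    case 4 then show ?thesis unfolding t by (simp add: max_def power2_eq_square algebra_simps)
  qed
qed

text \<open>The hat contributes at most 3 and the inner derivative \<open>2 * s\<close> at most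
  4.\<close>

lemma truncation'_bounds: "\<bar>truncation' s\<bar> \<le> (if 1 < \<bar>s\<bar> \<and> \<bar>s\<bar> < 2 then 12 else 0)"
proof (cases "1 < \<bar>s\<bar> \<and> \<bar>s\<bar> < 2")
  case True
  then have y: "1 < s\<^sup>2" "s\<^sup>2 < 4" using sq_cases[of s] by auto
  have "\<bar>2 * max 0 (s\<^sup>2 - 1) - 4 * max 0 (s\<^sup>2 - 5/2) + 2 * max 0 (s\<^sup>2 - 4)\<bar> \<le> 3"
    using y by (auto simp: max_def abs_le_iff)
  then have "\<bar>truncation' s\<bar> \<le> 3 * (2 * 2)"
    unfolding truncation'_def abs_mult using True by (intro mult_mono) auto
  then show ?thesis using True by simp
next
  case False
  then have "s\<^sup>2 \<le> 1 \<or> 4 \<le> s\<^sup>2" using sq_cases[of s] by auto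
  then have "2 * max 0 (s\<^sup>2 - 1) - 4 * max 0 (s\<^sup>2 - 5/2) + 2 * max 0 (s\<^sup>2 - 4) = 0"
    by (auto simp: max_def)
  then show ?thesis using False unfolding truncation'_def by simp
qed

text \<open>The weak-type inequality applied to a truncation of \<open>u\<close> between the levels \<open>L\<close> and \<open>2 L\<close>. Summed over
  dyadic levels it becomes the strong inequality, since the power of the critical norm on the right does
  not depend on the level.\<close>

lemma C1c_dyadic:
  fixes u :: "'a::euclidean_space \<Rightarrow> real"
  assumes u: "C1c u g" and N: "DIM('a) > 2" and q: "q = crit_exp DIM('a)" and L: "L > 0"
    and V: "V = (LINT x|lborel. \<bar>u x\<bar> powr q)" and V0: "V > 0"
  shows "L powr q * measure lborel {x. 2 * L \<le> \<bar>u x\<bar>}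
     \<le> 576 * (18 powr q / measure lborel (cball (0::'a) 1)) powr (2 / DIM('a)) * V powr (2 / DIM('a)) *
       (LINT x|lborel. indicator {x. L < \<bar>u x\<bar> \<and> \<bar>u x\<bar> < 2 * L} x * (norm (g x))\<^sup>2)"
proof -
  define n where "n = real DIM('a)"
  define w where "w = measure lborel (cball (0::'a) 1)"
  \<comment> \<open>The 18 is 4 times 9/2: the truncation is bounded by 9/2, and the weak-type
    inequality at level 1 compares with \<open>(1 / 4) powr q\<close>.\<close>
  define c where "c = 18 powr q / w"
  have n: "n > 2" using N by (simp add: n_def)
  have qv: "q = 2 * n / (n - 2)" by (simp add: q crit_exp_def n_def)
  have q2: "q > 2" unfolding qv using n by (simp add: field_simps)
  \<comment> \<open>The scale invariance of the critical exponent: because of it the powers of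
    \<open>L\<close> cancel in the last step.\<close>
  have qn: "q = q * (2 / n) + 2" unfolding qv using n by (simp add: field_simps)
  have w: "w > 0" unfolding w_def by (simp add: content_cball)
  have c: "c > 0" using w by (simp add: c_def)
  \<comment> \<open>The radius whose ball has exactly the volume that the weak-type inequality asks
    for, once the q-th power of the truncation is bounded by that of \<open>u / L\<close>.\<close>
  define r where "r = (c * V / L powr q) powr (1 / n)"
  have r: "r > 0" using c V0 L by (simp add: r_def)
  have rn: "r ^ DIM('a) = c * V / L powr q"
  proof -
    have "r ^ DIM('a) = r powr n" using r by (simp add: n_def powr_realpow)
    also have "\<dots> = c * V / L powr q" unfolding r_def powr_powr using n c V0 L by simp
    finally show ?thesis .
  qed
  have r2: "r\<^sup>2 = c powr (2 / n) * V powr (2 / n) / L powr (q * (2 / n))"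
  proof -
    have "r\<^sup>2 = r powr 2" using r by (simp add: powr_numeral)
    also have "\<dots> = (c * V / L powr q) powr (2 / n)" unfolding r_def powr_powr by simp
    also have "\<dots> = c powr (2 / n) * V powr (2 / n) / L powr (q * (2 / n))"
      using c V0 L by (simp add: powr_divide powr_mult powr_powr)
    finally show ?thesis .
  qed
  have cb: "measure lborel (cball (0::'a) r) = w * r ^ DIM('a)"
    unfolding w_def using r by (simp add: content_cball)
  define v where "v x = truncation (u x / L)" for x
  define k where "k x = truncation' (u x / L) *\<^sub>R ((1 / L) *\<^sub>R g x)" for x
  have cT: "continuous_on UNIV truncation'" unfolding truncation'_def[abs_def] by (intro continuous_intros)
  have "C1c (\<lambda>x. truncation ((1 / L) * u x)) (\<lambda>x. truncation' ((1 / L) * u x) *\<^sub>R ((1 / L) *\<^sub>R g x))"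
    by (rule C1c_comp[OF C1c_scale[OF u] truncation_deriv cT]) (simp add: truncation_bounds)
  then have v: "C1c v k" by (simp add: v_def[abs_def] k_def[abs_def])
  have "(LINT x|lborel. \<bar>v x\<bar> powr q) \<le> (LINT x|lborel. (9/2) powr q / L powr q * \<bar>u x\<bar> powr q)"
  proof (intro integral_mono integrable_mult_right C1c_powr_integrable[OF v] C1c_powr_integrable[OF u])
    fix x
    show "\<bar>v x\<bar> powr q \<le> (9/2) powr q / L powr q * \<bar>u x\<bar> powr q"
    proof (cases "\<bar>u x / L\<bar> \<le> 1")
      case True
      then show ?thesis using L by (simp add: v_def truncation_bounds)
    next
      case False
      then have ge: "1 \<le> \<bar>u x\<bar> / L" using L by simp
      have "\<bar>v x\<bar> powr q \<le> (9/2) powr q" unfolding v_def using truncation_bounds q2 by (intro powr_mono2) auto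
      also have "\<dots> \<le> (9/2) powr q * (\<bar>u x\<bar> / L) powr q"
        using ge q2 ge_one_powr_ge_zero[OF ge, of q] by simp
      also have "\<dots> = (9/2) powr q / L powr q * \<bar>u x\<bar> powr q" using L by (simp add: powr_divide)
      finally show ?thesis .
    qed
  qed (use q2 in auto)
  also have "\<dots> = (9/2) powr q / L powr q * V" by (simp add: V)
  also have "\<dots> = (1 / 4) powr q * measure lborel (cball (0::'a) r)"
  proof -
    have "(9/2::real) powr q = (1/4) powr q * 18 powr q" by (simp add: powr_mult[symmetric])
    then show ?thesis unfolding cb rn c_def using w by simp
  qed
  finally have "1\<^sup>2 / 4 * measure lborel {x. 1 \<le> \<bar>v x\<bar>} \<le> r\<^sup>2 * (LINT x|lborel. (norm (k x))\<^sup>2)"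
    by (intro C1c_weak_type[OF v q2 _ r]) auto
  then have 1: "measure lborel {x. 1 \<le> \<bar>v x\<bar>} \<le> 4 * r\<^sup>2 * (LINT x|lborel. (norm (k x))\<^sup>2)" by simp
  have [measurable]: "u \<in> borel_measurable borel" "v \<in> borel_measurable borel" "g \<in> borel_measurable borel"
    using C1c_D[OF u] C1c_D[OF v] by auto
  define E where "E = (LINT x|lborel. indicator {x. L < \<bar>u x\<bar> \<and> \<bar>u x\<bar> < 2 * L} x * (norm (g x))\<^sup>2)"
  have ie: "integrable lborel (\<lambda>x. indicator {x. L < \<bar>u x\<bar> \<and> \<bar>u x\<bar> < 2 * L} x * (norm (g x))\<^sup>2)"
    by (rule Bochner_Integration.integrable_bound[OF C1c_integrable(4)[OF u]])
       (auto simp: indicator_def)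
  have "(LINT x|lborel. (norm (k x))\<^sup>2) \<le> (LINT x|lborel. (144 / L\<^sup>2) * (indicator {x. L < \<bar>u x\<bar> \<and> \<bar>u x\<bar> < 2 * L} x * (norm (g x))\<^sup>2))"
  proof (intro integral_mono C1c_integrable(4)[OF v] integrable_mult_right ie)
    fix x
    have nk: "norm (k x) = \<bar>truncation' (u x / L)\<bar> * (norm (g x) / L)" using L by (simp add: k_def)
    show "(norm (k x))\<^sup>2 \<le> (144 / L\<^sup>2) * (indicator {x. L < \<bar>u x\<bar> \<and> \<bar>u x\<bar> < 2 * L} x * (norm (g x))\<^sup>2)"
    proof (cases "L < \<bar>u x\<bar> \<and> \<bar>u x\<bar> < 2 * L")
      case True
      then have "\<bar>truncation' (u x / L)\<bar> \<le> 12" using truncation'_bounds[of "u x / L"] by (auto split: if_splits)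
      then have "norm (k x) \<le> 12 * (norm (g x) / L)" unfolding nk using L by (intro mult_right_mono) auto
      then have "(norm (k x))\<^sup>2 \<le> (12 * (norm (g x) / L))\<^sup>2" by (intro power_mono) auto
      then show ?thesis using True by (simp add: power_mult_distrib power_divide)
    next
      case False
      then have "\<not> (1 < \<bar>u x / L\<bar> \<and> \<bar>u x / L\<bar> < 2)" using L by (auto simp: field_simps)
      then have "truncation' (u x / L) = 0" using truncation'_bounds[of "u x / L"] by auto
      then show ?thesis unfolding nk by simp
    qed
  qed
  also have "\<dots> = 144 / L\<^sup>2 * E" unfolding E_def by (rule integral_mult_right_zero)
  finally have 2: "(LINT x|lborel. (norm (k x))\<^sup>2) \<le> 144 / L\<^sup>2 * E" .
  have sub: "{x. 2 * L \<le> \<bar>u x\<bar>} \<subseteq> {x. 1 \<le> \<bar>v x\<bar>}"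
    using L by (auto simp: v_def truncation_bounds(2) field_simps)
  obtain R where R: "\<And>x. R < norm x \<Longrightarrow> v x = 0" using C1c_supp[OF v] by auto
  have "{x. 1 \<le> \<bar>v x\<bar>} \<subseteq> cball 0 R"
  proof
    fix x assume "x \<in> {x. 1 \<le> \<bar>v x\<bar>}"
    then have "v x \<noteq> 0" by auto
    then show "x \<in> cball 0 R" using R[of x] by (auto simp: not_less[symmetric])
  qed
  then have "emeasure lborel {x. 1 \<le> \<bar>v x\<bar>} < \<infinity>"
    by (intro emeasure_bounded_finite bounded_subset[OF bounded_cball])
  then have "{x. 1 \<le> \<bar>v x\<bar>} \<in> fmeasurable lborel" by (intro fmeasurableI) auto
  then have "measure lborel {x. 2 * L \<le> \<bar>u x\<bar>} \<le> measure lborel {x. 1 \<le> \<bar>v x\<bar>}"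
    by (intro measure_mono_fmeasurable sub) auto
  also note 1
  \<comment> \<open>The 576 in the claim is 4 times the square of 12, the bound for
    \<open>truncation'\<close>.\<close>
  also have "4 * r\<^sup>2 * (LINT x|lborel. (norm (k x))\<^sup>2) \<le> 4 * r\<^sup>2 * (144 / L\<^sup>2 * E)"
    using 2 by (intro mult_left_mono) auto
  finally have "L powr q * measure lborel {x. 2 * L \<le> \<bar>u x\<bar>} \<le> L powr q * (4 * r\<^sup>2 * (144 / L\<^sup>2 * E))"
    by (intro mult_left_mono) auto
  also have "\<dots> = 576 * c powr (2 / n) * V powr (2 / n) * E"
  proof -
    have "L powr q = L powr (q * (2 / n)) * L\<^sup>2" using L by (subst qn) (simp add: powr_add powr_numeral)
    then show ?thesis unfolding r2 using L by simp
  qed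
  finally show ?thesis unfolding E_def c_def w_def n_def .
qed

text \<open>A point with \<open>2 * \<delta> \<le> \<bar>u x\<bar>\<close> lies in a band
  \<open>2 * L k \<le> \<bar>u x\<bar> < 4 * L k\<close>, which costs the factor
  \<open>4 powr q\<close>. The gradient bands on the right are pairwise disjoint, so their energies
  add up to at most the full energy. The cutoff \<open>\<delta>\<close> makes the levels start
  somewhere.\<close>

lemma C1c_dyadic_sum:
  fixes u :: "'a::euclidean_space \<Rightarrow> real"
  assumes u: "C1c u g" and q: "q > 0" and d: "\<delta> > 0" and K: "K \<ge> 0"
    and dy: "\<And>L. L > 0 \<Longrightarrow> L powr q * measure lborel {x. 2 * L \<le> \<bar>u x\<bar>}
       \<le> K * (LINT x|lborel. indicator {x. L < \<bar>u x\<bar> \<and> \<bar>u x\<bar> < 2 * L} x * (norm (g x))\<^sup>2)"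
  shows "(LINT x|lborel. indicator {x. 2 * \<delta> \<le> \<bar>u x\<bar>} x * \<bar>u x\<bar> powr q)
     \<le> 4 powr q * (K * (LINT x|lborel. (norm (g x))\<^sup>2))"
proof -
  have [measurable]: "u \<in> borel_measurable borel" "g \<in> borel_measurable borel"
    using C1c_D[OF u] by auto
  obtain R where R: "\<And>x. R < norm x \<Longrightarrow> u x = 0" using C1c_supp[OF u] by auto
  obtain B where B: "B > 0" "\<And>x. norm (u x) \<le> B"
    using cont_supp_bounded[OF C1c_D(3)[OF u] R] by blast
  \<comment> \<open>\<open>u\<close> is bounded by \<open>B\<close>, so the levels below
    \<open>\<delta> * 2 ^ m\<close> are all that occur and the sum is finite.\<close>
  obtain m :: nat where m: "B / \<delta> < 2 ^ m" using real_arch_pow[of 2 "B / \<delta>"] by auto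
  define L where "L k = \<delta> * 2 ^ k" for k :: nat
  have L: "L k > 0" for k using d by (simp add: L_def)
  define P where "P k = {x. 2 * L k \<le> \<bar>u x\<bar>}" for k
  define E where "E k = {x. L k < \<bar>u x\<bar> \<and> \<bar>u x\<bar> < 2 * L k}" for k
  have [measurable]: "P k \<in> sets borel" "E k \<in> sets borel" for k
    unfolding P_def E_def by measurable
  have iP: "integrable lborel (\<lambda>x. indicator (P k) x * (4 powr q * L k powr q))" for k
  proof -
    have "P k \<subseteq> cball 0 R"
    proof
      fix x assume "x \<in> P k"
      then have "u x \<noteq> 0" using L[of k] by (auto simp: P_def)
      then show "x \<in> cball 0 R" using R[of x] by (auto simp: not_less[symmetric])
    qed
    then have "emeasure lborel (P k) < \<infinity>"
      by (intro emeasure_bounded_finite bounded_subset[OF bounded_cball])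
    then show ?thesis by (intro integrable_mult_left integrable_real_indicator) auto
  qed
  have iE: "integrable lborel (\<lambda>x. indicator (E k) x * (norm (g x))\<^sup>2)" for k
    by (rule Bochner_Integration.integrable_bound[OF C1c_integrable(4)[OF u]])
       (auto simp: indicator_def)
  have pw: "indicator {x. 2 * \<delta> \<le> \<bar>u x\<bar>} x * \<bar>u x\<bar> powr q
      \<le> (\<Sum>k<m. indicator (P k) x * (4 powr q * L k powr q))" for x
  proof (cases "2 * \<delta> \<le> \<bar>u x\<bar>")
    case False
    then show ?thesis by (simp add: sum_nonneg)
  next
    case True
    have um: "\<bar>u x\<bar> < L m" using m B(2)[of x] d by (simp add: L_def field_simps)
    \<comment> \<open>The band is found as the predecessor of the least \<open>j\<close> whose upper
      end \<open>2 * L j\<close> exceeds \<open>\<bar>u x\<bar>\<close>; the cutoff excludes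
      \<open>j = 0\<close>.\<close>
    define j where "j = (LEAST j. \<bar>u x\<bar> < 2 * L j)"
    have ex: "\<bar>u x\<bar> < 2 * L m" using um L[of m] by simp
    have j: "\<bar>u x\<bar> < 2 * L j" unfolding j_def by (rule LeastI[of _ m]) (rule ex)
    have "j \<noteq> 0"
    proof
      assume "j = 0"
      then show False using j True by (simp add: L_def)
    qed
    then obtain k where k: "j = Suc k" using not0_implies_Suc by blast
    have kn: "2 * L k \<le> \<bar>u x\<bar>" using not_less_Least[of k "\<lambda>j. \<bar>u x\<bar> < 2 * L j"] k
      unfolding j_def by simp
    have "k < m"
    proof (rule ccontr)
      assume "\<not> k < m"
      then have "L m \<le> L k" using d unfolding L_def by (intro mult_left_mono power_increasing) auto
      then show False using kn um L[of k] by simp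
    qed
    have "\<bar>u x\<bar> \<le> 4 * L k" using j unfolding k by (simp add: L_def)
    then have "\<bar>u x\<bar> powr q \<le> (4 * L k) powr q" using q by (intro powr_mono2) auto
    also have "\<dots> = indicator (P k) x * (4 powr q * L k powr q)"
      using kn L[of k] by (simp add: P_def powr_mult)
    also have "\<dots> \<le> (\<Sum>k<m. indicator (P k) x * (4 powr q * L k powr q))"
      using \<open>k < m\<close> by (intro member_le_sum) auto
    finally show ?thesis using True by simp
  qed
  have i0: "integrable lborel (\<lambda>x. indicator {x. 2 * \<delta> \<le> \<bar>u x\<bar>} x * \<bar>u x\<bar> powr q)"
    by (rule Bochner_Integration.integrable_bound[OF C1c_powr_integrable(1)[OF u q]])
       (auto simp: indicator_def)
  have "(LINT x|lborel. indicator {x. 2 * \<delta> \<le> \<bar>u x\<bar>} x * \<bar>u x\<bar> powr q)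
      \<le> (LINT x|lborel. (\<Sum>k<m. indicator (P k) x * (4 powr q * L k powr q)))"
    by (intro integral_mono i0 Bochner_Integration.integrable_sum iP pw)
  also have "\<dots> = (\<Sum>k<m. LINT x|lborel. indicator (P k) x * (4 powr q * L k powr q))"
    by (intro Bochner_Integration.integral_sum iP)
  also have "\<dots> = (\<Sum>k<m. 4 powr q * (L k powr q * measure lborel (P k)))"
    by (simp add: mult_ac)
  also have "\<dots> \<le> (\<Sum>k<m. 4 powr q * (K * (LINT x|lborel. indicator (E k) x * (norm (g x))\<^sup>2)))"
    using dy[OF L] unfolding P_def E_def by (intro sum_mono mult_left_mono) auto
  also have "\<dots> = 4 powr q * (K * (LINT x|lborel. (\<Sum>k<m. indicator (E k) x * (norm (g x))\<^sup>2)))"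
    by (subst Bochner_Integration.integral_sum[OF iE]) (simp add: sum_distrib_left)
  also have "\<dots> \<le> 4 powr q * (K * (LINT x|lborel. (norm (g x))\<^sup>2))"
  proof (intro mult_left_mono integral_mono Bochner_Integration.integrable_sum iE C1c_integrable(4)[OF u] K)
    fix x
    have "disjoint_family_on E {..<m}"
      unfolding disjoint_family_on_def
    proof safe
      fix j k y assume "j < m" "k < m" "j \<noteq> k" and y: "y \<in> E j" "y \<in> E k"
      have *: False if "i < l" "y \<in> E i" "y \<in> E l" for i l
      proof -
        have "2 * L i = \<delta> * 2 ^ Suc i" by (simp add: L_def)
        also have "\<dots> \<le> L l" unfolding L_def using d that(1)
          by (intro mult_left_mono power_increasing) auto
        finally show False using that(2,3) by (simp add: E_def)
      qed
      show "y \<in> {}" using *[of j k] *[of k j] y \<open>j \<noteq> k\<close> by (cases "j < k") auto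
    qed
    then have "(\<Sum>k<m. indicator (E k) x) = (indicator (\<Union>k<m. E k) x :: real)"
      by (intro indicator_UN_disjoint[symmetric]) auto
    then have "(\<Sum>k<m. indicator (E k) x) \<le> (1::real)" by (simp add: indicator_def)
    then show "(\<Sum>k<m. indicator (E k) x * (norm (g x))\<^sup>2) \<le> (norm (g x))\<^sup>2"
      unfolding sum_distrib_right[symmetric] by (intro mult_left_le_one_le) (auto intro: sum_nonneg)
  qed auto
  finally show ?thesis .
qed

text \<open>The dyadic sum gives \<open>V \<le> K * V powr (2 / n) * G\<close> with the critical
  integral \<open>V\<close> on both sides. It is finite for a compactly supported function, so it
  can be divided out, and \<open>1 - 2 / n = 2 / q\<close>. Dominated convergence removes the
  cutoff.\<close>

lemma C1c_sobolev:
  assumes N: "DIM('a::euclidean_space) > 2" and q: "q = crit_exp DIM('a)"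
  shows "\<exists>C>0. \<forall>(u::'a \<Rightarrow> real) g. C1c u g \<longrightarrow>
     (LINT x|lborel. \<bar>u x\<bar> powr q) powr (2 / q) \<le> C * (LINT x|lborel. (norm (g x))\<^sup>2)"
proof -
  define n where "n = real DIM('a)"
  have n: "n > 2" using N by (simp add: n_def)
  have qv: "q = 2 * n / (n - 2)" by (simp add: q crit_exp_def n_def)
  have q2: "q > 2" unfolding qv using n by (simp add: field_simps)
  have qn: "2 / q + 2 / n = 1" unfolding qv using n by (simp add: field_simps)
  define c where "c = 576 * (18 powr q / measure lborel (cball (0::'a) 1)) powr (2 / n)"
  have c: "c \<ge> 0" by (simp add: c_def)
  have main: "(LINT x|lborel. \<bar>u x\<bar> powr q) powr (2 / q) \<le> (4 powr q * c + 1) * (LINT x|lborel. (norm (g x))\<^sup>2)"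
    if u: "C1c u g" for u :: "'a \<Rightarrow> real" and g
  proof -
    define V where "V = (LINT x|lborel. \<bar>u x\<bar> powr q)"
    define G where "G = (LINT x|lborel. (norm (g x))\<^sup>2)"
    have G: "G \<ge> 0" by (simp add: G_def)
    have V0: "V \<ge> 0" by (simp add: V_def)
    have [measurable]: "u \<in> borel_measurable borel" using C1c_D[OF u] by auto
    show ?thesis
    proof (cases "V = 0")
      case True
      then show ?thesis using c G unfolding V_def[symmetric] G_def[symmetric] by simp
    next
      case False
      with V0 have V: "V > 0" by simp
      have bd: "(LINT x|lborel. indicator {x. 2 * inverse (real (Suc i)) \<le> \<bar>u x\<bar>} x * \<bar>u x\<bar> powr q)
          \<le> 4 powr q * (c * V powr (2 / n) * G)" for i
        unfolding G_def
        by (rule C1c_dyadic_sum[OF u])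
           (use q2 c C1c_dyadic[OF u N q _ V_def V] in \<open>auto simp: c_def n_def\<close>)
      have "(\<lambda>i. LINT x|lborel. indicator {x. 2 * inverse (real (Suc i)) \<le> \<bar>u x\<bar>} x * \<bar>u x\<bar> powr q) \<longlonglongrightarrow> V"
        unfolding V_def
      proof (rule integral_dominated_convergence[where w="\<lambda>x. \<bar>u x\<bar> powr q"])
        show "integrable lborel (\<lambda>x. \<bar>u x\<bar> powr q)" using q2 by (intro C1c_powr_integrable[OF u]) auto
        have "(\<lambda>i. indicator {x. 2 * inverse (real (Suc i)) \<le> \<bar>u x\<bar>} x * \<bar>u x\<bar> powr q) \<longlonglongrightarrow> \<bar>u x\<bar> powr q" for x
        proof (cases "u x = 0")
          case False
          have "(\<lambda>i. 2 * inverse (real (Suc i))) \<longlonglongrightarrow> 2 * 0"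
            by (intro tendsto_intros LIMSEQ_inverse_real_of_nat)
          then have "eventually (\<lambda>i. 2 * inverse (real (Suc i)) < \<bar>u x\<bar>) sequentially"
            by (rule order_tendstoD(2)) (use False in simp)
          then have "eventually (\<lambda>i. indicator {x. 2 * inverse (real (Suc i)) \<le> \<bar>u x\<bar>} x * \<bar>u x\<bar> powr q = \<bar>u x\<bar> powr q) sequentially"
            by eventually_elim simp
          then show ?thesis by (rule tendsto_eventually)
        qed simp
        then show "AE x in lborel. (\<lambda>i. indicator {x. 2 * inverse (real (Suc i)) \<le> \<bar>u x\<bar>} x * \<bar>u x\<bar> powr q) \<longlonglongrightarrow> \<bar>u x\<bar> powr q"
          by blast
      qed (auto simp: indicator_def)
      then have "V \<le> 4 powr q * (c * V powr (2 / n) * G)"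
        by (rule LIMSEQ_le_const2) (use bd in auto)
      moreover have "V = V powr (2 / q) * V powr (2 / n)"
        using V by (simp add: powr_add[symmetric] qn)
      ultimately have "V powr (2 / n) * V powr (2 / q) \<le> V powr (2 / n) * (4 powr q * c * G)"
        by (simp add: mult_ac)
      moreover have "V powr (2 / n) > 0" using V by simp
      ultimately have "V powr (2 / q) \<le> 4 powr q * c * G" by (simp only: mult_le_cancel_left_pos)
      then show ?thesis using G unfolding V_def[symmetric] G_def[symmetric] by (simp add: algebra_simps)
    qed
  qed
  show ?thesis using main c by (intro exI[of _ "4 powr q * c + 1"]) (auto intro: add_nonneg_pos)
qed

section \<open>Test functions\<close>

lemma frechet_eqI: "(f has_derivative f') (at x) \<Longrightarrow> frechet_derivative f (at x) i = f' i"
  using frechet_derivative_at by metis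

lemma C_k_const: "C_k k (\<lambda>x. c)"
  by (induction k arbitrary: c) (auto simp: frechet_derivative_const)

declare C_k.simps(2)[simp del]

lemma C_k_SucD: "C_k (Suc k) f \<Longrightarrow> C_k k f"
proof (induction k arbitrary: f)
  case 0
  then show ?case
    by (auto intro!: differentiable_imp_continuous_on simp: differentiable_on_def C_k.simps(2))
next
  case (Suc k)
  then show ?case unfolding C_k.simps(2)[of "Suc k" f] C_k.simps(2)[of k f] by blast
qed

lemma C_k_add:
  fixes f g :: "'a::euclidean_space \<Rightarrow> real"
  shows "C_k k f \<Longrightarrow> C_k k g \<Longrightarrow> C_k k (\<lambda>x. f x + g x)"
proof (induction k arbitrary: f g)
  case 0
  then show ?case by (auto intro: continuous_on_add)
next
  case (Suc k)
  have f: "f differentiable at x" and g: "g differentiable at x" for x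
    using Suc.prems by (auto simp: C_k.simps(2))
  have eq: "frechet_derivative (\<lambda>x. f x + g x) (at x) i
      = frechet_derivative f (at x) i + frechet_derivative g (at x) i" for x i
    using f[unfolded frechet_derivative_works] g[unfolded frechet_derivative_works]
    by (intro frechet_eqI has_derivative_add)
  show ?case unfolding C_k.simps(2) eq
    using Suc.prems f g by (auto intro!: differentiable_add Suc.IH simp: C_k.simps(2))
qed

lemma C_k_mult:
  fixes f g :: "'a::euclidean_space \<Rightarrow> real"
  shows "C_k k f \<Longrightarrow> C_k k g \<Longrightarrow> C_k k (\<lambda>x. f x * g x)"
proof (induction k arbitrary: f g)
  case 0
  then show ?case by (auto intro: continuous_on_mult)
next
  case (Suc k)
  have f: "f differentiable at x" and g: "g differentiable at x" for x
    using Suc.prems by (auto simp: C_k.simps(2))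
  have eq: "frechet_derivative (\<lambda>x. f x * g x) (at x) i
      = f x * frechet_derivative g (at x) i + frechet_derivative f (at x) i * g x" for x i
    using f[unfolded frechet_derivative_works] g[unfolded frechet_derivative_works]
    by (intro frechet_eqI has_derivative_mult)
  have c: "C_k k f" "C_k k g" using Suc.prems by (auto intro: C_k_SucD)
  show ?case unfolding C_k.simps(2) eq
    using Suc.prems f g by (auto intro!: differentiable_mult C_k_add Suc.IH c simp: C_k.simps(2))
qed

lemma C_k_prod:
  fixes f :: "'i \<Rightarrow> 'a::euclidean_space \<Rightarrow> real"
  shows "finite I \<Longrightarrow> (\<And>i. i \<in> I \<Longrightarrow> C_k k (f i)) \<Longrightarrow> C_k k (\<lambda>x. \<Prod>i\<in>I. f i x)"
  by (induction I rule: finite_induct) (auto intro: C_k_const C_k_mult)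

text \<open>The polynomial makes the family closed under differentiation, so that smoothness follows
  by one induction with \<open>p\<close> general. \<open>smooth_step 1\<close> is the usual flat
  function exp(-1/t).\<close>

definition smooth_step :: "real poly \<Rightarrow> real \<Rightarrow> real" where
  "smooth_step p t = (if t > 0 then poly p (1 / t) * exp (- 1 / t) else 0)"

lemma poly_exp_tendsto: "((\<lambda>y. poly p y * exp (- y)) \<longlongrightarrow> (0::real)) at_top"
proof -
  have "((\<lambda>y. \<Sum>i\<le>degree p. coeff p i * (y ^ i / exp y)) \<longlongrightarrow> (\<Sum>i\<le>degree p. coeff p i * 0)) at_top"
    by (intro tendsto_sum tendsto_mult tendsto_const tendsto_power_div_exp_0)
  moreover have "(\<lambda>y. \<Sum>i\<le>degree p. coeff p i * (y ^ i / exp y)) = (\<lambda>y. poly p y * exp (- y))"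
    by (auto simp: poly_altdef sum_distrib_right exp_minus divide_inverse mult.assoc intro!: ext sum.cong)
  ultimately show ?thesis by simp
qed

lemma smooth_step_tendsto0: "(smooth_step p \<longlongrightarrow> 0) (at 0)"
proof -
  have "((\<lambda>t. poly p (inverse t) * exp (- inverse t)) \<longlongrightarrow> 0) (at_right (0::real))"
    by (rule filterlim_compose[OF poly_exp_tendsto filterlim_inverse_at_top_right])
  then have 1: "(smooth_step p \<longlongrightarrow> 0) (at_right 0)"
    by (rule Lim_transform_eventually)
       (auto simp: smooth_step_def eventually_at_filter inverse_eq_divide intro!: always_eventually)
  have 2: "(smooth_step p \<longlongrightarrow> 0) (at_left 0)"
    by (rule tendsto_eventually) (auto simp: smooth_step_def eventually_at_filter)
  show ?thesis using 1 2 by (simp add: filterlim_at_split)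
qed

text \<open>In terms of y = 1/t, the derivative of p(y) exp(-y) with respect to t is y^2 (p(y) -
  p'(y)) exp(-y).\<close>

definition step_deriv :: "real poly \<Rightarrow> real poly" where
  "step_deriv p = [:0, 0, 1:] * (p - pderiv p)"

lemma smooth_step_deriv:
  "(smooth_step p has_real_derivative smooth_step (step_deriv p) x) (at x)"
proof -
  consider "x > 0" | "x < 0" | "x = 0" by linarith
  then show ?thesis
  proof cases
    case 1
    have "((\<lambda>t. poly p (1 / t) * exp (- 1 / t)) has_real_derivative smooth_step (step_deriv p) x) (at x)"
      using 1
      by (auto intro!: derivative_eq_intros DERIV_chain2[OF poly_DERIV]
          simp: smooth_step_def step_deriv_def field_simps power2_eq_square)
    then show ?thesis
      by (rule has_field_derivative_transform_within_open[where S="{0<..}"])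
         (use 1 in \<open>auto simp: smooth_step_def\<close>)
  next
    case 2
    have "((\<lambda>t. 0) has_real_derivative smooth_step (step_deriv p) x) (at x)"
      using 2 by (auto intro!: derivative_eq_intros simp: smooth_step_def)
    then show ?thesis
      by (rule has_field_derivative_transform_within_open[where S="{..<0}"])
         (use 2 in \<open>auto simp: smooth_step_def\<close>)
  next
    case 3
    \<comment> \<open>Division by \<open>h\<close> multiplies the polynomial by its variable, so the
      difference quotient at 0 belongs to the same family and tends to 0.\<close>
    have "(\<lambda>h. smooth_step p h / h) = smooth_step ([:0, 1:] * p)"
      by (auto simp: smooth_step_def)
    then show ?thesis using 3 smooth_step_tendsto0[of "[:0, 1:] * p"]
      by (simp add: DERIV_def smooth_step_def)
  qed
qed

lemma C_k_smooth_step: "C_k k (\<lambda>x::'a::euclidean_space. smooth_step p (c * (x \<bullet> e - d)))"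
proof (induction k arbitrary: p)
  case 0
  have "continuous_on UNIV (smooth_step p)"
    by (intro continuous_at_imp_continuous_on ballI DERIV_isCont[OF smooth_step_deriv])
  then show ?case
    by (auto intro!: continuous_on_compose2[of UNIV "smooth_step p"] continuous_intros)
next
  case (Suc k)
  have d: "((\<lambda>x::'a. smooth_step p (c * (x \<bullet> e - d))) has_derivative
      (\<lambda>h. smooth_step (step_deriv p) (c * (x \<bullet> e - d)) * (c * (h \<bullet> e)))) (at x)" for x
    by (rule has_derivative_compose[OF _ smooth_step_deriv[THEN has_field_derivative_imp_has_derivative]])
       (auto intro!: derivative_eq_intros)
  then have eq: "(\<lambda>x::'a. frechet_derivative (\<lambda>x. smooth_step p (c * (x \<bullet> e - d))) (at x) i)
      = (\<lambda>x. smooth_step (step_deriv p) (c * (x \<bullet> e - d)) * (c * (i \<bullet> e)))" for i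
    by (intro ext frechet_eqI)
  show ?case using d unfolding C_k.simps(2) eq
    by (auto intro!: C_k_mult Suc.IH C_k_const simp: differentiable_def)
qed

text \<open>The parameter \<open>c\<close> does not change the box where the function is nonzero; it
  only sharpens the profile, so that \<open>c \<longlonglongrightarrow> \<infinity>\<close> gives
  the indicator of the box.\<close>

definition bump :: "'a::euclidean_space \<Rightarrow> 'a \<Rightarrow> real \<Rightarrow> 'a \<Rightarrow> real" where
  "bump a b c x = (\<Prod>i\<in>Basis. smooth_step 1 (c * (x \<bullet> i - a \<bullet> i)) * smooth_step 1 ((- c) * (x \<bullet> i - b \<bullet> i)))"

lemma smooth_step_1: "0 \<le> smooth_step 1 t" "smooth_step 1 t \<le> 1" "smooth_step 1 t \<noteq> 0 \<longleftrightarrow> t > 0"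
  by (auto simp: smooth_step_def)

lemma C_k_bump: "C_k k (bump a b c)"
  unfolding bump_def[abs_def] by (intro C_k_prod C_k_mult C_k_smooth_step) auto

lemma bump_nonzero: "c > 0 \<Longrightarrow> bump a b c x \<noteq> 0 \<longleftrightarrow> x \<in> box a b"
  by (auto simp: bump_def smooth_step_1 mem_box zero_less_mult_iff mult_less_0_iff)

lemma bump_bounds: "0 \<le> bump a b c x" "bump a b c x \<le> 1"
  unfolding bump_def by (intro prod_nonneg prod_le_1 ballI conjI mult_nonneg_nonneg mult_le_one smooth_step_1)+

lemma smooth_step_lim: "t > 0 \<Longrightarrow> (\<lambda>n. smooth_step 1 (real (Suc n) * t)) \<longlonglongrightarrow> 1"
proof -
  assume t: "t > 0"
  have "(\<lambda>n. exp (- (inverse (real (Suc n)) * (1 / t)))) \<longlonglongrightarrow> exp (- (0 * (1 / t)))"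
    by (intro tendsto_intros LIMSEQ_inverse_real_of_nat)
  moreover have "exp (- (inverse (real (Suc n)) * (1 / t))) = smooth_step 1 (real (Suc n) * t)" for n
    using t by (simp add: smooth_step_def inverse_eq_divide zero_less_mult_iff)
  ultimately show ?thesis by simp
qed

lemma bump_lim: "(\<lambda>n. bump a b (real (Suc n)) x) \<longlonglongrightarrow> indicator (box a b) x"
proof (cases "x \<in> box a b")
  case True
  have "(\<lambda>n. bump a b (real (Suc n)) x) \<longlonglongrightarrow> (\<Prod>i\<in>(Basis::'a set). 1 * 1)"
    unfolding bump_def
  proof (intro tendsto_prod tendsto_mult)
    fix i :: 'a assume i: "i \<in> Basis"
    show "(\<lambda>n. smooth_step 1 (real (Suc n) * (x \<bullet> i - a \<bullet> i))) \<longlonglongrightarrow> 1"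
      using True i by (intro smooth_step_lim) (auto simp: mem_box)
    have "(\<lambda>n. smooth_step 1 (real (Suc n) * (b \<bullet> i - x \<bullet> i))) \<longlonglongrightarrow> 1"
      using True i by (intro smooth_step_lim) (auto simp: mem_box)
    moreover have "real (Suc n) * (b \<bullet> i - x \<bullet> i) = - real (Suc n) * (x \<bullet> i - b \<bullet> i)" for n
      by (simp add: algebra_simps)
    ultimately show "(\<lambda>n. smooth_step 1 (- real (Suc n) * (x \<bullet> i - b \<bullet> i))) \<longlonglongrightarrow> 1" by (simp only:)
  qed
  then show ?thesis using True by simp
next
  case False
  then have "bump a b (real (Suc n)) x = 0" for n using bump_nonzero[of "real (Suc n)" a b x] by auto
  then show ?thesis using False by simp
qed

lemma bump_test:
  assumes "c > 0" "cbox a b \<subseteq> \<Omega>"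
  shows "bump a b c \<in> test_functions \<Omega>"
proof -
  have "closure {x. bump a b c x \<noteq> 0} \<subseteq> cbox a b"
    using bump_nonzero[OF assms(1), of a b] box_subset_cbox[of a b]
    by (intro closure_minimal) auto
  moreover from this have "compact (closure {x. bump a b c x \<noteq> 0})"
    by (metis bounded_cbox bounded_subset closed_closure compact_eq_bounded_closed)
  ultimately show ?thesis using assms C_k_bump unfolding test_functions_def by blast
qed

lemma test_add:
  assumes "\<phi> \<in> test_functions \<Omega>" "\<psi> \<in> test_functions \<Omega>"
  shows "(\<lambda>x. \<phi> x + \<psi> x) \<in> test_functions \<Omega>"
proof -
  have "closure {x. \<phi> x + \<psi> x \<noteq> 0} \<subseteq> closure {x. \<phi> x \<noteq> 0} \<union> closure {x. \<psi> x \<noteq> 0}"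
    unfolding closure_Un[symmetric] by (intro closure_mono) auto
  moreover have "compact (closure {x. \<phi> x \<noteq> 0} \<union> closure {x. \<psi> x \<noteq> 0})"
    using assms by (intro compact_Un) (auto simp: test_functions_def)
  ultimately have "compact (closure {x. \<phi> x + \<psi> x \<noteq> 0})"
    using compact_Int_closed[of "closure {x. \<phi> x \<noteq> 0} \<union> closure {x. \<psi> x \<noteq> 0}" "closure {x. \<phi> x + \<psi> x \<noteq> 0}"]
    by (simp add: Int_absorb1)
  with \<open>closure {x. \<phi> x + \<psi> x \<noteq> 0} \<subseteq> _\<close> show ?thesis
    using assms by (auto simp: test_functions_def intro: C_k_add)
qed

lemma test_scale:
  assumes "\<phi> \<in> test_functions \<Omega>"
  shows "(\<lambda>x. c * \<phi> x) \<in> test_functions \<Omega>"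
proof (cases "c = 0")
  case True
  then show ?thesis by (simp add: test_functions_def C_k_const)
next
  case False
  then show ?thesis using assms by (auto simp: test_functions_def intro: C_k_mult C_k_const)
qed

definition gradf :: "('a::euclidean_space \<Rightarrow> real) \<Rightarrow> 'a \<Rightarrow> 'a" where
  "gradf \<phi> x = (\<Sum>i\<in>Basis. frechet_derivative \<phi> (at x) i *\<^sub>R i)"

lemma gradf_deriv:
  fixes \<phi> :: "'a::euclidean_space \<Rightarrow> real"
  assumes "\<phi> differentiable at x"
  shows "(\<phi> has_derivative (\<lambda>h. gradf \<phi> x \<bullet> h)) (at x)"
proof -
  have d: "(\<phi> has_derivative frechet_derivative \<phi> (at x)) (at x)"
    using assms by (simp add: frechet_derivative_works[symmetric])
  have l: "linear (frechet_derivative \<phi> (at x))" by (rule has_derivative_linear[OF d])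
  have "frechet_derivative \<phi> (at x) h = gradf \<phi> x \<bullet> h" for h
  proof -
    have "frechet_derivative \<phi> (at x) h = frechet_derivative \<phi> (at x) (\<Sum>i\<in>Basis. (h \<bullet> i) *\<^sub>R i)"
      by (simp add: euclidean_representation)
    also have "\<dots> = (\<Sum>i\<in>Basis. (h \<bullet> i) * frechet_derivative \<phi> (at x) i)"
      using l by (simp add: linear_sum linear_scale)
    also have "\<dots> = gradf \<phi> x \<bullet> h"
      by (simp add: gradf_def inner_sum_left inner_commute[of h] mult.commute)
    finally show ?thesis .
  qed
  then have "frechet_derivative \<phi> (at x) = (\<lambda>h. gradf \<phi> x \<bullet> h)" by (rule ext)
  then show ?thesis using d by metis
qed

lemma test_support: "\<phi> \<in> test_functions \<Omega> \<Longrightarrow> x \<notin> \<Omega> \<Longrightarrow> \<phi> x = 0"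
  using closure_subset[of "{x. \<phi> x \<noteq> 0}"] unfolding test_functions_def by blast

lemma test_C1c:
  assumes "\<phi> \<in> test_functions \<Omega>"
  shows "C1c \<phi> (gradf \<phi>)"
  unfolding C1c_def
proof (intro conjI allI)
  have k: "C_k k \<phi>" for k using assms by (auto simp: test_functions_def)
  have d: "\<phi> differentiable at x" for x using k[of 1] by (simp add: C_k.simps(2))
  then show "(\<phi> has_derivative (\<bullet>) (gradf \<phi> x)) (at x)" for x by (rule gradf_deriv)
  show "continuous_on UNIV (gradf \<phi>)"
    unfolding gradf_def[abs_def] using k[of 1] by (intro continuous_intros) (auto simp: C_k.simps(2))
  have "bounded (closure {x. \<phi> x \<noteq> 0})" using assms by (auto simp: test_functions_def compact_imp_bounded)
  then obtain R where "\<And>x. x \<in> closure {x. \<phi> x \<noteq> 0} \<Longrightarrow> norm x \<le> R" by (auto simp: bounded_iff)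
  then have "\<phi> x = 0" if "R < norm x" for x using that closure_subset[of "{x. \<phi> x \<noteq> 0}"] by fastforce
  then show "\<exists>R. \<forall>x. R < norm x \<longrightarrow> \<phi> x = 0" by blast
qed

lemma C1c_frechet: "C1c \<phi> g \<Longrightarrow> frechet_derivative \<phi> (at x) i = g x \<bullet> i"
  by (rule frechet_eqI[OF C1c_D(1)])

text \<open>Weak gradients are tested against partial derivatives, which must be admissible
  themselves: for the integrability of products, and for being differentiated a second time in
  \<open>grad_inner_test\<close>.\<close>

lemma test_partial:
  assumes t: "\<phi> \<in> test_functions \<Omega>" and i: "i \<in> Basis"
  shows "(\<lambda>x. frechet_derivative \<phi> (at x) i) \<in> test_functions \<Omega>"
proof -
  let ?S = "closure {x. \<phi> x \<noteq> 0}"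
  have "frechet_derivative \<phi> (at x) i = 0" if x: "x \<notin> ?S" for x
  proof -
    have "((\<lambda>y. 0) has_derivative (\<lambda>h. 0)) (at x)" by (rule has_derivative_const)
    then have "(\<phi> has_derivative (\<lambda>h. 0)) (at x)"
    proof (rule has_derivative_transform_within_open)
      show "open (- ?S)" by (rule open_Compl) (rule closed_closure)
      show "x \<in> - ?S" using x by simp
      show "0 = \<phi> y" if "y \<in> - ?S" for y using that closure_subset[of "{x. \<phi> x \<noteq> 0}"] by auto
    qed
    then show ?thesis by (rule frechet_eqI)
  qed
  then have sub: "closure {x. frechet_derivative \<phi> (at x) i \<noteq> 0} \<subseteq> ?S"
    by (intro closure_minimal) auto
  moreover have "compact (closure {x. frechet_derivative \<phi> (at x) i \<noteq> 0})"
    using t compact_Int_closed[of ?S "closure {x. frechet_derivative \<phi> (at x) i \<noteq> 0}"] sub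
    by (simp add: Int_absorb1 test_functions_def)
  moreover have "C_k k (\<lambda>x. frechet_derivative \<phi> (at x) i)" for k
  proof -
    have "C_k (Suc k) \<phi>" using t unfolding test_functions_def by blast
    then show ?thesis using i by (simp add: C_k.simps(2))
  qed
  ultimately show ?thesis using t by (auto simp: test_functions_def)
qed

lemma lebesgue_on_lborel:
  fixes f :: "'a::euclidean_space \<Rightarrow> 'b::{banach, second_countable_topology}"
  assumes [measurable]: "f \<in> borel_measurable borel" and S: "open \<Omega>" and z: "\<And>x. x \<notin> \<Omega> \<Longrightarrow> f x = 0"
  shows "(LINT x|lebesgue_on \<Omega>. f x) = (LINT x|lborel. f x)"
    "integrable (lebesgue_on \<Omega>) f \<longleftrightarrow> integrable lborel f"
proof -
  have *: "(\<lambda>x. indicator \<Omega> x *\<^sub>R f x) = f" using z by (auto simp: indicator_def fun_eq_iff)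
  have [simp]: "\<Omega> \<in> sets lebesgue" using S by auto
  show "(LINT x|lebesgue_on \<Omega>. f x) = (LINT x|lborel. f x)"
    by (simp add: integral_restrict_space * integral_completion)
  show "integrable (lebesgue_on \<Omega>) f \<longleftrightarrow> integrable lborel f"
    by (simp add: integrable_restrict_space * integrable_completion)
qed

text \<open>Open boxes are stable under intersection and generate the Borel sets, so the integral
  over every Borel set vanishes by induction over disjoint unions and complements.\<close>

lemma integral_boxes_zero_AE:
  fixes w :: "'a::euclidean_space \<Rightarrow> real"
  assumes w: "integrable lborel w" and z: "\<And>a b. (LINT x|lborel. indicator (box a b) x * w x) = 0"
  shows "AE x in lborel. w x = 0"
proof (rule sigma_finite_measure.density_zero[OF sigma_finite_lborel w])
  have [measurable]: "w \<in> borel_measurable borel" using w by (auto dest: borel_measurable_integrable)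
  let ?E = "range (\<lambda>(a, b). box a b::'a set)"
  have si: "set_integrable lborel A w" if "A \<in> sets borel" for A
    using w that unfolding set_integrable_def by (intro integrable_mult_indicator) auto
  \<comment> \<open>The complement step needs the integral over the whole space, which is not a box;
    it is reached by exhausting the space with cubes.\<close>
  have tot: "(LINT x|lborel. w x) = 0"
  proof -
    have "(\<lambda>n. LINT x|lborel. indicator (box (- (real n *\<^sub>R One)) (real n *\<^sub>R One)) x * w x) \<longlonglongrightarrow> (LINT x|lborel. w x)"
    proof (rule integral_dominated_convergence[where w="\<lambda>x. norm (w x)"])
      have "(\<lambda>n. indicator (box (- (real n *\<^sub>R One)) (real n *\<^sub>R One)) x * w x) \<longlonglongrightarrow> w x" for x :: 'a
      proof (rule tendsto_eventually)
        have "x \<in> (\<Union>i::nat. box (- (real i *\<^sub>R One)) (real i *\<^sub>R One))"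
          unfolding UN_box_eq_UNIV by simp
        then obtain n where n: "x \<in> box (- (real n *\<^sub>R One)) (real n *\<^sub>R One)"
          by blast
        have "indicator (box (- (real m *\<^sub>R One)) (real m *\<^sub>R One)) x * w x = w x" if "m \<ge> n" for m
        proof -
          have "x \<in> box (- (real m *\<^sub>R One)) (real m *\<^sub>R One)"
            unfolding mem_box
          proof
            fix i :: 'a assume i: "i \<in> Basis"
            have "- real n < x \<bullet> i" "x \<bullet> i < real n" using n i by (auto simp: mem_box)
            then show "- (real m *\<^sub>R One) \<bullet> i < x \<bullet> i \<and> x \<bullet> i < (real m *\<^sub>R One) \<bullet> i"
              using that i by auto
          qed
          then show ?thesis by simp
        qed
        then show "eventually (\<lambda>n. indicator (box (- (real n *\<^sub>R One)) (real n *\<^sub>R One)) x * w x = w x) sequentially"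
          unfolding eventually_sequentially by blast
      qed
      then show "AE x in lborel. (\<lambda>n. indicator (box (- (real n *\<^sub>R One)) (real n *\<^sub>R One)) x * w x) \<longlonglongrightarrow> w x"
        by blast
    qed (use w in \<open>auto simp: indicator_def\<close>)
    then show ?thesis using z by (simp add: LIMSEQ_const_iff)
  qed
  fix A :: "'a set" assume "A \<in> sets lborel"
  then have A: "A \<in> sigma_sets UNIV ?E" by (simp add: borel_eq_box)
  show "(LINT x:A|lborel. w x) = 0"
  proof (rule sigma_sets_induct_disjoint[OF _ _ A])
    show "Int_stable ?E" by (auto simp: Int_stable_def box_Int_box)
    show "(LINT x:A|lborel. w x) = 0" if "A \<in> ?E" for A
      using that z by (auto simp: set_lebesgue_integral_def)
    show "(LINT x:{}|lborel. w x) = 0" by (simp add: set_lebesgue_integral_def)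
    show "(LINT x:UNIV - A|lborel. w x) = 0"
      if A: "A \<in> sigma_sets UNIV ?E" and zA: "(LINT x:A|lborel. w x) = 0" for A
    proof -
      have Ab: "A \<in> sets borel" using A by (simp add: borel_eq_box)
      have "indicator (UNIV - A) x *\<^sub>R w x = w x - indicator A x *\<^sub>R w x" for x
        by (auto simp: indicator_def)
      then show ?thesis using zA si[OF Ab] w tot by (simp add: set_lebesgue_integral_def set_integrable_def)
    qed
    show "(LINT x:(\<Union>i. A i)|lborel. w x) = 0"
      if d: "disjoint_family A" and A: "range A \<subseteq> sigma_sets UNIV ?E" and zA: "\<And>i::nat. (LINT x:A i|lborel. w x) = 0" for A
    proof -
      have Ab: "A i \<in> sets lborel" for i using A by (auto simp: borel_eq_box)
      have "(LINT x:(\<Union>i. A i)|lborel. w x) = (\<Sum>i. LINT x:A i|lborel. w x)"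
        using Ab d si[of "\<Union>i. A i"] unfolding disjoint_family_on_def
        by (intro lebesgue_integral_countable_add) auto
      then show ?thesis using zA by simp
    qed
  qed auto
qed

section \<open>Square integrable functions\<close>

definition square_integrable :: "'a measure \<Rightarrow> ('a \<Rightarrow> 'b::euclidean_space) \<Rightarrow> bool" where
  "square_integrable M f \<longleftrightarrow> f \<in> borel_measurable M \<and> integrable M (\<lambda>x. (norm (f x))\<^sup>2)"

lemma L2_sqi: "f \<in> L2 \<Omega> \<longleftrightarrow> square_integrable (lebesgue_on \<Omega>) f"
  by (simp add: L2_def square_integrable_def)

lemma square_integrable_meas [measurable_dest]: "square_integrable M f \<Longrightarrow> f \<in> borel_measurable M" by (simp add: square_integrable_def)
lemma square_integrable_int: "square_integrable M f \<Longrightarrow> integrable M (\<lambda>x. (norm (f x))\<^sup>2)" by (simp add: square_integrable_def)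

lemma inner_le_squares: "\<bar>x \<bullet> y\<bar> \<le> (norm x)\<^sup>2 + (norm y)\<^sup>2" for x y :: "'b::euclidean_space"
proof -
  have "\<bar>x \<bullet> y\<bar> \<le> norm x * norm y" by (rule Cauchy_Schwarz_ineq2)
  moreover have "2 * (norm x * norm y) \<le> (norm x)\<^sup>2 + (norm y)\<^sup>2"
    using sum_squares_bound[of "norm x" "norm y"] by simp
  moreover have "0 \<le> norm x * norm y" by simp
  ultimately show ?thesis by linarith
qed

lemma norm_add_sq_le: "(norm (x + y))\<^sup>2 \<le> 2 * (norm x)\<^sup>2 + 2 * (norm y)\<^sup>2" for x y :: "'b::euclidean_space"
proof -
  have "0 \<le> (norm (x - y))\<^sup>2" by simp
  then show ?thesis by (simp add: power2_norm_eq_inner inner_add inner_diff inner_commute)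
qed

lemma norm_diff_sq_le: "(norm (x - y))\<^sup>2 \<le> 2 * (norm x)\<^sup>2 + 2 * (norm y)\<^sup>2" for x y :: "'b::euclidean_space"
  using norm_add_sq_le[of x "- y"] by simp

lemma square_integrable_inner: "square_integrable M f \<Longrightarrow> square_integrable M g \<Longrightarrow> integrable M (\<lambda>x. f x \<bullet> g x)"
  by (rule Bochner_Integration.integrable_bound[OF
        Bochner_Integration.integrable_add[OF square_integrable_int[of M f] square_integrable_int[of M g]]])
     (auto intro: order_trans[OF inner_le_squares])

lemma square_integrable_add: "square_integrable M f \<Longrightarrow> square_integrable M g \<Longrightarrow> square_integrable M (\<lambda>x. f x + g x)"
  unfolding square_integrable_def[of M "\<lambda>x. f x + g x"]
proof (intro conjI)
  assume f: "square_integrable M f" and g: "square_integrable M g"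
  then show "(\<lambda>x. f x + g x) \<in> borel_measurable M" by measurable
  show "integrable M (\<lambda>x. (norm (f x + g x))\<^sup>2)"
    using f g
    by (intro Bochner_Integration.integrable_bound[OF Bochner_Integration.integrable_add[OF
        integrable_mult_right[of 2, OF square_integrable_int[OF f]] integrable_mult_right[of 2, OF square_integrable_int[OF g]]]])
       (auto intro: norm_add_sq_le)
qed

lemma square_integrable_scale: "square_integrable M f \<Longrightarrow> square_integrable M (\<lambda>x. c *\<^sub>R f x)"
  by (auto simp: square_integrable_def power_mult_distrib)

lemma square_integrable_diff: "square_integrable M f \<Longrightarrow> square_integrable M g \<Longrightarrow> square_integrable M (\<lambda>x. f x - g x)"
  using square_integrable_add[of M f "\<lambda>x. (-1) *\<^sub>R g x"] square_integrable_scale[of M g "-1"] by simp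

lemma square_integrable_AE:
  assumes "square_integrable M f" "AE x in M. f x = g x" "g \<in> borel_measurable M"
  shows "square_integrable M g"
proof -
  have "integrable M (\<lambda>x. (norm (g x))\<^sup>2) = integrable M (\<lambda>x. (norm (f x))\<^sup>2)"
    using assms by (intro integrable_cong_AE) (auto dest: square_integrable_meas)
  then show ?thesis using assms by (auto simp: square_integrable_def)
qed

lemma square_integrable_integrable: "finite_measure M \<Longrightarrow> square_integrable M f \<Longrightarrow> integrable M f"
proof -
  assume "finite_measure M" and f: "square_integrable M f"
  then have c: "integrable M (\<lambda>x. 1 + (norm (f x))\<^sup>2)"
    by (auto intro!: Bochner_Integration.integrable_add square_integrable_int finite_measure.integrable_const)
  show ?thesis
  proof (rule Bochner_Integration.integrable_bound[OF c])
    have "t \<le> 1 + t\<^sup>2" for t :: real using zero_le_power2[of "t - 1/2"]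
      by (simp add: power2_eq_square algebra_simps)
    then show "AE x in M. norm (f x) \<le> norm (1 + (norm (f x))\<^sup>2)"
      by (auto intro!: AE_I2 simp: abs_of_nonneg)
  qed (use f in measurable)
qed

text \<open>The squared norm of \<open>t f - g\<close> is a nonnegative quadratic polynomial in
  \<open>t\<close>; the claim is that its discriminant is not positive.\<close>

lemma square_integrable_CS:
  assumes f: "square_integrable M f" and g: "square_integrable M g"
  shows "\<bar>LINT x|M. f x \<bullet> g x\<bar> \<le> sqrt (LINT x|M. (norm (f x))\<^sup>2) * sqrt (LINT x|M. (norm (g x))\<^sup>2)"
proof -
  define A where "A = (LINT x|M. (norm (f x))\<^sup>2)"
  define B where "B = (LINT x|M. f x \<bullet> g x)"
  define C where "C = (LINT x|M. (norm (g x))\<^sup>2)"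
  note i = square_integrable_int[OF f] square_integrable_int[OF g] square_integrable_inner[OF f g]
  have q: "0 \<le> A * t\<^sup>2 - 2 * B * t + C" for t
  proof -
    have "0 \<le> (LINT x|M. (norm (t *\<^sub>R f x - g x))\<^sup>2)" by simp
    also have "(\<lambda>x. (norm (t *\<^sub>R f x - g x))\<^sup>2)
        = (\<lambda>x. t\<^sup>2 * (norm (f x))\<^sup>2 - 2 * t * (f x \<bullet> g x) + (norm (g x))\<^sup>2)"
      by (intro ext) (simp add: power2_norm_eq_inner inner_diff inner_commute power2_eq_square[of t] algebra_simps)
    also have "(LINT x|M. t\<^sup>2 * (norm (f x))\<^sup>2 - 2 * t * (f x \<bullet> g x) + (norm (g x))\<^sup>2) = t\<^sup>2 * A - 2 * t * B + C"
      using i by (simp add: A_def B_def C_def)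
    finally show ?thesis by (simp add: mult_ac)
  qed
  have A: "A \<ge> 0" and C: "C \<ge> 0" by (simp_all add: A_def C_def)
  have "B\<^sup>2 \<le> A * C"
  proof (cases "A = 0")
    case True
    have "B = 0"
    proof (rule ccontr)
      assume "B \<noteq> 0"
      \<comment> \<open>For \<open>A = 0\<close> the polynomial is linear and has the value -1 at
        this point.\<close>
      then show False using q[of "(C + 1) / (2 * B)"] True C by simp
    qed
    then show ?thesis using A C by simp
  next
    case False
    then have "0 \<le> A * (A * (B / A)\<^sup>2 - 2 * B * (B / A) + C)" using A q[of "B / A"] by simp
    also have "\<dots> = A * C - B\<^sup>2" using False by (simp add: power2_eq_square field_simps)
    finally show ?thesis by simp
  qed
  then have "sqrt (B\<^sup>2) \<le> sqrt (A * C)" by (rule real_sqrt_le_mono)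
  then show ?thesis by (simp add: real_sqrt_mult A_def B_def C_def)
qed

lemma square_integrable_AE_subseq:
  assumes f: "\<And>n. square_integrable M (f n)" and g: "square_integrable M g"
    and l: "(\<lambda>n. LINT x|M. (norm (f n x - g x))\<^sup>2) \<longlonglongrightarrow> 0"
  shows "\<exists>r. strict_mono r \<and> (AE x in M. (\<lambda>n. f (r n) x) \<longlonglongrightarrow> g x)"
proof -
  have "\<exists>r. strict_mono r \<and> (AE x in M. (\<lambda>n. (norm (f (r n) x - g x))\<^sup>2) \<longlonglongrightarrow> 0)"
    using l by (intro tendsto_L1_AE_subseq) (auto intro: square_integrable_int[OF square_integrable_diff[OF f g]])
  then obtain r where r: "strict_mono r" "AE x in M. (\<lambda>n. (norm (f (r n) x - g x))\<^sup>2) \<longlonglongrightarrow> 0" by auto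
  have "AE x in M. (\<lambda>n. f (r n) x) \<longlonglongrightarrow> g x"
    using r(2)
  proof eventually_elim
    case (elim x)
    have "(\<lambda>n. sqrt ((norm (f (r n) x - g x))\<^sup>2)) \<longlonglongrightarrow> sqrt 0" by (rule tendsto_real_sqrt[OF elim])
    then have "(\<lambda>n. f (r n) x - g x) \<longlonglongrightarrow> 0" by (simp add: tendsto_norm_zero_iff)
    then show ?case by (simp add: LIM_zero_iff)
  qed
  with r(1) show ?thesis by blast
qed

text \<open>The Riesz-Fischer theorem. A rapidly Cauchy subsequence converges almost everywhere, and
  Fatou's lemma turns the pointwise limit into the limit in norm for the whole sequence.\<close>

lemma square_integrable_complete:
  fixes f :: "nat \<Rightarrow> 'a \<Rightarrow> 'b::euclidean_space"
  assumes f: "\<And>n. square_integrable M (f n)"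
    and C: "\<And>e. e > 0 \<Longrightarrow> \<exists>N. \<forall>m\<ge>N. \<forall>n\<ge>N. (LINT x|M. (norm (f m x - f n x))\<^sup>2) < e"
  shows "\<exists>g. square_integrable M g \<and> (\<lambda>n. LINT x|M. (norm (f n x - g x))\<^sup>2) \<longlonglongrightarrow> 0"
proof -
  have [measurable]: "f n \<in> borel_measurable M" for n using f by (rule square_integrable_meas)
  have "\<exists>N. \<forall>m\<ge>N. \<forall>n\<ge>N. (LINT x|M. (norm (f m x - f n x))\<^sup>2) < (1/4) ^ k" for k :: nat
    by (rule C) simp
  then obtain N where N: "\<And>k m n. m \<ge> N k \<Longrightarrow> n \<ge> N k \<Longrightarrow> (LINT x|M. (norm (f m x - f n x))\<^sup>2) < (1/4) ^ k"
    by metis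
  \<comment> \<open>The sum makes the indices increasing and at the same time at least
    \<open>N k\<close>.\<close>
  define r where "r k = (\<Sum>j\<le>k. N j) + k" for k
  have rN: "N k \<le> r k" "r k \<le> r (Suc k)" for k
    unfolding r_def by (auto intro: order_trans[OF member_le_sum trans_le_add1])
  have rS: "N k \<le> r (Suc k)" for k using rN[of k] by linarith
  define d where "d k x = f (r (Suc k)) x - f (r k) x" for k x
  have [measurable]: "d k \<in> borel_measurable M" for k unfolding d_def by measurable
  have dI: "(LINT x|M. (norm (d k x))\<^sup>2) \<le> (1/4) ^ k" for k
    using N[of k "r (Suc k)" "r k"] rN rS unfolding d_def by fastforce
  \<comment> \<open>The weight \<open>2 ^ k\<close> is lost against the bound
    \<open>(1/4) ^ k\<close> without harm, and it makes almost every increment of order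
    \<open>(1 / sqrt 2) ^ k\<close>, hence summable without the square.\<close>
  have "(\<integral>\<^sup>+x. (\<Sum>k. ennreal (2 ^ k * (norm (d k x))\<^sup>2)) \<partial>M) = (\<Sum>k. \<integral>\<^sup>+x. ennreal (2 ^ k * (norm (d k x))\<^sup>2) \<partial>M)"
    by (rule nn_integral_suminf) measurable
  also have "\<dots> \<le> (\<Sum>k. ennreal ((1/2) ^ k))"
  proof (rule suminf_le)
    fix k
    have "(\<integral>\<^sup>+x. ennreal (2 ^ k * (norm (d k x))\<^sup>2) \<partial>M) = ennreal (2 ^ k * (LINT x|M. (norm (d k x))\<^sup>2))"
      unfolding d_def using square_integrable_int[OF square_integrable_diff[OF f f]]
      by (subst nn_integral_eq_integral) auto
    also have "\<dots> \<le> ennreal (2 ^ k * (1/4) ^ k)" using dI by (intro ennreal_leI mult_left_mono) auto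
    also have "2 ^ k * (1/4) ^ k = (1/2::real) ^ k" by (simp add: power_mult_distrib[symmetric])
    finally show "(\<integral>\<^sup>+x. ennreal (2 ^ k * (norm (d k x))\<^sup>2) \<partial>M) \<le> ennreal ((1/2) ^ k)" .
  qed auto
  also have "\<dots> < \<infinity>" by (subst suminf_ennreal2) (auto simp: summable_geometric)
  finally have "AE x in M. (\<Sum>k. ennreal (2 ^ k * (norm (d k x))\<^sup>2)) \<noteq> \<infinity>"
    by (intro nn_integral_PInf_AE) auto
  then have conv: "AE x in M. convergent (\<lambda>k. f (r k) x)"
  proof eventually_elim
    case (elim x)
    then have s: "summable (\<lambda>k. 2 ^ k * (norm (d k x))\<^sup>2)"
      by (intro summable_suminf_not_top) (auto simp: infinity_ennreal_def)
    then have "Bseq (\<lambda>k. 2 ^ k * (norm (d k x))\<^sup>2)"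
      by (intro convergent_imp_Bseq) (auto simp: convergent_def dest: summable_LIMSEQ_zero)
    then obtain K where K: "K > 0" "\<And>k. norm (2 ^ k * (norm (d k x))\<^sup>2) \<le> K" by (auto simp: Bseq_def)
    have b: "norm (d k x) \<le> sqrt K * (1 / sqrt 2) ^ k" for k
    proof -
      have "2 ^ k * (norm (d k x))\<^sup>2 \<le> K" using K(2)[of k] by simp
      then have "(norm (d k x))\<^sup>2 \<le> K * (1/2) ^ k" by (simp add: field_simps power_divide)
      then have "sqrt ((norm (d k x))\<^sup>2) \<le> sqrt (K * (1/2) ^ k)" by (rule real_sqrt_le_mono)
      then show ?thesis by (simp add: real_sqrt_mult real_sqrt_power real_sqrt_divide)
    qed
    have "summable (\<lambda>k. sqrt K * (1 / sqrt 2) ^ k)" by (intro summable_mult summable_geometric) simp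
    then have "summable (\<lambda>k. d k x)" using b by (rule summable_comparison_test'[where N=0])
    then have "convergent (\<lambda>n. \<Sum>k<n. d k x)" by (simp add: summable_iff_convergent)
    moreover have "(\<Sum>k<n. d k x) = f (r n) x - f (r 0) x" for n
      unfolding d_def by (rule sum_lessThan_telescope)
    ultimately have "convergent (\<lambda>n. f (r n) x - f (r 0) x)" by simp
    then have "convergent (\<lambda>n. (f (r n) x - f (r 0) x) + f (r 0) x)"
      by (intro convergent_add convergent_const)
    then show ?case by simp
  qed
  define g where "g x = lim (\<lambda>k. f (r k) x)" for x
  have [measurable]: "g \<in> borel_measurable M" unfolding g_def by measurable
  have g: "AE x in M. (\<lambda>k. f (r k) x) \<longlonglongrightarrow> g x"
    using conv by eventually_elim (simp add: g_def convergent_LIMSEQ_iff)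
  \<comment> \<open>Fatou's lemma in the second index of the Cauchy condition.\<close>
  have est: "(\<integral>\<^sup>+x. ennreal ((norm (f m x - g x))\<^sup>2) \<partial>M) \<le> ennreal ((1/4) ^ k)" if m: "m \<ge> N k" for m k
  proof -
    have "(\<integral>\<^sup>+x. ennreal ((norm (f m x - g x))\<^sup>2) \<partial>M)
       = (\<integral>\<^sup>+x. liminf (\<lambda>j. ennreal ((norm (f m x - f (r j) x))\<^sup>2)) \<partial>M)"
    proof (rule nn_integral_cong_AE)
      show "AE x in M. ennreal ((norm (f m x - g x))\<^sup>2) = liminf (\<lambda>j. ennreal ((norm (f m x - f (r j) x))\<^sup>2))"
        using g
      proof eventually_elim
        case (elim x)
        have "(\<lambda>j. ennreal ((norm (f m x - f (r j) x))\<^sup>2)) \<longlonglongrightarrow> ennreal ((norm (f m x - g x))\<^sup>2)"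
          by (intro tendsto_intros elim)
        then show ?case by (rule lim_imp_Liminf[OF sequentially_bot, symmetric])
      qed
    qed
    also have "\<dots> \<le> liminf (\<lambda>j. \<integral>\<^sup>+x. ennreal ((norm (f m x - f (r j) x))\<^sup>2) \<partial>M)"
      by (rule nn_integral_liminf) measurable
    also have "\<dots> \<le> ennreal ((1/4) ^ k)"
    proof -
      have "eventually (\<lambda>j. (\<integral>\<^sup>+x. ennreal ((norm (f m x - f (r j) x))\<^sup>2) \<partial>M) \<le> ennreal ((1/4) ^ k)) sequentially"
      proof (rule eventually_sequentiallyI)
        fix j assume "j \<ge> N k"
        then have "r j \<ge> N k" by (simp add: r_def)
        have "(\<integral>\<^sup>+x. ennreal ((norm (f m x - f (r j) x))\<^sup>2) \<partial>M) = ennreal (LINT x|M. (norm (f m x - f (r j) x))\<^sup>2)"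
          by (rule nn_integral_eq_integral) (auto intro: square_integrable_int[OF square_integrable_diff[OF f f]])
        also have "\<dots> \<le> ennreal ((1/4) ^ k)"
          using N[OF m \<open>r j \<ge> N k\<close>] by (intro ennreal_leI) simp
        finally show "(\<integral>\<^sup>+x. ennreal ((norm (f m x - f (r j) x))\<^sup>2) \<partial>M) \<le> ennreal ((1/4) ^ k)" .
      qed
      from Liminf_mono[OF this] show ?thesis by (simp add: Liminf_const)
    qed
    finally show ?thesis .
  qed
  have fg: "integrable M (\<lambda>x. (norm (f m x - g x))\<^sup>2)" if "m \<ge> N k" for m k
    using est[OF that] by (intro integrableI_nonneg) (auto intro: le_less_trans)
  then have "square_integrable M (\<lambda>x. f (N 0) x - g x)" by (auto simp: square_integrable_def)
  from square_integrable_diff[OF f this, of "N 0"] have sg: "square_integrable M g" by simp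
  have "(\<lambda>n. LINT x|M. (norm (f n x - g x))\<^sup>2) \<longlonglongrightarrow> 0"
  proof (rule LIMSEQ_I)
    fix e :: real assume "e > 0"
    then obtain k where k: "(1/4) ^ k < e" using real_arch_pow_inv[of e "1/4"] by auto
    have "norm ((LINT x|M. (norm (f n x - g x))\<^sup>2) - 0) < e" if n: "n \<ge> N k" for n
    proof -
      have "ennreal (LINT x|M. (norm (f n x - g x))\<^sup>2) \<le> ennreal ((1/4) ^ k)"
        using est[OF n] nn_integral_eq_integral[OF fg[OF n]] by simp
      then have "(LINT x|M. (norm (f n x - g x))\<^sup>2) \<le> (1/4) ^ k" by (subst (asm) ennreal_le_iff) auto
      then show ?thesis using k by simp
    qed
    then show "\<exists>no. \<forall>n\<ge>no. norm ((LINT x|M. (norm (f n x - g x))\<^sup>2) - 0) < e" by blast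
  qed
  with sg show ?thesis by blast
qed

section \<open>Weak gradients\<close>

lemma square_integrable_tendsto_inner:
  assumes f: "\<And>n. square_integrable M (f n)" and g: "square_integrable M g" and h: "square_integrable M h"
    and l: "(\<lambda>n. LINT x|M. (norm (g x - f n x))\<^sup>2) \<longlonglongrightarrow> 0"
  shows "(\<lambda>n. LINT x|M. f n x \<bullet> h x) \<longlonglongrightarrow> (LINT x|M. g x \<bullet> h x)"
proof -
  have "(\<lambda>n. LINT x|M. (g x - f n x) \<bullet> h x) \<longlonglongrightarrow> 0"
  proof (rule Lim_null_comparison)
    show "eventually (\<lambda>n. norm (LINT x|M. (g x - f n x) \<bullet> h x) \<le>
        sqrt (LINT x|M. (norm (g x - f n x))\<^sup>2) * sqrt (LINT x|M. (norm (h x))\<^sup>2)) sequentially"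
      using square_integrable_CS[OF square_integrable_diff[OF g f] h] by (auto intro!: always_eventually)
    have "(\<lambda>n. sqrt (LINT x|M. (norm (g x - f n x))\<^sup>2) * sqrt (LINT x|M. (norm (h x))\<^sup>2))
        \<longlonglongrightarrow> sqrt 0 * sqrt (LINT x|M. (norm (h x))\<^sup>2)"
      by (intro tendsto_intros l)
    then show "(\<lambda>n. sqrt (LINT x|M. (norm (g x - f n x))\<^sup>2) * sqrt (LINT x|M. (norm (h x))\<^sup>2)) \<longlonglongrightarrow> 0"
      by simp
  qed
  moreover have "(LINT x|M. (g x - f n x) \<bullet> h x) = (LINT x|M. g x \<bullet> h x) - (LINT x|M. f n x \<bullet> h x)" for n
    by (simp add: inner_diff_left square_integrable_inner[OF g h] square_integrable_inner[OF f h])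
  ultimately have "(\<lambda>n. (LINT x|M. g x \<bullet> h x) - (LINT x|M. f n x \<bullet> h x)) \<longlonglongrightarrow> 0" by simp
  from tendsto_diff[OF tendsto_const[of "LINT x|M. g x \<bullet> h x"] this] show ?thesis by simp
qed

lemma square_integrable_tendsto_add:
  assumes f: "\<And>n. square_integrable M (f n)" "square_integrable M g" "\<And>n. square_integrable M (h n)" "square_integrable M k"
    and l: "(\<lambda>n. LINT x|M. (norm (g x - f n x))\<^sup>2) \<longlonglongrightarrow> 0" "(\<lambda>n. LINT x|M. (norm (k x - h n x))\<^sup>2) \<longlonglongrightarrow> 0"
  shows "(\<lambda>n. LINT x|M. (norm ((g x + k x) - (f n x + h n x)))\<^sup>2) \<longlonglongrightarrow> 0"
proof (rule Lim_null_comparison)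
  have "(LINT x|M. (norm ((g x + k x) - (f n x + h n x)))\<^sup>2)
      \<le> 2 * (LINT x|M. (norm (g x - f n x))\<^sup>2) + 2 * (LINT x|M. (norm (k x - h n x))\<^sup>2)" for n
  proof -
    note i = square_integrable_int[OF square_integrable_diff[OF f(2,1)]] square_integrable_int[OF square_integrable_diff[OF f(4,3)]]
    have "(LINT x|M. (norm ((g x + k x) - (f n x + h n x)))\<^sup>2)
       \<le> (LINT x|M. 2 * (norm (g x - f n x))\<^sup>2 + 2 * (norm (k x - h n x))\<^sup>2)"
    proof (intro integral_mono square_integrable_int square_integrable_diff square_integrable_add f Bochner_Integration.integrable_add integrable_mult_right)
      fix x show "(norm (g x + k x - (f n x + h n x)))\<^sup>2 \<le> 2 * (norm (g x - f n x))\<^sup>2 + 2 * (norm (k x - h n x))\<^sup>2"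
        using norm_add_sq_le[of "g x - f n x" "k x - h n x"] by (simp add: algebra_simps)
    qed
    then show ?thesis using i by simp
  qed
  then show "eventually (\<lambda>n. norm (LINT x|M. (norm ((g x + k x) - (f n x + h n x)))\<^sup>2)
      \<le> 2 * (LINT x|M. (norm (g x - f n x))\<^sup>2) + 2 * (LINT x|M. (norm (k x - h n x))\<^sup>2)) sequentially"
    by (intro always_eventually) simp
  have "(\<lambda>n. 2 * (LINT x|M. (norm (g x - f n x))\<^sup>2) + 2 * (LINT x|M. (norm (k x - h n x))\<^sup>2)) \<longlonglongrightarrow> 2 * 0 + 2 * 0"
    by (intro tendsto_intros l)
  then show "(\<lambda>n. 2 * (LINT x|M. (norm (g x - f n x))\<^sup>2) + 2 * (LINT x|M. (norm (k x - h n x))\<^sup>2)) \<longlonglongrightarrow> 0" by simp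
qed

lemma square_integrable_tendsto_norm:
  assumes f: "\<And>n. square_integrable M (f n)" and g: "square_integrable M g"
    and l: "(\<lambda>n. LINT x|M. (norm (g x - f n x))\<^sup>2) \<longlonglongrightarrow> 0"
  shows "(\<lambda>n. LINT x|M. (norm (f n x))\<^sup>2) \<longlonglongrightarrow> (LINT x|M. (norm (g x))\<^sup>2)"
proof -
  have "(LINT x|M. (norm (f n x))\<^sup>2)
      = (LINT x|M. (norm (g x - f n x))\<^sup>2) + 2 * (LINT x|M. f n x \<bullet> g x) - (LINT x|M. (norm (g x))\<^sup>2)" for n
  proof -
    have "(\<lambda>x. (norm (f n x))\<^sup>2) = (\<lambda>x. (norm (g x - f n x))\<^sup>2 + 2 * (f n x \<bullet> g x) - (norm (g x))\<^sup>2)"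
      by (intro ext) (simp add: power2_norm_eq_inner inner_diff inner_commute)
    then show ?thesis using square_integrable_int[OF square_integrable_diff[OF g f]] square_integrable_inner[OF f g] square_integrable_int[OF g] by simp
  qed
  moreover have "(\<lambda>n. (LINT x|M. (norm (g x - f n x))\<^sup>2) + 2 * (LINT x|M. f n x \<bullet> g x) - (LINT x|M. (norm (g x))\<^sup>2))
      \<longlonglongrightarrow> 0 + 2 * (LINT x|M. g x \<bullet> g x) - (LINT x|M. (norm (g x))\<^sup>2)"
    by (intro tendsto_intros l square_integrable_tendsto_inner[OF f g g])
  ultimately show ?thesis by (simp add: power2_norm_eq_inner)
qed

text \<open>This is completeness of Lebesgue measure. It is needed for objects that are determined
  only up to a null set, such as the representative picked by \<open>weak_grad\<close>.\<close>

lemma lebesgue_AE_measurable: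
  fixes f g :: "'a::euclidean_space \<Rightarrow> 'b::topological_space"
  assumes f: "f \<in> borel_measurable lebesgue" and ae: "AE x in lebesgue. f x = g x"
  shows "g \<in> borel_measurable lebesgue"
proof (rule measurableI)
  fix A :: "'b set" assume A: "A \<in> sets borel"
  show "g -` A \<inter> space lebesgue \<in> sets lebesgue"
  proof (rule completion.in_sets_AE)
    show "f -` A \<inter> space lebesgue \<in> sets lebesgue" using f A by (rule measurable_sets)
    show "AE x in lebesgue. x \<in> f -` A \<inter> space lebesgue \<longleftrightarrow> x \<in> g -` A \<inter> space lebesgue"
      using ae by eventually_elim simp
  qed simp
qed simp

section \<open>Weak gradients and the Sobolev space over a bounded open set\<close>

locale bounded_open =
  fixes \<Omega> :: "'a::euclidean_space set"
  assumes op: "open \<Omega>" and bd: "bounded \<Omega>"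
begin

abbreviation "M \<equiv> lebesgue_on \<Omega>"

lemma Om_sets [simp, measurable]: "\<Omega> \<in> sets lebesgue"
  using op by auto

lemma Om_fin: "finite_measure M"
  by (rule finite_measure_lebesgue_on) (use op bd in \<open>simp add: bounded_set_imp_lmeasurable\<close>)

lemma meas_AE:
  fixes f g :: "'a \<Rightarrow> 'b::real_normed_vector"
  assumes f: "f \<in> borel_measurable M" and ae: "AE x in M. f x = g x"
  shows "g \<in> borel_measurable M"
proof -
  have "(\<lambda>x. indicator \<Omega> x *\<^sub>R f x) \<in> borel_measurable lebesgue"
    using f by (simp add: borel_measurable_restrict_space_iff)
  moreover have "AE x in lebesgue. indicator \<Omega> x *\<^sub>R f x = indicator \<Omega> x *\<^sub>R g x"
    using ae by (simp add: AE_restrict_space_iff indicator_def) (auto elim: eventually_mono)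
  ultimately have "(\<lambda>x. indicator \<Omega> x *\<^sub>R g x) \<in> borel_measurable lebesgue" by (rule lebesgue_AE_measurable)
  then show ?thesis by (simp add: borel_measurable_restrict_space_iff)
qed

lemma integrable_M_lborel: "integrable lborel f \<Longrightarrow> integrable M f"
  for f :: "'a \<Rightarrow> 'b::{banach, second_countable_topology}"
  using integrable_completion[of f lborel] borel_measurable_integrable[of lborel f]
  by (simp add: integrable_restrict_space integrable_mult_indicator)

lemma meas_M_borel: "f \<in> borel_measurable borel \<Longrightarrow> f \<in> borel_measurable M"
  by (rule measurable_restrict_space1) (rule measurable_completion, simp)

lemma square_integrable_C1c: "C1c u g \<Longrightarrow> square_integrable M u" "C1c u g \<Longrightarrow> square_integrable M g"
  using C1c_integrable[of u g] C1c_D[of u g]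
  by (auto simp: square_integrable_def intro!: integrable_M_lborel meas_M_borel)

lemma locally_integrable_integrable:
  fixes u :: "'a \<Rightarrow> 'b::euclidean_space"
  assumes "integrable M u"
  shows "locally_integrable \<Omega> u"
  unfolding locally_integrable_def
proof safe
  fix K assume K: "compact K" "K \<subseteq> \<Omega>"
  then have "K \<in> sets lebesgue" by (auto simp: compact_imp_closed borel_closed)
  moreover have "set_integrable lebesgue \<Omega> u" using assms by (simp add: set_integrable_def integrable_restrict_space)
  ultimately show "integrable (lebesgue_on K) u" using K
    using set_integrable_subset[of lebesgue \<Omega> u K] by (simp add: set_integrable_def integrable_restrict_space)
qed

lemma locally_integrable_sqi: "square_integrable M u \<Longrightarrow> locally_integrable \<Omega> u"
  by (intro locally_integrable_integrable square_integrable_integrable Om_fin)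

lemma locally_integrable_compact:
  assumes "locally_integrable \<Omega> u" "compact K" "K \<subseteq> \<Omega>"
  shows "integrable lebesgue (\<lambda>x. indicator K x *\<^sub>R u x)"
proof -
  have "K \<in> sets lebesgue" using assms by (auto simp: compact_imp_closed borel_closed)
  then show ?thesis using assms unfolding locally_integrable_def by (auto simp: integrable_restrict_space)
qed

lemma locally_integrable_mult:
  fixes w :: "'a \<Rightarrow> real"
  assumes w: "locally_integrable \<Omega> w" and p: "\<phi> \<in> test_functions \<Omega>"
  shows "integrable M (\<lambda>x. w x * \<phi> x)"
proof -
  define K where "K = closure {x. \<phi> x \<noteq> 0}"
  have K: "compact K" "K \<subseteq> \<Omega>" using p by (auto simp: K_def test_functions_def)
  have z: "\<phi> x = 0" if "x \<notin> K" for x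
    using that closure_subset[of "{x. \<phi> x \<noteq> 0}"] unfolding K_def by blast
  note c = C1c_D(3)[OF test_C1c[OF p]]
  obtain R where R: "\<And>x. R < norm x \<Longrightarrow> \<phi> x = 0" using C1c_supp[OF test_C1c[OF p]] by auto
  obtain B where B: "B > 0" "\<And>x. norm (\<phi> x) \<le> B" using cont_supp_bounded[OF c R] by blast
  have iK: "integrable lebesgue (\<lambda>x. indicator K x *\<^sub>R w x)" by (rule locally_integrable_compact[OF w K])
  have [measurable]: "(\<lambda>x. indicator K x *\<^sub>R w x) \<in> borel_measurable lebesgue"
    using iK by (rule borel_measurable_integrable)
  have [measurable]: "\<phi> \<in> borel_measurable lebesgue"
    using c by (intro measurable_completion) (simp add: continuous_borel)
  have eq: "indicator \<Omega> x *\<^sub>R (w x * \<phi> x) = \<phi> x * (indicator K x *\<^sub>R w x)" for x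
    using z[of x] K by (auto simp: indicator_def)
  have "integrable lebesgue (\<lambda>x. \<phi> x * (indicator K x *\<^sub>R w x))"
  proof (rule Bochner_Integration.integrable_bound[OF integrable_mult_right[OF iK, of B]])
    show "(\<lambda>x. \<phi> x * (indicator K x *\<^sub>R w x)) \<in> borel_measurable lebesgue" by measurable
    show "AE x in lebesgue. norm (\<phi> x * (indicator K x *\<^sub>R w x)) \<le> norm (B * (indicator K x *\<^sub>R w x))"
      using B by (intro AE_I2) (auto simp: abs_mult intro!: mult_right_mono)
  qed
  then show ?thesis by (simp add: integrable_restrict_space eq del: real_scaleR_def)
qed

text \<open>On a box with closure inside \<open>\<Omega>\<close> the function is integrable. Bumps
  are test functions that converge to the indicators of its subboxes, so all box integrals vanish. A
  Borel version \<open>V\<close> takes over because the criterion on boxes is stated for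
  \<open>lborel\<close>.\<close>

lemma fundamental_box:
  fixes w :: "'a \<Rightarrow> real"
  assumes w: "locally_integrable \<Omega> w"
    and z: "\<And>\<phi>. \<phi> \<in> test_functions \<Omega> \<Longrightarrow> (LINT x|M. w x * \<phi> x) = 0"
    and ab: "cbox a b \<subseteq> \<Omega>"
  shows "AE x in lebesgue. x \<in> box a b \<longrightarrow> w x = 0"
proof -
  define W where "W x = indicator (box a b) x * w x" for x
  have W: "integrable lebesgue W"
  proof -
    have "integrable lebesgue (\<lambda>x. indicator (box a b) x *\<^sub>R (indicator (cbox a b) x *\<^sub>R w x))"
      by (intro integrable_mult_indicator locally_integrable_compact[OF w _ ab]) auto
    also have "(\<lambda>x. indicator (box a b) x *\<^sub>R (indicator (cbox a b) x *\<^sub>R w x)) = W"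
      using box_subset_cbox[of a b] by (auto simp: W_def indicator_def fun_eq_iff)
    finally show ?thesis .
  qed
  have Wm[measurable]: "W \<in> borel_measurable lebesgue" using W by (rule borel_measurable_integrable)
  obtain V where V[measurable]: "V \<in> borel_measurable lborel" and WV: "AE x in lborel. W x = V x"
    using completion_ex_borel_measurable_real[OF Wm] by auto
  have WV': "AE x in lebesgue. W x = V x" using WV by (rule AE_completion)
  have Vl[measurable]: "V \<in> borel_measurable lebesgue" using V by (rule measurable_completion)
  have iV: "integrable lborel V"
    using W integrable_cong_AE[OF Wm Vl WV'] integrable_completion[OF V] by simp
  have "(LINT x|lborel. indicator (box c d) x * V x) = 0" for c d
  proof -
    obtain p q where pq: "box a b \<inter> box c d = box p q" using box_Int_box by blast
    have "(LINT x|lborel. indicator (box c d) x * V x) = (LINT x|lebesgue. indicator (box c d) x * V x)"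
      by (rule integral_completion[symmetric]) measurable
    also have "\<dots> = (LINT x|lebesgue. indicator (box c d) x * W x)"
      using WV'
      by (intro integral_cong_AE borel_measurable_times borel_measurable_indicator Vl Wm)
         (auto elim: eventually_mono)
    also have "\<dots> = (LINT x|lebesgue. indicator (box p q) x * W x)"
      unfolding pq[symmetric] by (intro Bochner_Integration.integral_cong) (auto simp: W_def indicator_def)
    also have "\<dots> = 0"
    proof (cases "box p q = {}")
      case True
      then show ?thesis by simp
    next
      case False
      have "box p q \<subseteq> box a b" using pq by blast
      then have "closure (box p q) \<subseteq> closure (box a b)" by (rule closure_mono)
      also have "closure (box a b) \<subseteq> cbox a b" using box_subset_cbox by (intro closure_minimal) auto
      finally have sub: "cbox p q \<subseteq> \<Omega>" using False ab by simp
      have "(\<lambda>n. LINT x|lebesgue. bump p q (real (Suc n)) x * W x) \<longlonglongrightarrow> (LINT x|lebesgue. indicator (box p q) x * W x)"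
      proof (rule integral_dominated_convergence[where w="\<lambda>x. norm (W x)"])
        have bm: "bump p q c \<in> borel_measurable lebesgue" for c
          using C_k_bump[of 0 p q c] by (intro measurable_completion) (simp add: continuous_borel)
        show "(\<lambda>x. bump p q (real (Suc n)) x * W x) \<in> borel_measurable lebesgue" for n
          by (intro borel_measurable_times bm Wm)
        show "(\<lambda>x. indicator (box p q) x * W x) \<in> borel_measurable lebesgue"
          by (intro borel_measurable_times borel_measurable_indicator Wm) auto
        show "integrable lebesgue (\<lambda>x. norm (W x))" using W by simp
        show "AE x in lebesgue. (\<lambda>n. bump p q (real (Suc n)) x * W x) \<longlonglongrightarrow> indicator (box p q) x * W x"
          by (intro AE_I2 tendsto_mult bump_lim tendsto_const)
        fix n show "AE x in lebesgue. norm (bump p q (real (Suc n)) x * W x) \<le> norm (W x)"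
          using bump_bounds[of p q "real (Suc n)"]
          by (intro AE_I2) (simp add: abs_mult mult_left_le_one_le del: of_nat_Suc)
      qed
      moreover have "(LINT x|lebesgue. bump p q (real (Suc n)) x * W x) = 0" for n
      proof -
        have t: "bump p q (real (Suc n)) \<in> test_functions \<Omega>" using sub by (intro bump_test) auto
        have e: "bump p q (real (Suc n)) x * W x = indicator \<Omega> x *\<^sub>R (w x * bump p q (real (Suc n)) x)" for x
        proof (cases "x \<in> box p q")
          case True
          then have "x \<in> box a b" "x \<in> \<Omega>" using pq ab box_subset_cbox[of a b] by blast+
          then show ?thesis by (simp add: W_def)
        next
          case False
          then have "bump p q (real (Suc n)) x = 0" using bump_nonzero[of "real (Suc n)" p q x] by simp
          then show ?thesis by simp
        qed
        have "(LINT x|lebesgue. bump p q (real (Suc n)) x * W x) = (LINT x|M. w x * bump p q (real (Suc n)) x)"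
          unfolding e by (simp add: integral_restrict_space)
        then show ?thesis using z[OF t] by simp
      qed
      ultimately show ?thesis by (simp add: LIMSEQ_const_iff)
    qed
    finally show ?thesis .
  qed
  from integral_boxes_zero_AE[OF iV this] have "AE x in lebesgue. V x = 0" by (rule AE_completion)
  with WV' show ?thesis by eventually_elim (auto simp: W_def indicator_def)
qed

text \<open>The du Bois-Reymond lemma. \<open>\<Omega>\<close> is an uncountable union of admissible
  boxes; the Lindelof property leaves countably many, so the exceptional null sets can be
  collected.\<close>

lemma fundamental:
  fixes w :: "'a \<Rightarrow> real"
  assumes w: "locally_integrable \<Omega> w"
    and z: "\<And>\<phi>. \<phi> \<in> test_functions \<Omega> \<Longrightarrow> (LINT x|M. w x * \<phi> x) = 0"
  shows "AE x in M. w x = 0"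
proof -
  define F where "F = {box a b |a b. cbox a b \<subseteq> \<Omega>}"
  have "\<Union>F = \<Omega>"
  proof
    show "\<Union>F \<subseteq> \<Omega>" using box_subset_cbox by (fastforce simp: F_def)
    show "\<Omega> \<subseteq> \<Union>F"
    proof
      fix x assume "x \<in> \<Omega>"
      then obtain e where e: "e > 0" "cball x e \<subseteq> \<Omega>" using op open_contains_cball by blast
      obtain a b where ab: "x \<in> box a b" "box a b \<subseteq> ball x e" using rational_boxes[OF e(1)] by metis
      have "closure (box a b) \<subseteq> cball x e" using ab(2) by (intro closure_minimal) auto
      then have "cbox a b \<subseteq> \<Omega>" using e ab by (cases "box a b = {}") auto
      then show "x \<in> \<Union>F" using ab by (auto simp: F_def)
    qed
  qed
  moreover obtain F' where F': "F' \<subseteq> F" "countable F'" "\<Union>F' = \<Union>F"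
    using Lindelof[of F] by (auto simp: F_def)
  ultimately have "\<Union>F' = \<Omega>" by simp
  have "AE x in lebesgue. \<forall>B\<in>F'. x \<in> B \<longrightarrow> w x = 0"
    using F' fundamental_box[OF w z] by (subst AE_ball_countable) (auto simp: F_def)
  then have "AE x in lebesgue. x \<in> \<Omega> \<longrightarrow> w x = 0"
    by eventually_elim (use \<open>\<Union>F' = \<Omega>\<close> in blast)
  then show ?thesis by (simp add: AE_restrict_space_iff)
qed

lemma locally_integrable_lin:
  fixes u v :: "'a \<Rightarrow> 'b::euclidean_space"
  shows "locally_integrable \<Omega> u \<Longrightarrow> locally_integrable \<Omega> v \<Longrightarrow> locally_integrable \<Omega> (\<lambda>x. u x + v x)"
    "locally_integrable \<Omega> u \<Longrightarrow> locally_integrable \<Omega> (\<lambda>x. c *\<^sub>R u x)"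
    "locally_integrable \<Omega> u \<Longrightarrow> locally_integrable \<Omega> (\<lambda>x. u x \<bullet> d)"
  by (auto simp: locally_integrable_def)

text \<open>Two functions equal almost everywhere are allowed, so this also shows that the gradient
  does not depend on the representative of \<open>u\<close>.\<close>

lemma weak_gradient_unique:
  assumes u: "has_weak_gradient \<Omega> u g" and v: "has_weak_gradient \<Omega> v h" and ae: "AE x in M. u x = v x"
  shows "AE x in M. g x = h x"
proof -
  have "AE x in M. (g x - h x) \<bullet> i = 0" if i: "i \<in> Basis" for i
  proof (rule fundamental)
    have g: "locally_integrable \<Omega> (\<lambda>x. g x \<bullet> i)" and h: "locally_integrable \<Omega> (\<lambda>x. h x \<bullet> i)"
      using u v by (auto simp: has_weak_gradient_def intro: locally_integrable_lin)
    have "locally_integrable \<Omega> (\<lambda>x. g x \<bullet> i + (-1) *\<^sub>R (h x \<bullet> i))"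
      by (intro locally_integrable_lin g h)
    then show "locally_integrable \<Omega> (\<lambda>x. (g x - h x) \<bullet> i)" by (simp add: inner_diff_left)
    fix \<phi> assume p: "\<phi> \<in> test_functions \<Omega>"
    let ?d = "\<lambda>x. frechet_derivative \<phi> (at x) i"
    have lu: "locally_integrable \<Omega> u" "locally_integrable \<Omega> v" using u v by (auto simp: has_weak_gradient_def)
    have "(LINT x|M. u x * ?d x) = (LINT x|M. v x * ?d x)"
      using locally_integrable_mult[OF lu(1) test_partial[OF p i]] locally_integrable_mult[OF lu(2) test_partial[OF p i]] ae
      by (intro integral_cong_AE borel_measurable_integrable) (auto elim: eventually_mono)
    then have "(LINT x|M. (g x \<bullet> i) * \<phi> x) = (LINT x|M. (h x \<bullet> i) * \<phi> x)"
      using u v p i unfolding has_weak_gradient_def by fastforce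
    then show "(LINT x|M. (g x - h x) \<bullet> i * \<phi> x) = 0"
      using locally_integrable_mult[OF g p] locally_integrable_mult[OF h p] by (simp add: inner_diff_left left_diff_distrib)
  qed
  then have "AE x in M. \<forall>i\<in>Basis. (g x - h x) \<bullet> i = 0" by (simp add: AE_ball_countable countable_finite)
  then show ?thesis
    by eventually_elim (metis eq_iff_diff_eq_0 euclidean_all_zero_iff)
qed

text \<open>The product with a test function is again in \<open>C1c\<close>, and the integral of its
  gradient is 0.\<close>

lemma weak_gradient_C1c:
  assumes c: "C1c \<phi> g"
  shows "has_weak_gradient \<Omega> \<phi> g"
  unfolding has_weak_gradient_def
proof (intro conjI ballI)
  show "locally_integrable \<Omega> \<phi>" "locally_integrable \<Omega> g" using square_integrable_C1c[OF c] by (auto intro: locally_integrable_sqi)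
  fix \<psi> and i :: 'a assume p: "\<psi> \<in> test_functions \<Omega>" and i: "i \<in> Basis"
  let ?d = "\<lambda>x. frechet_derivative \<psi> (at x) i"
  note cp = test_C1c[OF p] and cd = test_C1c[OF test_partial[OF p i]]
  note m = C1c_D(2,3)[OF c] C1c_D(2,3)[OF cp] C1c_D(2,3)[OF cd]
  have b: "(\<lambda>x. \<phi> x * ?d x) \<in> borel_measurable borel" "(\<lambda>x. (g x \<bullet> i) * \<psi> x) \<in> borel_measurable borel"
    using m by (auto intro!: continuous_borel continuous_intros)
  have z: "\<phi> x * ?d x = 0" "(g x \<bullet> i) * \<psi> x = 0" if "x \<notin> \<Omega>" for x
    using test_support[OF p that] test_support[OF test_partial[OF p i] that] by auto
  obtain R where R: "\<And>x. R < norm x \<Longrightarrow> \<phi> x = 0 \<and> g x = 0" using C1c_supp[OF c] by auto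
  have int: "integrable lborel (\<lambda>x. \<phi> x * ?d x)" "integrable lborel (\<lambda>x. (g x \<bullet> i) * \<psi> x)"
    using R m by (auto intro!: cont_supp_integrable[of _ R] continuous_intros)
  have "(LINT x|lborel. (\<psi> x *\<^sub>R g x + \<phi> x *\<^sub>R gradf \<psi> x) \<bullet> i) = 0"
    by (rule C1c_integral_zero[OF C1c_mult[OF c cp]])
  also have "(\<lambda>x. (\<psi> x *\<^sub>R g x + \<phi> x *\<^sub>R gradf \<psi> x) \<bullet> i) = (\<lambda>x. (g x \<bullet> i) * \<psi> x + \<phi> x * ?d x)"
    by (auto simp: inner_add_left C1c_frechet[OF cp] mult.commute)
  finally have "(LINT x|lborel. (g x \<bullet> i) * \<psi> x) + (LINT x|lborel. \<phi> x * ?d x) = 0" using int by simp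
  then show "(LINT x|M. \<phi> x * ?d x) = - (LINT x|M. (g x \<bullet> i) * \<psi> x)"
    using lebesgue_on_lborel(1)[OF b(1) op z(1)] lebesgue_on_lborel(1)[OF b(2) op z(2)] by simp
qed

lemma square_integrable_test: "\<phi> \<in> test_functions \<Omega> \<Longrightarrow> square_integrable M \<phi>" "\<phi> \<in> test_functions \<Omega> \<Longrightarrow> square_integrable M (gradf \<phi>)"
  using square_integrable_C1c[OF test_C1c] by auto

lemma weak_gradient_limit:
  assumes p: "\<And>n. \<phi> n \<in> test_functions \<Omega>" and u: "square_integrable M u" and g: "square_integrable M g"
    and l: "(\<lambda>n. LINT x|M. (norm (u x - \<phi> n x))\<^sup>2) \<longlonglongrightarrow> 0"
    and lg: "(\<lambda>n. LINT x|M. (norm (g x - gradf (\<phi> n) x))\<^sup>2) \<longlonglongrightarrow> 0"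
  shows "has_weak_gradient \<Omega> u g"
  unfolding has_weak_gradient_def
proof (intro conjI ballI)
  show "locally_integrable \<Omega> u" "locally_integrable \<Omega> g" using u g by (auto intro: locally_integrable_sqi)
  fix \<psi> and i :: 'a assume ps: "\<psi> \<in> test_functions \<Omega>" and i: "i \<in> Basis"
  let ?d = "\<lambda>x. frechet_derivative \<psi> (at x) i"
  have "(\<lambda>n. LINT x|M. \<phi> n x \<bullet> ?d x) \<longlonglongrightarrow> (LINT x|M. u x \<bullet> ?d x)"
    by (rule square_integrable_tendsto_inner[OF square_integrable_test(1)[OF p] u square_integrable_test(1)[OF test_partial[OF ps i]] l])
  moreover have "square_integrable M (\<lambda>x. \<psi> x *\<^sub>R i)"
    using square_integrable_test(1)[OF ps] i by (auto simp: square_integrable_def)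
  from square_integrable_tendsto_inner[OF square_integrable_test(2)[OF p] g this lg]
  have "(\<lambda>n. - (LINT x|M. gradf (\<phi> n) x \<bullet> (\<psi> x *\<^sub>R i))) \<longlonglongrightarrow> - (LINT x|M. g x \<bullet> (\<psi> x *\<^sub>R i))"
    by (rule tendsto_minus)
  moreover have "(LINT x|M. \<phi> n x \<bullet> ?d x) = - (LINT x|M. gradf (\<phi> n) x \<bullet> (\<psi> x *\<^sub>R i))" for n
    using weak_gradient_C1c[OF test_C1c[OF p]] ps i unfolding has_weak_gradient_def by (fastforce simp: mult.commute)
  ultimately have "(LINT x|M. u x \<bullet> ?d x) = - (LINT x|M. g x \<bullet> (\<psi> x *\<^sub>R i))"
    using LIMSEQ_unique by auto
  then show "(LINT x|M. u x * ?d x) = - (LINT x|M. (g x \<bullet> i) * \<psi> x)" by (simp add: mult.commute)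
qed

text \<open>The same space as \<open>H01\<close>, with the gradient as an explicit argument and
  approximation stated in terms of it. Linear combinations and limits are immediate in this form,
  while \<open>weak_grad\<close> of a sum is only almost everywhere the sum of the chosen gradients.
  \<open>H01_HG\<close> and \<open>H01_grad_H01\<close> translate.\<close>

definition H01_grad :: "('a \<Rightarrow> real) \<Rightarrow> ('a \<Rightarrow> 'a) \<Rightarrow> bool" where
  "H01_grad u g \<longleftrightarrow> square_integrable M u \<and> square_integrable M g \<and> (\<exists>\<phi>. (\<forall>n::nat. \<phi> n \<in> test_functions \<Omega>) \<and>
     (\<lambda>n. LINT x|M. (norm (u x - \<phi> n x))\<^sup>2) \<longlonglongrightarrow> 0 \<and>
     (\<lambda>n. LINT x|M. (norm (g x - gradf (\<phi> n) x))\<^sup>2) \<longlonglongrightarrow> 0)"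

lemma H01_grad_sqi: "H01_grad u g \<Longrightarrow> square_integrable M u" "H01_grad u g \<Longrightarrow> square_integrable M g"
  by (auto simp: H01_grad_def)

lemma H01_grad_hwg: "H01_grad u g \<Longrightarrow> has_weak_gradient \<Omega> u g"
  unfolding H01_grad_def using weak_gradient_limit by blast

lemma H01_grad_unique: "H01_grad u g \<Longrightarrow> H01_grad v h \<Longrightarrow> AE x in M. u x = v x \<Longrightarrow> AE x in M. g x = h x"
  using weak_gradient_unique H01_grad_hwg by blast

lemma H01_grad_test: "\<phi> \<in> test_functions \<Omega> \<Longrightarrow> H01_grad \<phi> (gradf \<phi>)"
  unfolding H01_grad_def by (auto intro!: square_integrable_test exI[of _ "\<lambda>n. \<phi>"])

lemma gradf_C1c: "C1c \<phi> g \<Longrightarrow> gradf \<phi> = g"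
  by (rule ext) (simp add: gradf_def C1c_frechet euclidean_representation)

lemma H01_grad_add:
  assumes "H01_grad u g" "H01_grad v h"
  shows "H01_grad (\<lambda>x. u x + v x) (\<lambda>x. g x + h x)"
proof -
  obtain \<phi> where p: "\<And>n. \<phi> n \<in> test_functions \<Omega>" "(\<lambda>n. LINT x|M. (norm (u x - \<phi> n x))\<^sup>2) \<longlonglongrightarrow> 0"
     "(\<lambda>n. LINT x|M. (norm (g x - gradf (\<phi> n) x))\<^sup>2) \<longlonglongrightarrow> 0" using assms(1) by (auto simp: H01_grad_def)
  obtain \<psi> where q: "\<And>n. \<psi> n \<in> test_functions \<Omega>" "(\<lambda>n. LINT x|M. (norm (v x - \<psi> n x))\<^sup>2) \<longlonglongrightarrow> 0"
     "(\<lambda>n. LINT x|M. (norm (h x - gradf (\<psi> n) x))\<^sup>2) \<longlonglongrightarrow> 0" using assms(2) by (auto simp: H01_grad_def)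
  note s = H01_grad_sqi[OF assms(1)] H01_grad_sqi[OF assms(2)]
  have gr: "gradf (\<lambda>x. \<phi> n x + \<psi> n x) = (\<lambda>x. gradf (\<phi> n) x + gradf (\<psi> n) x)" for n
    by (rule gradf_C1c[OF C1c_add[OF test_C1c[OF p(1)] test_C1c[OF q(1)]]])
  show ?thesis unfolding H01_grad_def
    using s by (auto intro!: square_integrable_add exI[of _ "\<lambda>n x. \<phi> n x + \<psi> n x"] test_add[OF p(1) q(1)]
      square_integrable_tendsto_add[OF square_integrable_test(1)[OF p(1)] s(1) square_integrable_test(1)[OF q(1)] s(3) p(2) q(2)]
      square_integrable_tendsto_add[OF square_integrable_test(2)[OF p(1)] s(2) square_integrable_test(2)[OF q(1)] s(4) p(3) q(3)] simp: gr
      simp del: real_norm_def)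
qed

lemma H01_grad_scale:
  assumes "H01_grad u g"
  shows "H01_grad (\<lambda>x. c * u x) (\<lambda>x. c *\<^sub>R g x)"
proof -
  obtain \<phi> where p: "\<And>n. \<phi> n \<in> test_functions \<Omega>" "(\<lambda>n. LINT x|M. (norm (u x - \<phi> n x))\<^sup>2) \<longlonglongrightarrow> 0"
     "(\<lambda>n. LINT x|M. (norm (g x - gradf (\<phi> n) x))\<^sup>2) \<longlonglongrightarrow> 0" using assms(1) by (auto simp: H01_grad_def)
  have gr: "gradf (\<lambda>x. c * \<phi> n x) = (\<lambda>x. c *\<^sub>R gradf (\<phi> n) x)" for n
    by (rule gradf_C1c[OF C1c_scale[OF test_C1c[OF p(1)]]])
  have a: "(norm (c * u x - c * \<phi> n x))\<^sup>2 = c\<^sup>2 * (norm (u x - \<phi> n x))\<^sup>2" for n x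
    by (simp add: right_diff_distrib[symmetric] power_mult_distrib)
  have b: "(norm (c *\<^sub>R g x - c *\<^sub>R gradf (\<phi> n) x))\<^sup>2 = c\<^sup>2 * (norm (g x - gradf (\<phi> n) x))\<^sup>2" for n x
    by (simp add: scaleR_diff_right[symmetric] power_mult_distrib)
  show ?thesis unfolding H01_grad_def
  proof (intro conjI exI allI)
    show "square_integrable M (\<lambda>x. c * u x)" using square_integrable_scale[OF H01_grad_sqi(1)[OF assms], of c] by simp
    show "square_integrable M (\<lambda>x. c *\<^sub>R g x)" by (rule square_integrable_scale[OF H01_grad_sqi(2)[OF assms]])
    show "(\<lambda>x. c * \<phi> n x) \<in> test_functions \<Omega>" for n by (rule test_scale[OF p(1)])
    show "(\<lambda>n. LINT x|M. (norm (c * u x - c * \<phi> n x))\<^sup>2) \<longlonglongrightarrow> 0"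
      unfolding a using tendsto_mult_left[OF p(2), of "c\<^sup>2"] by (simp del: real_norm_def)
    show "(\<lambda>n. LINT x|M. (norm (c *\<^sub>R g x - gradf (\<lambda>x. c * \<phi> n x) x))\<^sup>2) \<longlonglongrightarrow> 0"
      unfolding gr b using tendsto_mult_left[OF p(3), of "c\<^sup>2"] by simp
  qed
qed

lemma H01_grad_AE:
  assumes "H01_grad u g" "AE x in M. u x = v x" "AE x in M. g x = h x"
  shows "H01_grad v h"
proof -
  note s = H01_grad_sqi[OF assms(1)]
  have s': "square_integrable M v" "square_integrable M h"
    using s assms(2,3) meas_AE[OF square_integrable_meas[OF s(1)] assms(2)] meas_AE[OF square_integrable_meas[OF s(2)] assms(3)]
    by (auto intro: square_integrable_AE)
  obtain \<phi> where p: "\<And>n. \<phi> n \<in> test_functions \<Omega>" "(\<lambda>n. LINT x|M. (norm (u x - \<phi> n x))\<^sup>2) \<longlonglongrightarrow> 0"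
     "(\<lambda>n. LINT x|M. (norm (g x - gradf (\<phi> n) x))\<^sup>2) \<longlonglongrightarrow> 0" using assms(1) by (auto simp: H01_grad_def)
  have e1: "(LINT x|M. (norm (u x - \<phi> n x))\<^sup>2) = (LINT x|M. (norm (v x - \<phi> n x))\<^sup>2)" for n
    using assms(2) square_integrable_int[OF square_integrable_diff[OF s(1) square_integrable_test(1)[OF p(1)]]] square_integrable_int[OF square_integrable_diff[OF s'(1) square_integrable_test(1)[OF p(1)]]]
    by (intro integral_cong_AE borel_measurable_integrable) (auto elim: eventually_mono)
  have e2: "(LINT x|M. (norm (g x - gradf (\<phi> n) x))\<^sup>2) = (LINT x|M. (norm (h x - gradf (\<phi> n) x))\<^sup>2)" for n
    using assms(3) square_integrable_int[OF square_integrable_diff[OF s(2) square_integrable_test(2)[OF p(1)]]] square_integrable_int[OF square_integrable_diff[OF s'(2) square_integrable_test(2)[OF p(1)]]]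
    by (intro integral_cong_AE borel_measurable_integrable) (auto elim: eventually_mono)
  show ?thesis unfolding H01_grad_def
    using s' p(1) p(2)[unfolded e1] p(3)[unfolded e2] by blast
qed

lemma weak_grad_AE:
  assumes "has_weak_gradient \<Omega> u g"
  shows "AE x in M. weak_grad \<Omega> u x = g x"
proof -
  have "has_weak_gradient \<Omega> u (weak_grad \<Omega> u)" unfolding weak_grad_def by (rule someI[of "has_weak_gradient \<Omega> u", OF assms])
  from weak_gradient_unique[OF this assms] show ?thesis by simp
qed

lemma weak_grad_integral:
  assumes g: "has_weak_gradient \<Omega> u g" "square_integrable M g"
  shows "(LINT x|M. (norm (weak_grad \<Omega> u x))\<^sup>2) = (LINT x|M. (norm (g x))\<^sup>2)"
proof -
  note ae = weak_grad_AE[OF g(1)]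
  have "weak_grad \<Omega> u \<in> borel_measurable M"
    by (rule meas_AE[OF square_integrable_meas[OF g(2)]]) (use ae in \<open>auto elim: eventually_mono\<close>)
  then show ?thesis using g square_integrable_meas[OF g(2)] ae by (intro integral_cong_AE) (auto elim: eventually_mono)
qed

text \<open>Needed to evaluate \<open>W12_norm\<close> of \<open>u - \<phi>\<close>, in which
  \<open>weak_grad\<close> is applied to the difference.\<close>

lemma weak_gradient_diff_test:
  assumes g: "has_weak_gradient \<Omega> u g" and p: "\<phi> \<in> test_functions \<Omega>"
  shows "has_weak_gradient \<Omega> (\<lambda>x. u x - \<phi> x) (\<lambda>x. g x - gradf \<phi> x)"
  unfolding has_weak_gradient_def
proof (intro conjI ballI)
  have w: "has_weak_gradient \<Omega> \<phi> (gradf \<phi>)" by (rule weak_gradient_C1c[OF test_C1c[OF p]])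
  have l: "locally_integrable \<Omega> u" "locally_integrable \<Omega> g" "locally_integrable \<Omega> \<phi>" "locally_integrable \<Omega> (gradf \<phi>)"
    using g w by (auto simp: has_weak_gradient_def)
  show "locally_integrable \<Omega> (\<lambda>x. u x - \<phi> x)" "locally_integrable \<Omega> (\<lambda>x. g x - gradf \<phi> x)"
    using l by (auto simp: locally_integrable_def)
  fix \<psi> and i :: 'a assume ps: "\<psi> \<in> test_functions \<Omega>" and i: "i \<in> Basis"
  let ?d = "\<lambda>x. frechet_derivative \<psi> (at x) i"
  note d = test_partial[OF ps i]
  have "(LINT x|M. (u x - \<phi> x) * ?d x) = (LINT x|M. u x * ?d x) - (LINT x|M. \<phi> x * ?d x)"
    by (simp add: left_diff_distrib locally_integrable_mult[OF l(1) d] locally_integrable_mult[OF l(3) d])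
  also have "\<dots> = - (LINT x|M. (g x \<bullet> i) * \<psi> x) + (LINT x|M. (gradf \<phi> x \<bullet> i) * \<psi> x)"
    using g w ps i by (simp add: has_weak_gradient_def)
  also have "\<dots> = - (LINT x|M. ((g x - gradf \<phi> x) \<bullet> i) * \<psi> x)"
    by (simp add: inner_diff_left left_diff_distrib locally_integrable_mult[OF locally_integrable_lin(3)[OF l(2)] ps]
        locally_integrable_mult[OF locally_integrable_lin(3)[OF l(4)] ps])
  finally show "(LINT x|M. (u x - \<phi> x) * ?d x) = - (LINT x|M. ((g x - gradf \<phi> x) \<bullet> i) * \<psi> x)" .
qed

lemma H01_HG:
  assumes u: "u \<in> H01 \<Omega>"
  shows "H01_grad u (weak_grad \<Omega> u)"
proof -
  obtain g where g: "square_integrable M g" "has_weak_gradient \<Omega> u g" and su: "square_integrable M u"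
    using u by (auto simp: H01_def W12_def L2_sqi)
  have "\<exists>\<phi>\<in>test_functions \<Omega>. W12_norm \<Omega> (\<lambda>x. u x - \<phi> x) < inverse (real (Suc n))" for n
    using u by (auto simp: H01_def)
  then obtain \<phi> where p: "\<And>n. \<phi> n \<in> test_functions \<Omega>"
    and pn: "\<And>n. W12_norm \<Omega> (\<lambda>x. u x - \<phi> n x) < inverse (real (Suc n))" by metis
  have b: "(LINT x|M. (norm (u x - \<phi> n x))\<^sup>2) \<le> (inverse (real (Suc n)))\<^sup>2 \<and>
      (LINT x|M. (norm (g x - gradf (\<phi> n) x))\<^sup>2) \<le> (inverse (real (Suc n)))\<^sup>2" for n
  proof -
    have "sqrt ((LINT x|M. (norm (u x - \<phi> n x))\<^sup>2) + (LINT x|M. (norm (g x - gradf (\<phi> n) x))\<^sup>2)) \<le> inverse (real (Suc n))"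
      using pn[of n] weak_grad_integral[OF weak_gradient_diff_test[OF g(2) p] square_integrable_diff[OF g(1) square_integrable_test(2)[OF p]]]
      by (simp add: W12_norm_def)
    then have "(LINT x|M. (norm (u x - \<phi> n x))\<^sup>2) + (LINT x|M. (norm (g x - gradf (\<phi> n) x))\<^sup>2) \<le> (inverse (real (Suc n)))\<^sup>2"
      by (rule sqrt_le_D)
    moreover have "0 \<le> (LINT x|M. (norm (u x - \<phi> n x))\<^sup>2)" "0 \<le> (LINT x|M. (norm (g x - gradf (\<phi> n) x))\<^sup>2)"
      by simp_all
    ultimately show ?thesis by linarith
  qed
  have l: "(\<lambda>n. (inverse (real (Suc n)))\<^sup>2) \<longlonglongrightarrow> 0"
    using tendsto_power[OF LIMSEQ_inverse_real_of_nat, of 2] by simp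
  have 1: "(\<lambda>n. LINT x|M. (norm (u x - \<phi> n x))\<^sup>2) \<longlonglongrightarrow> 0"
    by (rule Lim_null_comparison[OF _ l]) (use b in \<open>simp add: always_eventually\<close>)
  have 2: "(\<lambda>n. LINT x|M. (norm (g x - gradf (\<phi> n) x))\<^sup>2) \<longlonglongrightarrow> 0"
    by (rule Lim_null_comparison[OF _ l]) (use b in \<open>simp add: always_eventually\<close>)
  have "H01_grad u g" unfolding H01_grad_def using g su p 1 2 by blast
  then show ?thesis
    by (rule H01_grad_AE) (use weak_grad_AE[OF g(2)] in \<open>auto elim: eventually_mono\<close>)
qed

lemma H01_grad_H01:
  assumes h: "H01_grad u g"
  shows "u \<in> H01 \<Omega>" "AE x in M. weak_grad \<Omega> u x = g x" "(H01_norm \<Omega> u)\<^sup>2 = (LINT x|M. (norm (g x))\<^sup>2)"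
proof -
  note s = H01_grad_sqi[OF h] and w = H01_grad_hwg[OF h]
  show "AE x in M. weak_grad \<Omega> u x = g x" by (rule weak_grad_AE[OF w])
  show "(H01_norm \<Omega> u)\<^sup>2 = (LINT x|M. (norm (g x))\<^sup>2)"
    by (simp add: H01_norm_def weak_grad_integral[OF w s(2)])
  obtain \<phi> where p: "\<And>n. \<phi> n \<in> test_functions \<Omega>" "(\<lambda>n. LINT x|M. (norm (u x - \<phi> n x))\<^sup>2) \<longlonglongrightarrow> 0"
     "(\<lambda>n. LINT x|M. (norm (g x - gradf (\<phi> n) x))\<^sup>2) \<longlonglongrightarrow> 0" using h by (auto simp: H01_grad_def)
  show "u \<in> H01 \<Omega>" unfolding H01_def
  proof (intro CollectI conjI allI impI)
    show "u \<in> W12 \<Omega>" using s w by (auto simp: W12_def L2_sqi)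
    fix e :: real assume e: "e > 0"
    have "(\<lambda>n. sqrt ((LINT x|M. (norm (u x - \<phi> n x))\<^sup>2) + (LINT x|M. (norm (g x - gradf (\<phi> n) x))\<^sup>2))) \<longlonglongrightarrow> sqrt (0 + 0)"
      by (intro tendsto_intros p)
    then have "eventually (\<lambda>n. sqrt ((LINT x|M. (norm (u x - \<phi> n x))\<^sup>2) + (LINT x|M. (norm (g x - gradf (\<phi> n) x))\<^sup>2)) < e) sequentially"
      using e by (auto dest!: order_tendstoD(2)[of _ _ _ e])
    then obtain n where n: "sqrt ((LINT x|M. (norm (u x - \<phi> n x))\<^sup>2) + (LINT x|M. (norm (g x - gradf (\<phi> n) x))\<^sup>2)) < e"
      by (auto simp: eventually_sequentially)
    then have "W12_norm \<Omega> (\<lambda>x. u x - \<phi> n x) < e"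
      using weak_grad_integral[OF weak_gradient_diff_test[OF w p(1)] square_integrable_diff[OF s(2) square_integrable_test(2)[OF p(1)]]]
      by (simp add: W12_norm_def)
    then show "\<exists>\<phi>\<in>test_functions \<Omega>. W12_norm \<Omega> (\<lambda>x. u x - \<phi> x) < e" using p(1) by blast
  qed
qed

end

section \<open>Averages against a kernel\<close>

text \<open>A tent rather than a smooth mollifier: the averages only have to be Lipschitz. The mass
  is not normalized; \<open>kern_L2\<close> divides by it.\<close>

definition kern :: "real \<Rightarrow> 'a::euclidean_space \<Rightarrow> real" where "kern r z = max 0 (r - norm z)"

definition kern_mass :: "'a::euclidean_space itself \<Rightarrow> real \<Rightarrow> real" where
  "kern_mass _ r = (LINT z::'a|lborel. kern r z)"

definition kern_avg :: "real \<Rightarrow> ('a::euclidean_space \<Rightarrow> real) \<Rightarrow> 'a \<Rightarrow> real" where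
  "kern_avg r w x = (LINT h|lborel. kern r h * w (x + h))"

lemma kern_cont: "continuous_on S (kern r)"
  unfolding kern_def[abs_def] by (intro continuous_intros)

lemma kern_bounds: "0 \<le> kern r z" "r \<ge> 0 \<Longrightarrow> kern r z \<le> r" "r < norm z \<Longrightarrow> kern r z = 0"
  by (auto simp: kern_def)

lemma kern_lipschitz: "\<bar>kern r y - kern r z\<bar> \<le> norm (y - z)"
proof -
  have "\<bar>norm y - norm z\<bar> \<le> norm (y - z)" by (rule norm_triangle_ineq3)
  then show ?thesis by (auto simp: kern_def max_def abs_if split: if_splits)
qed

lemma kern_meas [measurable]: "kern r \<in> borel_measurable borel"
  by (rule continuous_borel[OF kern_cont])

lemma kern_integrable: "integrable lborel (kern r)"
  by (rule cont_supp_integrable[OF kern_cont kern_bounds(3)])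

lemma kern_mult_integrable:
  fixes f :: "'a::euclidean_space \<Rightarrow> real"
  assumes "continuous_on UNIV f"
  shows "integrable lborel (\<lambda>h. kern r h * f h)"
  by (rule cont_supp_integrable[of _ r]) (auto intro!: continuous_intros kern_cont assms simp: kern_bounds)

lemma kern_mass_pos: "r > 0 \<Longrightarrow> kern_mass TYPE('a::euclidean_space) r > 0"
proof -
  assume r: "r > 0"
  have "0 < r / 2 * measure lborel (cball (0::'a) (r / 2))" using r by (simp add: content_cball)
  also have "\<dots> = (LINT z::'a|lborel. r / 2 * indicator (cball 0 (r / 2)) z)" by simp
  also have "\<dots> \<le> kern_mass TYPE('a) r" unfolding kern_mass_def
  proof (rule integral_mono)
    show "integrable lborel (\<lambda>z::'a. r / 2 * indicator (cball 0 (r / 2)) z)"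
      using emeasure_lborel_cball_finite[of "0::'a" "r/2"]
      by (intro integrable_mult_right integrable_real_indicator) auto
    show "r / 2 * indicator (cball 0 (r / 2)) z \<le> kern r z" for z :: 'a
      using r by (auto simp: kern_def indicator_def)
  qed (rule kern_integrable)
  finally show ?thesis .
qed

text \<open>With the variable moved into the kernel, the modulus of continuity of the average comes
  from the tent and not from \<open>w\<close>.\<close>

lemma kern_avg_alt:
  assumes "continuous_on UNIV w"
  shows "kern_avg r w x = (LINT y|lborel. kern r (y - x) * w y)"
proof -
  have "(LINT y|lborel. kern r (y - x) * w y) = (LINT h|lborel. kern r (h + x - x) * w (h + x))"
    using continuous_borel[OF assms] by (subst lborel_translate[where h=x, symmetric]) auto
  then show ?thesis by (simp add: kern_avg_def add.commute)
qed

text \<open>Both bounds involve \<open>w\<close> only through its L^1 norm, hence they are uniform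
  along a bounded sequence; this is the equicontinuity behind the Rellich theorem.\<close>

lemma kern_avg_bounds:
  assumes w: "C1c w g" and r: "r \<ge> 0"
  shows "\<bar>kern_avg r w x\<bar> \<le> r * (LINT y|lborel. \<bar>w y\<bar>)"
    "\<bar>kern_avg r w x - kern_avg r w z\<bar> \<le> norm (x - z) * (LINT y|lborel. \<bar>w y\<bar>)"
proof -
  note c = C1c_D(3)[OF w]
  have i: "integrable lborel (\<lambda>y. \<bar>w y\<bar>)" using C1c_integrable(1)[OF w] by simp
  have ik: "integrable lborel (\<lambda>y. kern r (y - x) * w y)" for x
  proof -
    have "continuous_on UNIV (\<lambda>y. kern r (y - x))"
      by (intro continuous_on_compose2[OF kern_cont[of UNIV]] continuous_intros) auto
    then show ?thesis using C1c_supp[OF w]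
      by (elim exE) (rule cont_supp_integrable, auto intro!: continuous_intros c)
  qed
  have "\<bar>kern_avg r w x\<bar> \<le> (LINT y|lborel. \<bar>kern r (y - x) * w y\<bar>)"
    unfolding kern_avg_alt[OF c] by (rule integral_abs_bound)
  also have "\<dots> \<le> (LINT y|lborel. r * \<bar>w y\<bar>)"
  proof (rule integral_mono[OF integrable_abs[OF ik] integrable_mult_right[OF i]])
    show "\<bar>kern r (y - x) * w y\<bar> \<le> r * \<bar>w y\<bar>" for y
      using kern_bounds(1)[of r "y - x"] kern_bounds(2)[OF r, of "y - x"]
      by (auto simp: abs_mult intro!: mult_right_mono)
  qed
  finally show "\<bar>kern_avg r w x\<bar> \<le> r * (LINT y|lborel. \<bar>w y\<bar>)" by simp
  have "kern_avg r w x - kern_avg r w z = (LINT y|lborel. (kern r (y - x) - kern r (y - z)) * w y)"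
    unfolding kern_avg_alt[OF c] by (simp add: left_diff_distrib ik)
  also have "\<bar>\<dots>\<bar> \<le> (LINT y|lborel. \<bar>(kern r (y - x) - kern r (y - z)) * w y\<bar>)"
    by (rule integral_abs_bound)
  also have "\<dots> \<le> (LINT y|lborel. norm (x - z) * \<bar>w y\<bar>)"
  proof (rule integral_mono[OF integrable_abs integrable_mult_right[OF i]])
    show "integrable lborel (\<lambda>y. (kern r (y - x) - kern r (y - z)) * w y)"
      by (simp add: left_diff_distrib ik)
    fix y show "\<bar>(kern r (y - x) - kern r (y - z)) * w y\<bar> \<le> norm (x - z) * \<bar>w y\<bar>"
      using kern_lipschitz[of r "y - x" "y - z"]
      by (auto simp: abs_mult norm_minus_commute intro!: mult_right_mono)
  qed
  finally show "\<bar>kern_avg r w x - kern_avg r w z\<bar> \<le> norm (x - z) * (LINT y|lborel. \<bar>w y\<bar>)" by simp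
qed

lemma kern_avg_cont:
  assumes w: "C1c w g" and r: "r \<ge> 0"
  shows "continuous_on UNIV (kern_avg r w)"
proof -
  define L where "L = (LINT y|lborel. \<bar>w y\<bar>)"
  have L: "L \<ge> 0" by (simp add: L_def)
  have "L-lipschitz_on UNIV (kern_avg r w)"
    using kern_avg_bounds(2)[OF w r] L
    by (intro lipschitz_onI) (auto simp: dist_norm L_def mult.commute)
  then show ?thesis by (rule lipschitz_on_continuous_on)
qed

text \<open>A function differs from its average at scale \<open>r\<close> by its oscillation at that
  scale, which the translation estimate bounds by \<open>r\<^sup>2\<close> times the gradient
  energy. The average may be restricted to \<open>S\<close>, since \<open>w\<close> vanishes
  elsewhere.\<close>

lemma kern_L2:
  fixes w :: "'a::euclidean_space \<Rightarrow> real"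
  assumes w: "C1c w g" and r: "r > 0" and S[measurable]: "S \<in> sets borel" and bS: "bounded S"
    and z: "\<And>x. x \<notin> S \<Longrightarrow> w x = 0"
  shows "(LINT x|lborel. (w x)\<^sup>2) \<le> 2 * r\<^sup>2 * (LINT x|lborel. (norm (g x))\<^sup>2)
     + 4 / (kern_mass TYPE('a) r)\<^sup>2 * (LINT x|lborel. indicator S x * (kern_avg r w x)\<^sup>2)"
proof -
  define P where "P = kern_mass TYPE('a) r"
  define G where "G = (LINT x|lborel. (norm (g x))\<^sup>2)"
  define J where "J x h = kern r h * (w (x + h) - w x)\<^sup>2" for x h
  define Q where "Q = (LINT x|lborel. indicator S x * (kern_avg r w x)\<^sup>2)"
  have P: "P > 0" unfolding P_def by (rule kern_mass_pos[OF r])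
  have G: "G \<ge> 0" by (simp add: G_def)
  note c = C1c_D(3)[OF w]
  have [measurable]: "w \<in> borel_measurable borel" using c by (rule continuous_borel)
  have ck: "continuous_on UNIV (kern_avg r w)" using w r by (intro kern_avg_cont) auto
  have [measurable]: "kern_avg r w \<in> borel_measurable borel" by (rule continuous_borel[OF ck])
  have iS: "integrable lborel (\<lambda>x. indicator S x * (kern_avg r w x)\<^sup>2)"
  proof -
    obtain R where R: "\<And>x. x \<in> S \<Longrightarrow> norm x \<le> R" using bS by (auto simp: bounded_iff)
    have "integrable lborel (\<lambda>x. indicator (cball 0 R) x *\<^sub>R (kern_avg r w x)\<^sup>2)"
      by (intro borel_integrable_compact continuous_intros continuous_on_subset[OF ck]) auto
    then show ?thesis
      by (rule Bochner_Integration.integrable_bound) (use R in \<open>auto simp: indicator_def\<close>)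
  qed
  have int: "integrable lborel (J x)" for x
    unfolding J_def by (intro kern_mult_integrable continuous_intros continuous_on_compose2[OF c]) auto
  have J0: "J x h \<ge> 0" for x h by (simp add: J_def kern_bounds)
  have pw: "P * (w x)\<^sup>2 \<le> 2 * (LINT h|lborel. J x h) + 4 / P * (indicator S x * (kern_avg r w x)\<^sup>2)" for x
  proof (cases "x \<in> S")
    case False
    then show ?thesis using z[OF False] J0 by simp
  next
    case True
    define K where "K = kern_avg r w x"
    have i1: "integrable lborel (\<lambda>h. kern r h * (w x)\<^sup>2)" by (intro integrable_mult_left kern_integrable)
    have i2: "integrable lborel (\<lambda>h. 2 * w x * (kern r h * w (x + h)))"
      by (intro integrable_mult_right kern_mult_integrable continuous_intros continuous_on_compose2[OF c]) auto
    have "(LINT h|lborel. 2 * w x * (kern r h * w (x + h)) - kern r h * (w x)\<^sup>2) \<ge> - (LINT h|lborel. J x h)"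
    proof -
      have iw: "integrable lborel (\<lambda>h. kern r h * (w (x + h))\<^sup>2)"
        by (intro kern_mult_integrable continuous_intros continuous_on_compose2[OF c]) auto
      have "(LINT h|lborel. - J x h) \<le> (LINT h|lborel. 2 * w x * (kern r h * w (x + h)) - kern r h * (w x)\<^sup>2)"
      proof (intro integral_mono Bochner_Integration.integrable_diff Bochner_Integration.integrable_minus int i1 i2)
        fix h
        have "0 \<le> kern r h * (w (x + h))\<^sup>2" by (simp add: kern_bounds)
        then show "- J x h \<le> 2 * w x * (kern r h * w (x + h)) - kern r h * (w x)\<^sup>2"
          by (simp add: J_def power2_eq_square algebra_simps)
      qed
      then show ?thesis by simp
    qed
    moreover have "(LINT h|lborel. 2 * w x * (kern r h * w (x + h)) - kern r h * (w x)\<^sup>2) = 2 * w x * K - P * (w x)\<^sup>2"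
      unfolding Bochner_Integration.integral_diff[OF i2 i1]
      by (simp add: P_def kern_mass_def K_def kern_avg_def)
    ultimately have 1: "P * (w x)\<^sup>2 \<le> (LINT h|lborel. J x h) + 2 * w x * K" by linarith
    \<comment> \<open>Young's inequality with a parameter that absorbs half of
      \<open>P * (w x)\<^sup>2\<close>; this is the origin of the factors 2 and 4.\<close>
    have "0 \<le> (P * w x - 2 * K)\<^sup>2 / P" using P by simp
    also have "\<dots> = P * (w x)\<^sup>2 - 4 * w x * K + 4 * K\<^sup>2 / P"
      using P by (simp add: power2_eq_square field_simps)
    finally have "4 * w x * K \<le> P * (w x)\<^sup>2 + 4 / P * K\<^sup>2" by simp
    then show ?thesis using 1 True by (simp add: K_def)
  qed
  have Jm: "(\<lambda>(x, h). ennreal (J x h)) \<in> borel_measurable (lborel \<Otimes>\<^sub>M lborel)"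
    unfolding J_def by measurable
  have "(\<integral>\<^sup>+x. ennreal (LINT h|lborel. J x h) \<partial>lborel) = (\<integral>\<^sup>+x. (\<integral>\<^sup>+h. J x h \<partial>lborel) \<partial>lborel)"
    using J0 by (simp add: nn_integral_eq_integral[OF int])
  also have "\<dots> = (\<integral>\<^sup>+h. (\<integral>\<^sup>+x. J x h \<partial>lborel) \<partial>lborel)"
    using lborel_pair.Fubini'[OF Jm] by simp
  also have "\<dots> \<le> (\<integral>\<^sup>+h. ennreal (r\<^sup>2 * G * kern r (h::'a)) \<partial>lborel)"
  proof (rule nn_integral_mono)
    fix h :: 'a
    have "(\<integral>\<^sup>+x. J x h \<partial>lborel) = ennreal (kern r h * (LINT x|lborel. (w (x + h) - w x)\<^sup>2))"
      unfolding J_def using C1c_integrable(6)[OF w] kern_bounds(1)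
      by (subst nn_integral_eq_integral) (auto intro!: AE_I2 mult_nonneg_nonneg)
    also have "\<dots> \<le> ennreal (r\<^sup>2 * G * kern r h)"
    proof (rule ennreal_leI)
      show "kern r h * (LINT x|lborel. (w (x + h) - w x)\<^sup>2) \<le> r\<^sup>2 * G * kern r h"
      proof (cases "norm h \<le> r")
        case True
        have "(LINT x|lborel. (w (x + h) - w x)\<^sup>2) \<le> (norm h)\<^sup>2 * G"
          unfolding G_def by (rule C1c_translation_estimate[OF w])
        also have "\<dots> \<le> r\<^sup>2 * G" using True G by (intro mult_right_mono power_mono) auto
        finally show ?thesis using kern_bounds(1)[of r h] by (simp add: mult.commute mult_left_mono)
      qed (simp add: kern_bounds)
    qed
    finally show "(\<integral>\<^sup>+x. J x h \<partial>lborel) \<le> ennreal (r\<^sup>2 * G * kern r h)" .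
  qed
  also have "\<dots> = ennreal (r\<^sup>2 * G * P)"
    unfolding P_def kern_mass_def using G kern_bounds(1) kern_integrable
    by (subst nn_integral_eq_integral) (auto intro!: AE_I2 mult_nonneg_nonneg)
  finally have JJ: "(\<integral>\<^sup>+x. ennreal (LINT h|lborel. J x h) \<partial>lborel) \<le> ennreal (r\<^sup>2 * G * P)" .
  have LJ0: "0 \<le> (LINT h|lborel. J x h)" for x using J0 by simp
  have [measurable]: "(\<lambda>x. LINT h|lborel. J x h) \<in> borel_measurable lborel"
    unfolding J_def by measurable
  have iLJ: "integrable lborel (\<lambda>x. LINT h|lborel. J x h)"
    using JJ LJ0 by (intro integrableI_nonneg) (auto intro: le_less_trans)
  have LJ: "(LINT x|lborel. LINT h|lborel. J x h) \<le> r\<^sup>2 * G * P"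
    using JJ LJ0 G P by (subst (asm) nn_integral_eq_integral[OF iLJ]) auto
  have "P * (LINT x|lborel. (w x)\<^sup>2) = (LINT x|lborel. P * (w x)\<^sup>2)" by simp
  also have "\<dots> \<le> (LINT x|lborel. 2 * (LINT h|lborel. J x h) + 4 / P * (indicator S x * (kern_avg r w x)\<^sup>2))"
    by (intro integral_mono integrable_mult_right C1c_integrable[OF w] Bochner_Integration.integrable_add iLJ iS pw)
  also have "\<dots> = 2 * (LINT x|lborel. LINT h|lborel. J x h) + 4 / P * Q"
    unfolding Q_def using iLJ iS by simp
  also have "\<dots> \<le> 2 * (r\<^sup>2 * G * P) + 4 / P * Q" using LJ by simp
  also have "\<dots> = P * (2 * r\<^sup>2 * G + 4 / P\<^sup>2 * Q)" using P by (simp add: power2_eq_square field_simps)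
  finally have "(LINT x|lborel. (w x)\<^sup>2) \<le> 2 * r\<^sup>2 * G + 4 / P\<^sup>2 * Q" using P by simp
  then show ?thesis unfolding P_def G_def Q_def .
qed

section \<open>The Poincare and Sobolev inequalities on the Sobolev space\<close>

context bounded_open
begin

lemma gradf_zero: "\<phi> \<in> test_functions \<Omega> \<Longrightarrow> x \<notin> \<Omega> \<Longrightarrow> gradf \<phi> x = 0"
  unfolding gradf_def using test_support[OF test_partial] by (intro sum.neutral) auto

lemma test_integrals:
  assumes p: "\<phi> \<in> test_functions \<Omega>"
  shows "(LINT x|M. (norm (\<phi> x))\<^sup>2) = (LINT x|lborel. (\<phi> x)\<^sup>2)"
    "(LINT x|M. (norm (gradf \<phi> x))\<^sup>2) = (LINT x|lborel. (norm (gradf \<phi> x))\<^sup>2)"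
    "(LINT x|M. \<bar>\<phi> x\<bar>) = (LINT x|lborel. \<bar>\<phi> x\<bar>)"
    "(LINT x|M. \<bar>\<phi> x\<bar> powr q) = (LINT x|lborel. \<bar>\<phi> x\<bar> powr q)"
proof -
  note c = C1c_D[OF test_C1c[OF p]]
  have [measurable]: "\<phi> \<in> borel_measurable borel" "gradf \<phi> \<in> borel_measurable borel"
    using c by (auto intro: continuous_borel)
  note z = test_support[OF p] gradf_zero[OF p]
  show "(LINT x|M. (norm (\<phi> x))\<^sup>2) = (LINT x|lborel. (\<phi> x)\<^sup>2)"
    "(LINT x|M. (norm (gradf \<phi> x))\<^sup>2) = (LINT x|lborel. (norm (gradf \<phi> x))\<^sup>2)"
    "(LINT x|M. \<bar>\<phi> x\<bar>) = (LINT x|lborel. \<bar>\<phi> x\<bar>)"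
    "(LINT x|M. \<bar>\<phi> x\<bar> powr q) = (LINT x|lborel. \<bar>\<phi> x\<bar> powr q)"
    using z by (simp_all add: lebesgue_on_lborel(1)[OF _ op])
qed

lemma Om_ball: "\<exists>R\<ge>0. \<Omega> \<subseteq> cball 0 R"
proof -
  obtain R where "\<And>x. x \<in> \<Omega> \<Longrightarrow> norm x \<le> R" using bd by (auto simp: bounded_iff)
  then have "\<Omega> \<subseteq> cball 0 (max 0 R)" by force
  then show ?thesis by (intro exI[of _ "max 0 R"]) auto
qed

lemma poincare: "\<exists>P>0. \<forall>u g. H01_grad u g \<longrightarrow> (LINT x|M. (norm (u x))\<^sup>2) \<le> P * (LINT x|M. (norm (g x))\<^sup>2)"
proof -
  obtain R where R: "R \<ge> 0" "\<Omega> \<subseteq> cball 0 R" using Om_ball by auto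
  have t: "(LINT x|M. (norm (\<phi> x))\<^sup>2) \<le> (2 * R + 1)\<^sup>2 * (LINT x|M. (norm (gradf \<phi> x))\<^sup>2)"
    if p: "\<phi> \<in> test_functions \<Omega>" for \<phi>
  proof -
    have "\<phi> x = 0" if "R < norm x" for x using that R(2) test_support[OF p, of x] by (force simp: dist_norm)
    from C1c_poincare[OF test_C1c[OF p] this R(1)] show ?thesis by (simp only: test_integrals[OF p])
  qed
  have "(LINT x|M. (norm (u x))\<^sup>2) \<le> (2 * R + 1)\<^sup>2 * (LINT x|M. (norm (g x))\<^sup>2)" if h: "H01_grad u g" for u g
  proof -
    obtain \<phi> where p: "\<And>n. \<phi> n \<in> test_functions \<Omega>" "(\<lambda>n. LINT x|M. (norm (u x - \<phi> n x))\<^sup>2) \<longlonglongrightarrow> 0"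
     "(\<lambda>n. LINT x|M. (norm (g x - gradf (\<phi> n) x))\<^sup>2) \<longlonglongrightarrow> 0" using h by (auto simp: H01_grad_def)
    show ?thesis
    proof (rule LIMSEQ_le)
      show "(\<lambda>n. LINT x|M. (norm (\<phi> n x))\<^sup>2) \<longlonglongrightarrow> (LINT x|M. (norm (u x))\<^sup>2)"
        by (rule square_integrable_tendsto_norm[OF square_integrable_test(1)[OF p(1)] H01_grad_sqi(1)[OF h] p(2)])
      show "(\<lambda>n. (2 * R + 1)\<^sup>2 * (LINT x|M. (norm (gradf (\<phi> n) x))\<^sup>2)) \<longlonglongrightarrow> (2 * R + 1)\<^sup>2 * (LINT x|M. (norm (g x))\<^sup>2)"
        by (intro tendsto_mult_left square_integrable_tendsto_norm[OF square_integrable_test(2)[OF p(1)] H01_grad_sqi(2)[OF h] p(3)])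
      show "\<exists>N. \<forall>n\<ge>N. (LINT x|M. (norm (\<phi> n x))\<^sup>2) \<le> (2 * R + 1)\<^sup>2 * (LINT x|M. (norm (gradf (\<phi> n) x))\<^sup>2)"
        using t[OF p(1)] by blast
    qed
  qed
  moreover have "(2 * R + 1)\<^sup>2 > 0" using R by simp
  ultimately show ?thesis by blast
qed

text \<open>The approximating test functions converge in L^2 only, so the q-th powers are reached by
  Fatou's lemma along a subsequence that converges almost everywhere. Integrability of the q-th
  power is part of the conclusion.\<close>

lemma sobolev:
  assumes N: "DIM('a) > 2" and q: "q = crit_exp DIM('a)"
  shows "\<exists>S>0. \<forall>u g. H01_grad u g \<longrightarrow> integrable M (\<lambda>x. \<bar>u x\<bar> powr q) \<and>
      (LINT x|M. \<bar>u x\<bar> powr q) \<le> (S * (LINT x|M. (norm (g x))\<^sup>2)) powr (q / 2)"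
proof -
  obtain S where S: "S > 0" "\<And>(u::'a \<Rightarrow> real) g. C1c u g \<Longrightarrow>
     (LINT x|lborel. \<bar>u x\<bar> powr q) powr (2 / q) \<le> S * (LINT x|lborel. (norm (g x))\<^sup>2)"
    using C1c_sobolev[OF N q] by blast
  have q2: "q > 2" unfolding q crit_exp_def using N by (simp add: field_simps)
  have t: "(LINT x|M. \<bar>\<phi> x\<bar> powr q) \<le> (S * (LINT x|M. (norm (gradf \<phi> x))\<^sup>2)) powr (q / 2)"
    if p: "\<phi> \<in> test_functions \<Omega>" for \<phi>
  proof -
    define V where "V = (LINT x|lborel. \<bar>\<phi> x\<bar> powr q)"
    have V: "V \<ge> 0" by (simp add: V_def)
    have "V = (V powr (2 / q)) powr (q / 2)" using V q2 by (simp add: powr_powr)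
    also have "\<dots> \<le> (S * (LINT x|lborel. (norm (gradf \<phi> x))\<^sup>2)) powr (q / 2)"
      using S(2)[OF test_C1c[OF p]] q2 by (intro powr_mono2) (auto simp: V_def)
    finally show ?thesis unfolding V_def by (simp only: test_integrals[OF p])
  qed
  have "integrable M (\<lambda>x. \<bar>u x\<bar> powr q) \<and>
      (LINT x|M. \<bar>u x\<bar> powr q) \<le> (S * (LINT x|M. (norm (g x))\<^sup>2)) powr (q / 2)" if h: "H01_grad u g" for u g
  proof -
    define B where "B = (S * (LINT x|M. (norm (g x))\<^sup>2)) powr (q / 2)"
    have B: "B \<ge> 0" by (simp add: B_def)
    obtain \<phi> where p: "\<And>n. \<phi> n \<in> test_functions \<Omega>" "(\<lambda>n. LINT x|M. (norm (u x - \<phi> n x))\<^sup>2) \<longlonglongrightarrow> 0"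
     "(\<lambda>n. LINT x|M. (norm (g x - gradf (\<phi> n) x))\<^sup>2) \<longlonglongrightarrow> 0" using h by (auto simp: H01_grad_def)
    note su = H01_grad_sqi[OF h]
    have [measurable]: "u \<in> borel_measurable M" by (rule square_integrable_meas[OF su(1)])
    have [measurable]: "\<phi> n \<in> borel_measurable M" for n by (rule square_integrable_meas[OF square_integrable_test(1)[OF p(1)]])
    have p2': "(\<lambda>n. LINT x|M. (norm (\<phi> n x - u x))\<^sup>2) \<longlonglongrightarrow> 0" using p(2) by (simp add: power2_commute)
    obtain r where r: "strict_mono r" "AE x in M. (\<lambda>n. \<phi> (r n) x) \<longlonglongrightarrow> u x"
      using square_integrable_AE_subseq[OF square_integrable_test(1)[OF p(1)] su(1) p2'] by blast
    have lg: "(\<lambda>n. LINT x|M. (norm (gradf (\<phi> (r n)) x))\<^sup>2) \<longlonglongrightarrow> (LINT x|M. (norm (g x))\<^sup>2)"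
      using LIMSEQ_subseq_LIMSEQ[OF square_integrable_tendsto_norm[OF square_integrable_test(2)[OF p(1)] su(2) p(3)] r(1)]
      by (simp add: comp_def)
    have "(\<integral>\<^sup>+x. ennreal (\<bar>u x\<bar> powr q) \<partial>M) = (\<integral>\<^sup>+x. liminf (\<lambda>n. ennreal (\<bar>\<phi> (r n) x\<bar> powr q)) \<partial>M)"
    proof (rule nn_integral_cong_AE)
      show "AE x in M. ennreal (\<bar>u x\<bar> powr q) = liminf (\<lambda>n. ennreal (\<bar>\<phi> (r n) x\<bar> powr q))"
        using r(2)
      proof eventually_elim
        case (elim x)
        have "(\<lambda>n. ennreal (\<bar>\<phi> (r n) x\<bar> powr q)) \<longlonglongrightarrow> ennreal (\<bar>u x\<bar> powr q)"
          using q2 by (intro tendsto_ennrealI tendsto_powr2 tendsto_rabs elim tendsto_const) auto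
        then show ?case by (rule lim_imp_Liminf[OF sequentially_bot, symmetric])
      qed
    qed
    also have "\<dots> \<le> liminf (\<lambda>n. \<integral>\<^sup>+x. ennreal (\<bar>\<phi> (r n) x\<bar> powr q) \<partial>M)"
      by (rule nn_integral_liminf) measurable
    also have "\<dots> \<le> liminf (\<lambda>n. ennreal ((S * (LINT x|M. (norm (gradf (\<phi> (r n)) x))\<^sup>2)) powr (q / 2)))"
    proof (intro Liminf_mono always_eventually allI)
      fix n
      have "(\<integral>\<^sup>+x. ennreal (\<bar>\<phi> (r n) x\<bar> powr q) \<partial>M) = ennreal (LINT x|M. \<bar>\<phi> (r n) x\<bar> powr q)"
        using q2 by (intro nn_integral_eq_integral integrable_M_lborel C1c_powr_integrable[OF test_C1c[OF p(1)]]) auto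
      also have "\<dots> \<le> ennreal ((S * (LINT x|M. (norm (gradf (\<phi> (r n)) x))\<^sup>2)) powr (q / 2))"
        by (rule ennreal_leI[OF t[OF p(1)]])
      finally show "(\<integral>\<^sup>+x. ennreal (\<bar>\<phi> (r n) x\<bar> powr q) \<partial>M)
        \<le> ennreal ((S * (LINT x|M. (norm (gradf (\<phi> (r n)) x))\<^sup>2)) powr (q / 2))" .
    qed
    also have "\<dots> = ennreal B"
    proof (rule lim_imp_Liminf[OF sequentially_bot])
      show "(\<lambda>n. ennreal ((S * (LINT x|M. (norm (gradf (\<phi> (r n)) x))\<^sup>2)) powr (q / 2))) \<longlonglongrightarrow> ennreal B"
        unfolding B_def using q2 S(1)
        by (intro tendsto_ennrealI tendsto_powr2 tendsto_mult_left lg tendsto_const) auto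
    qed
    finally have le: "(\<integral>\<^sup>+x. ennreal (\<bar>u x\<bar> powr q) \<partial>M) \<le> ennreal B" .
    then have i: "integrable M (\<lambda>x. \<bar>u x\<bar> powr q)"
      by (intro integrableI_nonneg) (auto intro: le_less_trans)
    with le B show ?thesis unfolding B_def[symmetric]
      by (subst (asm) nn_integral_eq_integral) auto
  qed
  with S(1) show ?thesis by blast
qed

end

section \<open>Compactness\<close>

text \<open>Midpoints are enough for the Mazur argument below: by the parallelogram law, elements of almost
  minimal energy in a midpoint convex set form a Cauchy sequence.\<close>

inductive_set midhull :: "(nat \<Rightarrow> 'a \<Rightarrow> real) \<Rightarrow> nat \<Rightarrow> ('a \<Rightarrow> real) set" for \<phi> n where
  base: "n \<le> k \<Longrightarrow> \<phi> k \<in> midhull \<phi> n"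
| mid: "v \<in> midhull \<phi> n \<Longrightarrow> w \<in> midhull \<phi> n \<Longrightarrow> (\<lambda>x. 1/2 * v x + 1/2 * w x) \<in> midhull \<phi> n"

lemma midhull_mono: "v \<in> midhull \<phi> m \<Longrightarrow> n \<le> m \<Longrightarrow> v \<in> midhull \<phi> n"
proof (induction rule: midhull.induct)
  case (base k)
  then show ?case by (intro midhull.base) simp
next
  case (mid v w)
  then show ?case by (intro midhull.mid)
qed

lemma kern_avg_diff:
  assumes "C1c v g" "C1c w h"
  shows "kern_avg r (\<lambda>x. v x + (-1) * w x) x = kern_avg r v x - kern_avg r w x"
proof -
  have "integrable lborel (\<lambda>h. kern r h * v (x + h))" "integrable lborel (\<lambda>h. kern r h * w (x + h))"
    by (intro kern_mult_integrable continuous_intros continuous_on_compose2[OF C1c_D(3)[OF assms(1)]]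
        continuous_on_compose2[OF C1c_D(3)[OF assms(2)]]; auto)+
  then show ?thesis unfolding kern_avg_def by (simp add: right_diff_distrib)
qed

section \<open>The Rellich theorem and weak compactness\<close>

context bounded_open
begin

text \<open>The Arzela-Ascoli argument: a uniformly Lipschitz sequence that converges on a dense set
  converges everywhere.\<close>

lemma kern_avg_convergent:
  assumes c: "\<And>n. C1c (w n) (g n)" and r: "r \<ge> 0"
    and A: "\<And>n. (LINT y|lborel. \<bar>w n y\<bar>) \<le> A"
    and D: "\<And>X. open X \<Longrightarrow> X \<noteq> {} \<Longrightarrow> \<exists>d\<in>D. d \<in> X"
    and cv: "\<And>d. d \<in> D \<Longrightarrow> convergent (\<lambda>n. kern_avg r (w n) d)"
  shows "convergent (\<lambda>n. kern_avg r (w n) x)"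
proof -
  have A0: "A \<ge> 0" using A[of 0] by (rule order_trans[rotated]) simp
  have lip: "\<bar>kern_avg r (w n) x - kern_avg r (w n) d\<bar> \<le> norm (x - d) * A" for n d
    using kern_avg_bounds(2)[OF c r, of n x d] A[of n] by (meson mult_left_mono norm_ge_zero order_trans)
  have "Cauchy (\<lambda>n. kern_avg r (w n) x)"
  proof (rule CauchyI)
    fix e :: real assume e: "e > 0"
    \<comment> \<open>\<open>A + 1\<close> instead of \<open>A\<close> covers the case that all L^1
      norms vanish.\<close>
    have "e / (3 * (A + 1)) > 0" using e A0 by (intro divide_pos_pos) auto
    then have "ball x (e / (3 * (A + 1))) \<noteq> {}" by simp
    then obtain d where d: "d \<in> D" "dist x d < e / (3 * (A + 1))" using D[of "ball x (e / (3 * (A + 1)))"] by auto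
    have "norm (x - d) * A \<le> norm (x - d) * (A + 1)" by (intro mult_left_mono) auto
    also have "\<dots> < e / 3" using d(2) A0 by (simp add: dist_norm field_simps)
    finally have dA: "norm (x - d) * A < e / 3" .
    have "Cauchy (\<lambda>n. kern_avg r (w n) d)" using cv[OF d(1)] by (rule convergent_Cauchy)
    then obtain N where N: "\<And>m n. m \<ge> N \<Longrightarrow> n \<ge> N \<Longrightarrow> \<bar>kern_avg r (w m) d - kern_avg r (w n) d\<bar> < e / 3"
      using CauchyD[of _ "e / 3"] e by (metis divide_pos_pos real_norm_def zero_less_numeral)
    have "norm (kern_avg r (w m) x - kern_avg r (w n) x) < e" if "m \<ge> N" "n \<ge> N" for m n
      using N[OF that] lip[of m d] lip[of n d] dA unfolding real_norm_def by linarith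
    then show "\<exists>N. \<forall>m\<ge>N. \<forall>n\<ge>N. norm (kern_avg r (w m) x - kern_avg r (w n) x) < e" by blast
  qed
  then show ?thesis by (rule Cauchy_convergent)
qed

text \<open>For each scale the averages converge along one diagonal subsequence, pointwise and then
  in L^2 on \<open>\<Omega>\<close> by dominated convergence. \<open>kern_L2\<close> bounds the
  distance to the averages by the square of the scale, uniformly in the sequence.\<close>

lemma rellich_test:
  assumes p: "\<And>n::nat. \<phi> n \<in> test_functions \<Omega>" and B: "\<And>n. (LINT x|M. (norm (gradf (\<phi> n) x))\<^sup>2) \<le> B"
  shows "\<exists>r::nat \<Rightarrow> nat. strict_mono r \<and>
    (\<forall>e>0. \<exists>N. \<forall>m\<ge>N. \<forall>n\<ge>N. (LINT x|M. (norm (\<phi> (r m) x - \<phi> (r n) x))\<^sup>2) < e)"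
proof -
  obtain P where P: "P > 0" "\<And>u g. H01_grad u g \<Longrightarrow> (LINT x|M. (norm (u x))\<^sup>2) \<le> P * (LINT x|M. (norm (g x))\<^sup>2)"
    using poincare by blast
  have B0: "B \<ge> 0" using B[of 0] by (rule order_trans[rotated]) simp
  \<comment> \<open>An L^1 bound from the L^2 bound of Poincare's inequality, by
    \<open>\<bar>s\<bar> \<le> 1 + s\<^sup>2\<close> on a set of finite measure.\<close>
  define A where "A = measure M (space M) + P * B"
  have A: "(LINT y|lborel. \<bar>\<phi> n y\<bar>) \<le> A" for n
  proof -
    have "(LINT y|lborel. \<bar>\<phi> n y\<bar>) = (LINT y|M. \<bar>\<phi> n y\<bar>)" by (simp only: test_integrals[OF p])
    also have "\<dots> \<le> (LINT y|M. 1 + (norm (\<phi> n y))\<^sup>2)"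
    proof (rule integral_mono)
      show "integrable M (\<lambda>y. \<bar>\<phi> n y\<bar>)" by (intro integrable_abs square_integrable_integrable[OF Om_fin] square_integrable_test p)
      show "integrable M (\<lambda>y. 1 + (norm (\<phi> n y))\<^sup>2)"
        by (intro Bochner_Integration.integrable_add finite_measure.integrable_const[OF Om_fin] square_integrable_int square_integrable_test p)
      show "\<bar>\<phi> n y\<bar> \<le> 1 + (norm (\<phi> n y))\<^sup>2" for y
        using zero_le_power2[of "\<bar>\<phi> n y\<bar> - 1/2"] by (simp add: power2_eq_square algebra_simps)
    qed
    also have "\<dots> = measure M (space M) + (LINT y|M. (norm (\<phi> n y))\<^sup>2)"
      using square_integrable_int[OF square_integrable_test(1)[OF p]] finite_measure.integrable_const[OF Om_fin, of "1::real"]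
      by (subst Bochner_Integration.integral_add) auto
    also have "(LINT y|M. (norm (\<phi> n y))\<^sup>2) \<le> P * B"
      using P(2)[OF H01_grad_test[OF p], of n] mult_left_mono[OF B[of n], of P] P(1) by linarith
    finally show ?thesis by (simp add: A_def)
  qed
  have A0: "A \<ge> 0" using A[of 0] by (rule order_trans[rotated]) simp
  define \<rho> where "\<rho> m = inverse (real (Suc m))" for m
  have \<rho>: "\<rho> m > 0" "\<rho> m \<le> 1" for m by (simp_all add: \<rho>_def field_simps)
  note c = test_C1c[OF p]
  have Kb: "\<bar>kern_avg (\<rho> m) (\<phi> n) x\<bar> \<le> A" for m n x
  proof -
    have "\<bar>kern_avg (\<rho> m) (\<phi> n) x\<bar> \<le> \<rho> m * (LINT y|lborel. \<bar>\<phi> n y\<bar>)"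
      using \<rho>[of m] by (intro kern_avg_bounds[OF c]) auto
    also have "\<dots> \<le> 1 * A" using \<rho>[of m] A by (intro mult_mono) auto
    finally show ?thesis by simp
  qed
  obtain D :: "'a set" where D: "countable D" "\<And>X. open X \<Longrightarrow> X \<noteq> {} \<Longrightarrow> \<exists>d\<in>D. d \<in> X"
    using countable_dense_exists[where 'a='a] by metis
  \<comment> \<open>The diagonal argument runs over pairs of a scale and a point of the dense set at
    once.\<close>
  have "countable (UNIV \<times> D :: (nat \<times> 'a) set)" using D(1) by simp
  then obtain k where k: "strict_mono (k::nat \<Rightarrow> nat)"
    "\<And>y. y \<in> UNIV \<times> D \<Longrightarrow> \<exists>l. (\<lambda>n. kern_avg (\<rho> (fst y)) (\<phi> (k n)) (snd y)) \<longlonglongrightarrow> l"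
    by (rule function_convergent_subsequence[where f="\<lambda>n y. kern_avg (\<rho> (fst y)) (\<phi> n) (snd y)" and M=A])
       (use Kb in auto)
  define w where "w n = \<phi> (k n)" for n
  have cw: "C1c (w n) (gradf (w n))" for n unfolding w_def by (rule c)
  have wt: "w n \<in> test_functions \<Omega>" for n by (simp add: w_def p)
  have conv: "convergent (\<lambda>n. kern_avg (\<rho> m) (w n) x)" for m x
  proof (rule kern_avg_convergent[OF cw _ _ D(2)])
    show "\<rho> m \<ge> 0" using \<rho>[of m] by simp
    show "(LINT y|lborel. \<bar>w n y\<bar>) \<le> A" for n unfolding w_def by (rule A)
    show "convergent (\<lambda>n. kern_avg (\<rho> m) (w n) d)" if "d \<in> D" for d
      using k(2)[of "(m, d)"] that by (auto simp: convergent_def w_def)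
  qed
  define L where "L m x = lim (\<lambda>n. kern_avg (\<rho> m) (w n) x)" for m x
  have L: "(\<lambda>n. kern_avg (\<rho> m) (w n) x) \<longlonglongrightarrow> L m x" for m x
    using conv by (simp add: L_def convergent_LIMSEQ_iff)
  have Lb: "\<bar>L m x\<bar> \<le> A" for m x
    using LIMSEQ_le_const2[OF tendsto_rabs[OF L]] Kb by (metis w_def)
  have Km[measurable]: "kern_avg (\<rho> m) (w n) \<in> borel_measurable borel" for m n
    using \<rho>[of m] by (intro continuous_borel kern_avg_cont[OF cw]) auto
  have Lm[measurable]: "L m \<in> borel_measurable borel" for m
    by (rule borel_measurable_LIMSEQ_metric[OF Km L])
  have Om[measurable]: "\<Omega> \<in> sets borel" using op by simp
  define a where "a m n = (LINT x|lborel. indicator \<Omega> x * (kern_avg (\<rho> m) (w n) x - L m x)\<^sup>2)" for m n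
  have emO: "emeasure lborel \<Omega> < \<infinity>" by (rule emeasure_bounded_finite[OF bd])
  have iO: "integrable lborel (\<lambda>x. indicator \<Omega> x * K)" for K :: real
    using emO by (intro integrable_mult_left integrable_real_indicator) auto
  have sqb: "(kern_avg (\<rho> m) (w n) x - L m x)\<^sup>2 \<le> (2 * A)\<^sup>2" for m n x
    using Kb[of m "k n" x] Lb[of m x] A0 by (intro power2_le_iff_abs_le[THEN iffD2]) (auto simp: w_def)
  have ia: "integrable lborel (\<lambda>x. indicator \<Omega> x * (kern_avg (\<rho> m) (w n) x - L m x)\<^sup>2)" for m n
    by (rule Bochner_Integration.integrable_bound[OF iO[of "(2 * A)\<^sup>2"]])
       (use sqb[of m n] in \<open>auto simp: indicator_def\<close>)
  have a0: "a m \<longlonglongrightarrow> 0" for m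
  proof -
    have "a m \<longlonglongrightarrow> (LINT x|lborel. indicator \<Omega> x * (0::real))"
      unfolding a_def
    proof (rule integral_dominated_convergence[where w="\<lambda>x. indicator \<Omega> x * (2 * A)\<^sup>2"])
      have "(\<lambda>n. indicator \<Omega> x * (kern_avg (\<rho> m) (w n) x - L m x)\<^sup>2) \<longlonglongrightarrow> indicator \<Omega> x * (L m x - L m x)\<^sup>2" for x
        by (intro tendsto_intros L)
      then show "AE x in lborel. (\<lambda>n. indicator \<Omega> x * (kern_avg (\<rho> m) (w n) x - L m x)\<^sup>2) \<longlonglongrightarrow> indicator \<Omega> x * (0::real)"
        by simp
      show "AE x in lborel. norm (indicator \<Omega> x * (kern_avg (\<rho> m) (w n) x - L m x)\<^sup>2) \<le> indicator \<Omega> x * (2 * A)\<^sup>2" for n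
        using sqb[of m n] by (auto simp: indicator_def)
    qed (use iO in measurable)
    then show ?thesis by simp
  qed
  have est: "(LINT x|M. (norm (w i x - w j x))\<^sup>2)
      \<le> 8 * B * (\<rho> m)\<^sup>2 + 8 / (kern_mass TYPE('a) (\<rho> m))\<^sup>2 * (a m i + a m j)" for m i j
  proof -
    define v where "v x = w i x + (-1) * w j x" for x
    have vt: "v \<in> test_functions \<Omega>" unfolding v_def by (intro test_add test_scale wt)
    have cv: "C1c v (\<lambda>x. gradf (w i) x + (-1) *\<^sub>R gradf (w j) x)"
      unfolding v_def by (intro C1c_add C1c_scale cw)
    have gv: "gradf v = (\<lambda>x. gradf (w i) x - gradf (w j) x)" using gradf_C1c[OF cv] by simp
    define PP where "PP = kern_mass TYPE('a) (\<rho> m)"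
    have 1: "(LINT x|lborel. (v x)\<^sup>2) \<le> 2 * (\<rho> m)\<^sup>2 * (LINT x|lborel. (norm (gradf v x))\<^sup>2)
       + 4 / PP\<^sup>2 * (LINT x|lborel. indicator \<Omega> x * (kern_avg (\<rho> m) v x)\<^sup>2)"
      unfolding PP_def by (rule kern_L2[OF test_C1c[OF vt] \<rho>(1) Om bd test_support[OF vt]])
    have "(LINT x|M. (norm (gradf v x))\<^sup>2) \<le> (LINT x|M. 2 * (norm (gradf (w i) x))\<^sup>2 + 2 * (norm (gradf (w j) x))\<^sup>2)"
      unfolding gv
      by (intro integral_mono Bochner_Integration.integrable_add integrable_mult_right square_integrable_int square_integrable_diff square_integrable_test wt norm_diff_sq_le)
    also have "\<dots> = 2 * (LINT x|M. (norm (gradf (w i) x))\<^sup>2) + 2 * (LINT x|M. (norm (gradf (w j) x))\<^sup>2)"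
      using square_integrable_int[OF square_integrable_test(2)[OF wt]] by simp
    also have "\<dots> \<le> 4 * B" using B[of "k i"] B[of "k j"] by (simp add: w_def)
    finally have 2: "(LINT x|lborel. (norm (gradf v x))\<^sup>2) \<le> 4 * B" by (simp only: test_integrals[OF vt])
    have "(LINT x|lborel. indicator \<Omega> x * (kern_avg (\<rho> m) v x)\<^sup>2)
       \<le> (LINT x|lborel. 2 * (indicator \<Omega> x * (kern_avg (\<rho> m) (w i) x - L m x)\<^sup>2)
             + 2 * (indicator \<Omega> x * (kern_avg (\<rho> m) (w j) x - L m x)\<^sup>2))"
    proof (rule integral_mono_AE')
      show "integrable lborel (\<lambda>x. 2 * (indicator \<Omega> x * (kern_avg (\<rho> m) (w i) x - L m x)\<^sup>2)
             + 2 * (indicator \<Omega> x * (kern_avg (\<rho> m) (w j) x - L m x)\<^sup>2))"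
        by (intro Bochner_Integration.integrable_add integrable_mult_right ia)
      have "(kern_avg (\<rho> m) v x)\<^sup>2 \<le> 2 * (kern_avg (\<rho> m) (w i) x - L m x)\<^sup>2 + 2 * (kern_avg (\<rho> m) (w j) x - L m x)\<^sup>2" for x
        using norm_diff_sq_le[of "kern_avg (\<rho> m) (w i) x - L m x" "kern_avg (\<rho> m) (w j) x - L m x"]
        unfolding v_def kern_avg_diff[OF cw cw] by simp
      then show "AE x in lborel. indicator \<Omega> x * (kern_avg (\<rho> m) v x)\<^sup>2 \<le> 2 * (indicator \<Omega> x * (kern_avg (\<rho> m) (w i) x - L m x)\<^sup>2)
             + 2 * (indicator \<Omega> x * (kern_avg (\<rho> m) (w j) x - L m x)\<^sup>2)"
        by (auto simp: indicator_def)
      show "AE x in lborel. 0 \<le> 2 * (indicator \<Omega> x * (kern_avg (\<rho> m) (w i) x - L m x)\<^sup>2)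
             + 2 * (indicator \<Omega> x * (kern_avg (\<rho> m) (w j) x - L m x)\<^sup>2)" by simp
    qed
    also have "\<dots> = 2 * a m i + 2 * a m j" unfolding a_def using ia by simp
    finally have 3: "(LINT x|lborel. indicator \<Omega> x * (kern_avg (\<rho> m) v x)\<^sup>2) \<le> 2 * a m i + 2 * a m j" .
    have "(LINT x|M. (norm (w i x - w j x))\<^sup>2) = (LINT x|lborel. (v x)\<^sup>2)"
      unfolding test_integrals(1)[OF vt, symmetric] by (simp add: v_def)
    also have "\<dots> \<le> 2 * (\<rho> m)\<^sup>2 * (4 * B) + 4 / PP\<^sup>2 * (2 * a m i + 2 * a m j)"
      by (rule order_trans[OF 1 add_mono[OF mult_left_mono[OF 2] mult_left_mono[OF 3]]]) auto
    also have "\<dots> = 8 * B * (\<rho> m)\<^sup>2 + 8 / PP\<^sup>2 * (a m i + a m j)"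
      by (simp add: algebra_simps add_divide_distrib)
    finally show ?thesis unfolding PP_def .
  qed
  \<comment> \<open>The scale \<open>m\<close> is fixed first, to make the gradient part smaller
    than \<open>e / 2\<close>; only then is \<open>N\<close> chosen, since the kernel mass in the
    other part degenerates with the scale.\<close>
  have "\<exists>N. \<forall>i\<ge>N. \<forall>j\<ge>N. (LINT x|M. (norm (w i x - w j x))\<^sup>2) < e" if e: "e > 0" for e
  proof -
    have "(\<lambda>m. 8 * B * (\<rho> m)\<^sup>2) \<longlonglongrightarrow> 8 * B * 0\<^sup>2"
      unfolding \<rho>_def by (intro tendsto_intros LIMSEQ_inverse_real_of_nat)
    then have "eventually (\<lambda>m. 8 * B * (\<rho> m)\<^sup>2 < e / 2) sequentially"
      by (rule order_tendstoD(2)) (use e in simp)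
    then obtain m where m: "8 * B * (\<rho> m)\<^sup>2 < e / 2" by (auto simp: eventually_sequentially)
    define PP where "PP = kern_mass TYPE('a) (\<rho> m)"
    have PP: "PP > 0" unfolding PP_def by (rule kern_mass_pos[OF \<rho>(1)])
    have "eventually (\<lambda>n. a m n < e * PP\<^sup>2 / 64) sequentially"
      by (rule order_tendstoD(2)[OF a0]) (use e PP in simp)
    then obtain N where N: "\<And>n. n \<ge> N \<Longrightarrow> a m n < e * PP\<^sup>2 / 64" by (auto simp: eventually_sequentially)
    have "(LINT x|M. (norm (w i x - w j x))\<^sup>2) < e" if "i \<ge> N" "j \<ge> N" for i j
    proof -
      have "a m i + a m j \<le> e * PP\<^sup>2 / 32" using N[OF that(1)] N[OF that(2)] by simp
      then have "8 / PP\<^sup>2 * (a m i + a m j) \<le> 8 / PP\<^sup>2 * (e * PP\<^sup>2 / 32)" by (intro mult_left_mono) auto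
      also have "\<dots> = e / 4" using PP by simp
      finally show ?thesis using est[of i j m] m e unfolding PP_def by linarith
    qed
    then show ?thesis by blast
  qed
  then have "\<forall>e>0. \<exists>N. \<forall>m\<ge>N. \<forall>n\<ge>N. (LINT x|M. (norm (\<phi> (k m) x - \<phi> (k n) x))\<^sup>2) < e"
    by (simp add: w_def)
  with k(1) show ?thesis by (intro exI[of _ k] conjI)
qed

lemma midhull_test:
  assumes "\<And>n::nat. \<psi> n \<in> test_functions \<Omega>" "v \<in> midhull \<psi> n"
  shows "v \<in> test_functions \<Omega>"
  using assms(2) by induction (auto intro!: test_add test_scale assms(1) simp del: times_divide_eq_left divide_eq_eq)

lemma midhull_L2:
  assumes p: "\<And>n::nat. \<psi> n \<in> test_functions \<Omega>" and u: "square_integrable M u"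
    and e: "\<And>k. k \<ge> n \<Longrightarrow> (LINT x|M. (norm (u x - \<psi> k x))\<^sup>2) \<le> e" and v: "v \<in> midhull \<psi> n"
  shows "(LINT x|M. (norm (u x - v x))\<^sup>2) \<le> e"
  using v
proof induction
  case (base k)
  then show ?case by (rule e)
next
  case (mid v w)
  note s = square_integrable_diff[OF u square_integrable_test(1)[OF midhull_test[OF p mid(1)]]] square_integrable_diff[OF u square_integrable_test(1)[OF midhull_test[OF p mid(2)]]]
  have "(\<lambda>x. 1/2 * v x + 1/2 * w x) \<in> test_functions \<Omega>"
    by (rule midhull_test[OF p midhull.mid[OF mid(1,2)]])
  then have "(LINT x|M. (norm (u x - (1/2 * v x + 1/2 * w x)))\<^sup>2)
      \<le> (LINT x|M. 1/2 * (norm (u x - v x))\<^sup>2 + 1/2 * (norm (u x - w x))\<^sup>2)"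
  proof (intro integral_mono Bochner_Integration.integrable_add integrable_mult_right square_integrable_int s square_integrable_diff u square_integrable_test(1))
    fix x
    have "u x - (1/2 * v x + 1/2 * w x) = 1/2 * ((u x - v x) + (u x - w x))" by (simp add: algebra_simps)
    then have "(norm (u x - (1/2 * v x + 1/2 * w x)))\<^sup>2 = (1/2 * ((u x - v x) + (u x - w x)))\<^sup>2"
      by (simp only: real_norm_def power2_abs)
    also have "\<dots> = 1/4 * (norm ((u x - v x) + (u x - w x)))\<^sup>2"
      by (simp only: real_norm_def power2_abs power_mult_distrib) (simp add: power2_eq_square)
    also have "\<dots> \<le> 1/2 * (norm (u x - v x))\<^sup>2 + 1/2 * (norm (u x - w x))\<^sup>2"
      using norm_add_sq_le[of "u x - v x" "u x - w x"] by simp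
    finally show "(norm (u x - (1/2 * v x + 1/2 * w x)))\<^sup>2 \<le> 1/2 * (norm (u x - v x))\<^sup>2 + 1/2 * (norm (u x - w x))\<^sup>2" .
  qed
  also have "\<dots> = 1/2 * (LINT x|M. (norm (u x - v x))\<^sup>2) + 1/2 * (LINT x|M. (norm (u x - w x))\<^sup>2)"
    using square_integrable_int[OF s(1)] square_integrable_int[OF s(2)] by simp
  also have "\<dots> \<le> e" using mid by simp
  finally show ?case .
qed

text \<open>The L^2 limit of a sequence with bounded gradients stays in the space. Convex
  combinations replace the sequence by one whose gradients converge strongly, while averaging does
  not spoil the convergence of the functions.\<close>

lemma midhull_limit:
  assumes p: "\<And>n::nat. \<psi> n \<in> test_functions \<Omega>" and u: "square_integrable M u"
    and B: "\<And>n. (LINT x|M. (norm (gradf (\<psi> n) x))\<^sup>2) \<le> B"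
    and l: "(\<lambda>n. LINT x|M. (norm (u x - \<psi> n x))\<^sup>2) \<longlonglongrightarrow> 0"
  shows "\<exists>g. H01_grad u g"
proof -
  define E where "E v = (LINT x|M. (norm (gradf v x))\<^sup>2)" for v
  define d where "d n = Inf (E ` midhull \<psi> n)" for n
  have E0: "E v \<ge> 0" for v by (simp add: E_def)
  have bb: "bdd_below (E ` midhull \<psi> n)" for n by (intro bdd_belowI2[of _ 0] E0)
  have ne: "midhull \<psi> n \<noteq> {}" for n using midhull.base[of n n \<psi>] by auto
  have dle: "d n \<le> E v" if "v \<in> midhull \<psi> n" for n v unfolding d_def by (rule cINF_lower[OF bb that])
  have d_mono: "d n \<le> d m" if "n \<le> m" for n m
    unfolding d_def using midhull_mono[OF _ that] by (intro cINF_superset_mono ne bb) auto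
  have dB: "d n \<le> B" for n using dle[OF midhull.base[of n n]] B[of n] by (simp add: E_def)
  have "convergent d"
  proof (rule Bseq_mono_convergent)
    have "d n \<ge> 0" for n unfolding d_def by (rule cINF_greatest[OF ne E0])
    then show "Bseq d" using dB by (intro BseqI'[of _ B]) simp
  qed (use d_mono in blast)
  then have cd: "Cauchy d" by (rule convergent_Cauchy)
  have "\<exists>v\<in>midhull \<psi> n. E v < d n + inverse (real (Suc n))" for n
    using cINF_less_iff[OF ne bb, of n "d n + inverse (real (Suc n))"] by (simp add: d_def)
  then obtain w where w: "\<And>n. w n \<in> midhull \<psi> n" "\<And>n. E (w n) < d n + inverse (real (Suc n))" by metis
  have wt: "w n \<in> test_functions \<Omega>" for n by (rule midhull_test[OF p w(1)])
  \<comment> \<open>The midpoint of \<open>w m\<close> and \<open>w n\<close> lies in the hull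
    starting at \<open>n\<close>, so its energy is at least \<open>d n\<close>; the parallelogram
    law does the rest.\<close>
  have par: "(LINT x|M. (norm (gradf (w m) x - gradf (w n) x))\<^sup>2)
      \<le> 2 * (d m - d n) + 2 * inverse (real (Suc n)) + 2 * inverse (real (Suc m))" if nm: "n \<le> m" for n m
  proof -
    have mi: "(\<lambda>x. 1/2 * w m x + 1/2 * w n x) \<in> midhull \<psi> n"
      by (rule midhull.mid[OF midhull_mono[OF w(1) nm] w(1)])
    have gm: "gradf (\<lambda>x. 1/2 * w m x + 1/2 * w n x) = (\<lambda>x. (1/2) *\<^sub>R gradf (w m) x + (1/2) *\<^sub>R gradf (w n) x)"
      by (rule gradf_C1c[OF C1c_add[OF C1c_scale[OF test_C1c[OF wt]] C1c_scale[OF test_C1c[OF wt]]]])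
    have eq: "(norm (gradf (w m) x - gradf (w n) x))\<^sup>2 = 2 * (norm (gradf (w m) x))\<^sup>2 + 2 * (norm (gradf (w n) x))\<^sup>2
        - 4 * (norm (gradf (\<lambda>x. 1/2 * w m x + 1/2 * w n x) x))\<^sup>2" for x
      unfolding gm by (simp add: power2_norm_eq_inner inner_diff inner_add inner_commute algebra_simps)
    have "(LINT x|M. (norm (gradf (w m) x - gradf (w n) x))\<^sup>2)
        = 2 * E (w m) + 2 * E (w n) - 4 * E (\<lambda>x. 1/2 * w m x + 1/2 * w n x)"
      unfolding eq E_def
      by (simp only: Bochner_Integration.integral_diff Bochner_Integration.integral_add integral_mult_right_zero
        Bochner_Integration.integrable_add integrable_mult_right square_integrable_int[OF square_integrable_test(2)[OF wt]]
        square_integrable_int[OF square_integrable_test(2)[OF midhull_test[OF p mi]]])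
    then show ?thesis using dle[OF mi] w(2)[of m] w(2)[of n] by simp
  qed
  have inv0: "(\<lambda>n. inverse (real (Suc n))) \<longlonglongrightarrow> 0" by (rule LIMSEQ_inverse_real_of_nat)
  have "\<exists>N. \<forall>m\<ge>N. \<forall>n\<ge>N. (LINT x|M. (norm (gradf (w m) x - gradf (w n) x))\<^sup>2) < e" if e: "e > 0" for e
  proof -
    obtain N1 where N1: "\<And>m n. m \<ge> N1 \<Longrightarrow> n \<ge> N1 \<Longrightarrow> norm (d m - d n) < e / 8"
      using CauchyD[OF cd, of "e / 8"] e by auto
    have "eventually (\<lambda>n. inverse (real (Suc n)) < e / 8) sequentially"
      by (rule order_tendstoD(2)[OF inv0]) (use e in simp)
    then obtain N2 where N2: "\<And>n. n \<ge> N2 \<Longrightarrow> inverse (real (Suc n)) < e / 8" by (auto simp: eventually_sequentially)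
    have *: "(LINT x|M. (norm (gradf (w m) x - gradf (w n) x))\<^sup>2) < e"
      \<comment> \<open>The estimate \<open>par\<close> is available only for ordered indices; the
        other order follows by symmetry of the norm.\<close>
      if "n \<ge> max N1 N2" "m \<ge> max N1 N2" "n \<le> m" for m n
    proof -
      have "norm (d m - d n) < e / 8" by (rule N1) (use that in auto)
      then have "d m - d n < e / 8" unfolding real_norm_def by linarith
      moreover have "inverse (real (Suc m)) < e / 8" by (rule N2) (use that in simp)
      moreover have "inverse (real (Suc n)) < e / 8" by (rule N2) (use that in simp)
      moreover have "L < e" if "a < e / 8" "b < e / 8" "c < e / 8" "L \<le> 2 * a + 2 * b + 2 * c" for a b c L :: real
        using that e by linarith
      ultimately show ?thesis using par[OF that(3)] by blast
    qed
    have "(LINT x|M. (norm (gradf (w m) x - gradf (w n) x))\<^sup>2) < e"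
      if "m \<ge> max N1 N2" "n \<ge> max N1 N2" for m n
    proof (cases "n \<le> m")
      case True
      then show ?thesis using * that by blast
    next
      case False
      then show ?thesis using *[of m n] that by (simp add: norm_minus_commute)
    qed
    then show ?thesis by blast
  qed
  then obtain g where g: "square_integrable M g" "(\<lambda>n. LINT x|M. (norm (gradf (w n) x - g x))\<^sup>2) \<longlonglongrightarrow> 0"
    using square_integrable_complete[of M "\<lambda>n. gradf (w n)", OF square_integrable_test(2)[OF wt]] by blast
  have "(\<lambda>n. LINT x|M. (norm (u x - w n x))\<^sup>2) \<longlonglongrightarrow> 0"
  proof (rule LIMSEQ_I)
    fix e :: real assume e: "e > 0"
    have "eventually (\<lambda>n. (LINT x|M. (norm (u x - \<psi> n x))\<^sup>2) < e / 2) sequentially"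
      by (rule order_tendstoD(2)[OF l]) (use e in simp)
    then obtain N where N: "\<And>n. n \<ge> N \<Longrightarrow> (LINT x|M. (norm (u x - \<psi> n x))\<^sup>2) < e / 2" by (auto simp: eventually_sequentially)
    have "norm ((LINT x|M. (norm (u x - w n x))\<^sup>2) - 0) < e" if "n \<ge> N" for n
    proof -
      have "(LINT x|M. (norm (u x - w n x))\<^sup>2) \<le> e / 2"
      proof (rule midhull_L2[OF p u _ w(1)])
        fix k assume "n \<le> k"
        then show "(LINT x|M. (norm (u x - \<psi> k x))\<^sup>2) \<le> e / 2" using N[of k] that by simp
      qed
      then show ?thesis using e by simp
    qed
    then show "\<exists>no. \<forall>n\<ge>no. norm ((LINT x|M. (norm (u x - w n x))\<^sup>2) - 0) < e" by blast
  qed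
  moreover have "(\<lambda>n. LINT x|M. (norm (g x - gradf (w n) x))\<^sup>2) \<longlonglongrightarrow> 0" using g(2) by (simp add: norm_minus_commute)
  ultimately have "H01_grad u g" unfolding H01_grad_def using u g(1) wt by blast
  then show ?thesis by blast
qed

text \<open>Both derivatives land on the test function: the right side is minus the integral of
  \<open>u\<close> against the Laplacian of \<open>\<theta>\<close>. It depends on \<open>u\<close>
  alone and is continuous in L^2.\<close>

lemma grad_inner_test:
  assumes h: "has_weak_gradient \<Omega> u g" "square_integrable M u" "square_integrable M g" and c: "\<theta> \<in> test_functions \<Omega>"
  shows "(LINT x|M. g x \<bullet> gradf \<theta> x)
    = - (\<Sum>i\<in>Basis. LINT x|M. u x \<bullet> frechet_derivative (\<lambda>y. frechet_derivative \<theta> (at y) i) (at x) i)"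
proof -
  have s: "square_integrable M (\<lambda>x. frechet_derivative \<theta> (at x) i *\<^sub>R i)" if "i \<in> Basis" for i
    using square_integrable_test(1)[OF test_partial[OF c that]] that by (auto simp: square_integrable_def)
  have "(LINT x|M. g x \<bullet> gradf \<theta> x) = (\<Sum>i\<in>Basis. LINT x|M. g x \<bullet> (frechet_derivative \<theta> (at x) i *\<^sub>R i))"
    unfolding gradf_def inner_sum_right
    by (rule Bochner_Integration.integral_sum) (rule square_integrable_inner[OF h(3) s])
  also have "\<dots> = (\<Sum>i\<in>Basis. - (LINT x|M. u x \<bullet> frechet_derivative (\<lambda>y. frechet_derivative \<theta> (at y) i) (at x) i))"
  proof (rule sum.cong[OF refl])
    fix i :: 'a assume i: "i \<in> Basis"
    have "(LINT x|M. u x * frechet_derivative (\<lambda>y. frechet_derivative \<theta> (at y) i) (at x) i)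
        = - (LINT x|M. (g x \<bullet> i) * frechet_derivative \<theta> (at x) i)"
      using h(1) test_partial[OF c i] i unfolding has_weak_gradient_def by blast
    then show "(LINT x|M. g x \<bullet> (frechet_derivative \<theta> (at x) i *\<^sub>R i))
        = - (LINT x|M. u x \<bullet> frechet_derivative (\<lambda>y. frechet_derivative \<theta> (at y) i) (at x) i)"
      by (simp add: mult.commute)
  qed
  finally show ?thesis by (simp add: sum_negf)
qed

text \<open>For \<open>h = gradf \<theta>\<close> the claim follows from
  \<open>grad_inner_test\<close> and the L^2 convergence of the functions. General gradients
  \<open>h\<close> are approximated by these, with an error controlled by the common bound
  \<open>B\<close>.\<close>

lemma weak_conv:
  assumes w: "\<And>n::nat. has_weak_gradient \<Omega> (v n) (k n)" "\<And>n. square_integrable M (v n)" "\<And>n. square_integrable M (k n)"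
    and u: "H01_grad u g" and B: "\<And>n. (LINT x|M. (norm (k n x))\<^sup>2) \<le> B"
    and l: "(\<lambda>n. LINT x|M. (norm (u x - v n x))\<^sup>2) \<longlonglongrightarrow> 0" and h: "H01_grad z h"
  shows "(\<lambda>n. LINT x|M. k n x \<bullet> h x) \<longlonglongrightarrow> (LINT x|M. g x \<bullet> h x)"
proof -
  note su = H01_grad_sqi[OF u] and sh = H01_grad_sqi[OF h]
  have t: "(\<lambda>n. LINT x|M. k n x \<bullet> gradf \<theta> x) \<longlonglongrightarrow> (LINT x|M. g x \<bullet> gradf \<theta> x)"
    if c: "\<theta> \<in> test_functions \<Omega>" for \<theta>
    unfolding grad_inner_test[OF w c] grad_inner_test[OF H01_grad_hwg[OF u] su c]
    by (intro tendsto_minus tendsto_sum square_integrable_tendsto_inner[OF w(2) su(1) _ l] square_integrable_test(1) test_partial c)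
  obtain \<theta> where c: "\<And>n. \<theta> n \<in> test_functions \<Omega>" "(\<lambda>n. LINT x|M. (norm (h x - gradf (\<theta> n) x))\<^sup>2) \<longlonglongrightarrow> 0"
    using h by (auto simp: H01_grad_def)
  define Q where "Q = sqrt B + sqrt (LINT x|M. (norm (g x))\<^sup>2)"
  have Q: "Q \<ge> 0" unfolding Q_def using order_trans[OF _ B[of 0]] by (auto intro!: add_nonneg_nonneg)
  show ?thesis
  proof (rule LIMSEQ_I)
    fix e :: real assume e: "e > 0"
    have "(\<lambda>j. sqrt (LINT x|M. (norm (h x - gradf (\<theta> j) x))\<^sup>2) * Q) \<longlonglongrightarrow> sqrt 0 * Q"
      by (intro tendsto_intros c)
    then have "eventually (\<lambda>j. sqrt (LINT x|M. (norm (h x - gradf (\<theta> j) x))\<^sup>2) * Q < e / 2) sequentially"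
      by (rule order_tendstoD(2)) (use e in simp)
    then obtain j where j: "sqrt (LINT x|M. (norm (h x - gradf (\<theta> j) x))\<^sup>2) * Q < e / 2" by (auto simp: eventually_sequentially)
    note sd = square_integrable_diff[OF sh(2) square_integrable_test(2)[OF c(1)], of j]
    obtain N where N: "\<And>n. n \<ge> N \<Longrightarrow> norm ((LINT x|M. k n x \<bullet> gradf (\<theta> j) x) - (LINT x|M. g x \<bullet> gradf (\<theta> j) x)) < e / 2"
      using LIMSEQ_D[OF t[OF c(1)], of "e / 2"] e by auto
    have "norm ((LINT x|M. k n x \<bullet> h x) - (LINT x|M. g x \<bullet> h x)) < e" if n: "n \<ge> N" for n
    proof -
      define D where "D = (LINT x|M. k n x \<bullet> gradf (\<theta> j) x) - (LINT x|M. g x \<bullet> gradf (\<theta> j) x)"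
      define a where "a = (LINT x|M. k n x \<bullet> (h x - gradf (\<theta> j) x))"
      define b where "b = (LINT x|M. g x \<bullet> (h x - gradf (\<theta> j) x))"
      have 1: "(LINT x|M. k n x \<bullet> h x) - (LINT x|M. g x \<bullet> h x) = D + a - b"
        unfolding D_def a_def b_def inner_diff_right
        by (simp add: square_integrable_inner[OF w(3) sh(2)] square_integrable_inner[OF w(3) square_integrable_test(2)[OF c(1)]]
            square_integrable_inner[OF su(2) sh(2)] square_integrable_inner[OF su(2) square_integrable_test(2)[OF c(1)]])
      have "\<bar>a\<bar> \<le> sqrt (LINT x|M. (norm (k n x))\<^sup>2) * sqrt (LINT x|M. (norm (h x - gradf (\<theta> j) x))\<^sup>2)"
        unfolding a_def by (rule square_integrable_CS[OF w(3) sd])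
      also have "\<dots> \<le> sqrt B * sqrt (LINT x|M. (norm (h x - gradf (\<theta> j) x))\<^sup>2)"
        by (intro mult_right_mono real_sqrt_le_mono B) simp
      finally have 2: "\<bar>a\<bar> \<le> sqrt B * sqrt (LINT x|M. (norm (h x - gradf (\<theta> j) x))\<^sup>2)" .
      have 3: "\<bar>b\<bar> \<le> sqrt (LINT x|M. (norm (g x))\<^sup>2) * sqrt (LINT x|M. (norm (h x - gradf (\<theta> j) x))\<^sup>2)"
        unfolding b_def by (rule square_integrable_CS[OF su(2) sd])
      have "\<bar>a\<bar> + \<bar>b\<bar> < e / 2" using 2 3 j unfolding Q_def by (simp add: algebra_simps)
      moreover have "\<bar>D\<bar> < e / 2" using N[OF n] by (simp add: D_def)
      ultimately show ?thesis unfolding 1 real_norm_def by linarith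
    qed
    then show "\<exists>no. \<forall>n\<ge>no. norm ((LINT x|M. k n x \<bullet> h x) - (LINT x|M. g x \<bullet> h x)) < e" by blast
  qed
qed

text \<open>Each \<open>u n\<close> is replaced by a test function within
  \<open>inverse (real (Suc n))\<close> of it, the Rellich theorem is applied to these, and the
  limit is carried back. A further subsequence gives convergence almost everywhere.\<close>

lemma weak_compactness:
  assumes u: "\<And>n::nat. H01_grad (u n) (g n)" and B: "\<And>n. (LINT x|M. (norm (g n x))\<^sup>2) \<le> B"
  shows "\<exists>r v h. strict_mono r \<and> H01_grad v h \<and> (AE x in M. (\<lambda>n. u (r n) x) \<longlonglongrightarrow> v x) \<and>
     (\<forall>z k. H01_grad z k \<longrightarrow> (\<lambda>n. LINT x|M. g (r n) x \<bullet> k x) \<longlonglongrightarrow> (LINT x|M. h x \<bullet> k x))"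
proof -
  define iv where "iv n = inverse (real (Suc n))" for n
  have iv: "iv \<longlonglongrightarrow> 0" "\<And>n. iv n > 0" "\<And>n. iv n \<le> 1"
    unfolding iv_def[abs_def] by (rule LIMSEQ_inverse_real_of_nat) (auto simp: field_simps)
  have "\<exists>\<phi>\<in>test_functions \<Omega>. (LINT x|M. (norm (u n x - \<phi> x))\<^sup>2) < iv n \<and> (LINT x|M. (norm (g n x - gradf \<phi> x))\<^sup>2) < iv n" for n
  proof -
    obtain \<phi> where p: "\<And>j. \<phi> j \<in> test_functions \<Omega>" "(\<lambda>j. LINT x|M. (norm (u n x - \<phi> j x))\<^sup>2) \<longlonglongrightarrow> 0"
     "(\<lambda>j. LINT x|M. (norm (g n x - gradf (\<phi> j) x))\<^sup>2) \<longlonglongrightarrow> 0" using u[of n] by (auto simp: H01_grad_def)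
    have "eventually (\<lambda>j. (LINT x|M. (norm (u n x - \<phi> j x))\<^sup>2) < iv n \<and> (LINT x|M. (norm (g n x - gradf (\<phi> j) x))\<^sup>2) < iv n) sequentially"
      by (intro eventually_conj order_tendstoD(2)[OF p(2)] order_tendstoD(2)[OF p(3)] iv)
    then show ?thesis using p(1) by (auto simp: eventually_sequentially)
  qed
  then have "\<forall>n. \<exists>\<phi>. \<phi> \<in> test_functions \<Omega> \<and> (LINT x|M. (norm (u n x - \<phi> x))\<^sup>2) < iv n \<and> (LINT x|M. (norm (g n x - gradf \<phi> x))\<^sup>2) < iv n"
    by blast
  from choice[OF this] obtain \<phi> where p: "\<And>n. \<phi> n \<in> test_functions \<Omega>" "\<And>n. (LINT x|M. (norm (u n x - \<phi> n x))\<^sup>2) < iv n"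
     "\<And>n. (LINT x|M. (norm (g n x - gradf (\<phi> n) x))\<^sup>2) < iv n" by blast
  note su = H01_grad_sqi(1)[OF u] and sg = H01_grad_sqi(2)[OF u]
  have Bp: "(LINT x|M. (norm (gradf (\<phi> n) x))\<^sup>2) \<le> 2 * B + 2" for n
  proof -
    have "(LINT x|M. (norm (gradf (\<phi> n) x))\<^sup>2) \<le> (LINT x|M. 2 * (norm (g n x))\<^sup>2 + 2 * (norm (g n x - gradf (\<phi> n) x))\<^sup>2)"
    proof (intro integral_mono Bochner_Integration.integrable_add integrable_mult_right square_integrable_int square_integrable_diff sg square_integrable_test(2) p(1))
      fix x show "(norm (gradf (\<phi> n) x))\<^sup>2 \<le> 2 * (norm (g n x))\<^sup>2 + 2 * (norm (g n x - gradf (\<phi> n) x))\<^sup>2"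
        using norm_diff_sq_le[of "g n x" "g n x - gradf (\<phi> n) x"] by simp
    qed
    also have "\<dots> = 2 * (LINT x|M. (norm (g n x))\<^sup>2) + 2 * (LINT x|M. (norm (g n x - gradf (\<phi> n) x))\<^sup>2)"
      using square_integrable_int[OF sg] square_integrable_int[OF square_integrable_diff[OF sg square_integrable_test(2)[OF p(1)]]] by simp
    also have "\<dots> \<le> 2 * B + 2" using B[of n] p(3)[of n] iv(3)[of n] by simp
    finally show ?thesis .
  qed
  obtain r :: "nat \<Rightarrow> nat" where r: "strict_mono r"
    "\<forall>e>0. \<exists>N. \<forall>m\<ge>N. \<forall>n\<ge>N. (LINT x|M. (norm (\<phi> (r m) x - \<phi> (r n) x))\<^sup>2) < e"
    using rellich_test[of \<phi>, OF p(1) Bp] by blast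
  have "\<exists>v. square_integrable M v \<and> (\<lambda>n. LINT x|M. (norm (\<phi> (r n) x - v x))\<^sup>2) \<longlonglongrightarrow> 0"
    using r(2) by (intro square_integrable_complete square_integrable_test(1) p(1)) blast
  then obtain v where v: "square_integrable M v" "(\<lambda>n. LINT x|M. (norm (\<phi> (r n) x - v x))\<^sup>2) \<longlonglongrightarrow> 0" by blast
  have v': "(\<lambda>n. LINT x|M. (norm (v x - \<phi> (r n) x))\<^sup>2) \<longlonglongrightarrow> 0" using v(2) by (simp add: power2_commute)
  obtain h where h: "H01_grad v h" using midhull_limit[OF p(1) v(1) Bp v'] by blast
  have iv_r: "(\<lambda>n. iv (r n)) \<longlonglongrightarrow> 0" using LIMSEQ_subseq_LIMSEQ[OF iv(1) r(1)] by (simp add: comp_def)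
  have d: "(\<lambda>n. LINT x|M. (norm (\<phi> (r n) x - u (r n) x))\<^sup>2) \<longlonglongrightarrow> 0"
  proof (rule Lim_null_comparison[OF _ iv_r], intro always_eventually allI)
    fix n show "norm (LINT x|M. (norm (\<phi> (r n) x - u (r n) x))\<^sup>2) \<le> iv (r n)"
      using p(2)[of "r n"] by (simp add: power2_commute)
  qed
  have uv: "(\<lambda>n. LINT x|M. (norm (v x - u (r n) x))\<^sup>2) \<longlonglongrightarrow> 0"
  proof (rule Lim_null_comparison)
    have "(LINT x|M. (norm (v x - u (r n) x))\<^sup>2)
      \<le> 2 * (LINT x|M. (norm (v x - \<phi> (r n) x))\<^sup>2) + 2 * (LINT x|M. (norm (\<phi> (r n) x - u (r n) x))\<^sup>2)" for n
    proof -
      note s1 = square_integrable_diff[OF v(1) square_integrable_test(1)[OF p(1)], of "r n"] and s2 = square_integrable_diff[OF square_integrable_test(1)[OF p(1)] su, of "r n" "r n"]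
      have "(LINT x|M. (norm (v x - u (r n) x))\<^sup>2)
        \<le> (LINT x|M. 2 * (norm (v x - \<phi> (r n) x))\<^sup>2 + 2 * (norm (\<phi> (r n) x - u (r n) x))\<^sup>2)"
      proof (intro integral_mono Bochner_Integration.integrable_add integrable_mult_right square_integrable_int s1 s2)
        show "square_integrable M (\<lambda>x. v x - u (r n) x)" by (rule square_integrable_diff[OF v(1) su])
        fix x show "(norm (v x - u (r n) x))\<^sup>2 \<le> 2 * (norm (v x - \<phi> (r n) x))\<^sup>2 + 2 * (norm (\<phi> (r n) x - u (r n) x))\<^sup>2"
          using norm_add_sq_le[of "v x - \<phi> (r n) x" "\<phi> (r n) x - u (r n) x"] by simp
      qed
      then show ?thesis using square_integrable_int[OF s1] square_integrable_int[OF s2] by simp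
    qed
    then show "eventually (\<lambda>n. norm (LINT x|M. (norm (v x - u (r n) x))\<^sup>2)
      \<le> 2 * (LINT x|M. (norm (v x - \<phi> (r n) x))\<^sup>2) + 2 * (LINT x|M. (norm (\<phi> (r n) x - u (r n) x))\<^sup>2)) sequentially"
      by (intro always_eventually) simp
    have "(\<lambda>n. 2 * (LINT x|M. (norm (v x - \<phi> (r n) x))\<^sup>2) + 2 * (LINT x|M. (norm (\<phi> (r n) x - u (r n) x))\<^sup>2)) \<longlonglongrightarrow> 2 * 0 + 2 * 0"
      by (intro tendsto_intros v' d)
    then show "(\<lambda>n. 2 * (LINT x|M. (norm (v x - \<phi> (r n) x))\<^sup>2) + 2 * (LINT x|M. (norm (\<phi> (r n) x - u (r n) x))\<^sup>2)) \<longlonglongrightarrow> 0" by simp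
  qed
  have "(\<lambda>n. LINT x|M. (norm (u (r n) x - v x))\<^sup>2) \<longlonglongrightarrow> 0" using uv by (simp add: power2_commute)
  then obtain s where s: "strict_mono s" "AE x in M. (\<lambda>n. u (r (s n)) x) \<longlonglongrightarrow> v x"
    using square_integrable_AE_subseq[of M "\<lambda>n. u (r n)" v] su v(1) by blast
  have uvs: "(\<lambda>n. LINT x|M. (norm (v x - u (r (s n)) x))\<^sup>2) \<longlonglongrightarrow> 0"
    using LIMSEQ_subseq_LIMSEQ[OF uv s(1)] by (simp add: comp_def)
  have "(\<lambda>n. LINT x|M. g (r (s n)) x \<bullet> k x) \<longlonglongrightarrow> (LINT x|M. h x \<bullet> k x)" if k: "H01_grad z k" for z k
    by (rule weak_conv[OF H01_grad_hwg[OF u] su sg h B uvs k])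
  then show ?thesis
    using strict_mono_o[OF r(1) s(1)] s(2) h by (intro exI[of _ "r \<circ> s"] exI[of _ v] exI[of _ h]) (auto simp: comp_def)
qed

end

section \<open>Nemytskii operators and the Brezis--Lieb splitting\<close>

text \<open>The device of Brezis and Lieb: the part of \<open>\<bar>G n\<bar>\<close> above
  \<open>e * \<bar>v n\<bar> powr q\<close> is dominated by a fixed function, and what lies below it
  has integral at most \<open>e * K\<close>. No convergence of \<open>v n\<close> in the critical
  norm is required.\<close>

lemma dominated_up_to_epsilon:
  fixes G v :: "nat \<Rightarrow> 'a \<Rightarrow> real"
  assumes G[measurable]: "\<And>n. G n \<in> borel_measurable M" and v: "\<And>n. integrable M (\<lambda>x. \<bar>v n x\<bar> powr q)"
    and K: "\<And>n. (LINT x|M. \<bar>v n x\<bar> powr q) \<le> K"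
    and lim: "AE x in M. (\<lambda>n. G n x) \<longlonglongrightarrow> 0"
    and dom: "\<And>e. e > 0 \<Longrightarrow> \<exists>H. integrable M H \<and> (\<forall>n. AE x in M. \<bar>G n x\<bar> \<le> e * \<bar>v n x\<bar> powr q + H x)"
  shows "integrable M (G n)" "(\<lambda>n. LINT x|M. \<bar>G n x\<bar>) \<longlonglongrightarrow> 0"
proof -
  show iG: "integrable M (G n)" for n
  proof -
    obtain H where H: "integrable M H" "AE x in M. \<bar>G n x\<bar> \<le> 1 * \<bar>v n x\<bar> powr q + H x"
      using dom[of 1] by auto
    show ?thesis
      by (rule Bochner_Integration.integrable_bound[OF Bochner_Integration.integrable_add[OF v[of n] H(1)]])
         (use H(2) in \<open>auto elim!: eventually_mono\<close>)
  qed
  have K0: "K \<ge> 0" using K[of 0] by (rule order_trans[rotated]) simp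
  show "(\<lambda>n. LINT x|M. \<bar>G n x\<bar>) \<longlonglongrightarrow> 0"
  proof (rule LIMSEQ_I)
    fix e :: real assume e: "e > 0"
    \<comment> \<open>\<open>d * (K + 1)\<close> is \<open>e / 2\<close>; the other half goes to the
      dominated part \<open>W\<close>.\<close>
    define d where "d = e / (2 * (K + 1))"
    have d: "d > 0" using e K0 by (simp add: d_def)
    obtain H where H: "integrable M H" "\<And>n. AE x in M. \<bar>G n x\<bar> \<le> d * \<bar>v n x\<bar> powr q + H x"
      using dom[OF d] by auto
    define W where "W n x = max 0 (\<bar>G n x\<bar> - d * \<bar>v n x\<bar> powr q)" for n x
    have [measurable]: "(\<lambda>x. \<bar>v n x\<bar> powr q) \<in> borel_measurable M" for n
      using v by (rule borel_measurable_integrable)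
    have [measurable]: "W n \<in> borel_measurable M" for n unfolding W_def by measurable
    have WH: "AE x in M. norm (W n x) \<le> norm (H x)" for n
      using H(2)[of n] by eventually_elim (auto simp: W_def)
    have "(\<lambda>n. LINT x|M. W n x) \<longlonglongrightarrow> (LINT x|M. 0)"
    proof (rule integral_dominated_convergence[where w="\<lambda>x. norm (H x)"])
      show "AE x in M. (\<lambda>n. W n x) \<longlonglongrightarrow> 0"
        using lim
      proof eventually_elim
        case (elim x)
        show ?case
        proof (rule Lim_null_comparison)
          show "eventually (\<lambda>n. norm (W n x) \<le> \<bar>G n x\<bar>) sequentially"
            using d by (auto simp: W_def intro!: always_eventually)
          show "(\<lambda>n. \<bar>G n x\<bar>) \<longlonglongrightarrow> 0" using elim by (rule tendsto_rabs_zero)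
        qed
      qed
    qed (use H(1) WH in auto)
    then obtain N where N: "\<And>n. n \<ge> N \<Longrightarrow> norm ((LINT x|M. W n x) - (LINT x|M. 0)) < e / 2"
      using LIMSEQ_D[of _ _ "e / 2"] e by (metis half_gt_zero)
    have "norm ((LINT x|M. \<bar>G n x\<bar>) - 0) < e" if n: "n \<ge> N" for n
    proof -
      have iW: "integrable M (W n)"
        by (rule Bochner_Integration.integrable_bound[OF H(1)]) (use WH in auto)
      have "(LINT x|M. \<bar>G n x\<bar>) \<le> (LINT x|M. d * \<bar>v n x\<bar> powr q + W n x)"
        by (intro integral_mono integrable_abs iG Bochner_Integration.integrable_add integrable_mult_right v iW)
           (auto simp: W_def)
      also have "\<dots> = d * (LINT x|M. \<bar>v n x\<bar> powr q) + (LINT x|M. W n x)" using v iW by simp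
      also have "\<dots> < d * (K + 1) + e / 2"
      proof (rule add_le_less_mono)
        show "d * (LINT x|M. \<bar>v n x\<bar> powr q) \<le> d * (K + 1)" using K[of n] d by (intro mult_left_mono) auto
        show "(LINT x|M. W n x) < e / 2" using N[OF n] by simp
      qed
      also have "d * (K + 1) = e / 2" using K0 by (simp add: d_def field_simps)
      finally show ?thesis by simp
    qed
    then show "\<exists>no. \<forall>n\<ge>no. norm ((LINT x|M. \<bar>G n x\<bar>) - 0) < e" by blast
  qed
qed

section \<open>Elementary inequalities for powers\<close>

lemma abs_powr_tendsto_0: "r > 0 \<Longrightarrow> ((\<lambda>h::real. \<bar>h\<bar> powr r) \<longlongrightarrow> 0) (at 0)"
proof -
  assume "r > 0"
  then have "((\<lambda>h::real. \<bar>h\<bar> powr r) \<longlongrightarrow> \<bar>0\<bar> powr r) (at 0)"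
    by (intro tendsto_powr2 tendsto_rabs tendsto_ident_at tendsto_const) auto
  then show ?thesis by simp
qed

lemma DERIV_powr_mult:
  fixes s q :: real
  assumes q: "q > 2"
  shows "((\<lambda>s. \<bar>s\<bar> powr (q - 2) * s) has_real_derivative (q - 1) * \<bar>s\<bar> powr (q - 2)) (at s)"
proof -
  consider "s > 0" | "s < 0" | "s = 0" by linarith
  then show ?thesis
  proof cases
    case 1
    have "((\<lambda>s. s powr (q - 1)) has_real_derivative (q - 1) * s powr (q - 1 - 1)) (at s)"
      using 1 by (rule has_real_derivative_powr)
    then have "((\<lambda>s. s powr (q - 1)) has_real_derivative (q - 1) * \<bar>s\<bar> powr (q - 2)) (at s)" using 1 by simp
    then show ?thesis
    proof (rule has_field_derivative_transform_within_open[where S="{0<..}"])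
      fix x :: real assume "x \<in> {0<..}"
      then show "x powr (q - 1) = \<bar>x\<bar> powr (q - 2) * x" using powr_add[of x "q - 2" 1] by simp
    qed (use 1 in auto)
  next
    case 2
    have "((\<lambda>s. - ((- s) powr (q - 1))) has_real_derivative (q - 1) * \<bar>s\<bar> powr (q - 2)) (at s)"
      using 2 by (auto intro!: derivative_eq_intros DERIV_chain2[OF has_real_derivative_powr])
    then show ?thesis
    proof (rule has_field_derivative_transform_within_open[where S="{..<0}"])
      fix x :: real assume "x \<in> {..<0}"
      then show "- ((- x) powr (q - 1)) = \<bar>x\<bar> powr (q - 2) * x" using powr_add[of "- x" "q - 2" 1] by simp
    qed (use 2 in auto)
  next
    case 3
    have "(\<lambda>h. (\<bar>0 + h\<bar> powr (q - 2) * (0 + h) - \<bar>0\<bar> powr (q - 2) * 0) / h) = (\<lambda>h::real. if h = 0 then 0 else \<bar>h\<bar> powr (q - 2))"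
      by auto
    moreover have "((\<lambda>h::real. if h = 0 then 0 else \<bar>h\<bar> powr (q - 2)) \<longlongrightarrow> 0) (at 0)"
      using abs_powr_tendsto_0[of "q - 2"] q
      by (rule_tac Lim_transform_eventually[where f="\<lambda>h. \<bar>h\<bar> powr (q - 2)"]) (auto simp: eventually_at_filter)
    ultimately show ?thesis using 3 by (simp add: DERIV_def)
  qed
qed

lemma DERIV_abs_powr:
  fixes s q :: real
  assumes q: "q > 2"
  shows "((\<lambda>s. \<bar>s\<bar> powr q) has_real_derivative q * (\<bar>s\<bar> powr (q - 2) * s)) (at s)"
proof -
  have eq: "\<bar>s\<bar> powr q = (\<bar>s\<bar> powr (q - 2) * s) * s" for s :: real
  proof (cases "s = 0")
    case False
    then have "\<bar>s\<bar> powr q = \<bar>s\<bar> powr (q - 2) * \<bar>s\<bar> powr 2" by (simp add: powr_add[symmetric] del: powr_numeral)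
    also have "\<bar>s\<bar> powr 2 = s * s" using False by (simp add: powr_numeral power2_eq_square)
    finally show ?thesis by simp
  qed simp
  have "((\<lambda>s. (\<bar>s\<bar> powr (q - 2) * s) * s) has_real_derivative
      (q - 1) * \<bar>s\<bar> powr (q - 2) * s + 1 * (\<bar>s\<bar> powr (q - 2) * s)) (at s)"
    by (rule DERIV_mult[OF DERIV_powr_mult[OF q] DERIV_ident])
  then show ?thesis unfolding eq by (rule DERIV_cong) (simp add: algebra_simps)
qed

text \<open>Applied to the unit interval along the segment, so that the sign of \<open>h\<close> and
  the case \<open>h = 0\<close> need no distinction.\<close>

lemma mvt_between:
  fixes F F' :: "real \<Rightarrow> real"
  assumes "\<And>s. (F has_real_derivative F' s) (at s)"
  shows "\<exists>\<theta>. 0 \<le> \<theta> \<and> \<theta> \<le> 1 \<and> F (v + h) - F v = F' (v + \<theta> * h) * h"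
proof -
  have "\<exists>z>0. z < (1::real) \<and> F (v + 1 * h) - F (v + 0 * h) = (1 - 0) * (F' (v + z * h) * h)"
    by (rule MVT2) (auto intro!: derivative_eq_intros DERIV_chain2[OF assms])
  then show ?thesis by (metis less_imp_le mult_1 mult_zero_left diff_zero add_0_right)
qed

lemma abs_add_theta: "0 \<le> \<theta> \<Longrightarrow> \<theta> \<le> 1 \<Longrightarrow> \<bar>v + \<theta> * h\<bar> \<le> \<bar>v\<bar> + \<bar>h\<bar>" for v h \<theta> :: real
proof -
  assume "0 \<le> \<theta>" "\<theta> \<le> 1"
  then have "\<bar>\<theta> * h\<bar> \<le> 1 * \<bar>h\<bar>" unfolding abs_mult by (intro mult_right_mono) auto
  then show ?thesis by linarith
qed

lemma powr_add_le: "0 \<le> x \<Longrightarrow> 0 \<le> y \<Longrightarrow> 0 \<le> q \<Longrightarrow> (x + y) powr q \<le> 2 powr q * (x powr q + y powr q)" for x y q :: real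
proof -
  assume x: "0 \<le> x" "0 \<le> y" "0 \<le> q"
  have "(x + y) powr q \<le> (2 * max x y) powr q" using x by (intro powr_mono2) auto
  also have "\<dots> = 2 powr q * max x y powr q" by (rule powr_mult)
  also have "\<dots> \<le> 2 powr q * (x powr q + y powr q)" using x by (intro mult_left_mono) (auto simp: max_def)
  finally show ?thesis .
qed

lemma mult_powr_le: "0 \<le> x \<Longrightarrow> x \<le> s \<Longrightarrow> x * s powr (q - 1) \<le> s powr q" for x s q :: real
proof -
  assume x: "0 \<le> x" "x \<le> s"
  show ?thesis
  proof (cases "s = 0")
    case False
    then have s: "s > 0" using x by simp
    have "x * s powr (q - 1) \<le> s * s powr (q - 1)" using x s by (intro mult_right_mono) auto
    also have "\<dots> = s powr q" using powr_add[of s 1 "q - 1"] s by simp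
    finally show ?thesis .
  qed (use x in auto)
qed

lemma powr_difference_bound:
  fixes u v q :: real
  assumes q: "q > 2"
  shows "\<bar>\<bar>v + u\<bar> powr q - \<bar>v\<bar> powr q\<bar> \<le> q * ((\<bar>v\<bar> + \<bar>u\<bar>) powr (q - 1) * \<bar>u\<bar>)"
proof -
  obtain t where t: "0 \<le> t" "t \<le> 1" "\<bar>v + u\<bar> powr q - \<bar>v\<bar> powr q = q * (\<bar>v + t * u\<bar> powr (q - 2) * (v + t * u)) * u"
    using mvt_between[OF DERIV_abs_powr[OF q], of v u] by auto
  have "\<bar>\<bar>v + t * u\<bar> powr (q - 2) * (v + t * u)\<bar> = \<bar>v + t * u\<bar> * \<bar>v + t * u\<bar> powr ((q - 1) - 1)"
    by (simp add: abs_mult)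
  also have "\<dots> \<le> \<bar>v + t * u\<bar> powr (q - 1)" by (rule mult_powr_le) auto
  also have "\<dots> \<le> (\<bar>v\<bar> + \<bar>u\<bar>) powr (q - 1)" using abs_add_theta[OF t(1,2)] q by (intro powr_mono2) auto
  finally have "\<bar>\<bar>v + t * u\<bar> powr (q - 2) * (v + t * u)\<bar> * \<bar>u\<bar> \<le> (\<bar>v\<bar> + \<bar>u\<bar>) powr (q - 1) * \<bar>u\<bar>"
    by (rule mult_right_mono) simp
  then show ?thesis unfolding t(3) using q by (simp add: abs_mult mult.assoc)
qed

text \<open>Where \<open>\<bar>v\<bar>\<close> is much larger than \<open>\<bar>u\<bar>\<close>, the
  mean value bound contains a factor \<open>\<bar>u\<bar> \<le> \<bar>v\<bar> / T\<close> and is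
  small against \<open>\<bar>v\<bar> powr q\<close>. Elsewhere everything is bounded by a power of
  \<open>\<bar>u\<bar>\<close>.\<close>

lemma brezis_lieb_pointwise:
  fixes q e :: real
  assumes q: "q > 2" and e: "e > 0"
  shows "\<exists>C\<ge>0. \<forall>u v. \<bar>\<bar>v + u\<bar> powr q - \<bar>v\<bar> powr q - \<bar>u\<bar> powr q\<bar> \<le> e * \<bar>v\<bar> powr q + C * \<bar>u\<bar> powr q"
proof -
  \<comment> \<open>Chosen so that the factor \<open>q * 2 powr q / T\<close> of the first case is
    at most \<open>e\<close>.\<close>
  define T where "T = max 1 (q * 2 powr q / e)"
  have T: "T \<ge> 1" "q * 2 powr q / e \<le> T" by (auto simp: T_def)
  have Te: "q * 2 powr q / T \<le> e" using T e by (simp add: field_simps)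
  define C where "C = q * (T + 1) powr q + 1"
  have C: "C \<ge> 0" using q by (simp add: C_def)
  have "\<bar>\<bar>v + u\<bar> powr q - \<bar>v\<bar> powr q - \<bar>u\<bar> powr q\<bar> \<le> e * \<bar>v\<bar> powr q + C * \<bar>u\<bar> powr q" for u v
  proof -
    have 1: "\<bar>\<bar>v + u\<bar> powr q - \<bar>v\<bar> powr q - \<bar>u\<bar> powr q\<bar> \<le> q * ((\<bar>v\<bar> + \<bar>u\<bar>) powr (q - 1) * \<bar>u\<bar>) + \<bar>u\<bar> powr q"
      using powr_difference_bound[OF q, of v u] powr_ge_zero[of "\<bar>u\<bar>" q] by linarith
    have 2: "q * ((\<bar>v\<bar> + \<bar>u\<bar>) powr (q - 1) * \<bar>u\<bar>) \<le> e * \<bar>v\<bar> powr q + q * (T + 1) powr q * \<bar>u\<bar> powr q"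
    proof (cases "\<bar>v\<bar> \<ge> T * \<bar>u\<bar>")
      case True
      have u: "\<bar>u\<bar> \<le> \<bar>v\<bar> / T" using True T by (simp add: field_simps)
      also have "\<dots> \<le> \<bar>v\<bar>"
        using mult_right_mono[OF T(1), of "\<bar>v\<bar>"] T by (simp add: field_simps)
      finally have uv: "\<bar>u\<bar> \<le> \<bar>v\<bar>" .
      have "(\<bar>v\<bar> + \<bar>u\<bar>) powr (q - 1) * \<bar>u\<bar> \<le> (2 * \<bar>v\<bar>) powr (q - 1) * (\<bar>v\<bar> / T)"
        using uv u q by (intro mult_mono powr_mono2) auto
      also have "\<dots> = (\<bar>v\<bar> * (2 * \<bar>v\<bar>) powr (q - 1)) / T" by simp
      also have "\<dots> \<le> (2 * \<bar>v\<bar>) powr q / T" using T by (intro divide_right_mono mult_powr_le) auto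
      also have "\<dots> = 2 powr q / T * \<bar>v\<bar> powr q" by (simp add: powr_mult)
      finally have "q * ((\<bar>v\<bar> + \<bar>u\<bar>) powr (q - 1) * \<bar>u\<bar>) \<le> q * (2 powr q / T * \<bar>v\<bar> powr q)"
        using q by (intro mult_left_mono) auto
      also have "\<dots> = (q * 2 powr q / T) * \<bar>v\<bar> powr q" by simp
      also have "\<dots> \<le> e * \<bar>v\<bar> powr q" using Te by (intro mult_right_mono) auto
      also have "\<dots> \<le> e * \<bar>v\<bar> powr q + q * (T + 1) powr q * \<bar>u\<bar> powr q" using q by simp
      finally show ?thesis .
    next
      case False
      have "(\<bar>v\<bar> + \<bar>u\<bar>) powr (q - 1) * \<bar>u\<bar> \<le> ((T + 1) * \<bar>u\<bar>) powr (q - 1) * ((T + 1) * \<bar>u\<bar>)"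
        using False T q by (intro mult_mono powr_mono2) (auto simp: algebra_simps)
      also have "\<dots> \<le> ((T + 1) * \<bar>u\<bar>) powr q"
        using mult_powr_le[of "(T + 1) * \<bar>u\<bar>" "(T + 1) * \<bar>u\<bar>" q] T by (simp add: mult.commute)
      also have "\<dots> = (T + 1) powr q * \<bar>u\<bar> powr q" by (rule powr_mult)
      finally have "q * ((\<bar>v\<bar> + \<bar>u\<bar>) powr (q - 1) * \<bar>u\<bar>) \<le> q * ((T + 1) powr q * \<bar>u\<bar> powr q)"
        using q by (intro mult_left_mono) auto
      also have "\<dots> \<le> e * \<bar>v\<bar> powr q + q * (T + 1) powr q * \<bar>u\<bar> powr q" using e by simp
      finally show ?thesis .
    qed
    show ?thesis using 1 2 by (simp add: C_def algebra_simps)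
  qed
  with C show ?thesis by blast
qed

text \<open>The increment is written as \<open>t * k\<close> because \<open>k\<close> will have norm
  1 and \<open>t\<close> will be the norm of the increment. The integrated remainder is then of
  order \<open>t\<^sup>2\<close> with a constant that does not depend on the direction.\<close>

lemma powr_taylor:
  fixes u k t q :: real
  assumes q: "q > 2" and t: "0 \<le> t" "t \<le> 1"
  shows "\<bar>\<bar>u + t * k\<bar> powr q - \<bar>u\<bar> powr q - q * (\<bar>u\<bar> powr (q - 2) * u) * (t * k)\<bar>
      \<le> q * (q - 1) * t\<^sup>2 * (2 powr q * (\<bar>u\<bar> powr q + \<bar>k\<bar> powr q))"
proof -
  define s where "s = \<bar>u\<bar> + \<bar>k\<bar>"
  obtain a where a: "0 \<le> a" "a \<le> 1"
    "\<bar>u + t * k\<bar> powr q - \<bar>u\<bar> powr q = q * (\<bar>u + a * (t * k)\<bar> powr (q - 2) * (u + a * (t * k))) * (t * k)"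
    using mvt_between[OF DERIV_abs_powr[OF q], of u "t * k"] by auto
  obtain c where c: "0 \<le> c" "c \<le> 1"
    "\<bar>u + a * (t * k)\<bar> powr (q - 2) * (u + a * (t * k)) - \<bar>u\<bar> powr (q - 2) * u
      = (q - 1) * \<bar>u + c * (a * (t * k))\<bar> powr (q - 2) * (a * (t * k))"
    using mvt_between[OF DERIV_powr_mult[OF q], of u "a * (t * k)"] by auto
  have cat: "0 \<le> c * a * t" "c * a * t \<le> 1" using a c t by (auto intro!: mult_nonneg_nonneg mult_le_one)
  have s: "\<bar>u + c * (a * (t * k))\<bar> \<le> s" using abs_add_theta[OF cat, of u k] by (simp add: s_def mult.assoc)
  have "\<bar>u + t * k\<bar> powr q - \<bar>u\<bar> powr q - q * (\<bar>u\<bar> powr (q - 2) * u) * (t * k)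
     = q * (\<bar>u + a * (t * k)\<bar> powr (q - 2) * (u + a * (t * k)) - \<bar>u\<bar> powr (q - 2) * u) * (t * k)"
    unfolding a(3) by (simp add: algebra_simps)
  also have "\<dots> = q * (q - 1) * t\<^sup>2 * (a * (\<bar>u + c * (a * (t * k))\<bar> powr (q - 2) * k\<^sup>2))"
    unfolding c(3) by (simp add: power2_eq_square)
  finally have "\<bar>\<bar>u + t * k\<bar> powr q - \<bar>u\<bar> powr q - q * (\<bar>u\<bar> powr (q - 2) * u) * (t * k)\<bar>
     = q * (q - 1) * t\<^sup>2 * (a * (\<bar>u + c * (a * (t * k))\<bar> powr (q - 2) * k\<^sup>2))"
    using q a by (simp add: abs_mult)
  also have "\<dots> \<le> q * (q - 1) * t\<^sup>2 * (1 * (s powr (q - 2) * s\<^sup>2))"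
  proof (intro mult_left_mono mult_mono)
    show "\<bar>u + c * (a * (t * k))\<bar> powr (q - 2) \<le> s powr (q - 2)" using s q by (intro powr_mono2) auto
    show "k\<^sup>2 \<le> s\<^sup>2" unfolding s_def by (intro power2_le_iff_abs_le[THEN iffD2]) auto
  qed (use q a in auto)
  also have "s powr (q - 2) * s\<^sup>2 = s powr q"
  proof (cases "s = 0")
    case False
    then have "s > 0" unfolding s_def by linarith
    then have "s powr (q - 2) * s powr 2 = s powr q" by (simp add: powr_add[symmetric] del: powr_numeral)
    then show ?thesis using \<open>s > 0\<close> by (simp add: powr_numeral)
  qed (use q in simp)
  also have "q * (q - 1) * t\<^sup>2 * (1 * s powr q) \<le> q * (q - 1) * t\<^sup>2 * (2 powr q * (\<bar>u\<bar> powr q + \<bar>k\<bar> powr q))"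
    unfolding s_def using powr_add_le[of "\<bar>u\<bar>" "\<bar>k\<bar>" q] q by (intro mult_left_mono) auto
  finally show ?thesis .
qed

text \<open>Beyond the level \<open>T\<close> the factor \<open>e * s powr (q - p)\<close> exceeds
  \<open>2 * c\<close>; below it the left side is bounded by its value at \<open>T\<close>.\<close>

lemma subcritical:
  fixes c p q e :: real
  assumes c: "c > 0" and p: "1 < p" "p < q" and e: "e > 0"
  shows "\<exists>C\<ge>0. \<forall>s\<ge>0. c * (1 + s powr (p - 1)) \<le> e * s powr (q - 1) + C"
proof -
  define T where "T = max 1 ((2 * c / e) powr (1 / (q - p)))"
  have T: "T \<ge> 1" by (simp add: T_def)
  have Tq: "2 * c \<le> e * s powr (q - p)" if "s \<ge> T" for s
  proof -
    have "2 * c / e = ((2 * c / e) powr (1 / (q - p))) powr (q - p)" using p c e by (simp add: powr_powr)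
    also have "\<dots> \<le> s powr (q - p)" using that p by (intro powr_mono2) (auto simp: T_def)
    finally show ?thesis using e by (simp add: field_simps)
  qed
  have "c * (1 + s powr (p - 1)) \<le> e * s powr (q - 1) + c * (1 + T powr (p - 1))" if s: "s \<ge> 0" for s
  proof (cases "s \<ge> T")
    case True
    then have s1: "s \<ge> 1" using T by simp
    have "1 \<le> s powr (p - 1)" using s1 p by (intro ge_one_powr_ge_zero) auto
    then have "c * (1 + s powr (p - 1)) \<le> (2 * c) * s powr (p - 1)" using c by simp
    also have "\<dots> \<le> (e * s powr (q - p)) * s powr (p - 1)" using Tq[OF True] by (intro mult_right_mono) auto
    also have "\<dots> = e * s powr (q - 1)" using s1 by (simp add: powr_add[symmetric])
    finally show ?thesis using c by (simp add: add_increasing2)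
  next
    case False
    then have "s powr (p - 1) \<le> T powr (p - 1)" using s p by (intro powr_mono2) auto
    then have "c * (1 + s powr (p - 1)) \<le> c * (1 + T powr (p - 1))" using c by simp
    then show ?thesis using e by (simp add: add_increasing)
  qed
  then show ?thesis using c by (intro exI[of _ "c * (1 + T powr (p - 1))"]) auto
qed

text \<open>For a function with countably many values the claim is immediate. Rounding
  \<open>w\<close> down to multiples of \<open>1 / Suc n\<close> gives such functions, and
  continuity in the second variable passes to the limit.\<close>

lemma caratheodory_measurable:
  fixes h :: "'a \<Rightarrow> real \<Rightarrow> real"
  assumes h: "\<And>v. (\<lambda>x. h x v) \<in> borel_measurable M" and c: "\<And>x. x \<in> space M \<Longrightarrow> continuous_on UNIV (h x)"
    and w[measurable]: "w \<in> borel_measurable M"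
  shows "(\<lambda>x. h x (w x)) \<in> borel_measurable M"
proof (rule borel_measurable_LIMSEQ_metric)
  fix n :: nat
  show "(\<lambda>x. h x (real_of_int \<lfloor>real (Suc n) * w x\<rfloor> / real (Suc n))) \<in> borel_measurable M"
  proof (rule measurable_compose_countable[where f="\<lambda>i x. h x (real_of_int i / real (Suc n))" and g="\<lambda>x. \<lfloor>real (Suc n) * w x\<rfloor>"])
    show "(\<lambda>x. \<lfloor>real (Suc n) * w x\<rfloor>) \<in> measurable M (count_space UNIV)" by measurable
  qed (rule h)
next
  fix x assume x: "x \<in> space M"
  have "(\<lambda>n. real_of_int \<lfloor>real (Suc n) * w x\<rfloor> / real (Suc n)) \<longlonglongrightarrow> w x"
  proof (rule LIM_zero_cancel, rule Lim_null_comparison)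
    show "(\<lambda>n. inverse (real (Suc n))) \<longlonglongrightarrow> 0" by (rule LIMSEQ_inverse_real_of_nat)
    have "\<bar>real_of_int \<lfloor>real (Suc n) * w x\<rfloor> / real (Suc n) - w x\<bar> \<le> inverse (real (Suc n))" for n
    proof -
      define m where "m = real (Suc n)"
      have m: "m > 0" by (simp add: m_def)
      have "real_of_int \<lfloor>m * w x\<rfloor> / m - w x = (real_of_int \<lfloor>m * w x\<rfloor> - m * w x) / m" using m by (simp add: field_simps)
      also have "\<bar>\<dots>\<bar> \<le> 1 / m" unfolding abs_divide using m by (intro frac_le) linarith+
      finally show ?thesis by (simp add: m_def inverse_eq_divide)
    qed
    then show "eventually (\<lambda>n. norm (real_of_int \<lfloor>real (Suc n) * w x\<rfloor> / real (Suc n) - w x) \<le> inverse (real (Suc n))) sequentially"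
      by (intro always_eventually) simp
  qed
  moreover have "isCont (h x) (w x)" using c[OF x] by (simp add: continuous_on_eq_continuous_at)
  ultimately show "(\<lambda>n. h x (real_of_int \<lfloor>real (Suc n) * w x\<rfloor> / real (Suc n))) \<longlonglongrightarrow> h x (w x)"
    by (rule isCont_tendsto_compose[rotated])
qed

text \<open>The hypotheses on the nonlinearity give a null set for each value separately. Rational
  values can be treated simultaneously, and continuity supplies the others.\<close>

lemma rational_le_imp_le:
  fixes g h :: "real \<Rightarrow> real"
  assumes g: "continuous_on UNIV g" and h: "continuous_on UNIV h" and r: "\<And>r. r \<in> \<rat> \<Longrightarrow> g r \<le> h r"
  shows "g v \<le> h v"
proof (rule ccontr)
  assume "\<not> g v \<le> h v"
  then have "v \<in> {v. h v < g v}" by simp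
  moreover have "open {v. h v < g v}" by (intro open_Collect_less g h)
  ultimately obtain e where e: "e > 0" "ball v e \<subseteq> {v. h v < g v}" by (meson open_contains_ball)
  obtain r where r': "r \<in> \<rat>" "v < r" "r < v + e" using Rats_dense_in_real[of v "v + e"] e(1) by auto
  then have "r \<in> ball v e" by (simp add: dist_real_def)
  then show False using e(2) r[OF r'(1)] by auto
qed

text \<open>The last two conjuncts are the part of the strict sign condition that makes the primitive positive
  away from \<open>0\<close>; unlike the condition itself they involve countably many null sets only.\<close>

definition regular_at :: "real \<Rightarrow> real \<Rightarrow> (real \<Rightarrow> real) \<Rightarrow> bool" where
  "regular_at c p h \<longleftrightarrow> continuous_on UNIV h \<and> h 0 = 0 \<and> (\<forall>v. \<bar>h v\<bar> \<le> c * (1 + \<bar>v\<bar> powr (p - 1))) \<and>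
     (\<forall>v>0. 0 \<le> h v) \<and> (\<forall>v<0. h v \<le> 0) \<and>
     (\<forall>n. 0 < h (inverse (real (Suc n)))) \<and> (\<forall>n. h (- inverse (real (Suc n))) < 0)"

section \<open>The nonlinearity and its primitive\<close>

locale nonlin = bounded_open \<Omega> for \<Omega> :: "'a::euclidean_space set" +
  fixes f :: "'a \<Rightarrow> real \<Rightarrow> real" and c p :: real
  assumes N4: "DIM('a) > 4" and ne: "\<Omega> \<noteq> {}"
    and c: "c > 0" and p: "2 < p" "p < crit_exp DIM('a)"
    and f_meas: "\<And>v. (\<lambda>x. f x v) \<in> borel_measurable (lebesgue_on \<Omega>)"
    and reg: "AE x in lebesgue_on \<Omega>. regular_at c p (f x)"
    and F4: "hyp_F4 \<Omega> f"
begin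

definition "q = crit_exp DIM('a)"

text \<open>\<open>q < 4\<close> is equivalent to dimension above 4: the quartic term of the energy
  outgrows the critical power.\<close>

lemma q: "2 < q" "q < 4" "p < q"
proof -
  have "real DIM('a) > 4" using N4 by simp
  then show "2 < q" "q < 4" by (simp_all add: q_def crit_exp_def field_simps)
  show "p < q" using p by (simp add: q_def)
qed

abbreviation "F \<equiv> primitive f"

lemma F_0: "F x 0 = 0"
  by (simp add: primitive_def)

lemma F_DERIV:
  assumes "regular_at c p (f x)"
  shows "(F x has_real_derivative f x v) (at v)"
proof -
  have cf: "continuous_on {- (\<bar>v\<bar> + 1)..\<bar>v\<bar> + 1} (f x)"
    using assms by (auto simp: regular_at_def intro: continuous_on_subset)
  have "((\<lambda>u. LBINT y=ereal 0..ereal u. f x y) has_vector_derivative f x v) (at v within {- (\<bar>v\<bar> + 1)..\<bar>v\<bar> + 1})"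
    by (rule interval_integral_FTC2[OF _ _ cf]) auto
  then have "((\<lambda>u. F x u) has_vector_derivative f x v) (at v within {- (\<bar>v\<bar> + 1)..\<bar>v\<bar> + 1})"
    by (simp add: primitive_def)
  moreover have "at v within {- (\<bar>v\<bar> + 1)..\<bar>v\<bar> + 1} = at v"
    by (rule at_within_interior) (auto simp: interior_atLeastAtMost_real)
  ultimately show ?thesis by (simp add: has_real_derivative_iff_has_vector_derivative)
qed

lemma F_mvt:
  assumes "regular_at c p (f x)"
  shows "\<exists>\<theta>. 0 \<le> \<theta> \<and> \<theta> \<le> 1 \<and> F x (v + h) - F x v = f x (v + \<theta> * h) * h"
  by (rule mvt_between[OF F_DERIV[OF assms]])

lemma F_mono:
  assumes r: "regular_at c p (f x)"
  shows "0 \<le> s \<Longrightarrow> s \<le> t \<Longrightarrow> F x s \<le> F x t" "t \<le> s \<Longrightarrow> s \<le> 0 \<Longrightarrow> F x s \<le> F x t"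
proof -
  assume st: "0 \<le> s" "s \<le> t"
  obtain a where a: "0 \<le> a" "a \<le> 1" "F x (s + (t - s)) - F x s = f x (s + a * (t - s)) * (t - s)"
    using F_mvt[OF r] by blast
  have "0 \<le> s + a * (t - s)" using st a by simp
  then have "0 \<le> f x (s + a * (t - s))" using r unfolding regular_at_def by (metis le_less)
  then have "0 \<le> F x (s + (t - s)) - F x s" unfolding a(3) using st by (intro mult_nonneg_nonneg) auto
  then show "F x s \<le> F x t" by simp
next
  assume st: "t \<le> s" "s \<le> 0"
  obtain a where a: "0 \<le> a" "a \<le> 1" "F x (s + (t - s)) - F x s = f x (s + a * (t - s)) * (t - s)"
    using F_mvt[OF r] by blast
  have "a * (t - s) \<le> 0" using st a by (simp add: mult_nonneg_nonpos)
  then have "s + a * (t - s) \<le> 0" using st by linarith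
  then have "f x (s + a * (t - s)) \<le> 0" using r unfolding regular_at_def by (metis le_less)
  then show "F x s \<le> F x t" using a(3) st mult_nonpos_nonpos[of "f x (s + a * (t - s))" "t - s"] by simp
qed

lemma F_nonneg: "regular_at c p (f x) \<Longrightarrow> 0 \<le> F x v"
  using F_mono(1)[of x 0 v] F_mono(2)[of x v 0] F_0[of x] by (cases "v \<ge> 0") auto

text \<open>\<open>regular_at\<close> guarantees a strict sign only at the points plus or minus
  \<open>inverse (Suc n)\<close>. One of them lies between 0 and \<open>v\<close>; the primitive
  strictly increases there and never decreases on the way out.\<close>

lemma F_pos:
  assumes r: "regular_at c p (f x)" and v: "v \<noteq> 0"
  shows "0 < F x v"
proof -
  have "\<bar>v\<bar> > 0" using v by simp
  then obtain n where n: "inverse (real (Suc n)) < \<bar>v\<bar>" using reals_Archimedean by blast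
  define t where "t = inverse (real (Suc n))"
  have t: "0 < t" "t < \<bar>v\<bar>" using n by (simp_all add: t_def)
  show ?thesis
  proof (cases "v > 0")
    case True
    have "f x t > 0" using r by (simp add: regular_at_def t_def)
    then obtain d where d: "d > 0" "\<And>h. h > 0 \<Longrightarrow> h < d \<Longrightarrow> F x t < F x (t + h)"
      using DERIV_pos_inc_right[OF F_DERIV[OF r]] by blast
    define h where "h = min (d / 2) (\<bar>v\<bar> - t)"
    have h: "0 < h" "h < d" "t + h \<le> v" using d t True by (auto simp: h_def)
    have "0 \<le> F x t" by (rule F_nonneg[OF r])
    also have "\<dots> < F x (t + h)" using d h by blast
    also have "\<dots> \<le> F x v" using h t by (intro F_mono[OF r]) auto
    finally show ?thesis .
  next
    case False
    have "f x (- t) < 0" using r by (simp add: regular_at_def t_def)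
    then obtain d where d: "d > 0" "\<And>h. h > 0 \<Longrightarrow> h < d \<Longrightarrow> F x (- t) < F x (- t - h)"
      using DERIV_neg_dec_left[OF F_DERIV[OF r]] by blast
    define h where "h = min (d / 2) (\<bar>v\<bar> - t)"
    have h: "0 < h" "h < d" "v \<le> - t - h" using d t False by (auto simp: h_def)
    have "0 \<le> F x (- t)" by (rule F_nonneg[OF r])
    also have "\<dots> < F x (- t - h)" using d h by blast
    also have "\<dots> \<le> F x v" using h t by (intro F_mono(2)[OF r]) auto
    finally show ?thesis .
  qed
qed

text \<open>Near zero \<open>F4\<close> bounds \<open>f\<close> by a small multiple of
  \<open>\<bar>v\<bar>\<close>. Away from zero both terms of the growth condition are dominated by
  \<open>\<bar>v\<bar> powr (q - 1)\<close>, with a constant that depends on the distance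
  \<open>d\<close>.\<close>

lemma F_small:
  assumes e: "e > 0"
  shows "\<exists>C\<ge>0. \<forall>x\<in>\<Omega>. regular_at c p (f x) \<longrightarrow> (\<forall>v. F x v \<le> e * v\<^sup>2 + C * \<bar>v\<bar> powr q)"
proof -
  have "eventually (\<lambda>v. \<forall>x\<in>\<Omega>. dist (f x v / \<bar>v\<bar>) 0 < e) (at 0)"
    using F4 e unfolding hyp_F4_def uniform_limit_iff by blast
  then obtain d where d: "d > 0" "\<And>v x. v \<noteq> 0 \<Longrightarrow> dist v 0 < d \<Longrightarrow> x \<in> \<Omega> \<Longrightarrow> dist (f x v / \<bar>v\<bar>) 0 < e"
    unfolding eventually_at by blast
  define C where "C = c * (1 / d powr (q - 1) + 1 / d powr (q - p))"
  have C: "C \<ge> 0" using c by (simp add: C_def)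
  have fb: "\<bar>f x v\<bar> \<le> e * \<bar>v\<bar> + C * \<bar>v\<bar> powr (q - 1)" if r: "regular_at c p (f x)" and x: "x \<in> \<Omega>" for x v
  proof (cases "\<bar>v\<bar> < d")
    case True
    have "\<bar>f x v\<bar> \<le> e * \<bar>v\<bar>"
    proof (cases "v = 0")
      case False
      then have "\<bar>f x v / \<bar>v\<bar>\<bar> < e" using d(2)[of v x] True x by simp
      then show ?thesis using False by (simp add: abs_divide field_simps)
    qed (use r in \<open>simp add: regular_at_def\<close>)
    then show ?thesis using C by (simp add: add_increasing2)
  next
    case False
    define s where "s = \<bar>v\<bar>"
    have s: "s \<ge> d" "s > 0" using False d by (auto simp: s_def)
    have "d powr (q - 1) \<le> s powr (q - 1)" "d powr (q - p) \<le> s powr (q - p)"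
      using s d q by (intro powr_mono2; simp)+
    then have "1 \<le> s powr (q - 1) / d powr (q - 1)" "1 \<le> s powr (q - p) / d powr (q - p)" using d by simp_all
    then have "1 + s powr (p - 1) \<le> s powr (q - 1) / d powr (q - 1) + s powr (q - p) / d powr (q - p) * s powr (p - 1)"
      using mult_right_mono[of 1 "s powr (q - p) / d powr (q - p)" "s powr (p - 1)"] by simp
    also have "s powr (q - p) / d powr (q - p) * s powr (p - 1) = s powr (q - 1) / d powr (q - p)"
      using s by (simp add: powr_add[symmetric])
    finally have "c * (1 + s powr (p - 1)) \<le> c * (s powr (q - 1) / d powr (q - 1) + s powr (q - 1) / d powr (q - p))"
      using c by (intro mult_left_mono) auto
    also have "\<dots> = C * s powr (q - 1)" by (simp add: C_def field_simps)
    finally have "\<bar>f x v\<bar> \<le> C * s powr (q - 1)" using r by (auto simp: regular_at_def s_def intro: order_trans)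
    then show ?thesis using e by (simp add: s_def add_increasing)
  qed
  have "F x v \<le> e * v\<^sup>2 + C * \<bar>v\<bar> powr q" if r: "regular_at c p (f x)" and x: "x \<in> \<Omega>" for x v
  proof -
    obtain t where t: "0 \<le> t" "t \<le> 1" "F x (0 + v) - F x 0 = f x (0 + t * v) * v" using F_mvt[OF r] by blast
    have tv: "\<bar>t * v\<bar> \<le> \<bar>v\<bar>" using abs_add_theta[OF t(1,2), of 0 v] by simp
    have "F x v \<le> \<bar>f x (t * v)\<bar> * \<bar>v\<bar>" using t(3) F_0[of x] by (simp add: abs_mult[symmetric])
    also have "\<dots> \<le> (e * \<bar>t * v\<bar> + C * \<bar>t * v\<bar> powr (q - 1)) * \<bar>v\<bar>" by (intro mult_right_mono fb r x) simp
    also have "\<dots> \<le> (e * \<bar>v\<bar> + C * \<bar>v\<bar> powr (q - 1)) * \<bar>v\<bar>"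
      using tv C e q by (intro mult_right_mono add_mono mult_left_mono powr_mono2) auto
    also have "\<dots> = e * v\<^sup>2 + C * (\<bar>v\<bar> * \<bar>v\<bar> powr (q - 1))"
      by (simp add: algebra_simps power2_eq_square abs_mult_self_eq)
    also have "\<dots> \<le> e * v\<^sup>2 + C * \<bar>v\<bar> powr q"
      using C mult_powr_le[of "\<bar>v\<bar>" "\<bar>v\<bar>" q] by (intro add_left_mono mult_left_mono) auto
    finally show ?thesis .
  qed
  with C show ?thesis by blast
qed

text \<open>The form that \<open>dominated_up_to_epsilon\<close> asks for: an arbitrarily small
  coefficient at the varying \<open>k\<close>, and a remainder that involves only the fixed
  \<open>u\<close>. Subcritical growth is what makes the coefficient small. The argument
  \<open>w\<close> stands for an intermediate point of the mean value theorem.\<close>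

lemma f_bound_eps:
  assumes e: "e > 0"
  shows "\<exists>C\<ge>0. \<forall>x u k w. regular_at c p (f x) \<longrightarrow> \<bar>w\<bar> \<le> \<bar>u\<bar> + \<bar>k\<bar> \<longrightarrow>
     \<bar>f x w\<bar> * \<bar>k\<bar> \<le> e * \<bar>k\<bar> powr q + C * (1 + \<bar>u\<bar> powr q)"
proof -
  define d where "d = e / (2 powr q + 1)"
  have d: "d > 0" using e by (simp add: d_def add_pos_pos)
  have de: "d * 2 powr q + d = e" by (simp add: d_def field_simps add_pos_pos less_imp_neq[symmetric])
  obtain C1 where C1: "C1 \<ge> 0" "\<And>s. s \<ge> 0 \<Longrightarrow> c * (1 + s powr (p - 1)) \<le> d * s powr (q - 1) + C1"
    using subcritical[OF c _ _ d, of p q] p q by auto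
  \<comment> \<open>With the exponents 2 and \<open>q + 1\<close>, \<open>subcritical\<close> bounds
    a linear term by a small multiple of the q-th power.\<close>
  obtain C2 where C2: "C2 \<ge> 0" "\<And>s. s \<ge> 0 \<Longrightarrow> (C1 + 1) * (1 + s powr (2 - 1)) \<le> d * s powr (q + 1 - 1) + C2"
    using subcritical[OF _ _ _ d, of "C1 + 1" 2 "q + 1"] C1 q by auto
  define C where "C = max C2 e"
  have "\<bar>f x w\<bar> * \<bar>k\<bar> \<le> e * \<bar>k\<bar> powr q + C * (1 + \<bar>u\<bar> powr q)"
    if r: "regular_at c p (f x)" and w: "\<bar>w\<bar> \<le> \<bar>u\<bar> + \<bar>k\<bar>" for x u k w
  proof -
    define s where "s = \<bar>u\<bar> + \<bar>k\<bar>"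
    have s: "s \<ge> 0" "\<bar>k\<bar> \<le> s" "\<bar>w\<bar> \<le> s" using w by (auto simp: s_def)
    have "\<bar>f x w\<bar> \<le> c * (1 + \<bar>w\<bar> powr (p - 1))" using r by (simp add: regular_at_def)
    also have "\<dots> \<le> d * \<bar>w\<bar> powr (q - 1) + C1" by (rule C1) simp
    also have "\<dots> \<le> d * s powr (q - 1) + C1" using s d q by (intro add_right_mono mult_left_mono powr_mono2) auto
    finally have "\<bar>f x w\<bar> * \<bar>k\<bar> \<le> (d * s powr (q - 1) + C1) * \<bar>k\<bar>" by (rule mult_right_mono) simp
    also have "\<dots> = d * (\<bar>k\<bar> * s powr (q - 1)) + C1 * \<bar>k\<bar>" by (simp add: algebra_simps)
    also have "\<dots> \<le> d * s powr q + (d * \<bar>k\<bar> powr q + C2)"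
    proof (intro add_mono mult_left_mono mult_powr_le)
      have "C1 * \<bar>k\<bar> \<le> (C1 + 1) * (1 + \<bar>k\<bar> powr (2 - 1))" using C1 by (simp add: algebra_simps)
      also have "\<dots> \<le> d * \<bar>k\<bar> powr q + C2" using C2(2)[of "\<bar>k\<bar>"] by simp
      finally show "C1 * \<bar>k\<bar> \<le> d * \<bar>k\<bar> powr q + C2" .
    qed (use s d in auto)
    also have "\<dots> \<le> d * (2 powr q * (\<bar>u\<bar> powr q + \<bar>k\<bar> powr q)) + (d * \<bar>k\<bar> powr q + C2)"
      using powr_add_le[of "\<bar>u\<bar>" "\<bar>k\<bar>" q] d q by (intro add_right_mono mult_left_mono) (auto simp: s_def)
    also have "\<dots> = (d * 2 powr q + d) * \<bar>k\<bar> powr q + (d * 2 powr q * \<bar>u\<bar> powr q + C2)" by (simp add: algebra_simps)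
    also have "\<dots> \<le> e * \<bar>k\<bar> powr q + (C * \<bar>u\<bar> powr q + C)"
      unfolding de using de d by (intro add_mono mult_right_mono) (auto simp: C_def)
    finally show ?thesis by (simp add: algebra_simps)
  qed
  moreover have "C \<ge> 0" using e by (simp add: C_def)
  ultimately show ?thesis by blast
qed

lemma F_bound_eps:
  assumes e: "e > 0"
  shows "\<exists>C\<ge>0. \<forall>x u v. regular_at c p (f x) \<longrightarrow>
     \<bar>F x (u + v) - F x u\<bar> \<le> e * \<bar>v\<bar> powr q + C * (1 + \<bar>u\<bar> powr q)"
proof -
  obtain C where C: "C \<ge> 0" "\<And>x u k w. regular_at c p (f x) \<Longrightarrow> \<bar>w\<bar> \<le> \<bar>u\<bar> + \<bar>k\<bar> \<Longrightarrow>
     \<bar>f x w\<bar> * \<bar>k\<bar> \<le> e * \<bar>k\<bar> powr q + C * (1 + \<bar>u\<bar> powr q)" using f_bound_eps[OF e] by blast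
  have "\<bar>F x (u + v) - F x u\<bar> \<le> e * \<bar>v\<bar> powr q + C * (1 + \<bar>u\<bar> powr q)" if r: "regular_at c p (f x)" for x u v
  proof -
    obtain t where t: "0 \<le> t" "t \<le> 1" "F x (u + v) - F x u = f x (u + t * v) * v" using F_mvt[OF r] by blast
    show ?thesis unfolding t(3) abs_mult by (rule C(2)[OF r abs_add_theta[OF t(1,2)]])
  qed
  with C(1) show ?thesis by blast
qed

lemma F_quotient_eps:
  assumes e: "e > 0"
  shows "\<exists>C\<ge>0. \<forall>x u k t. regular_at c p (f x) \<longrightarrow> 0 < t \<longrightarrow> t \<le> 1 \<longrightarrow>
     \<bar>(F x (u + t * k) - F x u) / t - f x u * k\<bar> \<le> e * \<bar>k\<bar> powr q + C * (1 + \<bar>u\<bar> powr q)"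
proof -
  obtain C where C: "C \<ge> 0" "\<And>x u k w. regular_at c p (f x) \<Longrightarrow> \<bar>w\<bar> \<le> \<bar>u\<bar> + \<bar>k\<bar> \<Longrightarrow>
     \<bar>f x w\<bar> * \<bar>k\<bar> \<le> e / 2 * \<bar>k\<bar> powr q + C * (1 + \<bar>u\<bar> powr q)" using f_bound_eps[of "e / 2"] e by auto
  have "\<bar>(F x (u + t * k) - F x u) / t - f x u * k\<bar> \<le> e * \<bar>k\<bar> powr q + (2 * C) * (1 + \<bar>u\<bar> powr q)"
    if r: "regular_at c p (f x)" and t: "0 < t" "t \<le> 1" for x u k t
  proof -
    obtain a where a: "0 \<le> a" "a \<le> 1" "F x (u + t * k) - F x u = f x (u + a * (t * k)) * (t * k)"
      using F_mvt[OF r] by blast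
    have at: "0 \<le> a * t" "a * t \<le> 1" using a t by (auto intro: mult_le_one)
    have "(F x (u + t * k) - F x u) / t - f x u * k = f x (u + (a * t) * k) * k - f x u * k"
      unfolding a(3) using t by (simp add: mult.assoc)
    then have "\<bar>(F x (u + t * k) - F x u) / t - f x u * k\<bar> \<le> \<bar>f x (u + (a * t) * k)\<bar> * \<bar>k\<bar> + \<bar>f x u\<bar> * \<bar>k\<bar>"
      unfolding abs_mult[symmetric] by simp
    also have "\<dots> \<le> (e / 2 * \<bar>k\<bar> powr q + C * (1 + \<bar>u\<bar> powr q)) + (e / 2 * \<bar>k\<bar> powr q + C * (1 + \<bar>u\<bar> powr q))"
      by (intro add_mono C(2)[OF r] abs_add_theta at) auto
    finally show ?thesis by (simp add: algebra_simps)
  qed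
  with C(1) show ?thesis by (intro exI[of _ "2 * C"]) auto
qed

text \<open>\<open>caratheodory_measurable\<close> needs continuity at every point of the space, so
  \<open>f\<close> is replaced by 0 where it fails.\<close>

lemma regular_modification:
  "\<exists>g. (\<forall>x. continuous_on UNIV (g x)) \<and> (\<forall>v. (\<lambda>x. g x v) \<in> borel_measurable M) \<and> (AE x in M. f x = g x)"
proof -
  define g where "g x = (if continuous_on UNIV (f x) then f x else (\<lambda>v. 0))" for x
  have ae: "AE x in M. f x = g x" using reg by eventually_elim (simp add: g_def regular_at_def)
  have "(\<lambda>x. g x v) \<in> borel_measurable M" for v
    by (rule meas_AE[OF f_meas[of v]]) (use ae in \<open>auto elim: eventually_mono\<close>)
  moreover have "continuous_on UNIV (g x)" for x by (simp add: g_def)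
  ultimately show ?thesis using ae by blast
qed

lemma f_comp_measurable:
  assumes u: "u \<in> borel_measurable M"
  shows "(\<lambda>x. f x (u x)) \<in> borel_measurable M"
proof -
  obtain g where g: "\<And>x. continuous_on UNIV (g x)" "\<And>v. (\<lambda>x. g x v) \<in> borel_measurable M" "AE x in M. f x = g x"
    using regular_modification by blast
  have "(\<lambda>x. g x (u x)) \<in> borel_measurable M" by (rule caratheodory_measurable[OF g(2,1) u])
  then show ?thesis by (rule meas_AE) (use g(3) in \<open>auto elim: eventually_mono\<close>)
qed

text \<open>The oriented integral up to \<open>u x\<close> is written as an integral over the whole
  line with a signed weight. The integrand is then jointly measurable, and integrating out one
  variable preserves measurability.\<close>

lemma F_comp_measurable:
  assumes u[measurable]: "u \<in> borel_measurable M"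
  shows "(\<lambda>x. F x (u x)) \<in> borel_measurable M"
proof -
  obtain g where g: "\<And>x. continuous_on UNIV (g x)" "\<And>v. (\<lambda>x. g x v) \<in> borel_measurable M" "AE x in M. f x = g x"
    using regular_modification by blast
  have gm[measurable]: "(\<lambda>z. g (fst z) (snd z)) \<in> borel_measurable (M \<Otimes>\<^sub>M lborel)"
  proof (rule caratheodory_measurable[where h="\<lambda>z. g (fst z)"])
    fix v show "(\<lambda>z. g (fst z) v) \<in> borel_measurable (M \<Otimes>\<^sub>M lborel)"
      by (rule measurable_compose[OF measurable_fst g(2)])
  qed (use g in auto)
  define k where "k x t = ((if 0 < t \<and> t < u x then 1 else 0) - (if u x < t \<and> t < 0 then 1 else 0)) * g x t" for x t
  have "(\<lambda>z. k (fst z) (snd z)) \<in> borel_measurable (M \<Otimes>\<^sub>M lborel)"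
    unfolding k_def by measurable
  then have "(\<lambda>x. LINT t|lborel. k x t) \<in> borel_measurable M"
    by (intro lborel.borel_measurable_lebesgue_integral) (simp add: split_beta')
  then show ?thesis
  proof (rule meas_AE)
    show "AE x in M. (LINT t|lborel. k x t) = F x (u x)"
      using g(3)
    proof eventually_elim
      case (elim x)
      show ?case
      proof (cases "0 \<le> u x")
        case True
        have "F x (u x) = (LINT t|lborel. indicator {0<..<u x} t * g x t)"
          using True by (simp add: primitive_def elim interval_lebesgue_integral_def set_lebesgue_integral_def)
        also have "\<dots> = (LINT t|lborel. k x t)"
          using True by (intro Bochner_Integration.integral_cong) (auto simp: k_def indicator_def)
        finally show ?thesis by simp
      next
        case False
        have "F x (u x) = - (LINT t|lborel. indicator {u x<..<0} t * g x t)"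
          using False by (simp add: primitive_def elim interval_lebesgue_integral_def set_lebesgue_integral_def)
        also have "\<dots> = (LINT t|lborel. - (indicator {u x<..<0} t * g x t))" by simp
        also have "\<dots> = (LINT t|lborel. k x t)"
          using False by (intro Bochner_Integration.integral_cong) (auto simp: k_def indicator_def)
        finally show ?thesis by simp
      qed
    qed
  qed
qed

end

section \<open>Differentiability of the energy\<close>

context nonlin
begin

abbreviation "H \<equiv> H01 \<Omega>"
abbreviation "nrm \<equiv> H01_norm \<Omega>"
abbreviation "wgrad \<equiv> weak_grad \<Omega>"

definition inner_H01 :: "('a \<Rightarrow> real) \<Rightarrow> ('a \<Rightarrow> real) \<Rightarrow> real" where
  "inner_H01 u v = (LINT x|M. wgrad u x \<bullet> wgrad v x)"

definition V :: "('a \<Rightarrow> real) \<Rightarrow> real" where "V u = (LINT x|M. \<bar>u x\<bar> powr q)"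

definition J :: "('a \<Rightarrow> real) \<Rightarrow> real" where "J u = (LINT x|M. F x (u x))"

lemma nrm_nonneg: "0 \<le> nrm u" by (simp add: H01_norm_def)

lemma nrm_sq: "u \<in> H \<Longrightarrow> (nrm u)\<^sup>2 = (LINT x|M. (norm (wgrad u x))\<^sup>2)"
  using H01_grad_H01(3)[OF H01_HG] .

lemma H_meas: "u \<in> H \<Longrightarrow> u \<in> borel_measurable M"
  using H01_grad_sqi(1)[OF H01_HG] by (rule square_integrable_meas)

lemma H01_grad_comb:
  assumes "u \<in> H" "v \<in> H"
  shows "H01_grad (\<lambda>x. u x + t * v x) (\<lambda>x. wgrad u x + t *\<^sub>R wgrad v x)"
  by (intro H01_grad_add H01_grad_scale H01_HG assms)

lemma H_comb: "u \<in> H \<Longrightarrow> v \<in> H \<Longrightarrow> (\<lambda>x. u x + t * v x) \<in> H"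
  by (rule H01_grad_H01(1)[OF H01_grad_comb])

lemma H_add: "u \<in> H \<Longrightarrow> v \<in> H \<Longrightarrow> (\<lambda>x. u x + v x) \<in> H"
  using H_comb[of u v 1] by simp

lemma H_diff: "u \<in> H \<Longrightarrow> v \<in> H \<Longrightarrow> (\<lambda>x. u x - v x) \<in> H"
  using H_comb[of u v "-1"] by simp

lemma H_scale: "u \<in> H \<Longrightarrow> (\<lambda>x. t * u x) \<in> H"
  by (rule H01_grad_H01(1)[OF H01_grad_scale[OF H01_HG]])

lemma nrm_comb:
  assumes u: "u \<in> H" and v: "v \<in> H"
  shows "(nrm (\<lambda>x. u x + t * v x))\<^sup>2 = (nrm u)\<^sup>2 + 2 * t * inner_H01 u v + t\<^sup>2 * (nrm v)\<^sup>2"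
proof -
  note s = H01_grad_sqi(2)[OF H01_HG[OF u]] H01_grad_sqi(2)[OF H01_HG[OF v]]
  have "(nrm (\<lambda>x. u x + t * v x))\<^sup>2 = (LINT x|M. (norm (wgrad u x + t *\<^sub>R wgrad v x))\<^sup>2)"
    by (rule H01_grad_H01(3)[OF H01_grad_comb[OF u v]])
  also have "\<dots> = (LINT x|M. (norm (wgrad u x))\<^sup>2 + 2 * t * (wgrad u x \<bullet> wgrad v x) + t\<^sup>2 * (norm (wgrad v x))\<^sup>2)"
    by (intro Bochner_Integration.integral_cong refl)
       (simp add: power2_norm_eq_inner inner_add inner_commute power2_eq_square[of t] algebra_simps)
  also have "\<dots> = (nrm u)\<^sup>2 + 2 * t * inner_H01 u v + t\<^sup>2 * (nrm v)\<^sup>2"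
    unfolding nrm_sq[OF u] nrm_sq[OF v] inner_H01_def
    using square_integrable_int[OF s(1)] square_integrable_int[OF s(2)] square_integrable_inner[OF s] by simp
  finally show ?thesis .
qed

lemma nrm_scale: "u \<in> H \<Longrightarrow> nrm (\<lambda>x. t * u x) = \<bar>t\<bar> * nrm u"
proof -
  assume u: "u \<in> H"
  have "(nrm (\<lambda>x. t * u x))\<^sup>2 = (LINT x|M. (norm (t *\<^sub>R wgrad u x))\<^sup>2)" by (rule H01_grad_H01(3)[OF H01_grad_scale[OF H01_HG[OF u]]])
  also have "\<dots> = (\<bar>t\<bar> * nrm u)\<^sup>2" by (simp add: power_mult_distrib nrm_sq[OF u])
  finally show ?thesis by (rule power2_eq_imp_eq) (auto simp: nrm_nonneg)
qed

lemma inner_H01_self: "u \<in> H \<Longrightarrow> inner_H01 u u = (nrm u)\<^sup>2"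
  by (simp add: inner_H01_def nrm_sq power2_norm_eq_inner)

lemma inner_H01_le: "u \<in> H \<Longrightarrow> v \<in> H \<Longrightarrow> \<bar>inner_H01 u v\<bar> \<le> nrm u * nrm v"
  using square_integrable_CS[OF H01_grad_sqi(2)[OF H01_HG] H01_grad_sqi(2)[OF H01_HG], of u v]
  by (simp add: inner_H01_def H01_norm_def)

lemma inner_H01_scale: "u \<in> H \<Longrightarrow> v \<in> H \<Longrightarrow> inner_H01 u (\<lambda>x. t * v x) = t * inner_H01 u v"
proof -
  assume u: "u \<in> H" and v: "v \<in> H"
  note s = H01_grad_sqi(2)[OF H01_HG[OF u]] H01_grad_sqi(2)[OF H01_HG[OF v]]
  note s3 = H01_grad_sqi(2)[OF H01_HG[OF H_scale[OF v, of t]]]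
  have "inner_H01 u (\<lambda>x. t * v x) = (LINT x|M. wgrad u x \<bullet> (t *\<^sub>R wgrad v x))"
    unfolding inner_H01_def
    using H01_grad_H01(2)[OF H01_grad_scale[OF H01_HG[OF v], of t]]
    by (intro integral_cong_AE borel_measurable_integrable square_integrable_inner s s3 square_integrable_scale) (auto elim: eventually_mono)
  then show ?thesis by (simp add: inner_H01_def)
qed

lemma sob: "\<exists>S>0. \<forall>u\<in>H. integrable M (\<lambda>x. \<bar>u x\<bar> powr q) \<and> V u \<le> S * nrm u powr q"
proof -
  obtain S where S: "S > 0" "\<And>u g. H01_grad u g \<Longrightarrow> integrable M (\<lambda>x. \<bar>u x\<bar> powr q) \<and>
      (LINT x|M. \<bar>u x\<bar> powr q) \<le> (S * (LINT x|M. (norm (g x))\<^sup>2)) powr (q / 2)"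
    using sobolev[OF _ q_def] N4 by auto
  have "V u \<le> S powr (q / 2) * nrm u powr q" if u: "u \<in> H" for u
  proof -
    have "V u \<le> (S * (nrm u)\<^sup>2) powr (q / 2)" using S(2)[OF H01_HG[OF u]] by (simp add: V_def nrm_sq[OF u])
    also have "\<dots> = S powr (q / 2) * (nrm u powr 2) powr (q / 2)"
      using nrm_nonneg[of u] by (simp add: powr_mult powr_numeral)
    also have "\<dots> = S powr (q / 2) * nrm u powr q" using nrm_nonneg[of u] by (simp add: powr_powr del: powr_numeral)
    finally show ?thesis .
  qed
  then show ?thesis using S H01_HG by (intro exI[of _ "S powr (q / 2)"]) auto
qed

lemma V_integrable: "u \<in> H \<Longrightarrow> integrable M (\<lambda>x. \<bar>u x\<bar> powr q)"
  using sob by blast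

lemma V_nonneg: "V u \<ge> 0" by (simp add: V_def)

lemma zero_iff: "u \<in> H \<Longrightarrow> nrm u = 0 \<longleftrightarrow> (AE x in M. u x = 0)"
proof
  assume u: "u \<in> H"
  {
    assume "nrm u = 0"
    then have "V u = 0" using sob u V_nonneg[of u] q by force
    then have "AE x in M. \<bar>u x\<bar> powr q = 0"
      unfolding V_def using V_integrable[OF u] by (subst (asm) integral_nonneg_eq_0_iff_AE) auto
    then show "AE x in M. u x = 0" by eventually_elim simp
  next
    assume ae: "AE x in M. u x = 0"
    have "H01_grad (\<lambda>x. 0 * u x) (\<lambda>x. 0 *\<^sub>R wgrad u x)" by (rule H01_grad_scale[OF H01_HG[OF u]])
    from H01_grad_unique[OF H01_HG[OF u] this] ae have "AE x in M. wgrad u x = 0" by simp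
    then have "(nrm u)\<^sup>2 = (LINT x|M. 0)"
      unfolding nrm_sq[OF u] using H01_grad_sqi(2)[OF H01_HG[OF u]]
      by (intro integral_cong_AE borel_measurable_integrable square_integrable_int) (auto elim: eventually_mono)
    then show "nrm u = 0" by simp
  }
qed

lemma nonzero_nrm: "u \<in> H01_nonzero \<Omega> \<longleftrightarrow> u \<in> H \<and> nrm u > 0"
  using zero_iff nrm_nonneg[of u] by (auto simp: H01_nonzero_def less_le)

text \<open>Keeps the infima in \<open>sobolev_const\<close> and \<open>lambda0_star\<close> from
  ranging over the empty set.\<close>

lemma nonzero_ex: "H01_nonzero \<Omega> \<noteq> {}"
proof -
  obtain y where "y \<in> \<Omega>" using ne by blast
  then obtain e where e: "e > 0" "cball y e \<subseteq> \<Omega>" using op open_contains_cball by blast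
  obtain a b where ab: "y \<in> box a b" "box a b \<subseteq> ball y e" using rational_boxes[OF e(1)] by metis
  have "closure (box a b) \<subseteq> cball y e" using ab(2) by (intro closure_minimal) auto
  then have sub: "cbox a b \<subseteq> \<Omega>" using e ab by (cases "box a b = {}") auto
  define w where "w = bump a b 1"
  have wt: "w \<in> test_functions \<Omega>" unfolding w_def using sub by (intro bump_test) auto
  have "\<not> (AE x in M. w x = 0)"
  proof
    assume "AE x in M. w x = 0"
    then have "AE x in lebesgue. x \<in> \<Omega> \<longrightarrow> w x = 0" by (simp add: AE_restrict_space_iff)
    then have "AE x in lebesgue. x \<notin> box a b"
    proof eventually_elim
      case (elim x)
      then show ?case using bump_nonzero[of 1 a b x] sub box_subset_cbox[of a b] by (auto simp: w_def)
    qed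
    then have "box a b \<in> null_sets lebesgue" by (subst (asm) AE_iff_null_sets[symmetric]) auto
    then have "negligible (box a b)" by (simp add: negligible_iff_null_sets)
    then have "box a b = {}" using open_not_negligible open_box by blast
    then show False using ab(1) by simp
  qed
  then show ?thesis using H01_grad_H01(1)[OF H01_grad_test[OF wt]] by (auto simp: H01_nonzero_def)
qed

lemma const_integrable: "integrable M (\<lambda>x. k::real)"
  by (rule finite_measure.integrable_const[OF Om_fin])

lemma J_integrable:
  assumes u: "u \<in> H"
  shows "integrable M (\<lambda>x. F x (u x))"
proof -
  obtain C where C: "C \<ge> 0" "\<And>x u v. regular_at c p (f x) \<Longrightarrow>
     \<bar>F x (u + v) - F x u\<bar> \<le> 1 * \<bar>v\<bar> powr q + C * (1 + \<bar>u\<bar> powr q)" using F_bound_eps[of 1] by auto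
  show ?thesis
  proof (rule Bochner_Integration.integrable_bound[OF Bochner_Integration.integrable_add[OF V_integrable[OF u] const_integrable[of C]]])
    show "(\<lambda>x. F x (u x)) \<in> borel_measurable M" by (rule F_comp_measurable[OF H_meas[OF u]])
    show "AE x in M. norm (F x (u x)) \<le> norm (\<bar>u x\<bar> powr q + C)"
      using reg
    proof eventually_elim
      case (elim x)
      have "\<bar>F x (u x)\<bar> \<le> \<bar>u x\<bar> powr q + C" using C(2)[OF elim, of 0 "u x"] F_0[of x] by simp
      then show ?case by simp
    qed
  qed
qed

lemma J_nonneg: "J u \<ge> 0"
  unfolding J_def by (rule integral_nonneg_AE) (use reg F_nonneg in \<open>auto elim: eventually_mono\<close>)

lemma J_pos:
  assumes u: "u \<in> H" "nrm u > 0"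
  shows "J u > 0"
proof (rule ccontr)
  assume "\<not> J u > 0"
  then have "J u = 0" using J_nonneg[of u] by simp
  moreover have "AE x in M. 0 \<le> F x (u x)" using reg by eventually_elim (rule F_nonneg)
  ultimately have "AE x in M. F x (u x) = 0"
    unfolding J_def using integral_nonneg_eq_0_iff_AE[OF J_integrable[OF u(1)]] by simp
  with reg have "AE x in M. u x = 0" by eventually_elim (use F_pos in force)
  then show False using u zero_iff[OF u(1)] by simp
qed

text \<open>\<open>F_small\<close> with \<open>e / P\<close>, where \<open>P\<close> is the Poincare
  constant, followed by the Sobolev inequality. It is used twice: near zero because
  \<open>q > 2\<close>, and at infinity because \<open>q < 4\<close>.\<close>

lemma J_small:
  assumes e: "e > 0"
  shows "\<exists>C\<ge>0. \<forall>u\<in>H. J u \<le> e * (nrm u)\<^sup>2 + C * nrm u powr q"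
proof -
  obtain P where P: "P > 0" "\<And>u g. H01_grad u g \<Longrightarrow> (LINT x|M. (norm (u x))\<^sup>2) \<le> P * (LINT x|M. (norm (g x))\<^sup>2)"
    using poincare by blast
  obtain S where S: "S > 0" "\<And>u. u \<in> H \<Longrightarrow> V u \<le> S * nrm u powr q" using sob by blast
  obtain C where C: "C \<ge> 0" "\<And>x v. x \<in> \<Omega> \<Longrightarrow> regular_at c p (f x) \<Longrightarrow> F x v \<le> e / P * v\<^sup>2 + C * \<bar>v\<bar> powr q"
    using F_small[of "e / P"] e P by auto
  have "J u \<le> e * (nrm u)\<^sup>2 + (C * S) * nrm u powr q" if u: "u \<in> H" for u
  proof -
    note i2 = square_integrable_int[OF H01_grad_sqi(1)[OF H01_HG[OF u]]]
    have "J u \<le> (LINT x|M. e / P * (norm (u x))\<^sup>2 + C * \<bar>u x\<bar> powr q)"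
      unfolding J_def
    proof (rule integral_mono_AE)
      show "integrable M (\<lambda>x. F x (u x))" by (rule J_integrable[OF u])
      show "integrable M (\<lambda>x. e / P * (norm (u x))\<^sup>2 + C * \<bar>u x\<bar> powr q)"
        by (intro Bochner_Integration.integrable_add integrable_mult_right i2 V_integrable[OF u])
      have "AE x in M. x \<in> \<Omega>" using AE_space[of M] by (simp add: space_restrict_space)
      with reg show "AE x in M. F x (u x) \<le> e / P * (norm (u x))\<^sup>2 + C * \<bar>u x\<bar> powr q"
        by eventually_elim (use C in auto)
    qed
    also have "\<dots> = e / P * (LINT x|M. (norm (u x))\<^sup>2) + C * V u"
      using i2 V_integrable[OF u] by (simp add: V_def)
    also have "\<dots> \<le> e / P * (P * (nrm u)\<^sup>2) + C * (S * nrm u powr q)"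
      using P(2)[OF H01_HG[OF u]] S(2)[OF u] e P(1) C(1) by (intro add_mono mult_left_mono) (auto simp: nrm_sq[OF u])
    finally show ?thesis using P by simp
  qed
  then show ?thesis using C S by (intro exI[of _ "C * S"]) auto
qed

lemma bounded_compact:
  assumes u: "\<And>n::nat. u n \<in> H" and B: "\<And>n. nrm (u n) \<le> B"
  shows "\<exists>r w. strict_mono r \<and> w \<in> H \<and> (AE x in M. (\<lambda>n. u (r n) x) \<longlonglongrightarrow> w x) \<and>
    (\<lambda>n. inner_H01 (u (r n)) w) \<longlonglongrightarrow> (nrm w)\<^sup>2"
proof -
  have B2: "(LINT x|M. (norm (wgrad (u n) x))\<^sup>2) \<le> B\<^sup>2" for n
    using power_mono[OF B[of n] nrm_nonneg, of 2] by (simp add: nrm_sq[OF u])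
  obtain r w h where r: "strict_mono r" "H01_grad w h" "AE x in M. (\<lambda>n. u (r n) x) \<longlonglongrightarrow> w x"
     "\<And>z k. H01_grad z k \<Longrightarrow> (\<lambda>n. LINT x|M. wgrad (u (r n)) x \<bullet> k x) \<longlonglongrightarrow> (LINT x|M. h x \<bullet> k x)"
    using weak_compactness[of u "\<lambda>n. wgrad (u n)", OF H01_HG[OF u] B2] by blast
  have w: "w \<in> H" by (rule H01_grad_H01(1)[OF r(2)])
  note s = H01_grad_sqi(2)[OF r(2)] H01_grad_sqi(2)[OF H01_HG[OF w]]
  have "(LINT x|M. h x \<bullet> wgrad w x) = (LINT x|M. wgrad w x \<bullet> wgrad w x)"
    using H01_grad_H01(2)[OF r(2)] by (intro integral_cong_AE borel_measurable_integrable square_integrable_inner s) (auto elim: eventually_mono)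
  then have "(\<lambda>n. inner_H01 (u (r n)) w) \<longlonglongrightarrow> (nrm w)\<^sup>2"
    using r(4)[OF H01_HG[OF w]] inner_H01_self[OF w] by (simp add: inner_H01_def)
  with r w show ?thesis by blast
qed

lemma fv_integrable:
  assumes u: "u \<in> H" and k: "k \<in> H"
  shows "integrable M (\<lambda>x. f x (u x) * k x)"
proof -
  obtain C where C: "C \<ge> 0" "\<And>x u k w. regular_at c p (f x) \<Longrightarrow> \<bar>w\<bar> \<le> \<bar>u\<bar> + \<bar>k\<bar> \<Longrightarrow>
     \<bar>f x w\<bar> * \<bar>k\<bar> \<le> 1 * \<bar>k\<bar> powr q + C * (1 + \<bar>u\<bar> powr q)" using f_bound_eps[of 1] by auto
  have i: "integrable M (\<lambda>x. \<bar>k x\<bar> powr q + C * (1 + \<bar>u x\<bar> powr q))"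
    by (intro Bochner_Integration.integrable_add integrable_mult_right V_integrable u k const_integrable)
  show ?thesis
  proof (rule Bochner_Integration.integrable_bound[OF i])
    show "(\<lambda>x. f x (u x) * k x) \<in> borel_measurable M"
      by (intro borel_measurable_times f_comp_measurable H_meas u k)
    show "AE x in M. norm (f x (u x) * k x) \<le> norm (\<bar>k x\<bar> powr q + C * (1 + \<bar>u x\<bar> powr q))"
      using reg
    proof eventually_elim
      case (elim x)
      have "\<bar>f x (u x)\<bar> * \<bar>k x\<bar> \<le> \<bar>k x\<bar> powr q + C * (1 + \<bar>u x\<bar> powr q)"
        using C(2)[OF elim, of "u x" "u x" "k x"] by simp
      then show ?case by (simp add: abs_mult)
    qed
  qed
qed

lemma uv_integrable:
  assumes u: "u \<in> H" and k: "k \<in> H"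
  shows "integrable M (\<lambda>x. \<bar>u x\<bar> powr (q - 2) * u x * k x)"
proof -
  have i: "integrable M (\<lambda>x. 2 powr q * (\<bar>u x\<bar> powr q + \<bar>k x\<bar> powr q))"
    by (intro Bochner_Integration.integrable_add integrable_mult_right V_integrable u k)
  have [measurable]: "u \<in> borel_measurable M" "k \<in> borel_measurable M" using u k by (auto intro: H_meas)
  have "\<bar>\<bar>u x\<bar> powr (q - 2) * u x * k x\<bar> \<le> 2 powr q * (\<bar>u x\<bar> powr q + \<bar>k x\<bar> powr q)" for x
  proof -
    define s where "s = \<bar>u x\<bar> + \<bar>k x\<bar>"
    have "\<bar>u x\<bar> * \<bar>u x\<bar> powr (q - 1 - 1) \<le> \<bar>u x\<bar> powr (q - 1)" by (rule mult_powr_le) auto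
    also have "\<dots> \<le> s powr (q - 1)" using q by (intro powr_mono2) (auto simp: s_def)
    finally have "\<bar>k x\<bar> * (\<bar>u x\<bar> * \<bar>u x\<bar> powr (q - 1 - 1)) \<le> \<bar>k x\<bar> * s powr (q - 1)" by (rule mult_left_mono) simp
    also have "\<dots> \<le> s powr q" by (rule mult_powr_le) (auto simp: s_def)
    also have "\<dots> \<le> 2 powr q * (\<bar>u x\<bar> powr q + \<bar>k x\<bar> powr q)" unfolding s_def using q by (intro powr_add_le) auto
    finally show ?thesis by (simp add: abs_mult mult_ac)
  qed
  then show ?thesis
    by (intro Bochner_Integration.integrable_bound[OF i]) (auto intro: order_trans[OF _ abs_ge_self])
qed

text \<open>\<open>powr_taylor\<close> in the normalized direction \<open>k\<close> with
  \<open>t = nrm h\<close>; the Sobolev inequality bounds \<open>V k\<close> by a constant.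
  Increments of norm 0 cannot be normalized, but they vanish almost everywhere.\<close>

lemma V_frechet:
  assumes u: "u \<in> H"
  shows "\<exists>C\<ge>0. \<forall>h\<in>H. nrm h \<le> 1 \<longrightarrow>
    \<bar>V (\<lambda>x. u x + h x) - V u - q * (LINT x|M. \<bar>u x\<bar> powr (q - 2) * u x * h x)\<bar> \<le> C * (nrm h)\<^sup>2"
proof -
  obtain S where S: "S > 0" "\<And>u. u \<in> H \<Longrightarrow> V u \<le> S * nrm u powr q" using sob by blast
  define A where "A = q * (q - 1) * 2 powr q"
  have A: "A \<ge> 0" using q by (simp add: A_def)
  have "\<bar>V (\<lambda>x. u x + h x) - V u - q * (LINT x|M. \<bar>u x\<bar> powr (q - 2) * u x * h x)\<bar> \<le> A * (V u + S) * (nrm h)\<^sup>2"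
    if h: "h \<in> H" and t1: "nrm h \<le> 1" for h
  proof (cases "nrm h = 0")
    case True
    then have ae: "AE x in M. h x = 0" using zero_iff[OF h] by simp
    have "V (\<lambda>x. u x + h x) = V u"
      unfolding V_def using ae
      by (intro integral_cong_AE borel_measurable_integrable V_integrable[OF H_add[OF u h]] V_integrable[OF u])
         (auto elim: eventually_mono)
    moreover have "(LINT x|M. \<bar>u x\<bar> powr (q - 2) * u x * h x) = (LINT x|M. 0)"
      using ae by (intro integral_cong_AE borel_measurable_integrable uv_integrable u h) (auto elim: eventually_mono)
    ultimately show ?thesis using True by simp
  next
    case False
    define t where "t = nrm h"
    have t: "0 < t" "t \<le> 1" using False nrm_nonneg[of h] t1 by (auto simp: t_def)
    define k where "k x = 1 / t * h x" for x
    have k: "k \<in> H" unfolding k_def by (rule H_scale[OF h])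
    have nk: "nrm k = 1" unfolding k_def nrm_scale[OF h] using t by (simp add: t_def)
    have hk: "h x = t * k x" for x using t by (simp add: k_def)
    have "V (\<lambda>x. u x + h x) - V u - q * (LINT x|M. \<bar>u x\<bar> powr (q - 2) * u x * h x)
       = (LINT x|M. \<bar>u x + h x\<bar> powr q - \<bar>u x\<bar> powr q - q * (\<bar>u x\<bar> powr (q - 2) * u x * h x))"
      unfolding V_def using V_integrable[OF u] V_integrable[OF H_add[OF u h]] uv_integrable[OF u h] by simp
    then have "\<bar>V (\<lambda>x. u x + h x) - V u - q * (LINT x|M. \<bar>u x\<bar> powr (q - 2) * u x * h x)\<bar>
        \<le> (LINT x|M. \<bar>\<bar>u x + h x\<bar> powr q - \<bar>u x\<bar> powr q - q * (\<bar>u x\<bar> powr (q - 2) * u x * h x)\<bar>)"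
      by (simp only: integral_abs_bound)
    also have "\<dots> \<le> (LINT x|M. A * t\<^sup>2 * (\<bar>u x\<bar> powr q + \<bar>k x\<bar> powr q))"
    proof (rule integral_mono)
      show "integrable M (\<lambda>x. \<bar>\<bar>u x + h x\<bar> powr q - \<bar>u x\<bar> powr q - q * (\<bar>u x\<bar> powr (q - 2) * u x * h x)\<bar>)"
      proof (rule integrable_abs, rule Bochner_Integration.integrable_diff, rule Bochner_Integration.integrable_diff)
        show "integrable M (\<lambda>x. \<bar>u x + h x\<bar> powr q)" by (rule V_integrable[OF H_add[OF u h]])
        show "integrable M (\<lambda>x. \<bar>u x\<bar> powr q)" by (rule V_integrable[OF u])
        show "integrable M (\<lambda>x. q * (\<bar>u x\<bar> powr (q - 2) * u x * h x))"
          by (rule integrable_mult_right) (rule uv_integrable[OF u h])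
      qed
      have "integrable M (\<lambda>x. \<bar>u x\<bar> powr q + \<bar>k x\<bar> powr q)"
        by (rule Bochner_Integration.integrable_add[OF V_integrable[OF u] V_integrable[OF k]])
      then show "integrable M (\<lambda>x. A * t\<^sup>2 * (\<bar>u x\<bar> powr q + \<bar>k x\<bar> powr q))"
        by (rule integrable_mult_right)
      fix x
      show "\<bar>\<bar>u x + h x\<bar> powr q - \<bar>u x\<bar> powr q - q * (\<bar>u x\<bar> powr (q - 2) * u x * h x)\<bar> \<le> A * t\<^sup>2 * (\<bar>u x\<bar> powr q + \<bar>k x\<bar> powr q)"
        using powr_taylor[OF q(1), of t "u x" "k x"] t unfolding hk A_def by (simp add: mult_ac)
    qed
    also have "\<dots> = A * t\<^sup>2 * (V u + V k)" using V_integrable[OF u] V_integrable[OF k] by (simp add: V_def)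
    also have "\<dots> \<le> A * t\<^sup>2 * (V u + S)" using S(2)[OF k] nk A by (intro mult_left_mono) auto
    finally show ?thesis by (simp add: t_def mult_ac)
  qed
  then show ?thesis using A S V_nonneg[of u] by (intro exI[of _ "A * (V u + S)"]) auto
qed

text \<open>\<open>f\<close> is only continuous, so no quadratic remainder is available. Instead a
  sequence of increments violating the claim is normalized; compactness provides directions
  converging almost everywhere, along which the errors of the difference quotients tend to 0 in L^1,
  although they should stay above \<open>e\<close>.\<close>

lemma J_frechet:
  assumes u: "u \<in> H" and e: "e > 0"
  shows "\<exists>d>0. \<forall>h\<in>H. nrm h < d \<longrightarrow>
    \<bar>J (\<lambda>x. u x + h x) - J u - (LINT x|M. f x (u x) * h x)\<bar> \<le> e * nrm h"
proof (rule ccontr)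
  define R where "R h = J (\<lambda>x. u x + h x) - J u - (LINT x|M. f x (u x) * h x)" for h
  assume neg: "\<not> (\<exists>d>0. \<forall>h\<in>H. nrm h < d \<longrightarrow>
    \<bar>J (\<lambda>x. u x + h x) - J u - (LINT x|M. f x (u x) * h x)\<bar> \<le> e * nrm h)"
  have "\<forall>n. \<exists>h. h \<in> H \<and> nrm h < inverse (real (Suc n)) \<and> \<not> \<bar>R h\<bar> \<le> e * nrm h"
  proof
    fix n
    have "inverse (real (Suc n)) > 0" by simp
    with neg show "\<exists>h. h \<in> H \<and> nrm h < inverse (real (Suc n)) \<and> \<not> \<bar>R h\<bar> \<le> e * nrm h"
      unfolding R_def by blast
  qed
  from choice[OF this] obtain h where h: "\<And>n. h n \<in> H" "\<And>n. nrm (h n) < inverse (real (Suc n))"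
    "\<And>n. \<not> \<bar>R (h n)\<bar> \<le> e * nrm (h n)" by blast
  define t where "t n = nrm (h n)" for n
  \<comment> \<open>An increment of norm 0 leaves both sides of the estimate equal to 0 and so
    cannot violate it.\<close>
  have t0: "t n > 0" for n
  proof (rule ccontr)
    assume "\<not> t n > 0"
    then have z: "nrm (h n) = 0" using nrm_nonneg[of "h n"] by (simp add: t_def)
    then have ae: "AE x in M. h n x = 0" using zero_iff[OF h(1)] by simp
    have "J (\<lambda>x. u x + h n x) = J u"
      unfolding J_def using ae
      by (intro integral_cong_AE borel_measurable_integrable J_integrable[OF H_add[OF u h(1)]] J_integrable[OF u])
         (auto elim: eventually_mono)
    moreover have "(LINT x|M. f x (u x) * h n x) = (LINT x|M. 0)"
      using ae by (intro integral_cong_AE borel_measurable_integrable fv_integrable u h) (auto elim: eventually_mono)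
    ultimately show False using h(3)[of n] z by (simp add: R_def)
  qed
  have t1: "t n \<le> 1" for n
  proof -
    have "t n < inverse (real (Suc n))" using h(2)[of n] by (simp add: t_def)
    also have "\<dots> \<le> 1" by (simp add: field_simps)
    finally show ?thesis by simp
  qed
  have tl: "t \<longlonglongrightarrow> 0"
  proof (rule Lim_null_comparison[OF _ LIMSEQ_inverse_real_of_nat], intro always_eventually allI)
    fix n
    show "norm (t n) \<le> inverse (real (Suc n))"
      using h(2)[of n] t0[of n] unfolding t_def real_norm_def by (simp only: abs_of_pos less_imp_le)
  qed
  define k where "k n x = 1 / t n * h n x" for n x
  have k: "k n \<in> H" for n unfolding k_def by (rule H_scale[OF h(1)])
  have nk: "nrm (k n) = 1" for n unfolding k_def nrm_scale[OF h(1)] using t0[of n] by (simp add: t_def)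
  have hk: "h n x = t n * k n x" for n x using t0[of n] by (simp add: k_def)
  obtain r w where r: "strict_mono r" "w \<in> H" "AE x in M. (\<lambda>n. k (r n) x) \<longlonglongrightarrow> w x"
    using bounded_compact[of k 1] k nk by force
  have trl: "(\<lambda>n. t (r n)) \<longlonglongrightarrow> 0" using LIMSEQ_subseq_LIMSEQ[OF tl r(1)] by (simp add: comp_def)
  define G where "G n x = (F x (u x + t (r n) * k (r n) x) - F x (u x)) / t (r n) - f x (u x) * k (r n) x" for n x
  obtain S where S: "S > 0" "\<And>u. u \<in> H \<Longrightarrow> V u \<le> S * nrm u powr q" using sob by blast
  have Gl: "(\<lambda>n. LINT x|M. \<bar>G n x\<bar>) \<longlonglongrightarrow> 0"
  proof (rule dominated_up_to_epsilon(2)[where v="\<lambda>n. k (r n)" and q=q and K=S])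
    show "G n \<in> borel_measurable M" for n
      unfolding G_def
      by (intro borel_measurable_diff borel_measurable_divide borel_measurable_const
          F_comp_measurable[OF H_meas[OF H_comb[OF u k]]] F_comp_measurable[OF H_meas[OF u]]
          borel_measurable_integrable[OF fv_integrable[OF u k]])
    show "integrable M (\<lambda>x. \<bar>k (r n) x\<bar> powr q)" for n by (rule V_integrable[OF k])
    show "(LINT x|M. \<bar>k (r n) x\<bar> powr q) \<le> S" for n using S(2)[OF k, of "r n"] nk by (simp add: V_def)
    show "AE x in M. (\<lambda>n. G n x) \<longlonglongrightarrow> 0"
      using reg r(3)
    proof eventually_elim
      case (elim x)
      have "\<forall>n. \<exists>a. 0 \<le> a \<and> a \<le> 1 \<and> F x (u x + t (r n) * k (r n) x) - F x (u x)
          = f x (u x + a * (t (r n) * k (r n) x)) * (t (r n) * k (r n) x)"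
        using F_mvt[OF elim(1)] by blast
      from choice[OF this] obtain a where a: "\<And>n. 0 \<le> a n" "\<And>n. a n \<le> 1"
        "\<And>n. F x (u x + t (r n) * k (r n) x) - F x (u x)
          = f x (u x + a n * (t (r n) * k (r n) x)) * (t (r n) * k (r n) x)" by blast
      have Ge: "G n x = f x (u x + a n * (t (r n) * k (r n) x)) * k (r n) x - f x (u x) * k (r n) x" for n
        unfolding G_def a(3) using t0[of "r n"] by simp
      have z: "(\<lambda>n. t (r n) * k (r n) x) \<longlonglongrightarrow> 0" using tendsto_mult[OF trl elim(2)] by simp
      have "(\<lambda>n. a n * (t (r n) * k (r n) x)) \<longlonglongrightarrow> 0"
      proof (rule Lim_null_comparison[OF _ tendsto_rabs_zero[OF z]])
        show "eventually (\<lambda>n. norm (a n * (t (r n) * k (r n) x)) \<le> \<bar>t (r n) * k (r n) x\<bar>) sequentially"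
          using a(1,2) by (intro always_eventually) (auto simp: abs_mult intro!: mult_left_le_one_le)
      qed
      then have l: "(\<lambda>n. u x + a n * (t (r n) * k (r n) x)) \<longlonglongrightarrow> u x + 0" by (intro tendsto_add tendsto_const)
      have "isCont (f x) (u x + 0)" using elim(1) by (simp add: regular_at_def continuous_on_eq_continuous_at)
      from isCont_tendsto_compose[OF this l]
      have "(\<lambda>n. f x (u x + a n * (t (r n) * k (r n) x)) * k (r n) x - f x (u x) * k (r n) x) \<longlonglongrightarrow> f x (u x + 0) * w x - f x (u x) * w x"
        by (intro tendsto_intros elim(2))
      then show ?case unfolding Ge by simp
    qed
    fix e' :: real assume "e' > 0"
    then obtain C where C: "C \<ge> 0" "\<And>x u k t. regular_at c p (f x) \<Longrightarrow> 0 < t \<Longrightarrow> t \<le> 1 \<Longrightarrow>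
     \<bar>(F x (u + t * k) - F x u) / t - f x u * k\<bar> \<le> e' * \<bar>k\<bar> powr q + C * (1 + \<bar>u\<bar> powr q)"
      using F_quotient_eps by blast
    show "\<exists>Hb. integrable M Hb \<and> (\<forall>n. AE x in M. \<bar>G n x\<bar> \<le> e' * \<bar>k (r n) x\<bar> powr q + Hb x)"
    proof (intro exI[of _ "\<lambda>x. C * (1 + \<bar>u x\<bar> powr q)"] conjI allI)
      show "integrable M (\<lambda>x. C * (1 + \<bar>u x\<bar> powr q))"
        by (intro integrable_mult_right Bochner_Integration.integrable_add const_integrable V_integrable u)
      show "AE x in M. \<bar>G n x\<bar> \<le> e' * \<bar>k (r n) x\<bar> powr q + C * (1 + \<bar>u x\<bar> powr q)" for n
        using reg by eventually_elim (unfold G_def, rule C(2), auto intro: t0 t1)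
    qed
  qed
  have "e \<le> (LINT x|M. \<bar>G n x\<bar>)" for n
  proof -
    let ?n = "r n"
    have i: "integrable M (\<lambda>x. F x (u x + t ?n * k ?n x))" "integrable M (\<lambda>x. F x (u x))" "integrable M (\<lambda>x. f x (u x) * k ?n x)"
      by (rule J_integrable[OF H_comb[OF u k]], rule J_integrable[OF u], rule fv_integrable[OF u k])
    have "R (h ?n) = t ?n * (LINT x|M. G n x)"
    proof -
      have "(LINT x|M. G n x) = (J (\<lambda>x. u x + t ?n * k ?n x) - J u) / t ?n - (LINT x|M. f x (u x) * k ?n x)"
        unfolding G_def J_def using i by simp
      moreover have "(LINT x|M. f x (u x) * h ?n x) = t ?n * (LINT x|M. f x (u x) * k ?n x)"
        unfolding hk by (simp add: mult.left_commute)
      moreover have "t ?n * ((X - Y) / t ?n - Z) = X - Y - t ?n * Z" for X Y Z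
        using t0[of ?n] by (simp add: field_simps)
      ultimately show ?thesis unfolding R_def by (simp only: hk)
    qed
    then have "e * t ?n < t ?n * \<bar>LINT x|M. G n x\<bar>" using h(3)[of ?n] t0[of ?n] by (simp add: t_def abs_mult)
    then have "e < \<bar>LINT x|M. G n x\<bar>" using t0[of ?n] by (simp add: mult.commute)
    also have "\<dots> \<le> (LINT x|M. \<bar>G n x\<bar>)" by (rule integral_abs_bound)
    finally show ?thesis by simp
  qed
  then have "e \<le> 0" by (intro LIMSEQ_le_const[OF Gl]) auto
  then show False using e by simp
qed

end

section \<open>Splitting of norm, critical term and lower-order term along bounded sequences\<close>

context nonlin
begin

text \<open>Norm and critical term lose exactly the contribution of the defect
  \<open>u (r n) - w\<close>: the former by weak convergence tested with \<open>w\<close>, the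
  latter by the pointwise inequality of Brezis and Lieb. \<open>J\<close> loses nothing, as its
  growth is subcritical.\<close>

lemma splitting:
  assumes u: "\<And>n::nat. u n \<in> H" and B: "\<And>n. nrm (u n) \<le> B"
  shows "\<exists>r w. strict_mono r \<and> w \<in> H \<and>
     (\<lambda>n. (nrm (u (r n)))\<^sup>2 - (nrm (\<lambda>x. u (r n) x - w x))\<^sup>2) \<longlonglongrightarrow> (nrm w)\<^sup>2 \<and>
     (\<lambda>n. V (u (r n)) - V (\<lambda>x. u (r n) x - w x)) \<longlonglongrightarrow> V w \<and>
     (\<lambda>n. J (u (r n))) \<longlonglongrightarrow> J w"
proof -
  obtain r w where r: "strict_mono r" "w \<in> H" "AE x in M. (\<lambda>n. u (r n) x) \<longlonglongrightarrow> w x"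
    "(\<lambda>n. inner_H01 (u (r n)) w) \<longlonglongrightarrow> (nrm w)\<^sup>2" using bounded_compact[of u B, OF u B] by blast
  define v where "v n x = u (r n) x - w x" for n x
  have v: "v n \<in> H" for n unfolding v_def by (rule H_diff[OF u r(2)])
  have nv: "(nrm (v n))\<^sup>2 = (nrm (u (r n)))\<^sup>2 - 2 * inner_H01 (u (r n)) w + (nrm w)\<^sup>2" for n
    using nrm_comb[OF u r(2), of "r n" "-1"] by (simp add: v_def[abs_def])
  have "(\<lambda>n. 2 * inner_H01 (u (r n)) w - (nrm w)\<^sup>2) \<longlonglongrightarrow> 2 * (nrm w)\<^sup>2 - (nrm w)\<^sup>2"
    by (intro tendsto_intros r(4))
  then have 1: "(\<lambda>n. (nrm (u (r n)))\<^sup>2 - (nrm (v n))\<^sup>2) \<longlonglongrightarrow> (nrm w)\<^sup>2" unfolding nv by simp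
  obtain S where S: "S > 0" "\<And>u. u \<in> H \<Longrightarrow> V u \<le> S * nrm u powr q" using sob by blast
  define K where "K = S * (2 * B + 2 * nrm w) powr q"
  have nvb: "nrm (v n) \<le> 2 * B + 2 * nrm w" for n
  proof -
    have B0: "0 \<le> B" using B[of 0] nrm_nonneg[of "u 0"] by linarith
    have "(nrm (v n))\<^sup>2 \<le> (nrm (u (r n)))\<^sup>2 + 2 * (nrm (u (r n)) * nrm w) + (nrm w)\<^sup>2"
      unfolding nv using inner_H01_le[OF u r(2), of "r n"] by linarith
    also have "\<dots> = (nrm (u (r n)) + nrm w)\<^sup>2" by (simp add: power2_eq_square algebra_simps)
    finally have "nrm (v n) \<le> nrm (u (r n)) + nrm w" by (rule power2_le_imp_le) (auto simp: nrm_nonneg)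
    then show ?thesis using B[of "r n"] B0 nrm_nonneg[of w] by linarith
  qed
  have VK: "(LINT x|M. \<bar>v n x\<bar> powr q) \<le> K" for n
  proof -
    have "V (v n) \<le> S * nrm (v n) powr q" by (rule S(2)[OF v])
    also have "\<dots> \<le> K" unfolding K_def using nvb[of n] nrm_nonneg S q by (intro mult_left_mono powr_mono2) auto
    finally show ?thesis by (simp add: V_def)
  qed
  have vl: "AE x in M. (\<lambda>n. v n x) \<longlonglongrightarrow> 0"
    using r(3)
  proof eventually_elim
    case (elim x)
    from tendsto_diff[OF elim tendsto_const[of "w x"]] show ?case by (simp add: v_def)
  qed
  have uv: "u (r n) x = v n x + w x" for n x by (simp add: v_def)
  have [measurable]: "v n \<in> borel_measurable M" "w \<in> borel_measurable M" for n by (auto intro: H_meas v r(2))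
  define G where "G n x = \<bar>v n x + w x\<bar> powr q - \<bar>v n x\<bar> powr q - \<bar>w x\<bar> powr q" for n x
  have Gl: "(\<lambda>n. LINT x|M. \<bar>G n x\<bar>) \<longlonglongrightarrow> 0"
  proof (rule dominated_up_to_epsilon(2)[where v=v and q=q and K=K])
    show "G n \<in> borel_measurable M" for n unfolding G_def by measurable
    show "AE x in M. (\<lambda>n. G n x) \<longlonglongrightarrow> 0"
      using vl
    proof eventually_elim
      case (elim x)
      have "(\<lambda>n. G n x) \<longlonglongrightarrow> \<bar>0 + w x\<bar> powr q - \<bar>0\<bar> powr q - \<bar>w x\<bar> powr q"
        unfolding G_def using q by (intro tendsto_diff tendsto_powr2 tendsto_rabs tendsto_add elim tendsto_const) auto
      then show ?case by simp
    qed
    fix e :: real assume "e > 0"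
    then obtain C where C: "C \<ge> 0" "\<And>u v. \<bar>\<bar>v + u\<bar> powr q - \<bar>v\<bar> powr q - \<bar>u\<bar> powr q\<bar> \<le> e * \<bar>v\<bar> powr q + C * \<bar>u\<bar> powr q"
      using brezis_lieb_pointwise[OF q(1)] by blast
    show "\<exists>Hb. integrable M Hb \<and> (\<forall>n. AE x in M. \<bar>G n x\<bar> \<le> e * \<bar>v n x\<bar> powr q + Hb x)"
      using C(2) by (intro exI[of _ "\<lambda>x. C * \<bar>w x\<bar> powr q"] conjI allI AE_I2 integrable_mult_right V_integrable r(2))
         (auto simp: G_def)
  qed (use V_integrable[OF v] VK in auto)
  have 2: "(\<lambda>n. V (u (r n)) - V (v n)) \<longlonglongrightarrow> V w"
  proof (rule LIM_zero_cancel, rule Lim_null_comparison[OF _ Gl], intro always_eventually allI)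
    fix n
    have "V (u (r n)) - V (v n) - V w = (LINT x|M. G n x)"
      unfolding G_def V_def uv[symmetric] using V_integrable[OF u] V_integrable[OF v] V_integrable[OF r(2)] by simp
    then show "norm (V (u (r n)) - V (v n) - V w) \<le> (LINT x|M. \<bar>G n x\<bar>)"
      by (simp only: real_norm_def integral_abs_bound)
  qed
  define D where "D n x = F x (w x + v n x) - F x (w x)" for n x
  have Dl: "(\<lambda>n. LINT x|M. \<bar>D n x\<bar>) \<longlonglongrightarrow> 0"
  proof (rule dominated_up_to_epsilon(2)[where v=v and q=q and K=K])
    show "D n \<in> borel_measurable M" for n
      unfolding D_def by (rule borel_measurable_diff[OF
        F_comp_measurable[OF borel_measurable_add[OF H_meas[OF r(2)] H_meas[OF v]]] F_comp_measurable[OF H_meas[OF r(2)]]])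
    show "AE x in M. (\<lambda>n. D n x) \<longlonglongrightarrow> 0"
      using vl reg
    proof eventually_elim
      case (elim x)
      have "(\<lambda>n. w x + v n x) \<longlonglongrightarrow> w x + 0" by (intro tendsto_add tendsto_const elim)
      moreover have "isCont (F x) (w x + 0)" using F_DERIV[OF elim(2)] by (rule DERIV_isCont)
      ultimately have "(\<lambda>n. F x (w x + v n x)) \<longlonglongrightarrow> F x (w x + 0)" by (rule isCont_tendsto_compose[rotated])
      from tendsto_diff[OF this tendsto_const[of "F x (w x)"]] show ?case by (simp add: D_def)
    qed
    fix e :: real assume "e > 0"
    then obtain C where C: "C \<ge> 0" "\<And>x u v. regular_at c p (f x) \<Longrightarrow>
     \<bar>F x (u + v) - F x u\<bar> \<le> e * \<bar>v\<bar> powr q + C * (1 + \<bar>u\<bar> powr q)" using F_bound_eps by blast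
    show "\<exists>Hb. integrable M Hb \<and> (\<forall>n. AE x in M. \<bar>D n x\<bar> \<le> e * \<bar>v n x\<bar> powr q + Hb x)"
    proof (intro exI[of _ "\<lambda>x. C * (1 + \<bar>w x\<bar> powr q)"] conjI allI)
      show "integrable M (\<lambda>x. C * (1 + \<bar>w x\<bar> powr q))"
        by (intro integrable_mult_right Bochner_Integration.integrable_add const_integrable V_integrable r(2))
      show "AE x in M. \<bar>D n x\<bar> \<le> e * \<bar>v n x\<bar> powr q + C * (1 + \<bar>w x\<bar> powr q)" for n
        using reg by eventually_elim (unfold D_def, rule C(2))
    qed
  qed (use V_integrable[OF v] VK in auto)
  have 3: "(\<lambda>n. J (u (r n))) \<longlonglongrightarrow> J w"
  proof (rule LIM_zero_cancel, rule Lim_null_comparison[OF _ Dl], intro always_eventually allI)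
    fix n
    have e: "u (r n) x = w x + v n x" for x by (simp add: v_def)
    have "J (u (r n)) - J w = (LINT x|M. D n x)"
      unfolding D_def J_def e[symmetric] using J_integrable[OF u] J_integrable[OF r(2)] by simp
    then show "norm (J (u (r n)) - J w) \<le> (LINT x|M. \<bar>D n x\<bar>)"
      by (simp only: real_norm_def integral_abs_bound)
  qed
  show ?thesis using r(1,2) 1 2 3 unfolding v_def by blast
qed

end

section \<open>The constant \<open>C\<^sub>2(N)\<close>\<close>

lemma half_cancel: "w > 0 \<Longrightarrow> x / (2 * w) * w = x / 2" for x w :: real
  by simp

text \<open>Strict convexity: the graph of \<open>2 powr x\<close> lies strictly below its chord
  over [0, 1]. The mean value theorem on both sides of \<open>\<theta>\<close> compares the
  slopes.\<close>

lemma two_powr_less: "0 < \<theta> \<Longrightarrow> \<theta> < 1 \<Longrightarrow> (2::real) powr \<theta> < 1 + \<theta>"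
proof -
  assume t: "0 < \<theta>" "\<theta> < 1"
  have d: "((\<lambda>x. 2 powr x) has_real_derivative 2 powr x * ln 2) (at x)" for x :: real
    by (auto intro!: derivative_eq_intros)
  obtain y where y: "0 < y" "y < \<theta>" "2 powr \<theta> - 2 powr 0 = (\<theta> - 0) * (2 powr y * ln 2 :: real)"
    using MVT2[OF t(1), of "\<lambda>x. 2 powr x" "\<lambda>x. 2 powr x * ln 2"] d by blast
  obtain z where z: "\<theta> < z" "z < 1" "2 powr 1 - 2 powr \<theta> = (1 - \<theta>) * (2 powr z * ln 2 :: real)"
    using MVT2[OF t(2), of "\<lambda>x. 2 powr x" "\<lambda>x. 2 powr x * ln 2"] d by blast
  have "(1 - \<theta>) * \<theta> * (2 powr y * ln 2) < (1 - \<theta>) * \<theta> * (2 powr z * ln 2 :: real)"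
    using t y z by (intro mult_strict_left_mono mult_strict_right_mono) auto
  moreover have "(1 - \<theta>) * \<theta> * (2 powr y * ln 2) = (1 - \<theta>) * (2 powr \<theta> - 1)" using y(3) by simp
  moreover have "(1 - \<theta>) * \<theta> * (2 powr z * ln 2) = \<theta> * (2 - 2 powr \<theta>)" using z(3) by simp
  ultimately show ?thesis by (simp add: algebra_simps)
qed

text \<open>With \<open>\<theta> = 2 / (N - 2)\<close> the hypothesis says, by weighted AM--GM, that \<open>a + b X\<close> dominates
  \<open>X\<^sup>\<theta> / S\<^sup>1\<^sup>+\<^sup>\<theta>\<close>. For the primitives the same AM--GM estimate gains the factor
  \<open>2\<^sup>\<theta> / (1 + \<theta>) < 1\<close>.\<close>

lemma lower_bound_C2:
  fixes N a b S q :: real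
  assumes N: "N > 4" and a: "a > 0" and b: "b > 0" and S: "S > 0" and q: "q = 2 * N / (N - 2)"
    and hyp: "a powr ((N - 4) / 2) * b \<ge> 2 * (N - 4) powr ((N - 4) / 2) / ((N - 2) powr ((N - 2) / 2) * S powr (N / 2))"
  shows "\<exists>\<kappa>>0. \<forall>X\<ge>0. \<kappa> * (X + X\<^sup>2) \<le> a / 2 * X + b / 4 * X\<^sup>2 - 1 / q * (X / S) powr (q / 2)"
proof -
  define \<theta> where "\<theta> = 2 / (N - 2)"
  have t: "0 < \<theta>" "\<theta> < 1" "1 - \<theta> = (N - 4) / (N - 2)" using N by (simp_all add: \<theta>_def field_simps)
  have q2: "q / 2 = 1 + \<theta>" "q = 2 * (1 + \<theta>)" using N by (simp_all add: q \<theta>_def field_simps)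
  \<comment> \<open>\<open>Q\<close> is the minimum of \<open>(a + b * X) / X powr \<theta>\<close>
    over positive \<open>X\<close>, by AM-GM with weights \<open>1 - \<theta>\<close> and
    \<open>\<theta>\<close>.\<close>
  define Q where "Q = (a / (1 - \<theta>)) powr (1 - \<theta>) * (b / \<theta>) powr \<theta>"
  \<comment> \<open>The hypothesis is raised to the power \<open>\<theta>\<close>; these identities
    turn its exponents into those of AM-GM.\<close>
  have ex: "(N - 4) / 2 * \<theta> = 1 - \<theta>" "(N - 2) / 2 * \<theta> = 1" "N / 2 * \<theta> = 1 + \<theta>"
    using N by (simp_all add: \<theta>_def field_simps)
  have lhs: "(a powr ((N - 4) / 2) * b) powr \<theta> = a powr (1 - \<theta>) * b powr \<theta>"
    by (simp only: powr_mult powr_powr ex)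
  have rhs: "(2 * (N - 4) powr ((N - 4) / 2) / ((N - 2) powr ((N - 2) / 2) * S powr (N / 2))) powr \<theta>
      = 2 powr \<theta> * (N - 4) powr (1 - \<theta>) / ((N - 2) * S powr (1 + \<theta>))"
    by (simp only: powr_mult powr_divide powr_powr ex) (use N in simp)
  have "(2 * (N - 4) powr ((N - 4) / 2) / ((N - 2) powr ((N - 2) / 2) * S powr (N / 2))) powr \<theta>
      \<le> (a powr ((N - 4) / 2) * b) powr \<theta>"
    using hyp t N S by (intro powr_mono2) auto
  then have h: "2 powr \<theta> * (N - 4) powr (1 - \<theta>) / ((N - 2) * S powr (1 + \<theta>)) \<le> a powr (1 - \<theta>) * b powr \<theta>"
    unfolding lhs rhs .
  have w: "(1 - \<theta>) powr (1 - \<theta>) * \<theta> powr \<theta> = 2 powr \<theta> * (N - 4) powr (1 - \<theta>) / (N - 2)"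
  proof -
    have "(1 - \<theta>) powr (1 - \<theta>) * \<theta> powr \<theta> = ((N - 4) / (N - 2)) powr (1 - \<theta>) * (2 / (N - 2)) powr \<theta>"
      using t(3) by (simp add: \<theta>_def)
    also have "\<dots> = 2 powr \<theta> * (N - 4) powr (1 - \<theta>) / ((N - 2) powr (1 - \<theta>) * (N - 2) powr \<theta>)"
      using N by (simp add: powr_divide)
    also have "(N - 2) powr (1 - \<theta>) * (N - 2) powr \<theta> = N - 2" using N by (simp add: powr_add[symmetric])
    finally show ?thesis .
  qed
  have QS: "1 / S powr (1 + \<theta>) \<le> Q"
  proof -
    have wp: "(1 - \<theta>) powr (1 - \<theta>) * \<theta> powr \<theta> > 0" using t by (auto intro!: mult_pos_pos)
    have "((1 - \<theta>) powr (1 - \<theta>) * \<theta> powr \<theta>) * (1 / S powr (1 + \<theta>)) \<le> a powr (1 - \<theta>) * b powr \<theta>"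
      using h unfolding w by simp
    also have "\<dots> = ((1 - \<theta>) powr (1 - \<theta>) * \<theta> powr \<theta>) * Q"
      unfolding Q_def using t(1,2) by (simp add: powr_divide)
    finally show ?thesis using wp by (simp only: mult_le_cancel_left_pos)
  qed
  define \<rho> where "\<rho> = 2 powr \<theta> / (1 + \<theta>)"
  have \<rho>: "\<rho> < 1" using two_powr_less[OF t(1,2)] t by (simp add: \<rho>_def)
  \<comment> \<open>The fraction \<open>1 - \<rho>\<close> of
    \<open>a / 2 * X + b / 4 * X\<^sup>2\<close> survives the critical term; the smaller coefficient
    makes it comparable with \<open>X + X\<^sup>2\<close>.\<close>
  define \<kappa> where "\<kappa> = (1 - \<rho>) * min (a / 2) (b / 4)"
  have \<kappa>: "\<kappa> > 0" using \<rho> a b by (simp add: \<kappa>_def)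
  have "\<kappa> * (X + X\<^sup>2) \<le> a / 2 * X + b / 4 * X\<^sup>2 - 1 / q * (X / S) powr (q / 2)" if X: "X \<ge> 0" for X
  proof (cases "X = 0")
    case True
    then show ?thesis by simp
  next
    case False
    then have X: "X > 0" using X by simp
    \<comment> \<open>AM-GM again, now for the coefficients \<open>a / 2\<close> and
      \<open>b / 4\<close> of the primitives. Halving one and quartering the other produces the
      power \<open>2 powr (1 + \<theta>)\<close>, to be compared with
      \<open>q = 2 * (1 + \<theta>)\<close>.\<close>
    have "(a / (2 * (1 - \<theta>))) powr (1 - \<theta>) * (b * X / (4 * \<theta>)) powr \<theta>
        \<le> (1 - \<theta>) * (a / (2 * (1 - \<theta>))) + \<theta> * (b * X / (4 * \<theta>))"
      using t(1,2) a b X by (intro Youngs_inequality_0 divide_pos_pos mult_pos_pos) auto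
    also have "\<dots> = a / 2 + b / 4 * X"
      using half_cancel[of "1 - \<theta>" a] t(1,2) by (simp add: mult.commute[of "1 - \<theta>"])
    also have "(a / (2 * (1 - \<theta>))) powr (1 - \<theta>) * (b * X / (4 * \<theta>)) powr \<theta> = Q * X powr \<theta> / 2 powr (1 + \<theta>)"
    proof -
      have 1: "a / (2 * (1 - \<theta>)) = (a / (1 - \<theta>)) * (1 / 2)" "b * X / (4 * \<theta>) = (b / \<theta>) * X * (1 / 4)" by simp_all
      have "(1 / 2::real) powr (1 - \<theta>) * (1 / 4) powr \<theta> = 1 / 2 powr (1 + \<theta>)"
      proof -
        have "(4::real) powr \<theta> = 2 powr (2 * \<theta>)"
          using powr_powr[of 2 2 \<theta>] by (simp add: powr_numeral)
        then have "(1 / 2::real) powr (1 - \<theta>) * (1 / 4) powr \<theta> = 1 / (2 powr (1 - \<theta>) * 2 powr (2 * \<theta>))"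
          by (simp add: powr_divide)
        also have "(2::real) powr (1 - \<theta>) * 2 powr (2 * \<theta>) = 2 powr ((1 - \<theta>) + 2 * \<theta>)" by (rule powr_add[symmetric])
        also have "(1 - \<theta>) + 2 * \<theta> = 1 + \<theta>" by simp
        finally show ?thesis .
      qed
      note c = this
      have "(a / (2 * (1 - \<theta>))) powr (1 - \<theta>) * (b * X / (4 * \<theta>)) powr \<theta>
          = Q * X powr \<theta> * ((1 / 2) powr (1 - \<theta>) * (1 / 4) powr \<theta>)"
        unfolding 1 powr_mult Q_def by (simp only: mult_ac)
      then show ?thesis unfolding c by simp
    qed
    finally have am: "Q * X powr \<theta> / 2 powr (1 + \<theta>) \<le> a / 2 + b / 4 * X" .
    have "1 / q * (X / S) powr (q / 2) = X * (1 / q * (X powr \<theta> * (1 / S powr (1 + \<theta>))))"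
      unfolding q2(1) using X S by (simp add: powr_divide powr_add)
    also have "\<dots> \<le> X * (1 / q * (X powr \<theta> * Q))"
      using X QS t q2(2) by (intro mult_left_mono) auto
    also have "1 / q * (X powr \<theta> * Q) = \<rho> * (Q * X powr \<theta> / 2 powr (1 + \<theta>))"
    proof -
      have "1 / (2 * w) * (x * Q) = y / w * (Q * x / (2 * y))" if "y > 0" for x y w :: real
        using that by (simp add: field_simps)
      from this[of "2 powr \<theta>" "1 + \<theta>" "X powr \<theta>"] show ?thesis
        unfolding \<rho>_def q2(2) by (simp add: powr_add)
    qed
    also have "X * (\<rho> * (Q * X powr \<theta> / 2 powr (1 + \<theta>))) \<le> X * (\<rho> * (a / 2 + b / 4 * X))"
      using am X t by (intro mult_left_mono) (auto simp: \<rho>_def)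
    finally have 1: "1 / q * (X / S) powr (q / 2) \<le> X * (\<rho> * (a / 2 + b / 4 * X))" .
    have "\<kappa> * (X + X\<^sup>2) = (1 - \<rho>) * (min (a / 2) (b / 4) * X + min (a / 2) (b / 4) * X\<^sup>2)"
      by (simp add: \<kappa>_def algebra_simps)
    also have "\<dots> \<le> (1 - \<rho>) * (a / 2 * X + b / 4 * X\<^sup>2)"
      using \<rho> X by (intro mult_left_mono add_mono mult_right_mono) auto
    also have "\<dots> = a / 2 * X + b / 4 * X\<^sup>2 - X * (\<rho> * (a / 2 + b / 4 * X))"
    proof -
      have "X * (\<rho> * (a / 2 + b / 4 * X)) = \<rho> * (a / 2 * X + b / 4 * X\<^sup>2)"
        by (simp add: power2_eq_square algebra_simps)
      then show ?thesis by (simp only: left_diff_distrib mult_1)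
    qed
    finally show ?thesis using 1 by linarith
  qed
  with \<kappa> show ?thesis by blast
qed

section \<open>Coercivity and the derivative of the energy\<close>

context nonlin
begin

lemma energy_eq: "energy \<Omega> a b f lam u = a / 2 * (nrm u)\<^sup>2 + b / 4 * nrm u ^ 4 - 1 / q * V u - lam * J u"
proof -
  have "Lq_norm q \<Omega> u powr q = V u"
    using q V_nonneg[of u] by (simp add: Lq_norm_def powr_powr V_def[symmetric])
  then show ?thesis unfolding energy_def by (simp add: q_def[symmetric] J_def)
qed

lemma sobolev_const_bound:
  shows "sobolev_const \<Omega> > 0" "u \<in> H \<Longrightarrow> V u \<le> ((nrm u)\<^sup>2 / sobolev_const \<Omega>) powr (q / 2)"
proof -
  obtain S where S: "S > 0" "\<And>u. u \<in> H \<Longrightarrow> V u \<le> S * nrm u powr q" using sob by blast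
  define R where "R u = (nrm u)\<^sup>2 / (Lq_norm q \<Omega> u)\<^sup>2" for u
  have sc: "sobolev_const \<Omega> = (INF u\<in>H01_nonzero \<Omega>. R u)" by (simp add: sobolev_const_def R_def q_def)
  have L2: "(Lq_norm q \<Omega> u)\<^sup>2 = V u powr (2 / q)" for u
  proof -
    have "(Lq_norm q \<Omega> u)\<^sup>2 = (V u powr (1 / q)) powr 2" by (simp add: Lq_norm_def V_def powr_numeral)
    then show ?thesis by (simp add: powr_powr)
  qed
  have Vpos: "V u > 0" if u: "u \<in> H" "nrm u > 0" for u
  proof (rule ccontr)
    assume "\<not> V u > 0"
    then have "V u = 0" using V_nonneg[of u] by simp
    then have "AE x in M. \<bar>u x\<bar> powr q = 0"
      unfolding V_def using V_integrable[OF u(1)] by (subst (asm) integral_nonneg_eq_0_iff_AE) auto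
    then have "AE x in M. u x = 0" by eventually_elim simp
    then show False using zero_iff[OF u(1)] u by simp
  qed
  have R_ge: "1 / S powr (2 / q) \<le> R u" if u: "u \<in> H01_nonzero \<Omega>" for u
  proof -
    have u': "u \<in> H" "nrm u > 0" using u by (auto simp: nonzero_nrm)
    have "V u powr (2 / q) \<le> (S * nrm u powr q) powr (2 / q)" using S(2)[OF u'(1)] V_nonneg q by (intro powr_mono2) auto
    also have "\<dots> = S powr (2 / q) * (nrm u)\<^sup>2" using q u' by (simp add: powr_mult powr_powr powr_numeral)
    finally have "V u powr (2 / q) \<le> S powr (2 / q) * (nrm u)\<^sup>2" .
    then show ?thesis unfolding R_def L2 using Vpos[OF u'] S(1) by (simp add: field_simps)
  qed
  have "1 / S powr (2 / q) \<le> sobolev_const \<Omega>" unfolding sc by (rule cINF_greatest[OF nonzero_ex R_ge])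
  moreover have "1 / S powr (2 / q) > 0" using S(1) by simp
  ultimately show pos: "sobolev_const \<Omega> > 0" by linarith
  assume u: "u \<in> H"
  show "V u \<le> ((nrm u)\<^sup>2 / sobolev_const \<Omega>) powr (q / 2)"
  proof (cases "nrm u > 0")
    case False
    then have "nrm u = 0" using nrm_nonneg[of u] by simp
    then have "V u \<le> 0" using S(2)[OF u] by simp
    then show ?thesis using powr_ge_zero by (rule order_trans)
  next
    case True
    have un: "u \<in> H01_nonzero \<Omega>" using u True by (simp add: nonzero_nrm)
    have "sobolev_const \<Omega> \<le> R u" unfolding sc
      by (rule cINF_lower[OF _ un]) (auto intro!: bdd_belowI2[of _ 0] simp: R_def)
    then have "sobolev_const \<Omega> \<le> (nrm u)\<^sup>2 / V u powr (2 / q)" by (simp add: R_def L2)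
    then have "V u powr (2 / q) \<le> (nrm u)\<^sup>2 / sobolev_const \<Omega>" using pos Vpos[OF u True] by (simp add: field_simps)
    then have "(V u powr (2 / q)) powr (q / 2) \<le> ((nrm u)\<^sup>2 / sobolev_const \<Omega>) powr (q / 2)" using q by (intro powr_mono2) auto
    then show ?thesis using q V_nonneg[of u] by (simp add: powr_powr)
  qed
qed

lemma coercive:
  assumes a: "a > 0" and b: "b > 0" and C2: "a powr ((real DIM('a) - 4) / 2) * b \<ge> C2_const \<Omega>"
  shows "\<exists>\<kappa>>0. \<forall>u\<in>H. \<kappa> * ((nrm u)\<^sup>2 + nrm u ^ 4) \<le> a / 2 * (nrm u)\<^sup>2 + b / 4 * nrm u ^ 4 - 1 / q * V u"
proof -
  have N: "real DIM('a) > 4" using N4 by simp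
  obtain \<kappa> where k: "\<kappa> > 0" "\<And>X. X \<ge> 0 \<Longrightarrow> \<kappa> * (X + X\<^sup>2) \<le> a / 2 * X + b / 4 * X\<^sup>2 - 1 / q * (X / sobolev_const \<Omega>) powr (q / 2)"
    using lower_bound_C2[OF N a b sobolev_const_bound(1) _ C2[unfolded C2_const_def Let_def], of q]
    by (auto simp: q_def crit_exp_def)
  have "\<kappa> * ((nrm u)\<^sup>2 + nrm u ^ 4) \<le> a / 2 * (nrm u)\<^sup>2 + b / 4 * nrm u ^ 4 - 1 / q * V u" if u: "u \<in> H" for u
  proof -
    have "1 / q * V u \<le> 1 / q * ((nrm u)\<^sup>2 / sobolev_const \<Omega>) powr (q / 2)"
      using sobolev_const_bound(2)[OF u] q by (intro mult_left_mono) auto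
    moreover have "((nrm u)\<^sup>2)\<^sup>2 = nrm u ^ 4" by (simp add: power_mult[symmetric])
    ultimately show ?thesis using k(2)[of "(nrm u)\<^sup>2"] by simp
  qed
  with k(1) show ?thesis by blast
qed

definition dE :: "real \<Rightarrow> real \<Rightarrow> real \<Rightarrow> ('a \<Rightarrow> real) \<Rightarrow> ('a \<Rightarrow> real) \<Rightarrow> real" where
  "dE a b lam u h = (a + b * (nrm u)\<^sup>2) * inner_H01 u h - (LINT x|M. \<bar>u x\<bar> powr (q - 2) * u x * h x) - lam * (LINT x|M. f x (u x) * h x)"

lemma dE_scale: "u \<in> H \<Longrightarrow> h \<in> H \<Longrightarrow> dE a b lam u (\<lambda>x. t * h x) = t * dE a b lam u h"
proof -
  assume u: "u \<in> H" and h: "h \<in> H"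
  have "(LINT x|M. \<bar>u x\<bar> powr (q - 2) * u x * (t * h x)) = t * (LINT x|M. \<bar>u x\<bar> powr (q - 2) * u x * h x)"
    by (simp add: mult.left_commute[of _ t])
  moreover have "(LINT x|M. f x (u x) * (t * h x)) = t * (LINT x|M. f x (u x) * h x)"
    by (simp add: mult.left_commute[of _ t])
  ultimately show ?thesis unfolding dE_def inner_H01_scale[OF u h] by (simp add: algebra_simps)
qed

lemma energy_frechet:
  assumes u: "u \<in> H" and e: "e > 0" and a: "a > 0" and b: "b > 0"
  shows "\<exists>d>0. \<forall>h\<in>H. nrm h < d \<longrightarrow>
    \<bar>energy \<Omega> a b f lam (\<lambda>x. u x + h x) - energy \<Omega> a b f lam u - dE a b lam u h\<bar> \<le> e * nrm h"
proof -
  define s where "s = nrm u"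
  have s: "s \<ge> 0" by (simp add: s_def nrm_nonneg)
  obtain C where C: "C \<ge> 0" "\<And>h. h \<in> H \<Longrightarrow> nrm h \<le> 1 \<Longrightarrow>
    \<bar>V (\<lambda>x. u x + h x) - V u - q * (LINT x|M. \<bar>u x\<bar> powr (q - 2) * u x * h x)\<bar> \<le> C * (nrm h)\<^sup>2"
    using V_frechet[OF u] by blast
  define e' where "e' = e / (2 * (\<bar>lam\<bar> + 1))"
  have e': "e' > 0" using e by (simp add: e'_def)
  have le': "\<bar>lam\<bar> * e' \<le> e / 2" using e by (simp add: e'_def field_simps)
  obtain d1 where d1: "d1 > 0" "\<And>h. h \<in> H \<Longrightarrow> nrm h < d1 \<Longrightarrow>
    \<bar>J (\<lambda>x. u x + h x) - J u - (LINT x|M. f x (u x) * h x)\<bar> \<le> e' * nrm h"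
    using J_frechet[OF u e'] by blast
  \<comment> \<open>Collects the coefficients of \<open>t\<^sup>2\<close> in the remainders of the
    Kirchhoff part and of the critical term; below \<open>t = e / (2 * K)\<close> they amount to at
    most \<open>e / 2 * t\<close>.\<close>
  define K where "K = a / 2 + b / 4 * (2 * s\<^sup>2 + (2 * s + 1)\<^sup>2) + C / q + 1"
  have K: "K > 0" unfolding K_def using a b C q by (intro add_nonneg_pos add_nonneg_nonneg) auto
  define d where "d = min 1 (min d1 (e / (2 * K)))"
  have d: "d > 0" using d1 e K by (simp add: d_def)
  have "\<bar>energy \<Omega> a b f lam (\<lambda>x. u x + h x) - energy \<Omega> a b f lam u - dE a b lam u h\<bar> \<le> e * nrm h"
    if h: "h \<in> H" and hd: "nrm h < d" for h
  proof -
    define t where "t = nrm h"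
    have t: "0 \<le> t" "t \<le> 1" "t < d1" "t < e / (2 * K)" using hd nrm_nonneg[of h] by (auto simp: t_def d_def)
    define i where "i = inner_H01 u h"
    have i: "\<bar>i\<bar> \<le> s * t" unfolding i_def s_def t_def by (rule inner_H01_le[OF u h])
    define X where "X = (nrm (\<lambda>x. u x + h x))\<^sup>2"
    have X: "X = s\<^sup>2 + (2 * i + t\<^sup>2)" using nrm_comb[OF u h, of 1] by (simp add: X_def s_def i_def t_def)
    have p4: "nrm (\<lambda>x. u x + h x) ^ 4 = X\<^sup>2" "nrm u ^ 4 = (s\<^sup>2)\<^sup>2" by (simp_all add: X_def s_def power_mult[symmetric])
    define v where "v = V (\<lambda>x. u x + h x) - V u - q * (LINT x|M. \<bar>u x\<bar> powr (q - 2) * u x * h x)"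
    define j where "j = J (\<lambda>x. u x + h x) - J u - (LINT x|M. f x (u x) * h x)"
    \<comment> \<open>The part of the Kirchhoff terms beyond first order, obtained by expanding
      \<open>X = s\<^sup>2 + (2 * i + t\<^sup>2)\<close> and removing the terms linear in
      \<open>i\<close> alone.\<close>
    define n where "n = a / 2 * t\<^sup>2 + b / 4 * (2 * s\<^sup>2 * t\<^sup>2 + (2 * i + t\<^sup>2)\<^sup>2)"
    have eq: "energy \<Omega> a b f lam (\<lambda>x. u x + h x) - energy \<Omega> a b f lam u - dE a b lam u h = n - v / q - lam * j"
    proof -
      have "1 / q * V (\<lambda>x. u x + h x) = 1 / q * V u + (LINT x|M. \<bar>u x\<bar> powr (q - 2) * u x * h x) + v / q"
        using q by (simp add: v_def field_simps)
      moreover have "lam * J (\<lambda>x. u x + h x) = lam * J u + lam * (LINT x|M. f x (u x) * h x) + lam * j"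
        by (simp add: j_def algebra_simps)
      moreover have "a / 2 * X + b / 4 * X\<^sup>2 = a / 2 * s\<^sup>2 + b / 4 * s ^ 4 + (a + b * s\<^sup>2) * i + n"
        unfolding X n_def by (simp add: power2_eq_square power4_eq_xxxx field_simps)
      ultimately show ?thesis unfolding energy_eq dE_def p4 X_def[symmetric] s_def[symmetric] i_def[symmetric] by linarith
    qed
    have tt: "t\<^sup>2 \<le> t" using t by (simp add: power2_eq_square mult_left_le_one_le)
    have "\<bar>2 * i + t\<^sup>2\<bar> \<le> 2 * (s * t) + t" using i tt t zero_le_power2[of t] by (intro abs_leI; linarith)
    also have "\<dots> = (2 * s + 1) * t" by (simp add: algebra_simps)
    finally have "(2 * i + t\<^sup>2)\<^sup>2 \<le> ((2 * s + 1) * t)\<^sup>2" using s t by (subst power2_le_iff_abs_le) auto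
    then have "2 * s\<^sup>2 * t\<^sup>2 + (2 * i + t\<^sup>2)\<^sup>2 \<le> (2 * s\<^sup>2 + (2 * s + 1)\<^sup>2) * t\<^sup>2"
      unfolding power_mult_distrib[of "2 * s + 1"] distrib_right[of "2 * s\<^sup>2"] by linarith
    then have n1: "n \<le> a / 2 * t\<^sup>2 + b / 4 * ((2 * s\<^sup>2 + (2 * s + 1)\<^sup>2) * t\<^sup>2)"
      unfolding n_def using b by (intro add_left_mono mult_left_mono) auto
    have n0: "n \<ge> 0" unfolding n_def using a b by (intro add_nonneg_nonneg mult_nonneg_nonneg) auto
    have vb: "\<bar>v / q\<bar> \<le> C / q * t\<^sup>2" using C(2)[OF h] t q unfolding v_def[symmetric] t_def[symmetric]
      by (simp add: abs_divide divide_right_mono)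
    have jb: "\<bar>lam * j\<bar> \<le> e / 2 * t"
    proof -
      have "\<bar>lam * j\<bar> \<le> \<bar>lam\<bar> * (e' * t)"
        using d1(2)[OF h] t unfolding abs_mult j_def[symmetric] t_def[symmetric] by (intro mult_left_mono) auto
      also have "\<dots> \<le> e / 2 * t" using mult_right_mono[OF le' t(1)] by simp
      finally show ?thesis .
    qed
    have "\<bar>n - v / q - lam * j\<bar> \<le> n + \<bar>v / q\<bar> + \<bar>lam * j\<bar>" using n0 by linarith
    also have "\<dots> \<le> K * t\<^sup>2 + e / 2 * t"
    proof -
      have "K * t\<^sup>2 = a / 2 * t\<^sup>2 + b / 4 * ((2 * s\<^sup>2 + (2 * s + 1)\<^sup>2) * t\<^sup>2) + C / q * t\<^sup>2 + t\<^sup>2"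
        by (simp add: K_def algebra_simps)
      moreover have "0 \<le> t\<^sup>2" by simp
      ultimately show ?thesis using n1 vb jb by linarith
    qed
    also have "K * t\<^sup>2 \<le> e / 2 * t"
    proof -
      have "K * t \<le> e / 2" using t(4) K by (simp add: field_simps)
      then have "(K * t) * t \<le> e / 2 * t" using t by (intro mult_right_mono) auto
      then show ?thesis by (simp add: power2_eq_square mult.assoc)
    qed
    finally show ?thesis unfolding eq by (simp add: t_def)
  qed
  with d show ?thesis by blast
qed

text \<open>The chain rule along a ray. The defining conditions of \<open>lambda0\<close> include a
  vanishing derivative of the fiber, so differentiability has to be established there.\<close>

lemma fiber_deriv:
  assumes u: "u \<in> H" and a: "a > 0" and b: "b > 0"
  shows "(fiber \<Omega> a b f lam u has_real_derivative dE a b lam (\<lambda>x. t * u x) u) (at t)"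
  unfolding DERIV_def
proof (rule LIM_I)
  fix e :: real assume e: "e > 0"
  define e' where "e' = e / (2 * (nrm u + 1))"
  have e': "e' > 0" using e nrm_nonneg[of u] by (simp add: e'_def add_nonneg_pos)
  note tu = H_scale[OF u, of t]
  obtain d where d: "d > 0" "\<And>h. h \<in> H \<Longrightarrow> nrm h < d \<Longrightarrow>
    \<bar>energy \<Omega> a b f lam (\<lambda>x. t * u x + h x) - energy \<Omega> a b f lam (\<lambda>x. t * u x) - dE a b lam (\<lambda>x. t * u x) h\<bar> \<le> e' * nrm h"
    using energy_frechet[OF tu e' a b] by blast
  show "\<exists>s>0. \<forall>x. x \<noteq> 0 \<and> norm (x - 0) < s \<longrightarrow>
      norm ((fiber \<Omega> a b f lam u (t + x) - fiber \<Omega> a b f lam u t) / x - dE a b lam (\<lambda>x. t * u x) u) < e"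
  proof (intro exI[of _ "d / (nrm u + 1)"] conjI allI impI)
    show "d / (nrm u + 1) > 0" using d nrm_nonneg[of u] by (intro divide_pos_pos) auto
    fix x :: real assume x: "x \<noteq> 0 \<and> norm (x - 0) < d / (nrm u + 1)"
    have "\<bar>x\<bar> * nrm u \<le> \<bar>x\<bar> * (nrm u + 1)" by (intro mult_left_mono) auto
    also have "\<dots> < d" using x nrm_nonneg[of u] by (simp add: field_simps)
    finally have "nrm (\<lambda>y. x * u y) < d" by (simp add: nrm_scale[OF u])
    from d(2)[OF H_scale[OF u] this]
    have "\<bar>fiber \<Omega> a b f lam u (t + x) - fiber \<Omega> a b f lam u t - x * dE a b lam (\<lambda>x. t * u x) u\<bar> \<le> e' * (\<bar>x\<bar> * nrm u)"
      unfolding fiber_def dE_scale[OF tu u] nrm_scale[OF u] by (simp add: distrib_right)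
    also have "fiber \<Omega> a b f lam u (t + x) - fiber \<Omega> a b f lam u t - x * dE a b lam (\<lambda>x. t * u x) u
      = x * ((fiber \<Omega> a b f lam u (t + x) - fiber \<Omega> a b f lam u t) / x - dE a b lam (\<lambda>x. t * u x) u)"
      using x by (simp add: field_simps)
    finally have "\<bar>x\<bar> * \<bar>(fiber \<Omega> a b f lam u (t + x) - fiber \<Omega> a b f lam u t) / x - dE a b lam (\<lambda>x. t * u x) u\<bar> \<le> \<bar>x\<bar> * (e' * nrm u)"
      by (simp add: abs_mult mult_ac)
    then have "\<bar>(fiber \<Omega> a b f lam u (t + x) - fiber \<Omega> a b f lam u t) / x - dE a b lam (\<lambda>x. t * u x) u\<bar> \<le> e' * nrm u"
      using x by simp
    also have "\<dots> \<le> e' * (nrm u + 1)" using e' by (intro mult_left_mono) auto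
    also have "\<dots> = e / 2" unfolding e'_def using nrm_nonneg[of u] half_cancel[of "nrm u + 1" e] by simp
    also have "\<dots> < e" using e by simp
    finally show "norm ((fiber \<Omega> a b f lam u (t + x) - fiber \<Omega> a b f lam u t) / x - dE a b lam (\<lambda>x. t * u x) u) < e" by simp
  qed
qed

text \<open>At a local minimizer the first variation is nonnegative in every direction, and being
  odd in the direction it vanishes. The weak equation is this identity written out, and the Frechet
  expansion gives criticality.\<close>

lemma stationary:
  assumes u: "u \<in> H" and a: "a > 0" and b: "b > 0" and min: "local_minimizer \<Omega> (energy \<Omega> a b f lam) u"
  shows "weak_solution \<Omega> a b f lam u" "critical_point \<Omega> (energy \<Omega> a b f lam) u"
proof -
  obtain r where r: "r > 0" "\<And>v. v \<in> H \<Longrightarrow> nrm (\<lambda>x. v x - u x) < r \<Longrightarrow> energy \<Omega> a b f lam u \<le> energy \<Omega> a b f lam v"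
    using min unfolding local_minimizer_def by blast
  have ge: "dE a b lam u h \<ge> 0" if h: "h \<in> H" for h
  proof -
    have "- (e * (nrm h + 1)) \<le> dE a b lam u h" if e: "e > 0" for e
    proof -
      obtain d where d: "d > 0" "\<And>h. h \<in> H \<Longrightarrow> nrm h < d \<Longrightarrow>
        \<bar>energy \<Omega> a b f lam (\<lambda>x. u x + h x) - energy \<Omega> a b f lam u - dE a b lam u h\<bar> \<le> e * nrm h"
        using energy_frechet[OF u e a b] by blast
      define t where "t = min d r / (2 * (nrm h + 1))"
      have h1: "nrm h + 1 > 0" using nrm_nonneg[of h] by simp
      have t: "t > 0" using d r h1 by (simp add: t_def)
      have "t * nrm h \<le> t * (nrm h + 1)" using t by (intro mult_left_mono) auto
      also have "\<dots> = min d r / 2" unfolding t_def by (rule half_cancel[OF h1])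
      finally have th: "t * nrm h < d" "t * nrm h < r" using d r by linarith+
      have n: "nrm (\<lambda>x. t * h x) = t * nrm h" using t by (simp add: nrm_scale[OF h])
      have "energy \<Omega> a b f lam u \<le> energy \<Omega> a b f lam (\<lambda>x. u x + t * h x)"
        by (rule r(2)[OF H_comb[OF u h]]) (simp add: n th)
      moreover have "\<bar>energy \<Omega> a b f lam (\<lambda>x. u x + t * h x) - energy \<Omega> a b f lam u - t * dE a b lam u h\<bar> \<le> e * (t * nrm h)"
        using d(2)[OF H_scale[OF h], of t] th by (simp add: n dE_scale[OF u h])
      ultimately have "0 \<le> t * (dE a b lam u h + e * nrm h)" by (simp add: algebra_simps)
      then have "0 \<le> dE a b lam u h + e * nrm h" using t by (simp add: zero_le_mult_iff)
      then show ?thesis using e by (simp add: algebra_simps)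
    qed
    note * = this
    show ?thesis
    proof (rule ccontr)
      assume "\<not> 0 \<le> dE a b lam u h"
      then have n: "dE a b lam u h < 0" by simp
      have h1: "nrm h + 1 > 0" using nrm_nonneg[of h] by simp
      have "- (- dE a b lam u h / (2 * (nrm h + 1)) * (nrm h + 1)) \<le> dE a b lam u h"
        using n h1 by (intro * divide_pos_pos) auto
      then show False unfolding half_cancel[OF h1] using n by simp
    qed
  qed
  have z: "dE a b lam u h = 0" if h: "h \<in> H" for h
    using ge[OF h] ge[OF H_scale[OF h, of "-1"]] dE_scale[OF u h, of a b lam "-1"] by simp
  show "weak_solution \<Omega> a b f lam u"
    unfolding weak_solution_def
  proof (intro conjI ballI u)
    fix v assume v: "v \<in> H"
    from z[OF v] show "(a + b * (LINT x|M. (norm (wgrad u x))\<^sup>2)) * (LINT x|M. wgrad u x \<bullet> wgrad v x)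
      = (LINT x|M. \<bar>u x\<bar> powr (crit_exp DIM('a) - 2) * u x * v x) + lam * (LINT x|M. f x (u x) * v x)"
      unfolding dE_def nrm_sq[OF u] inner_H01_def q_def by simp
  qed
  show "critical_point \<Omega> (energy \<Omega> a b f lam) u"
    unfolding critical_point_def
  proof (intro conjI allI impI u)
    fix e :: real assume e: "e > 0"
    obtain d where d: "d > 0" "\<And>h. h \<in> H \<Longrightarrow> nrm h < d \<Longrightarrow>
        \<bar>energy \<Omega> a b f lam (\<lambda>x. u x + h x) - energy \<Omega> a b f lam u - dE a b lam u h\<bar> \<le> e * nrm h"
      using energy_frechet[OF u e a b] by blast
    have "\<bar>energy \<Omega> a b f lam v - energy \<Omega> a b f lam u\<bar> \<le> e * nrm (\<lambda>x. v x - u x)"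
      if v: "v \<in> H" and n: "nrm (\<lambda>x. v x - u x) < d" for v
      using d(2)[OF H_diff[OF v u] n] z[OF H_diff[OF v u]] by simp
    then show "\<exists>d>0. \<forall>v\<in>H. nrm (\<lambda>x. v x - u x) < d \<longrightarrow>
      \<bar>energy \<Omega> a b f lam v - energy \<Omega> a b f lam u\<bar> \<le> e * nrm (\<lambda>x. v x - u x)" using d(1) by blast
  qed
qed

end

section \<open>The extremal parameter and the local minimizer\<close>

lemma powr_le_squares: "0 \<le> s \<Longrightarrow> 2 < q \<Longrightarrow> q < 4 \<Longrightarrow> s powr q \<le> s\<^sup>2 + s ^ 4" for s q :: real
proof -
  assume s: "0 \<le> s" "2 < q" "q < 4"
  consider "s = 0" | "0 < s" "s \<le> 1" | "1 < s" using s by linarith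
  then show ?thesis
  proof cases
    case 2
    have "s powr q \<le> s powr 2" using 2 s by (intro powr_mono') auto
    also have "\<dots> = s\<^sup>2" using 2 by (simp add: powr_numeral)
    finally show ?thesis using s by (simp add: add_increasing2)
  next
    case 3
    have "s powr q \<le> s powr 4" using 3 s by (intro powr_mono) auto
    also have "\<dots> = s ^ 4" using 3 by (simp add: powr_numeral)
    finally show ?thesis using s by (simp add: add_increasing)
  qed (use s in simp)
qed

text \<open>The bound \<open>lower\<close> is assumed in place of the condition on \<open>a\<close>
  and \<open>b\<close>: from here on \<open>C2_const\<close> is felt only through
  \<open>\<kappa>\<close>.\<close>

locale kirchhoff = nonlin \<Omega> f c p for \<Omega> :: "'a::euclidean_space set" and f c p +
  fixes a b \<kappa> :: real
  assumes a: "a > 0" and b: "b > 0" and \<kappa>: "\<kappa> > 0"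
    and lower: "\<And>u. u \<in> H01 \<Omega> \<Longrightarrow> \<kappa> * ((H01_norm \<Omega> u)\<^sup>2 + H01_norm \<Omega> u ^ 4)
      \<le> a / 2 * (H01_norm \<Omega> u)\<^sup>2 + b / 4 * H01_norm \<Omega> u ^ 4 - 1 / q * V u"
begin

definition \<Phi> :: "('a \<Rightarrow> real) \<Rightarrow> real" where
  "\<Phi> u = a / 2 * (nrm u)\<^sup>2 + b / 4 * nrm u ^ 4 - 1 / q * V u"

definition growth :: "('a \<Rightarrow> real) \<Rightarrow> real" where "growth u = (nrm u)\<^sup>2 + nrm u ^ 4"

lemma energy_\<Phi>: "energy \<Omega> a b f lam u = \<Phi> u - lam * J u"
  by (simp add: energy_eq \<Phi>_def)

lemma lower': "u \<in> H \<Longrightarrow> \<kappa> * growth u \<le> \<Phi> u"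
  using lower by (simp add: \<Phi>_def growth_def)

lemma growth_bounds: "0 \<le> growth u" "(nrm u)\<^sup>2 \<le> growth u" "nrm u > 0 \<Longrightarrow> 0 < growth u" "nrm u \<le> 1 + growth u"
proof -
  show "0 \<le> growth u" "(nrm u)\<^sup>2 \<le> growth u" by (simp_all add: growth_def nrm_nonneg)
  show "nrm u > 0 \<Longrightarrow> 0 < growth u" unfolding growth_def by (intro add_pos_pos) auto
  have "nrm u \<le> 1 + (nrm u)\<^sup>2" using zero_le_power2[of "nrm u - 1/2"] by (simp add: power2_eq_square algebra_simps)
  also have "\<dots> \<le> 1 + growth u" by (simp add: growth_def nrm_nonneg)
  finally show "nrm u \<le> 1 + growth u" .
qed

section \<open>Comparison of the lower-order term with the quadratic and quartic terms\<close>

lemma J_le_sz: "\<exists>C>0. \<forall>u\<in>H. J u \<le> C * growth u"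
proof -
  obtain C where C: "C \<ge> 0" "\<And>u. u \<in> H \<Longrightarrow> J u \<le> 1 * (nrm u)\<^sup>2 + C * nrm u powr q" using J_small[of 1] by auto
  have "J u \<le> (1 + C) * growth u" if u: "u \<in> H" for u
  proof -
    have "C * nrm u powr q \<le> C * growth u"
      unfolding growth_def using powr_le_squares[OF nrm_nonneg q(1,2)] C(1) by (intro mult_left_mono) auto
    then show ?thesis using C(2)[OF u] growth_bounds(2)[of u] by (simp add: algebra_simps)
  qed
  then show ?thesis using C(1) by (intro exI[of _ "1 + C"]) auto
qed

lemma J_near_zero:
  assumes L: "L \<ge> 0"
  shows "\<exists>r>0. \<forall>u\<in>H. nrm u \<le> r \<longrightarrow> L * J u \<le> \<kappa> / 2 * (nrm u)\<^sup>2"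
proof -
  \<comment> \<open>The quadratic term takes one quarter of \<open>\<kappa>\<close>; the other
    quarter is reserved for the critical power and determines \<open>r\<close>.\<close>
  define e where "e = \<kappa> / (4 * (L + 1))"
  have e: "e > 0" using \<kappa> L by (simp add: e_def)
  have Le: "L * e \<le> \<kappa> / 4"
  proof -
    have "L * e \<le> (L + 1) * e" using e by (intro mult_right_mono) auto
    also have "\<dots> = \<kappa> / 4"
      using half_cancel[of "L + 1" "\<kappa> / 2"] L by (simp add: e_def mult.commute mult.assoc)
    finally show ?thesis .
  qed
  obtain C where C: "C \<ge> 0" "\<And>u. u \<in> H \<Longrightarrow> J u \<le> e * (nrm u)\<^sup>2 + C * nrm u powr q" using J_small[OF e] by auto
  define D where "D = L * C + 1"
  have D: "D > 0" using L C by (simp add: D_def add_nonneg_pos)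
  define r where "r = (\<kappa> / (4 * D)) powr (1 / (q - 2))"
  have r: "r > 0" using \<kappa> D by (simp add: r_def)
  have rq: "r powr (q - 2) = \<kappa> / (4 * D)" using \<kappa> D q by (simp add: r_def powr_powr)
  have "L * J u \<le> \<kappa> / 2 * (nrm u)\<^sup>2" if u: "u \<in> H" and n: "nrm u \<le> r" for u
  proof -
    define s where "s = nrm u"
    have s: "0 \<le> s" "s \<le> r" using n nrm_nonneg by (auto simp: s_def)
    have "s powr q = s powr (q - 2) * s\<^sup>2"
    proof (cases "s = 0")
      case False
      then have "s > 0" using s by simp
      then show ?thesis using powr_add[of s "q - 2" 2] by (simp add: powr_numeral)
    qed simp
    also have "\<dots> \<le> r powr (q - 2) * s\<^sup>2" using s q by (intro mult_right_mono powr_mono2) auto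
    finally have "D * s powr q \<le> D * (\<kappa> / (4 * D) * s\<^sup>2)" unfolding rq using D by (intro mult_left_mono) auto
    also have "\<dots> = \<kappa> / 4 * s\<^sup>2" using D by simp
    finally have 1: "D * s powr q \<le> \<kappa> / 4 * s\<^sup>2" .
    have "L * J u \<le> L * (e * s\<^sup>2 + C * s powr q)" using C(2)[OF u] L unfolding s_def by (intro mult_left_mono) auto
    also have "\<dots> = (L * e) * s\<^sup>2 + L * C * s powr q" by (simp add: algebra_simps)
    also have "\<dots> \<le> \<kappa> / 4 * s\<^sup>2 + D * s powr q" using Le by (intro add_mono mult_right_mono) (auto simp: D_def)
    finally show ?thesis using 1 by (simp add: s_def)
  qed
  with r show ?thesis by blast
qed

lemma J_coercive:
  assumes L: "L \<ge> 0"
  shows "\<exists>Y\<ge>0. \<forall>u\<in>H. L * J u \<le> \<kappa> / 2 * growth u + Y"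
proof -
  define e where "e = \<kappa> / (2 * (L + 1))"
  have e: "e > 0" using \<kappa> L by (simp add: e_def)
  have Le: "L * e \<le> \<kappa> / 2"
  proof -
    have "L * e \<le> (L + 1) * e" using e by (intro mult_right_mono) auto
    also have "\<dots> = \<kappa> / 2"
      using half_cancel[of "L + 1" \<kappa>] L by (simp add: e_def mult.commute)
    finally show ?thesis .
  qed
  obtain C where C: "C \<ge> 0" "\<And>u. u \<in> H \<Longrightarrow> J u \<le> e * (nrm u)\<^sup>2 + C * nrm u powr q" using J_small[OF e] by auto
  \<comment> \<open>\<open>subcritical\<close> with the exponents \<open>q + 1\<close> and 5: since
    \<open>q < 4\<close>, the critical power is a small multiple of the fourth power up to a
    constant.\<close>
  obtain C2 where C2: "C2 \<ge> 0" "\<And>s. s \<ge> 0 \<Longrightarrow> (C + 1) * (1 + s powr (q + 1 - 1)) \<le> e * s powr (5 - 1) + C2"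
    using subcritical[OF _ _ _ e, of "C + 1" "q + 1" 5] C(1) q by auto
  have "L * J u \<le> \<kappa> / 2 * growth u + L * C2" if u: "u \<in> H" for u
  proof -
    have "C * nrm u powr q \<le> (C + 1) * (1 + nrm u powr q)" using C(1) by (simp add: algebra_simps)
    also have "\<dots> \<le> e * nrm u ^ 4 + C2" using C2(2)[OF nrm_nonneg, of u] nrm_nonneg[of u] by (simp add: powr_numeral)
    finally have "J u \<le> e * growth u + C2" using C(2)[OF u] by (simp add: growth_def algebra_simps)
    then have "L * J u \<le> L * (e * growth u + C2)" using L by (rule mult_left_mono)
    also have "\<dots> = (L * e) * growth u + L * C2" by (simp add: algebra_simps)
    also have "\<dots> \<le> \<kappa> / 2 * growth u + L * C2" using Le growth_bounds(1)[of u] by (intro add_right_mono mult_right_mono) auto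
    finally show ?thesis .
  qed
  then show ?thesis using L C2(1) by (intro exI[of _ "L * C2"]) auto
qed

section \<open>Minimization along rays and the extremal parameter\<close>

lemma ray_continuous:
  assumes u: "u \<in> H"
  shows "isCont (\<lambda>t. \<Phi> (\<lambda>x. t * u x)) t" "isCont (\<lambda>t. J (\<lambda>x. t * u x)) t"
proof -
  \<comment> \<open>Every fiber map is continuous. The parameter 0 isolates \<open>\<Phi>\<close>,
    and comparison with the parameter -1 isolates \<open>J\<close>.\<close>
  have c: "isCont (\<lambda>t. \<Phi> (\<lambda>x. t * u x) - lam * J (\<lambda>x. t * u x)) t" for lam
    using DERIV_isCont[OF fiber_deriv[OF u a b, of lam t]] by (simp add: fiber_def[abs_def] energy_\<Phi>)
  show 1: "isCont (\<lambda>t. \<Phi> (\<lambda>x. t * u x)) t" using c[of 0] by simp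
  have "isCont (\<lambda>t. (\<Phi> (\<lambda>x. t * u x) - (-1) * J (\<lambda>x. t * u x)) - \<Phi> (\<lambda>x. t * u x)) t"
    by (intro isCont_diff c 1)
  then show "isCont (\<lambda>t. J (\<lambda>x. t * u x)) t" by simp
qed

text \<open>Where the quotient is at most \<open>L\<close>, the lower bound on \<open>\<Phi>\<close>
  contradicts smallness of \<open>J\<close> near zero and its slow growth at infinity, so
  \<open>t\<close> is confined to a compact interval away from 0. The level \<open>L\<close> is at
  least the value at 1, so that 1 belongs to the interval.\<close>

lemma ray_minimum:
  assumes u: "u \<in> H" "nrm u > 0"
  shows "\<exists>t>0. \<forall>s>0. \<Phi> (\<lambda>x. t * u x) / J (\<lambda>x. t * u x) \<le> \<Phi> (\<lambda>x. s * u x) / J (\<lambda>x. s * u x)"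
proof -
  define g where "g t = \<Phi> (\<lambda>x. t * u x) / J (\<lambda>x. t * u x)" for t
  have tu: "(\<lambda>x. t * u x) \<in> H" for t by (rule H_scale[OF u(1)])
  have nt: "nrm (\<lambda>x. t * u x) = t * nrm u" if "t > 0" for t using that by (simp add: nrm_scale[OF u(1)])
  have Jp: "J (\<lambda>x. t * u x) > 0" if "t > 0" for t using that u by (intro J_pos tu) (simp add: nt)
  define L where "L = max 0 (g 1)"
  have L: "L \<ge> 0" "g 1 \<le> L" by (simp_all add: L_def)
  obtain r where r: "r > 0" "\<And>u. u \<in> H \<Longrightarrow> nrm u \<le> r \<Longrightarrow> L * J u \<le> \<kappa> / 2 * (nrm u)\<^sup>2" using J_near_zero[OF L(1)] by blast
  obtain Y where Y: "Y \<ge> 0" "\<And>u. u \<in> H \<Longrightarrow> L * J u \<le> \<kappa> / 2 * growth u + Y" using J_coercive[OF L(1)] by blast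
  define R where "R = 1 + 2 * Y / \<kappa>"
  have range: "r < t * nrm u \<and> t * nrm u \<le> R" if t: "t > 0" and gt: "g t \<le> L" for t
  proof -
    define w where "w x = t * u x" for x
    have w: "w \<in> H" "nrm w = t * nrm u" "J w > 0" using tu nt[OF t] Jp[OF t] by (simp_all add: w_def[abs_def])
    have "\<Phi> w \<le> L * J w" using gt w(3) by (simp add: g_def w_def[abs_def] field_simps)
    then have k: "\<kappa> * growth w \<le> L * J w" using lower'[OF w(1)] by simp
    have szp: "growth w > 0" using t u w(2) by (intro growth_bounds(3)) simp
    have "r < nrm w"
    proof (rule ccontr)
      assume "\<not> r < nrm w"
      then have "\<kappa> * growth w \<le> \<kappa> / 2 * (nrm w)\<^sup>2" using r(2)[OF w(1)] k by simp
      also have "\<dots> \<le> \<kappa> / 2 * growth w" using \<kappa> growth_bounds(2)[of w] by (intro mult_left_mono) auto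
      finally show False using \<kappa> szp by simp
    qed
    moreover have "\<kappa> / 2 * growth w \<le> Y" using k Y(2)[OF w(1)] by simp
    then have "growth w \<le> 2 * Y / \<kappa>" using \<kappa> by (simp add: field_simps)
    then have "nrm w \<le> R" using growth_bounds(4)[of w] by (simp add: R_def)
    ultimately show ?thesis using w(2) by simp
  qed
  define t1 where "t1 = r / nrm u"
  define t2 where "t2 = R / nrm u"
  have r1: "t1 < t \<and> t \<le> t2" if t: "t > 0" and gt: "g t \<le> L" for t
    using range[OF that] u(2) by (simp add: t1_def t2_def field_simps)
  have t1: "t1 > 0" using r u by (simp add: t1_def)
  have one: "1 \<in> {t1..t2}" using r1[of 1] L by simp
  have "continuous_on {t1..t2} g"
  proof (intro continuous_at_imp_continuous_on ballI)
    fix t assume "t \<in> {t1..t2}"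
    then have t: "t > 0" using t1 by simp
    show "isCont g t"
      unfolding g_def using Jp[OF t] by (intro continuous_divide ray_continuous[OF u(1)]) auto
  qed
  then obtain t0 where t0: "t0 \<in> {t1..t2}" "\<And>t. t \<in> {t1..t2} \<Longrightarrow> g t0 \<le> g t"
    using continuous_attains_inf[of "{t1..t2}" g] one by fastforce
  have "g t0 \<le> g s" if s: "s > 0" for s
  proof (cases "g s \<le> L")
    case True
    then show ?thesis using r1[OF s] t0(2)[of s] by simp
  next
    case False
    then show ?thesis using t0(2)[OF one] L by simp
  qed
  moreover have "t0 > 0" using t0(1) t1 by simp
  ultimately show ?thesis unfolding g_def by blast
qed

text \<open>The number \<open>lambda0 \<Omega> a b f u\<close> is the minimum of \<open>\<Phi> (t u) / J (t u)\<close> over \<open>t > 0\<close>.\<close>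

lemma lambda0_props:
  assumes u: "u \<in> H01_nonzero \<Omega>"
  shows "lambda0 \<Omega> a b f u * J u \<le> \<Phi> u"
    "\<exists>w. w \<in> H \<and> nrm w > 0 \<and> \<Phi> w = lambda0 \<Omega> a b f u * J w"
proof -
  have uH: "u \<in> H" "nrm u > 0" using u by (auto simp: nonzero_nrm)
  have tu: "(\<lambda>x. t * u x) \<in> H" for t by (rule H_scale[OF uH(1)])
  have nt: "nrm (\<lambda>x. t * u x) > 0" if "t > 0" for t using that uH by (simp add: nrm_scale[OF uH(1)])
  have Jp: "J (\<lambda>x. t * u x) > 0" if "t > 0" for t using that by (intro J_pos tu nt)
  have Pp: "\<Phi> (\<lambda>x. t * u x) > 0" if "t > 0" for t
  proof -
    have "0 < \<kappa> * growth (\<lambda>x. t * u x)" using \<kappa> growth_bounds(3)[OF nt[OF that]] by simp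
    also have "\<dots> \<le> \<Phi> (\<lambda>x. t * u x)" by (rule lower'[OF tu])
    finally show ?thesis .
  qed
  obtain t0 where t0: "t0 > 0" "\<And>s. s > 0 \<Longrightarrow> \<Phi> (\<lambda>x. t0 * u x) / J (\<lambda>x. t0 * u x) \<le> \<Phi> (\<lambda>x. s * u x) / J (\<lambda>x. s * u x)"
    using ray_minimum[OF uH] by blast
  define l where "l = \<Phi> (\<lambda>x. t0 * u x) / J (\<lambda>x. t0 * u x)"
  have l: "l > 0" using Pp[OF t0(1)] Jp[OF t0(1)] by (simp add: l_def)
  have eq: "\<Phi> (\<lambda>x. t0 * u x) = l * J (\<lambda>x. t0 * u x)" using Jp[OF t0(1)] by (simp add: l_def)
  have le: "l * J (\<lambda>x. s * u x) \<le> \<Phi> (\<lambda>x. s * u x)" if "s > 0" for s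
    using t0(2)[OF that] Jp[OF that] unfolding l_def[symmetric] by (simp add: field_simps)
  have fib: "fiber \<Omega> a b f lam u s = \<Phi> (\<lambda>x. s * u x) - lam * J (\<lambda>x. s * u x)" for lam s
    by (simp add: fiber_def energy_\<Phi>)
  have "lambda0 \<Omega> a b f u = l"
    unfolding lambda0_def
  proof (rule the_equality)
    have min: "fiber \<Omega> a b f l u t0 \<le> fiber \<Omega> a b f l u s" if "s > 0" for s
      unfolding fib using le[OF that] eq by simp
    note d = fiber_deriv[OF uH(1) a b, of l t0]
    have "dE a b l (\<lambda>x. t0 * u x) u = 0"
    proof (rule DERIV_local_min[OF d t0(1)], intro allI impI)
      fix y assume "\<bar>t0 - y\<bar> < t0"
      then have "y > 0" by linarith
      then show "fiber \<Omega> a b f l u t0 \<le> fiber \<Omega> a b f l u y" by (rule min)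
    qed
    then have "(fiber \<Omega> a b f l u has_real_derivative 0) (at t0)" using d by simp
    then show "l > 0 \<and> (\<exists>t>0. fiber \<Omega> a b f l u t = 0 \<and> (fiber \<Omega> a b f l u has_real_derivative 0) (at t) \<and>
        (\<forall>s>0. fiber \<Omega> a b f l u t \<le> fiber \<Omega> a b f l u s))"
      using l t0(1) min eq by (intro conjI exI[of _ t0] allI impI) (auto simp: fib)
    \<comment> \<open>Uniqueness: \<open>l\<close> is compared with \<open>lam\<close> at the zero
      \<open>t\<close> of the fiber for \<open>lam\<close>, and at \<open>t0\<close>, where the
      fiber for \<open>l\<close> vanishes. The derivative condition follows from the rest.\<close>
    fix lam
    assume "lam > 0 \<and> (\<exists>t>0. fiber \<Omega> a b f lam u t = 0 \<and> (fiber \<Omega> a b f lam u has_real_derivative 0) (at t) \<and>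
        (\<forall>s>0. fiber \<Omega> a b f lam u t \<le> fiber \<Omega> a b f lam u s))"
    then obtain t where t: "t > 0" "fiber \<Omega> a b f lam u t = 0" "\<And>s. s > 0 \<Longrightarrow> fiber \<Omega> a b f lam u t \<le> fiber \<Omega> a b f lam u s"
      by blast
    have "l * J (\<lambda>x. t * u x) \<le> lam * J (\<lambda>x. t * u x)" using le[OF t(1)] t(2) by (simp add: fib)
    then have 1: "l \<le> lam" using Jp[OF t(1)] by simp
    have "0 \<le> \<Phi> (\<lambda>x. t0 * u x) - lam * J (\<lambda>x. t0 * u x)" using t(3)[OF t0(1)] t(2) by (simp add: fib)
    then have "lam * J (\<lambda>x. t0 * u x) \<le> l * J (\<lambda>x. t0 * u x)" using eq by simp
    then have "lam \<le> l" using Jp[OF t0(1)] by simp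
    with 1 show "lam = l" by simp
  qed
  then show "lambda0 \<Omega> a b f u * J u \<le> \<Phi> u" "\<exists>w. w \<in> H \<and> nrm w > 0 \<and> \<Phi> w = lambda0 \<Omega> a b f u * J w"
    using le[of 1] eq tu[of t0] nt[OF t0(1)] by auto
qed

abbreviation "lstar \<equiv> lambda0_star \<Omega> a b f"

text \<open>The uniform bound makes the infimum \<open>lambda0_star\<close> meaningful and positive.
  It is read off at the optimal point of the ray, where \<open>\<Phi>\<close> equals
  \<open>lambda0\<close> times \<open>J\<close>.\<close>

lemma lambda0_ge: "\<exists>m>0. \<forall>u\<in>H01_nonzero \<Omega>. m \<le> lambda0 \<Omega> a b f u"
proof -
  obtain C where C: "C > 0" "\<And>u. u \<in> H \<Longrightarrow> J u \<le> C * growth u" using J_le_sz by blast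
  have "\<kappa> / C \<le> lambda0 \<Omega> a b f u" if u: "u \<in> H01_nonzero \<Omega>" for u
  proof -
    obtain w where w: "w \<in> H" "nrm w > 0" "\<Phi> w = lambda0 \<Omega> a b f u * J w" using lambda0_props(2)[OF u] by blast
    have "\<kappa> / C * J w \<le> \<kappa> / C * (C * growth w)" using C w \<kappa> by (intro mult_left_mono) auto
    also have "\<dots> \<le> lambda0 \<Omega> a b f u * J w" using lower'[OF w(1)] w(3) C(1) by simp
    finally show ?thesis using J_pos[OF w(1,2)] by (simp only: mult_le_cancel_right_pos)
  qed
  then show ?thesis using C(1) \<kappa> by (intro exI[of _ "\<kappa> / C"]) auto
qed

lemma lambda_bdd: "bdd_below (lambda0 \<Omega> a b f ` H01_nonzero \<Omega>)"
  using lambda0_ge by (auto intro: bdd_belowI2)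

lemma lstar_pos: "lstar > 0"
proof -
  obtain m where m: "m > 0" "\<And>u. u \<in> H01_nonzero \<Omega> \<Longrightarrow> m \<le> lambda0 \<Omega> a b f u" using lambda0_ge by blast
  have "m \<le> lstar" unfolding lambda0_star_def by (rule cINF_greatest[OF nonzero_ex m(2)])
  with m(1) show ?thesis by simp
qed

lemma energy_pos:
  assumes lam: "lam < lstar" and u: "u \<in> H01_nonzero \<Omega>"
  shows "energy \<Omega> a b f lam u > 0"
proof -
  have uH: "u \<in> H" "nrm u > 0" using u by (auto simp: nonzero_nrm)
  have "lstar \<le> lambda0 \<Omega> a b f u" unfolding lambda0_star_def by (rule cINF_lower[OF lambda_bdd u])
  then have "lam < lambda0 \<Omega> a b f u" using lam by simp
  then have "lam * J u < lambda0 \<Omega> a b f u * J u" using J_pos[OF uH] by simp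
  also have "\<dots> \<le> \<Phi> u" by (rule lambda0_props(1)[OF u])
  finally show ?thesis by (simp add: energy_\<Phi>)
qed

section \<open>Minimization outside a small ball\<close>

lemma nrm_triangle: "u \<in> H \<Longrightarrow> v \<in> H \<Longrightarrow> nrm u \<le> nrm v + nrm (\<lambda>x. v x - u x)"
proof -
  assume u: "u \<in> H" and v: "v \<in> H"
  note d = H_diff[OF v u]
  have "(nrm u)\<^sup>2 = (nrm v)\<^sup>2 - 2 * inner_H01 v (\<lambda>x. v x - u x) + (nrm (\<lambda>x. v x - u x))\<^sup>2"
    using nrm_comb[OF v d, of "-1"] by simp
  also have "\<dots> \<le> (nrm v)\<^sup>2 + 2 * (nrm v * nrm (\<lambda>x. v x - u x)) + (nrm (\<lambda>x. v x - u x))\<^sup>2"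
    using inner_H01_le[OF v d] by linarith
  also have "\<dots> = (nrm v + nrm (\<lambda>x. v x - u x))\<^sup>2" by (simp add: power2_eq_square algebra_simps)
  finally show ?thesis by (rule power2_le_imp_le) (simp add: nrm_nonneg)
qed

text \<open>\<open>y n\<close> is the squared norm of the defect. The energy splits into that of the
  limit, that of the defect at \<open>lam = 0\<close>, and a cross term from the square of the
  squared norm; the defect part is at least \<open>\<kappa> * y n\<close>.\<close>

lemma split_energy:
  assumes u: "\<And>n::nat. u n \<in> H" and B: "\<And>n. nrm (u n) \<le> B"
  shows "\<exists>r w y e. strict_mono r \<and> w \<in> H \<and> (\<forall>n. 0 \<le> y n) \<and> e \<longlonglongrightarrow> 0 \<and>
     (\<forall>n. \<kappa> * y n + energy \<Omega> a b f lam w + e n \<le> energy \<Omega> a b f lam (u (r n))) \<and>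
     (\<lambda>n. (nrm (u (r n)))\<^sup>2 - y n) \<longlonglongrightarrow> (nrm w)\<^sup>2"
proof -
  obtain r w where r: "strict_mono r" "w \<in> H"
     "(\<lambda>n. (nrm (u (r n)))\<^sup>2 - (nrm (\<lambda>x. u (r n) x - w x))\<^sup>2) \<longlonglongrightarrow> (nrm w)\<^sup>2"
     "(\<lambda>n. V (u (r n)) - V (\<lambda>x. u (r n) x - w x)) \<longlonglongrightarrow> V w" "(\<lambda>n. J (u (r n))) \<longlonglongrightarrow> J w"
    using splitting[of u B, OF u B] by blast
  define v where "v n x = u (r n) x - w x" for n x
  have v: "v n \<in> H" for n unfolding v_def by (rule H_diff[OF u r(2)])
  define X where "X n = (nrm (u (r n)))\<^sup>2" for n
  define y where "y n = (nrm (v n))\<^sup>2" for n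
  define z where "z = (nrm w)\<^sup>2"
  define A where "A n = X n - y n - z" for n
  \<comment> \<open>The error that remains when all three splittings are treated as exact; the
    quartic part vanishes because \<open>X\<close> is bounded.\<close>
  define e where "e n = a / 2 * A n + b / 4 * (A n * (2 * X n - A n)) - 1 / q * (V (u (r n)) - V (v n) - V w) - lam * (J (u (r n)) - J w)" for n
  have p4: "nrm k ^ 4 = ((nrm k)\<^sup>2)\<^sup>2" for k by (simp add: power_mult[symmetric])
  have A0: "A \<longlonglongrightarrow> 0" unfolding A_def X_def y_def z_def using r(3) by (intro LIM_zero) (simp add: v_def[abs_def])
  have B0: "0 \<le> B" using B[of 0] nrm_nonneg[of "u 0"] by linarith
  have XB: "X n \<le> B\<^sup>2" for n unfolding X_def by (intro power_mono B nrm_nonneg)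
  have X0: "0 \<le> X n" for n by (simp add: X_def)
  have AX: "(\<lambda>n. A n * X n) \<longlonglongrightarrow> 0"
  proof (rule Lim_null_comparison)
    show "eventually (\<lambda>n. norm (A n * X n) \<le> \<bar>A n\<bar> * B\<^sup>2) sequentially"
      using XB X0 by (intro always_eventually allI) (auto simp: abs_mult intro!: mult_left_mono)
    show "(\<lambda>n. \<bar>A n\<bar> * B\<^sup>2) \<longlonglongrightarrow> 0" using tendsto_mult[OF tendsto_rabs_zero[OF A0] tendsto_const[of "B\<^sup>2"]] by simp
  qed
  have "e \<longlonglongrightarrow> 0"
  proof -
    have "(\<lambda>n. a / 2 * A n + b / 4 * (2 * (A n * X n) - A n * A n) - 1 / q * (V (u (r n)) - V (v n) - V w) - lam * (J (u (r n)) - J w))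
       \<longlonglongrightarrow> a / 2 * 0 + b / 4 * (2 * 0 - 0 * 0) - 1 / q * 0 - lam * 0"
      using r(4,5) by (intro tendsto_intros A0 AX LIM_zero) (simp add: v_def[abs_def])
    moreover have "(\<lambda>n. a / 2 * A n + b / 4 * (2 * (A n * X n) - A n * A n) - 1 / q * (V (u (r n)) - V (v n) - V w) - lam * (J (u (r n)) - J w)) = e"
      unfolding e_def by (intro ext) (simp add: algebra_simps)
    ultimately show ?thesis by simp
  qed
  moreover have "\<kappa> * y n + energy \<Omega> a b f lam w + e n \<le> energy \<Omega> a b f lam (u (r n))" for n
  proof -
    have "\<kappa> * y n \<le> \<kappa> * growth (v n)" using \<kappa> growth_bounds(2)[of "v n"] by (simp add: y_def)
    also have "\<dots> \<le> a / 2 * y n + b / 4 * (y n)\<^sup>2 - 1 / q * V (v n)"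
      using lower'[OF v, of n] unfolding \<Phi>_def y_def p4 .
    finally have 1: "\<kappa> * y n \<le> a / 2 * y n + b / 4 * (y n)\<^sup>2 - 1 / q * V (v n)" .
    \<comment> \<open>The nonlocal cross term between defect and limit has the favourable sign and
      is dropped.\<close>
    have 2: "0 \<le> b / 2 * (y n * z)" using b by (simp add: y_def z_def)
    have Xe: "X n = y n + z + A n" by (simp add: A_def)
    have 3: "a / 2 * X n + b / 4 * (X n)\<^sup>2 = (a / 2 * y n + b / 4 * (y n)\<^sup>2) + (a / 2 * z + b / 4 * z\<^sup>2)
        + b / 2 * (y n * z) + (a / 2 * A n + b / 4 * (A n * (2 * X n - A n)))"
      unfolding Xe by (simp add: power2_eq_square field_simps)
    have 4: "energy \<Omega> a b f lam (u (r n)) = a / 2 * X n + b / 4 * (X n)\<^sup>2 - 1 / q * V (u (r n)) - lam * J (u (r n))"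
      unfolding energy_eq p4 X_def ..
    have 5: "energy \<Omega> a b f lam w = a / 2 * z + b / 4 * z\<^sup>2 - 1 / q * V w - lam * J w"
      unfolding energy_eq p4 z_def ..
    have 6: "1 / q * (V (u (r n)) - V (v n) - V w) = 1 / q * V (u (r n)) - 1 / q * V (v n) - 1 / q * V w"
      "lam * (J (u (r n)) - J w) = lam * J (u (r n)) - lam * J w" by (simp_all add: right_diff_distrib)
    show ?thesis unfolding 4 5 e_def 6 using 1 2 3 by linarith
  qed
  moreover have "(\<lambda>n. (nrm (u (r n)))\<^sup>2 - y n) \<longlonglongrightarrow> (nrm w)\<^sup>2" using r(3) by (simp add: y_def v_def[abs_def])
  moreover have "0 \<le> y n" for n by (simp add: y_def)
  ultimately show ?thesis using r(1,2) by blast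
qed

text \<open>A weak limit of a minimizing sequence cannot fall into the ball of radius \<open>r\<close>: both the limit and the
  defect contribute at least \<open>\<kappa> / 2\<close> times their squared norms to the energy.\<close>

lemma interior_minimizer:
  assumes lam: "0 < lam" "lam \<le> L" and r: "r > 0"
    and near: "\<And>u. u \<in> H \<Longrightarrow> nrm u \<le> r \<Longrightarrow> L * J u \<le> \<kappa> / 2 * (nrm u)\<^sup>2"
    and Y: "\<And>u. u \<in> H \<Longrightarrow> L * J u \<le> \<kappa> / 2 * growth u + Y"
    and w: "w \<in> H" "nrm w \<ge> r" "energy \<Omega> a b f lam w < \<kappa> / 2 * r\<^sup>2"
  shows "\<exists>u\<in>H. nrm u > r \<and> (\<forall>v\<in>H. nrm v \<ge> r \<longrightarrow> energy \<Omega> a b f lam u \<le> energy \<Omega> a b f lam v)"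
proof -
  define E where "E = energy \<Omega> a b f lam"
  define S where "S = {u \<in> H. nrm u \<ge> r}"
  define m where "m = Inf (E ` S)"
  have wS: "w \<in> S" using w by (simp add: S_def)
  \<comment> \<open>Since \<open>J\<close> is nonnegative, estimates for the fixed \<open>L\<close>
    serve every \<open>lam\<close> below it, so \<open>r\<close> and \<open>Y\<close> need not
    depend on \<open>lam\<close>.\<close>
  have lamJ: "lam * J u \<le> L * J u" for u using lam J_nonneg[of u] by (intro mult_right_mono) auto
  have coer: "\<kappa> / 2 * growth u - Y \<le> E u" if u: "u \<in> H" for u
    using lower'[OF u] Y[OF u] lamJ[of u] by (simp add: E_def energy_\<Phi>)
  have near': "\<kappa> / 2 * (nrm u)\<^sup>2 \<le> E u" if u: "u \<in> H" "nrm u \<le> r" for u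
  proof -
    have "\<kappa> * (nrm u)\<^sup>2 \<le> \<kappa> * growth u" using \<kappa> growth_bounds(2)[of u] by simp
    then show ?thesis using lower'[OF u(1)] near[OF u] lamJ[of u] by (simp add: E_def energy_\<Phi>)
  qed
  have bb: "bdd_below (E ` S)"
  proof (rule bdd_belowI2)
    fix u assume "u \<in> S"
    then have u: "u \<in> H" by (simp add: S_def)
    have "0 \<le> \<kappa> / 2 * growth u" using \<kappa> growth_bounds(1)[of u] by simp
    then show "- Y \<le> E u" using coer[OF u] by simp
  qed
  have mle: "m \<le> E u" if "u \<in> S" for u unfolding m_def by (rule cINF_lower[OF bb that])
  have m_lt: "m < \<kappa> / 2 * r\<^sup>2" using mle[OF wS] w(3) by (simp add: E_def)
  define iv where "iv n = inverse (real (Suc n))" for n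
  have iv: "iv \<longlonglongrightarrow> 0" unfolding iv_def[abs_def] by (rule LIMSEQ_inverse_real_of_nat)
  have iv1: "iv n \<le> 1" for n by (simp add: iv_def field_simps)
  have "\<forall>n. \<exists>u. u \<in> S \<and> E u < m + iv n"
  proof
    fix n
    have "m < m + iv n" by (simp add: iv_def)
    then show "\<exists>u. u \<in> S \<and> E u < m + iv n"
      using cINF_less_iff[OF _ bb, of "m + iv n"] wS unfolding m_def by blast
  qed
  from choice[OF this] obtain u where u: "\<And>n. u n \<in> S" "\<And>n. E (u n) < m + iv n" by blast
  have uH: "u n \<in> H" "nrm (u n) \<ge> r" for n using u(1)[of n] by (auto simp: S_def)
  have ub: "nrm (u n) \<le> 1 + 2 * (m + 1 + Y) / \<kappa>" for n
  proof -
    have "\<kappa> / 2 * growth (u n) \<le> m + 1 + Y" using coer[OF uH(1), of n] u(2)[of n] iv1[of n] by linarith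
    then have "growth (u n) \<le> 2 * (m + 1 + Y) / \<kappa>" using \<kappa> by (simp add: field_simps)
    then show ?thesis using growth_bounds(4)[of "u n"] by linarith
  qed
  obtain k v y e where k: "strict_mono k" "v \<in> H" "\<And>n. 0 \<le> y n" "e \<longlonglongrightarrow> 0"
     "\<And>n. \<kappa> * y n + E v + e n \<le> E (u (k n))"
     "(\<lambda>n. (nrm (u (k n)))\<^sup>2 - y n) \<longlonglongrightarrow> (nrm v)\<^sup>2"
    using split_energy[of u, OF uH(1) ub, of lam] unfolding E_def by blast
  have ivk: "(\<lambda>n. iv (k n)) \<longlonglongrightarrow> 0" using LIMSEQ_subseq_LIMSEQ[OF iv k(1)] by (simp add: comp_def)
  have up: "\<kappa> * y n + E v + e n \<le> m + iv (k n)" for n using k(5)[of n] u(2)[of "k n"] by linarith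
  have Evm: "E v \<le> m"
  proof (rule LIMSEQ_le)
    show "(\<lambda>n. E v + e n) \<longlonglongrightarrow> E v" using tendsto_add[OF tendsto_const[of "E v"] k(4)] by simp
    show "(\<lambda>n. m + iv (k n)) \<longlonglongrightarrow> m" using tendsto_add[OF tendsto_const[of m] ivk] by simp
    have "E v + e n \<le> m + iv (k n)" for n using up[of n] mult_nonneg_nonneg[OF less_imp_le[OF \<kappa>] k(3), of n] by linarith
    then show "\<exists>N. \<forall>n\<ge>N. E v + e n \<le> m + iv (k n)" by blast
  qed
  have vr: "nrm v > r"
  proof (rule ccontr)
    assume "\<not> nrm v > r"
    then have vb: "\<kappa> / 2 * (nrm v)\<^sup>2 \<le> E v" using near'[OF k(2)] by simp
    have "\<kappa> / 2 * r\<^sup>2 \<le> m"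
    proof (rule LIMSEQ_le)
      define D where "D n = (nrm (u (k n)))\<^sup>2 - y n - (nrm v)\<^sup>2" for n
      have D: "D \<longlonglongrightarrow> 0" unfolding D_def using k(6) by (rule LIM_zero)
      show "(\<lambda>n. \<kappa> / 2 * (r\<^sup>2 - D n) + e n) \<longlonglongrightarrow> \<kappa> / 2 * r\<^sup>2"
        using tendsto_add[OF tendsto_mult[OF tendsto_const[of "\<kappa> / 2"] tendsto_diff[OF tendsto_const[of "r\<^sup>2"] D]] k(4)] by simp
      show "(\<lambda>n. m + iv (k n)) \<longlonglongrightarrow> m" using tendsto_add[OF tendsto_const[of m] ivk] by simp
      have "\<kappa> / 2 * (r\<^sup>2 - D n) + e n \<le> m + iv (k n)" for n
      proof -
        have "r\<^sup>2 \<le> (nrm (u (k n)))\<^sup>2" using r uH(2)[of "k n"] by (intro power_mono) auto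
        then have "r\<^sup>2 - D n \<le> y n + (nrm v)\<^sup>2" by (simp add: D_def)
        then have "\<kappa> / 2 * (r\<^sup>2 - D n) \<le> \<kappa> / 2 * (y n + (nrm v)\<^sup>2)" using \<kappa> by (intro mult_left_mono) auto
        also have "\<dots> = \<kappa> / 2 * y n + \<kappa> / 2 * (nrm v)\<^sup>2" by (rule distrib_left)
        also have "\<kappa> / 2 * y n \<le> \<kappa> * y n" using \<kappa> k(3)[of n] by (intro mult_right_mono) auto
        finally show ?thesis using up[of n] vb by linarith
      qed
      then show "\<exists>N. \<forall>n\<ge>N. \<kappa> / 2 * (r\<^sup>2 - D n) + e n \<le> m + iv (k n)" by blast
    qed
    with m_lt show False by simp
  qed
  have "E v \<le> E x" if "x \<in> H" "nrm x \<ge> r" for x using Evm mle[of x] that by (simp add: S_def)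
  with vr k(2) show ?thesis unfolding E_def by blast
qed

lemma existence:
  "\<exists>\<epsilon>>0. \<forall>lam. lstar - \<epsilon> < lam \<and> lam < lstar \<longrightarrow>
     (\<exists>u\<in>H01_nonzero \<Omega>. local_minimizer \<Omega> (energy \<Omega> a b f lam) u)"
proof -
  \<comment> \<open>One bound for all parameters that occur: \<open>lam\<close> lies below
    \<open>lambda0_star\<close>, and \<open>l\<close> exceeds it by less than
    \<open>\<delta> \<le> 1\<close>.\<close>
  define L where "L = lstar + 1"
  have L: "L \<ge> 0" "L > 0" using lstar_pos by (simp_all add: L_def)
  obtain r where r: "r > 0" "\<And>u. u \<in> H \<Longrightarrow> nrm u \<le> r \<Longrightarrow> L * J u \<le> \<kappa> / 2 * (nrm u)\<^sup>2" using J_near_zero[OF L(1)] by blast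
  obtain Y where Y: "Y \<ge> 0" "\<And>u. u \<in> H \<Longrightarrow> L * J u \<le> \<kappa> / 2 * growth u + Y" using J_coercive[OF L(1)] by blast
  \<comment> \<open>Bounds \<open>J w\<close> for every competitor with
    \<open>\<Phi> w = l * J w\<close> and \<open>l \<le> L\<close>; it must be known before
    \<open>\<delta>\<close>, and hence \<open>w\<close>, is chosen.\<close>
  define Q where "Q = 2 * Y / L + 1"
  have Q: "Q > 0" using Y L by (simp add: Q_def add_nonneg_pos)
  \<comment> \<open>Makes the energy \<open>(l - lam) * J w \<le> 2 * \<delta> * Q\<close> of the
    competitor at most half of the barrier \<open>\<kappa> / 2 * r\<^sup>2\<close>.\<close>
  define \<delta> where "\<delta> = min 1 (\<kappa> * r\<^sup>2 / (8 * Q))"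
  have d: "\<delta> > 0" "\<delta> \<le> 1" using \<kappa> r Q by (simp_all add: \<delta>_def)
  have dQ: "\<delta> * Q \<le> \<kappa> / 8 * r\<^sup>2"
  proof -
    have "\<delta> * Q \<le> \<kappa> * r\<^sup>2 / (8 * Q) * Q" using Q by (intro mult_right_mono) (auto simp: \<delta>_def)
    also have "\<dots> = \<kappa> / 8 * r\<^sup>2" using Q by simp
    finally show ?thesis .
  qed
  have "\<exists>u\<in>H01_nonzero \<Omega>. lambda0 \<Omega> a b f u < lstar + \<delta>"
    using cINF_less_iff[OF nonzero_ex lambda_bdd, of "lstar + \<delta>"] d unfolding lambda0_star_def by simp
  then obtain u0 where u0: "u0 \<in> H01_nonzero \<Omega>" "lambda0 \<Omega> a b f u0 < lstar + \<delta>" by blast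
  define l where "l = lambda0 \<Omega> a b f u0"
  obtain w where w: "w \<in> H" "nrm w > 0" "\<Phi> w = l * J w" using lambda0_props(2)[OF u0(1)] unfolding l_def by blast
  have lL: "l \<le> L" using u0(2) d by (simp add: l_def L_def)
  have Jw: "J w > 0" by (rule J_pos[OF w(1,2)])
  have k1: "\<kappa> * growth w \<le> L * J w"
  proof -
    have "\<kappa> * growth w \<le> l * J w" using lower'[OF w(1)] w(3) by simp
    also have "\<dots> \<le> L * J w" using lL Jw by (intro mult_right_mono) auto
    finally show ?thesis .
  qed
  have szw: "growth w > 0" by (rule growth_bounds(3)[OF w(2)])
  have wr: "nrm w > r"
  proof (rule ccontr)
    assume "\<not> nrm w > r"
    then have "\<kappa> * growth w \<le> \<kappa> / 2 * (nrm w)\<^sup>2" using r(2)[OF w(1)] k1 by simp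
    also have "\<dots> \<le> \<kappa> / 2 * growth w" using \<kappa> growth_bounds(2)[of w] by (intro mult_left_mono) auto
    finally show False using \<kappa> szw by simp
  qed
  have JQ: "J w \<le> Q"
  proof -
    have "\<kappa> / 2 * growth w \<le> Y" using k1 Y(2)[OF w(1)] by simp
    then have "L * J w \<le> 2 * Y" using Y(2)[OF w(1)] by simp
    then have "J w \<le> 2 * Y / L" using L by (simp add: field_simps)
    then show ?thesis by (simp add: Q_def)
  qed
  \<comment> \<open>The minimum with \<open>lstar\<close> keeps \<open>lam\<close> positive.\<close>
  define \<epsilon> where "\<epsilon> = min lstar \<delta>"
  have eps: "\<epsilon> > 0" using d lstar_pos by (simp add: \<epsilon>_def)
  have "\<exists>u\<in>H01_nonzero \<Omega>. local_minimizer \<Omega> (energy \<Omega> a b f lam) u"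
    if lam: "lstar - \<epsilon> < lam" "lam < lstar" for lam
  proof -
    have l0: "0 < lam" "lam \<le> L" using lam by (auto simp: \<epsilon>_def L_def)
    have "energy \<Omega> a b f lam w = (l - lam) * J w" by (simp add: energy_\<Phi> w(3) algebra_simps)
    also have "\<dots> \<le> (2 * \<delta>) * J w"
      using lam u0(2) Jw by (intro mult_right_mono) (auto simp: \<epsilon>_def l_def)
    also have "\<dots> \<le> (2 * \<delta>) * Q" using JQ d by (intro mult_left_mono) auto
    also have "\<dots> \<le> \<kappa> / 4 * r\<^sup>2" using dQ by simp
    also have "\<dots> < \<kappa> / 2 * r\<^sup>2" using \<kappa> r by simp
    finally have we: "energy \<Omega> a b f lam w < \<kappa> / 2 * r\<^sup>2" .
    obtain u where u: "u \<in> H" "nrm u > r" "\<And>v. v \<in> H \<Longrightarrow> nrm v \<ge> r \<Longrightarrow> energy \<Omega> a b f lam u \<le> energy \<Omega> a b f lam v"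
      using interior_minimizer[OF l0 r(1) r(2) Y(2) w(1) less_imp_le[OF wr] we] by blast
    \<comment> \<open>\<open>u\<close> minimizes only outside the ball of radius \<open>r\<close>,
      but a neighbourhood of radius \<open>nrm u - r\<close> does not reach that ball.\<close>
    have "local_minimizer \<Omega> (energy \<Omega> a b f lam) u"
      unfolding local_minimizer_def
    proof (intro conjI exI[of _ "nrm u - r"] ballI impI u(1))
      show "nrm u - r > 0" using u(2) by simp
      fix v assume v: "v \<in> H" "nrm (\<lambda>x. v x - u x) < nrm u - r"
      then have "nrm v \<ge> r" using nrm_triangle[OF u(1) v(1)] by linarith
      then show "energy \<Omega> a b f lam u \<le> energy \<Omega> a b f lam v" by (rule u(3)[OF v(1)])
    qed
    moreover have "u \<in> H01_nonzero \<Omega>" using u r(1) by (simp add: nonzero_nrm)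
    ultimately show ?thesis by blast
  qed
  with eps show ?thesis by blast
qed

end

text \<open>The hypotheses say for each value that almost every point is good;
  \<open>regular_at\<close> needs almost every point good for all values. Rational values and
  continuity exchange the quantifiers. Limits weaken the strict signs, which is why these are
  recorded only at the rational points \<open>inverse (Suc n)\<close> and their negatives.\<close>

lemma AE_regular:
  assumes F1: "hyp_F1 \<Omega> f" and F2: "hyp_F2 \<Omega> f"
    and F3: "\<And>v. AE x in lebesgue_on \<Omega>. \<bar>f x v\<bar> \<le> c * (1 + \<bar>v\<bar> powr (p - 1))" and p: "2 < p"
  shows "AE x in lebesgue_on \<Omega>. regular_at c p (f x)"
proof -
  have Q: "countable (\<rat> :: real set)" by (rule countable_rat)
  have 0: "AE x in lebesgue_on \<Omega>. continuous_on UNIV (f x) \<and> f x 0 = 0"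
    using F1 by (simp add: hyp_F1_def)
  have 1: "AE x in lebesgue_on \<Omega>. \<forall>v\<in>\<rat>. \<bar>f x v\<bar> \<le> c * (1 + \<bar>v\<bar> powr (p - 1))"
    using F3 by (subst AE_ball_countable[OF Q]) blast
  have 2: "AE x in lebesgue_on \<Omega>. \<forall>v\<in>\<rat>. v > 0 \<longrightarrow> f x v > 0"
    using F2 by (subst AE_ball_countable[OF Q]) (auto simp: hyp_F2_def)
  have 3: "AE x in lebesgue_on \<Omega>. \<forall>v\<in>\<rat>. v < 0 \<longrightarrow> f x v < 0"
    using F2 by (subst AE_ball_countable[OF Q]) (auto simp: hyp_F2_def)
  from 0 1 2 3 show ?thesis
  proof eventually_elim
    case (elim x)
    have cf: "continuous_on UNIV (f x)" using elim by simp
    \<comment> \<open>Freezing the argument at 0 turns an inequality on a half-line into one on the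
      whole line, as \<open>rational_le_imp_le\<close> requires.\<close>
    have c1: "continuous_on UNIV (\<lambda>v. f x (max 0 v))" "continuous_on UNIV (\<lambda>v. f x (min 0 v))"
      by (intro continuous_on_compose2[OF cf] continuous_intros; simp)+
    have c2: "continuous_on UNIV (\<lambda>v. \<bar>f x v\<bar>)" by (intro continuous_intros cf)
    have c3: "continuous_on UNIV (\<lambda>v::real. c * (1 + \<bar>v\<bar> powr (p - 1)))"
      using p by (intro continuous_intros continuous_on_powr') auto
    have "\<bar>f x v\<bar> \<le> c * (1 + \<bar>v\<bar> powr (p - 1))" for v
      by (rule rational_le_imp_le[OF c2 c3]) (use elim in blast)
    moreover have "0 \<le> f x v" if "v > 0" for v
    proof -
      have "0 \<le> f x (max 0 v)"
        by (rule rational_le_imp_le[OF continuous_on_const c1(1)])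
           (use elim in \<open>auto simp: max_def less_imp_le\<close>)
      then show ?thesis using that by (simp add: max_def)
    qed
    moreover have "f x v \<le> 0" if "v < 0" for v
    proof -
      have "f x (min 0 v) \<le> 0"
        by (rule rational_le_imp_le[OF c1(2) continuous_on_const])
           (use elim in \<open>auto simp: min_def less_imp_le\<close>)
      then show ?thesis using that by (simp add: min_def)
    qed
    moreover have "inverse (real (Suc n)) \<in> \<rat>" for n by (intro Rats_inverse) simp
    then have "0 < f x (inverse (real (Suc n)))" "f x (- inverse (real (Suc n))) < 0" for n
      using elim by (auto simp del: of_nat_Suc)
    ultimately show ?case using elim unfolding regular_at_def by blast
  qed
qed

theorem theorem1p2:
  fixes \<Omega> :: "'a::euclidean_space set"
    and f :: "'a \<Rightarrow> real \<Rightarrow> real"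
    and a b :: real
  assumes "DIM('a) > 4"
    and "open \<Omega>" and "connected \<Omega>" and "\<Omega> \<noteq> {}" and "bounded \<Omega>"
    and "a > 0" and "b > 0"
    and "hyp_F1 \<Omega> f" and "hyp_F2 \<Omega> f" and "hyp_F3 \<Omega> f" and "hyp_F4 \<Omega> f"
    and "a powr ((real DIM('a) - 4) / 2) * b \<ge> C2_const \<Omega>"
  shows "\<exists>\<epsilon>>0. \<forall>lam. lambda0_star \<Omega> a b f - \<epsilon> < lam \<and> lam < lambda0_star \<Omega> a b f \<longrightarrow>
           (\<exists>u\<in>H01_nonzero \<Omega>.
              weak_solution \<Omega> a b f lam u \<and> critical_point \<Omega> (energy \<Omega> a b f lam) u \<and>
              local_minimizer \<Omega> (energy \<Omega> a b f lam) u \<and> energy \<Omega> a b f lam u > 0) \<and>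
           (\<forall>u\<in>H01_nonzero \<Omega>. energy \<Omega> a b f lam u > 0)"
proof -
  obtain c p where cp: "c > 0" "2 < p" "p < crit_exp DIM('a)"
    "\<And>v. AE x in lebesgue_on \<Omega>. \<bar>f x v\<bar> \<le> c * (1 + \<bar>v\<bar> powr (p - 1))"
    using \<open>hyp_F3 \<Omega> f\<close> unfolding hyp_F3_def by blast
  have "bounded_open \<Omega>" using assms by (simp add: bounded_open_def)
  interpret nl: nonlin \<Omega> f c p
  proof (intro nonlin.intro \<open>bounded_open \<Omega>\<close> nonlin_axioms.intro)
    show "AE x in lebesgue_on \<Omega>. regular_at c p (f x)"
      using assms cp by (intro AE_regular) auto
    show "(\<lambda>x. f x v) \<in> borel_measurable (lebesgue_on \<Omega>)" for v
      using \<open>hyp_F1 \<Omega> f\<close> by (simp add: hyp_F1_def)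
  qed (use assms cp in auto)
  obtain \<kappa> where k: "\<kappa> > 0" "\<And>u. u \<in> H01 \<Omega> \<Longrightarrow> \<kappa> * ((H01_norm \<Omega> u)\<^sup>2 + H01_norm \<Omega> u ^ 4)
      \<le> a / 2 * (H01_norm \<Omega> u)\<^sup>2 + b / 4 * H01_norm \<Omega> u ^ 4 - 1 / nl.q * nl.V u"
    using nl.coercive[OF \<open>a > 0\<close> \<open>b > 0\<close> assms(12)] by blast
  interpret k: kirchhoff \<Omega> f c p a b \<kappa>
    by unfold_locales (use assms k in auto)
  obtain \<epsilon> where e: "\<epsilon> > 0" "\<And>lam. lambda0_star \<Omega> a b f - \<epsilon> < lam \<Longrightarrow> lam < lambda0_star \<Omega> a b f \<Longrightarrow>
     \<exists>u\<in>H01_nonzero \<Omega>. local_minimizer \<Omega> (energy \<Omega> a b f lam) u" using k.existence by blast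
  show ?thesis
  proof (intro exI[of _ \<epsilon>] conjI allI impI e(1))
    fix lam assume lam: "lambda0_star \<Omega> a b f - \<epsilon> < lam \<and> lam < lambda0_star \<Omega> a b f"
    show pos: "\<forall>u\<in>H01_nonzero \<Omega>. energy \<Omega> a b f lam u > 0" using k.energy_pos lam by blast
    obtain u where u: "u \<in> H01_nonzero \<Omega>" "local_minimizer \<Omega> (energy \<Omega> a b f lam) u" using e(2) lam by blast
    have uH: "u \<in> H01 \<Omega>" using u(1) by (simp add: H01_nonzero_def)
    show "\<exists>u\<in>H01_nonzero \<Omega>. weak_solution \<Omega> a b f lam u \<and> critical_point \<Omega> (energy \<Omega> a b f lam) u \<and>
              local_minimizer \<Omega> (energy \<Omega> a b f lam) u \<and> energy \<Omega> a b f lam u > 0"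
      using nl.stationary[OF uH \<open>a > 0\<close> \<open>b > 0\<close> u(2)] u pos by blast
  qed
qed

end
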